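(* Let $K$ be a field, $u_1,\dots,u_\ell\in K$, and suppose that the degenerate cyclotomic Hecke algebra $H_{\ell,n}(\mathbf u)$ over $K$ is semisimple. Let $\mu\in\mathscr P_{n-1}$, $\lambda\in\mathscr P_n$, $\mathfrak s,\mathfrak t\in\mathrm{Std}(\mu)$ and $\mathfrak u,\mathfrak v\in\mathrm{Std}(\lambda)$. Let $b^{\mathfrak s\mathfrak t}_{\mathfrak u\mathfrak v}\in K$ be the coefficients in the expansion $$\iota_1\big(\mathrm f^{(n-1)}_{\mathfrak s\mathfrak t}\big)=\sum_{\lambda\in\mathscr P_n}\ \sum_{\mathfrak u,\mathfrak v\in\mathrm{Std}(\lambda)}b^{\mathfrak s\mathfrak t}_{\mathfrak u\mathfrak v}\,\mathrm f^{(n)}_{\mathfrak u\mathfrak v}$$ under the natural embedding $\iota_1:H_{\ell,n-1}(\mathbf u)\hookrightarrow H_{\ell,n}(\mathbf u)$, $s_i\mapsto s_i$ ($1\le i<n-1$), $L_k\mapsto L_k$ ($1\le k\le n-1$). Then $b^{\mathfrak s\mathfrak t}_{\mathfrak u\mathfrak v}\ne 0$ if and only if $\mathfrak u\downarrow_{n-1}=\mathfrak s$ and $\mathfrak v\downarrow_{n-1}=\mathfrak t$. In that case $$b^{\mathfrak s\mathfrak t}_{\mathfrak u\mathfrak v}=\frac{r^{(n-1)}_{\mathfrak s}}{r^{(n)}_{\mathfrak u}}=\frac{r^{(n-1)}_{\mathfrak t}}{r^{(n)}_{\mathfrak v}}.$$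
   Context: **Combinatorics.** $\ell,n\ge 1$ are integers. A multipartition of $n$ is an $\ell$-tuple $\lambda=(\lambda^{(1)},\dots,\lambda^{(\ell)})$ of partitions whose sizes sum to $n$; $\mathscr P_n$ is the set of these. Its diagram is $[\lambda]=\{(i,j,c):1\le c\le \ell,\ 1\le j\le \lambda^{(c)}_i\}$. A $\lambda$-tableau is a bijection $\mathfrak t:[\lambda]\to\{1,\dots,n\}$, written $\mathfrak t=(\mathfrak t^{(1)},\dots,\mathfrak t^{(\ell)})$; it is standard if in every component entries increase along rows and down columns; $\mathrm{Std}(\lambda)$ is the set of standard $\lambda$-tableaux. $\mathfrak t\downarrow_{k}$ is the subtableau of $\mathfrak t$ with entries $1,\dots,k$. Dominance: $\lambda\unrhd\mu$ if $\sum_{t<s}|\lambda^{(t)}|+\sum_{j\le i}\lambda^{(s)}_j\ge\sum_{t<s}|\mu^{(t)}|+\sum_{j\le i}\mu^{(s)}_j$ for all $1\le s\le \ell$, $i\ge 1$; for standard tableaux $\mathfrak s\unrhd\mathfrak t$ if for every $k$ the shape of $\mathfrak s\downarrow_k$ dominates that of $\mathfrak t\downarrow_k$; $\rhd$ means $\unrhd$ and $\ne$. $\mathfrak t^\lambda$ is the standard $\lambda$-tableau with $1,\dots,n$ entered in order along the rows of component 1, then the rows of component 2, etc. $\mathfrak S_n$ acts from the right on tableaux by permuting entries (permutations are composed left to right); $s_i=(i,i+1)$; $d(\mathfrak t)\in\mathfrak S_n$ is defined by $\mathfrak t^\lambda d(\mathfrak t)=\mathfrak t$. $\mathfrak S_\lambda$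 is the standard Young subgroup of $\lambda$ (the row stabiliser of $\mathfrak t^\lambda$). **Algebra.** $H_{\ell,n}(\mathbf u)$, $\mathbf u=(u_1,\dots,u_\ell)$, is the unital associative $K$-algebra with generators $s_1,\dots,s_{n-1},L_1,\dots,L_n$ and relations $(L_1-u_1)\cdots(L_1-u_\ell)=0$; $s_i^2=1$; $s_is_j=s_js_i$ for $|i-j|>1$; $s_is_{i+1}s_i=s_{i+1}s_is_{i+1}$; $L_iL_k=L_kL_i$; $s_iL_l=L_ls_i$ for $l\ne i,i+1$; $L_{i+1}=s_iL_is_i+s_i$ for $1\le i<n$. Elements of $\mathfrak S_n$ are viewed in $H_{\ell,n}(\mathbf u)$ through the $s_i$. Semisimplicity is equivalent to $n!\prod_{1\le i<j\le\ell,\,|d|<n}(d\cdot 1_K+u_i-u_j)\ne 0$ in $K$, and it implies that for any standard tableaux $\mathfrak s\ne\mathfrak t$ of shapes in $\mathscr P_n$ there is $k$ with $c_{\mathfrak s}(k)\ne c_{\mathfrak t}(k)$, where $c_{\mathfrak t}(k)=j-i+u_c$ if $k$ is in row $i$, column $j$ of $\mathfrak t^{(c)}$. Let $C(k)=\{c_{\mathfrak t}(k):\mathfrak t\in\mathrm{Std}(\lambda),\lambda\in\mathscr P_n\}$. **Seminormal basis.** For $\mathfrak s,\mathfrak t\in\mathrm{Std}(\lambda)$: $\mathrm m_{\mathfrak s\mathfrak t}=d(\mathfrak s)^{-1}\big(\sum_{w\in\mathfrak S_\lambda}w\big)\big(\prod_{s=2}^{\ell}\prod_{k=1}^{|\lambda^{(1)}|+\cdots+|\lambda^{(s-1)}|}(L_k-u_s)\big)d(\mathfrak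 t)$, $\mathrm F_{\mathfrak t}=\prod_{k=1}^n\prod_{c\in C(k),\,c\ne c_{\mathfrak t}(k)}\frac{L_k-c}{c_{\mathfrak t}(k)-c}$, and $\mathrm f_{\mathfrak s\mathfrak t}=\mathrm F_{\mathfrak s}\mathrm m_{\mathfrak s\mathfrak t}\mathrm F_{\mathfrak t}$. The $\mathrm f_{\mathfrak s\mathfrak t}$ ($\mathfrak s,\mathfrak t\in\mathrm{Std}(\lambda)$, $\lambda\in\mathscr P_n$) form a $K$-basis of $H_{\ell,n}(\mathbf u)$. **$r$-coefficients.** The scalars $r_{\mathfrak t}\in K^\times$ are uniquely determined by: (a) $r_{\mathfrak t^\lambda}=\Big(\prod_{c=1}^\ell\prod_{i\ge1}\lambda^{(c)}_i!\Big)\prod_{1\le s<t\le\ell}\prod_{(i,j):\,1\le j\le\lambda^{(s)}_i}(j-i+u_s-u_t)$; (b) if $\mathfrak s=\mathfrak t(i,i+1)\rhd\mathfrak t$ then $\frac{r_{\mathfrak t}}{r_{\mathfrak s}}=\frac{(c_{\mathfrak s}(i)-c_{\mathfrak t}(i)+1)(c_{\mathfrak s}(i)-c_{\mathfrak t}(i)-1)}{(c_{\mathfrak s}(i)-c_{\mathfrak t}(i))^2}$. A superscript $(n)$ or $(n-1)$ indicates whether an object is formed for $H_{\ell,n}(\mathbf u)$ or for $H_{\ell,n-1}(\mathbf u)$ (same $\mathbf u$). For $n=1$ the conventions are $H_{\ell,0}=K$, with one (empty) standard tableau, $\mathrm f^{(0)}=1$ and $r^{(0)}=1$. *)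

theory Defs
  imports
    "HOL-Library.Poly_Mapping"
    "HOL-Combinatorics.Permutations"
    "HOL-Algebra.QuotRing"
begin

section \<open>Multipartitions and tableaux\<close>

text \<open>
  A multipartition is a function \<open>lam\<close>, where \<open>lam c i\<close> is the length of row \<open>i\<close> of
  component \<open>c\<close>; components and rows are numbered from 1, and \<open>lam\<close> vanishes outside
  this range, so that equality of multipartitions is equality of functions.
\<close>

type_synonym mpart = "nat \<Rightarrow> nat \<Rightarrow> nat"

definition psize :: "(nat \<Rightarrow> nat) \<Rightarrow> nat" where
  "psize p = (\<Sum>i | p i \<noteq> 0. p i)"

definition is_partition :: "(nat \<Rightarrow> nat) \<Rightarrow> bool" where
  "is_partition p \<longleftrightarrow> p 0 = 0 \<and> (\<forall>i\<ge>1. p (Suc i) \<le> p i) \<and> finite {i. p i \<noteq> 0}"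

definition mparts :: "nat \<Rightarrow> nat \<Rightarrow> mpart set" where
  "mparts l n = {lam. (\<forall>c. is_partition (lam c)) \<and> (\<forall>c. c \<notin> {1..l} \<longrightarrow> lam c = (\<lambda>_. 0)) \<and>
                      (\<Sum>c=1..l. psize (lam c)) = n}"

type_synonym box = "nat \<times> nat \<times> nat"

definition diagram :: "nat \<Rightarrow> mpart \<Rightarrow> box set" where
  "diagram l lam = {(i, j, c). 1 \<le> c \<and> c \<le> l \<and> 1 \<le> i \<and> 1 \<le> j \<and> j \<le> lam c i}"

text \<open>
  Tableaux have positive entries on their diagram and are extended by 0 to all other boxes.
  Hence a tableau determines its diagram, and a subtableau is again such a function.
\<close>

type_synonym tableau = "box \<Rightarrow> nat"

definition Std :: "nat \<Rightarrow> nat \<Rightarrow> mpart \<Rightarrow> tableau set" where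
  "Std l n lam = {t. bij_betw t (diagram l lam) {1..n} \<and>
     (\<forall>b. b \<notin> diagram l lam \<longrightarrow> t b = 0) \<and>
     (\<forall>i j c. (i, j, c) \<in> diagram l lam \<and> (i, Suc j, c) \<in> diagram l lam \<longrightarrow>
        t (i, j, c) < t (i, Suc j, c)) \<and>
     (\<forall>i j c. (i, j, c) \<in> diagram l lam \<and> (Suc i, j, c) \<in> diagram l lam \<longrightarrow>
        t (i, j, c) < t (Suc i, j, c))}"

definition restrict_tab :: "tableau \<Rightarrow> nat \<Rightarrow> tableau" (infixl \<open>\<down>\<close> 75) where
  "t \<down> k = (\<lambda>b. if t b \<le> k then t b else 0)"

definition shape :: "tableau \<Rightarrow> mpart" where
  "shape t = (\<lambda>c i. card {j. t (i, j, c) \<noteq> 0})"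

definition dominates :: "nat \<Rightarrow> mpart \<Rightarrow> mpart \<Rightarrow> bool" where
  "dominates l lam mu \<longleftrightarrow> (\<forall>s\<in>{1..l}. \<forall>i\<ge>1.
     (\<Sum>t=1..<s. psize (mu t)) + (\<Sum>j=1..i. mu s j)
       \<le> (\<Sum>t=1..<s. psize (lam t)) + (\<Sum>j=1..i. lam s j))"

definition tab_dominates :: "nat \<Rightarrow> tableau \<Rightarrow> tableau \<Rightarrow> bool" where
  "tab_dominates l s t \<longleftrightarrow> (\<forall>k. dominates l (shape (s \<down> k)) (shape (t \<down> k)))"

text \<open>The tableau \<open>t\<^sup>\<lambda>\<close>, filled row by row.\<close>

definition init_tab :: "nat \<Rightarrow> mpart \<Rightarrow> tableau" where
  "init_tab l lam = (\<lambda>(i, j, c). if (i, j, c) \<in> diagram l lam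
     then (\<Sum>c'=1..<c. psize (lam c')) + (\<Sum>i'=1..<i. lam c i') + j else 0)"

text \<open>
  Permutations are functions on \<^typ>\<open>nat\<close> fixing everything outside \<open>{1..n}\<close>. The right
  action of \<open>w\<close> on a tableau \<open>t\<close> is \<open>w \<circ> t\<close>; as \<open>w 0 = 0\<close>, this respects the extension by 0.
\<close>

definition d_perm :: "nat \<Rightarrow> nat \<Rightarrow> mpart \<Rightarrow> tableau \<Rightarrow> nat \<Rightarrow> nat" where
  "d_perm l n lam t = (THE w. w permutes {1..n} \<and> w \<circ> init_tab l lam = t)"

definition young :: "nat \<Rightarrow> nat \<Rightarrow> mpart \<Rightarrow> (nat \<Rightarrow> nat) set" where
  "young l n lam = {w. w permutes {1..n} \<and>
     (\<forall>i j c. (i, j, c) \<in> diagram l lam \<longrightarrow>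
        (\<exists>j'. (i, j', c) \<in> diagram l lam \<and>
              w (init_tab l lam (i, j, c)) = init_tab l lam (i, j', c)))}"

definition content :: "(nat \<Rightarrow> 'k::field) \<Rightarrow> tableau \<Rightarrow> nat \<Rightarrow> 'k" where
  "content u t k = (case (THE b. t b = k) of (i, j, c) \<Rightarrow> of_nat j - of_nat i + u c)"

definition contents :: "nat \<Rightarrow> nat \<Rightarrow> (nat \<Rightarrow> 'k::field) \<Rightarrow> nat \<Rightarrow> 'k set" where
  "contents l n u k = {content u t k | t lam. lam \<in> mparts l n \<and> t \<in> Std l n lam}"

section \<open>The degenerate cyclotomic Hecke algebra\<close>

text \<open>
  Words in the generators form the free monoid, written additively because the
  (noncommutative) convolution product of \<^typ>\<open>'a \<Rightarrow>\<^sub>0 'b\<close> uses \<open>+\<close> on keys. With these keys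
  \<^typ>\<open>'a \<Rightarrow>\<^sub>0 'b\<close> is the free associative algebra.
\<close>

datatype gen = GS nat | GL nat

datatype gword = GWord (letters: "gen list")

instantiation gword :: monoid_add
begin

definition zero_gword :: gword where "0 = GWord []"

definition plus_gword :: "gword \<Rightarrow> gword \<Rightarrow> gword" where
  "v + w = GWord (letters v @ letters w)"

instance
  by standard (simp_all add: zero_gword_def plus_gword_def)

end

type_synonym 'k free_alg = "gword \<Rightarrow>\<^sub>0 'k"

definition scl :: "'k::field \<Rightarrow> 'k free_alg" where
  "scl a = Poly_Mapping.single 0 a"

definition gS :: "nat \<Rightarrow> 'k::field free_alg" where
  "gS i = Poly_Mapping.single (GWord [GS i]) 1"

definition gL :: "nat \<Rightarrow> 'k::field free_alg" where
  "gL k = Poly_Mapping.single (GWord [GL k]) 1"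

definition gens :: "nat \<Rightarrow> gen set" where
  "gens n = GS ` {1..<n} \<union> GL ` {1..n}"

definition free_hecke :: "nat \<Rightarrow> 'k::field free_alg ring" where
  "free_hecke n = \<lparr>carrier = {p. \<forall>w\<in>Poly_Mapping.keys p. set (letters w) \<subseteq> gens n},
                   mult = (*), one = 1, zero = 0, add = (+)\<rparr>"

text \<open>
  A relation \<open>x = y\<close> is encoded as \<open>x - y\<close>. For \<open>n = 0\<close> there are no generators and
  no relations, so that the algebra below is the ground field.
\<close>

definition hecke_rels :: "nat \<Rightarrow> nat \<Rightarrow> (nat \<Rightarrow> 'k::field) \<Rightarrow> 'k free_alg set" where
  "hecke_rels l n u =
     (if 1 \<le> n then {prod_list (map (\<lambda>c. gL 1 - scl (u c)) [1..<Suc l])} else {})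
   \<union> {gS i * gS i - 1 | i. 1 \<le> i \<and> i < n}
   \<union> {gS i * gS j - gS j * gS i | i j. 1 \<le> i \<and> i < n \<and> 1 \<le> j \<and> j < n \<and> (Suc i < j \<or> Suc j < i)}
   \<union> {gS i * gS (Suc i) * gS i - gS (Suc i) * gS i * gS (Suc i) | i. 1 \<le> i \<and> Suc i < n}
   \<union> {gL i * gL k - gL k * gL i | i k. 1 \<le> i \<and> i \<le> n \<and> 1 \<le> k \<and> k \<le> n}
   \<union> {gS i * gL k - gL k * gS i | i k. 1 \<le> i \<and> i < n \<and> 1 \<le> k \<and> k \<le> n \<and> k \<noteq> i \<and> k \<noteq> Suc i}
   \<union> {gL (Suc i) - (gS i * gL i * gS i + gS i) | i. 1 \<le> i \<and> i < n}"

definition hecke_ideal :: "nat \<Rightarrow> nat \<Rightarrow> (nat \<Rightarrow> 'k::field) \<Rightarrow> 'k free_alg set" where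
  "hecke_ideal l n u = Idl\<^bsub>free_hecke n\<^esub> (hecke_rels l n u)"

definition hecke :: "nat \<Rightarrow> nat \<Rightarrow> (nat \<Rightarrow> 'k::field) \<Rightarrow> 'k free_alg set ring" where
  "hecke l n u = free_hecke n Quot hecke_ideal l n u"

definition hecke_proj ::
    "nat \<Rightarrow> nat \<Rightarrow> (nat \<Rightarrow> 'k::field) \<Rightarrow> 'k free_alg \<Rightarrow> 'k free_alg set" where
  "hecke_proj l n u x = hecke_ideal l n u +>\<^bsub>free_hecke n\<^esub> x"

abbreviation hS :: "nat \<Rightarrow> nat \<Rightarrow> (nat \<Rightarrow> 'k::field) \<Rightarrow> nat \<Rightarrow> 'k free_alg set" where
  "hS l n u i \<equiv> hecke_proj l n u (gS i)"

abbreviation hL :: "nat \<Rightarrow> nat \<Rightarrow> (nat \<Rightarrow> 'k::field) \<Rightarrow> nat \<Rightarrow> 'k free_alg set" where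
  "hL l n u k \<equiv> hecke_proj l n u (gL k)"

abbreviation hscl :: "nat \<Rightarrow> nat \<Rightarrow> (nat \<Rightarrow> 'k::field) \<Rightarrow> 'k \<Rightarrow> 'k free_alg set" where
  "hscl l n u a \<equiv> hecke_proj l n u (scl a)"

text \<open>
  The map \<open>\<iota>\<^sub>1\<close> from \<^term>\<open>hecke l (n - 1) u\<close> to \<^term>\<open>hecke l n u\<close> induced by the inclusion of
  free algebras: the images of all representatives of a coset lie in one coset.
\<close>

definition hecke_iota ::
    "nat \<Rightarrow> nat \<Rightarrow> (nat \<Rightarrow> 'k::field) \<Rightarrow> 'k free_alg set \<Rightarrow> 'k free_alg set" where
  "hecke_iota l n u X = the_elem (hecke_proj l n u ` X)"

text \<open>A ring is semisimple if every left ideal is a direct summand of the left regular module.\<close>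

definition left_ideal :: "'a set \<Rightarrow> ('a, 'b) ring_scheme \<Rightarrow> bool" where
  "left_ideal I R \<longleftrightarrow> additive_subgroup I R \<and>
     (\<forall>a\<in>carrier R. \<forall>x\<in>I. a \<otimes>\<^bsub>R\<^esub> x \<in> I)"

definition semisimple_ring :: "('a, 'b) ring_scheme \<Rightarrow> bool" where
  "semisimple_ring R \<longleftrightarrow> ring R \<and> (\<forall>I. left_ideal I R \<longrightarrow>
     (\<exists>J. left_ideal J R \<and> I \<inter> J = {\<zero>\<^bsub>R\<^esub>} \<and> I <+>\<^bsub>R\<^esub> J = carrier R))"

section \<open>The seminormal basis\<close>

text \<open>
  Permutations are composed from left to right, so the first letter of a word in the
  \<open>s\<^sub>i\<close> is applied first.
\<close>

definition word_perm :: "nat list \<Rightarrow> nat \<Rightarrow> nat" where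
  "word_perm is = foldr (\<lambda>i w. w \<circ> Transposition.transpose i (Suc i)) is id"

text \<open>
  The image of \<open>w\<close> in the algebra does not depend on the chosen word, because the
  \<open>s\<^sub>i\<close> satisfy the Coxeter relations.
\<close>

definition hperm :: "nat \<Rightarrow> nat \<Rightarrow> (nat \<Rightarrow> 'k::field) \<Rightarrow> (nat \<Rightarrow> nat) \<Rightarrow> 'k free_alg set" where
  "hperm l n u w = hecke_proj l n u
     (prod_list (map gS (SOME is. set is \<subseteq> {1..<n} \<and> word_perm is = w)))"

text \<open>
  \<^const>\<open>finprod\<close> is used below in a noncommutative ring, but only for factors in the subring
  generated by the \<open>L\<^sub>k\<close>, which commute; so the fold behind it is independent of the order.
\<close>

definition seminormal_m ::
    "nat \<Rightarrow> nat \<Rightarrow> (nat \<Rightarrow> 'k::field) \<Rightarrow> mpart \<Rightarrow> tableau \<Rightarrow> tableau \<Rightarrow> 'k free_alg set" where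
  "seminormal_m l n u lam s t =
     hperm l n u (inv_into UNIV (d_perm l n lam s))
     \<otimes>\<^bsub>hecke l n u\<^esub> (\<Oplus>\<^bsub>hecke l n u\<^esub>w\<in>young l n lam. hperm l n u w)
     \<otimes>\<^bsub>hecke l n u\<^esub> (\<Otimes>\<^bsub>hecke l n u\<^esub>c\<in>{2..l}.
           \<Otimes>\<^bsub>hecke l n u\<^esub>k\<in>{1..(\<Sum>c'=1..<c. psize (lam c'))}.
             hL l n u k \<ominus>\<^bsub>hecke l n u\<^esub> hscl l n u (u c))
     \<otimes>\<^bsub>hecke l n u\<^esub> hperm l n u (d_perm l n lam t)"

definition seminormal_F ::
    "nat \<Rightarrow> nat \<Rightarrow> (nat \<Rightarrow> 'k::field) \<Rightarrow> tableau \<Rightarrow> 'k free_alg set" where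
  "seminormal_F l n u t =
     (\<Otimes>\<^bsub>hecke l n u\<^esub>k\<in>{1..n}. \<Otimes>\<^bsub>hecke l n u\<^esub>c\<in>contents l n u k - {content u t k}.
        hscl l n u (1 / (content u t k - c)) \<otimes>\<^bsub>hecke l n u\<^esub>
          (hL l n u k \<ominus>\<^bsub>hecke l n u\<^esub> hscl l n u c))"

definition seminormal_f ::
    "nat \<Rightarrow> nat \<Rightarrow> (nat \<Rightarrow> 'k::field) \<Rightarrow> mpart \<Rightarrow> tableau \<Rightarrow> tableau \<Rightarrow> 'k free_alg set" where
  "seminormal_f l n u lam s t =
     seminormal_F l n u s \<otimes>\<^bsub>hecke l n u\<^esub> seminormal_m l n u lam s t
       \<otimes>\<^bsub>hecke l n u\<^esub> seminormal_F l n u t"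

text \<open>
  The coefficients of an element in the basis of all \<^const>\<open>seminormal_f\<close>, indexed by pairs of
  tableaux (which determine their shape) and put to 0 for pairs that do not index a basis element.
\<close>

definition seminormal_coeffs ::
    "nat \<Rightarrow> nat \<Rightarrow> (nat \<Rightarrow> 'k::field) \<Rightarrow> 'k free_alg set \<Rightarrow> tableau \<Rightarrow> tableau \<Rightarrow> 'k" where
  "seminormal_coeffs l n u X = (THE b.
     (\<forall>s t. \<not> (\<exists>lam\<in>mparts l n. s \<in> Std l n lam \<and> t \<in> Std l n lam) \<longrightarrow> b s t = 0) \<and>
     X = (\<Oplus>\<^bsub>hecke l n u\<^esub>lam\<in>mparts l n. \<Oplus>\<^bsub>hecke l n u\<^esub>s\<in>Std l n lam.
           \<Oplus>\<^bsub>hecke l n u\<^esub>t\<in>Std l n lam.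
             hscl l n u (b s t) \<otimes>\<^bsub>hecke l n u\<^esub> seminormal_f l n u lam s t))"

section \<open>The coefficients \<open>r\<close>\<close>

definition r_init :: "nat \<Rightarrow> (nat \<Rightarrow> 'k::field) \<Rightarrow> mpart \<Rightarrow> 'k" where
  "r_init l u lam =
     (\<Prod>c=1..l. \<Prod>i | lam c i \<noteq> 0. of_nat (fact (lam c i))) *
     (\<Prod>a=1..l. \<Prod>b\<in>{a<..l}. \<Prod>(i, j)\<in>{(i, j). 1 \<le> i \<and> 1 \<le> j \<and> j \<le> lam a i}.
        of_nat j - of_nat i + u a - u b)"

definition is_r_coeffs :: "nat \<Rightarrow> nat \<Rightarrow> (nat \<Rightarrow> 'k::field) \<Rightarrow> (tableau \<Rightarrow> 'k) \<Rightarrow> bool" where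
  "is_r_coeffs l n u r \<longleftrightarrow>
     (\<forall>lam\<in>mparts l n. \<forall>t\<in>Std l n lam. r t \<noteq> 0) \<and>
     (\<forall>lam\<in>mparts l n. r (init_tab l lam) = r_init l u lam) \<and>
     (\<forall>lam\<in>mparts l n. \<forall>s\<in>Std l n lam. \<forall>t\<in>Std l n lam. \<forall>i\<in>{1..<n}.
        s = Transposition.transpose i (Suc i) \<circ> t \<and> tab_dominates l s t \<and> s \<noteq> t \<longrightarrow>
        r t / r s = (content u s i - content u t i + 1) * (content u s i - content u t i - 1)
                      / (content u s i - content u t i)\<^sup>2)"

text \<open>The \<open>r\<close>-coefficients as one function on all tableaux, 0 on those that are not standard.\<close>

definition r_coeff :: "nat \<Rightarrow> nat \<Rightarrow> (nat \<Rightarrow> 'k::field) \<Rightarrow> tableau \<Rightarrow> 'k" where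
  "r_coeff l n u = (THE r. is_r_coeffs l n u r \<and>
     (\<forall>t. \<not> (\<exists>lam\<in>mparts l n. t \<in> Std l n lam) \<longrightarrow> r t = 0))"

end

theory Submission
  imports Defs "HOL.Vector_Spaces" "HOL-Library.Function_Algebras" "HOL-Computational_Algebra.Polynomial"
begin

text \<open>
  An element of the algebra is determined by its action on the linear forms on the algebra, so the
  expansion is compared on weight vectors, that is, on vectors \<open>v\<close> with \<open>L\<^sub>k v = c\<^sub>V(k) v\<close> for a standard
  tableau \<open>V\<close>. Semisimplicity separates the contents (by testing it on suitable modules in which
  a submodule would otherwise have no complement), and then every module is spanned by weight
  vectors. On a vector \<open>v\<close> of weight \<open>V\<close> the element \<open>f\<^sub>s\<^sub>t\<close> acts as \<open>r\<^sub>t\<close> if \<open>s = t = V\<close> and as \<open>0\<close> if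
  \<open>t \<noteq> V\<close>, and the action of the other \<open>f\<^sub>s\<^sub>t\<close> is reached from this by simple transpositions, with the
  same structure constants for \<open>n - 1\<close> and for \<open>n\<close>. Restricting to \<open>n - 1\<close> turns weight \<open>V\<close> into
  weight \<open>V\<down>(n - 1)\<close>; hence \<open>f\<^sub>s\<^sub>t\<close> for \<open>n - 1\<close> acts on \<open>v\<close> as \<open>r\<^sub>s / r\<^sub>U\<close> times \<open>f\<^sub>U\<^sub>V\<close> for \<open>n\<close>, where \<open>U\<close>
  is \<open>s\<close> with the last box of \<open>V\<close> added. The ratio \<open>r\<^sub>s / r\<^sub>U\<close> does not depend on \<open>s\<close>, because the
  contents of \<open>1, \<dots>, n - 1\<close> in \<open>s\<close> and \<open>U\<close> agree.
\<close>

section \<open>Permutations and words in simple transpositions\<close>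

text \<open>Two modules carry the proof, with opposite merits. The dual of the regular module is
  faithful, so an identity in the algebra may be tested on it, but it does not show which weights
  occur. The seminormal module has a nonzero vector of every weight; it yields the existence of the
  \<open>r\<close>-coefficients and the uniqueness of the expansion. The dual replaces the regular
  module because its vectors are functions on words and can be added as such, whereas the elements
  of the algebra are cosets. The hardest step is that weight vectors span. It amounts to confining
  the spectrum of \<open>L_k\<close> on a joint eigenspace of the earlier \<open>L_j\<close> to the
  contents of the addable boxes. The cyclotomic relation gives this for \<open>k = 1\<close>. In the
  step from \<open>k\<close> to \<open>k + 1\<close> the neighbours of the last content appear as
  two eigenvalues that may be spurious; where they are, the braid relation removes them.
  Semisimplicity is assumed for size \<open>n\<close> only; the bound \<open>N\<close> in
  \<open>separated\<close> is therefore independent of the size of the tableaux and serves for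
  \<open>n - 1\<close> as well.\<close>

abbreviation st :: "nat \<Rightarrow> nat \<Rightarrow> nat" where
  "st i \<equiv> Transposition.transpose i (Suc i)"

definition ninv :: "nat \<Rightarrow> (nat \<Rightarrow> nat) \<Rightarrow> nat" where
  "ninv n w = card {(p, q). 1 \<le> p \<and> p < q \<and> q \<le> n \<and> w q < w p}"

lemma st_apply: "st i k = (if k = i then Suc i else if k = Suc i then i else k)"
  by (simp add: Transposition.transpose_def)

lemma st_st[simp]: "st i (st i k) = k"
  by simp

lemma st_permutes: "i \<in> {1..<n} \<Longrightarrow> st i permutes {1..n}"
  by (rule permutes_swap_id) auto

lemma ninv_swap:
  assumes i: "i \<in> {1..<n}" and d: "w (Suc i) < w i"
  shows "ninv n w = Suc (ninv n (w \<circ> st i))"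
proof -
  let ?A = "{(p, q). 1 \<le> p \<and> p < q \<and> q \<le> n \<and> w q < w p}"
  let ?B = "{(p, q). 1 \<le> p \<and> p < q \<and> q \<le> n \<and> (w \<circ> st i) q < (w \<circ> st i) p}"
  have fin: "finite ?A"
    by (rule finite_subset[of _ "{0..n} \<times> {0..n}"]) auto
  have "bij_betw (map_prod (st i) (st i)) ?B (?A - {(i, Suc i)})"
  proof (rule bij_betw_byWitness[where f' = "map_prod (st i) (st i)"])
    show "map_prod (st i) (st i) ` ?B \<subseteq> ?A - {(i, Suc i)}"
      using i d by (auto simp: st_apply split: if_splits)
    show "map_prod (st i) (st i) ` (?A - {(i, Suc i)}) \<subseteq> ?B"
      using i d by (auto simp: st_apply split: if_splits)
  qed auto
  then have "card ?B = card (?A - {(i, Suc i)})"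
    by (rule bij_betw_same_card)
  moreover have "(i, Suc i) \<in> ?A" using i d by auto
  ultimately show ?thesis
    unfolding ninv_def using card_Suc_Diff1[OF fin, of "(i, Suc i)"] by simp
qed

lemma ninv_swap':
  assumes "i \<in> {1..<n}" "w i < w (Suc i)"
  shows "ninv n (w \<circ> st i) = Suc (ninv n w)"
proof -
  have "w \<circ> st i \<circ> st i = w" by (simp add: comp_assoc)
  then show ?thesis using ninv_swap[of i n "w \<circ> st i"] assms by (simp add: st_apply)
qed

text \<open>An increasing permutation of \<open>{1..n}\<close> satisfies \<open>p \<le> w p\<close>,
  counting up from 1, and \<open>w p \<le> p\<close>, counting down from \<open>n\<close>; so it is
  the identity.\<close>

lemma exists_descent:
  assumes w: "w permutes {1..n}" and "w \<noteq> id"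
  shows "\<exists>i\<in>{1..<n}. w (Suc i) < w i"
proof (rule ccontr)
  assume "\<not> ?thesis"
  then have inc: "w i < w (Suc i)" if "i \<in> {1..<n}" for i
    using that permutes_inj[OF w] by (metis injD linorder_neqE_nat n_not_Suc_n)
  have ge: "1 \<le> p \<Longrightarrow> p \<le> n \<Longrightarrow> p \<le> w p" for p
  proof (induction p)
    case (Suc p)
    show ?case
    proof (cases "p = 0")
      case True
      then show ?thesis using permutes_in_image[OF w, of 1] Suc by auto
    next
      case False
      then show ?thesis using Suc inc[of p] by force
    qed
  qed simp
  have le: "w (n - d) \<le> n - d" if "d < n" for d
    using that
  proof (induction d)
    case 0
    then show ?case using permutes_in_image[OF w, of n] by auto
  next
    case (Suc d)
    then have "Suc (n - Suc d) = n - d" "n - Suc d \<in> {1..<n}" by auto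
    then have "w (n - Suc d) < w (n - d)" using inc[of "n - Suc d"] by simp
    moreover have "w (n - d) \<le> n - d" using Suc by simp
    ultimately show ?case by simp
  qed
  have "w p = p" for p
  proof (cases "p \<in> {1..n}")
    case True
    then show ?thesis using ge[of p] le[of "n - p"] by auto
  next
    case False
    then show ?thesis using w by (simp add: permutes_def)
  qed
  then show False using assms(2) by auto
qed

text \<open>Composing with \<open>st i\<close> at a descent lowers the number of inversions by one,
  and only the identity has no descent.\<close>

lemma perm_induct[consumes 1, case_names id step]:
  assumes "w permutes {1..n}" and "P id"
    and "\<And>w i. w permutes {1..n} \<Longrightarrow> i \<in> {1..<n} \<Longrightarrow> w (Suc i) < w i \<Longrightarrow> P (w \<circ> st i) \<Longrightarrow> P w"
  shows "P w"
  using assms(1)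
proof (induction "ninv n w" arbitrary: w rule: less_induct)
  case less
  show ?case
  proof (cases "w = id")
    case False
    then obtain i where i: "i \<in> {1..<n}" "w (Suc i) < w i"
      using exists_descent less.prems by blast
    show ?thesis
      using assms(3)[OF less.prems i] less.hyps[of "w \<circ> st i"] ninv_swap[OF i]
        permutes_compose[OF st_permutes[OF i(1)] less.prems] by simp
  qed (simp add: assms(2))
qed

lemma word_perm_Nil[simp]: "word_perm [] = id"
  by (simp add: word_perm_def)

lemma word_perm_Cons[simp]: "word_perm (i # is) = word_perm is \<circ> st i"
  by (simp add: word_perm_def)

lemma word_perm_append[simp]: "word_perm (xs @ ys) = word_perm ys \<circ> word_perm xs"
  by (induction xs) (simp_all add: comp_assoc)

lemma word_perm_permutes: "set is \<subseteq> {1..<n} \<Longrightarrow> word_perm is permutes {1..n}"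
proof (induction "is")
  case (Cons i "is")
  then show ?case
    using permutes_compose[OF st_permutes[of i n] Cons.IH] by (simp del: comp_apply)
qed (simp add: permutes_id)

lemma word_exists:
  assumes "w permutes {1..n}"
  shows "\<exists>is. set is \<subseteq> {1..<n} \<and> word_perm is = w"
  using assms
proof (induction rule: perm_induct)
  case id
  show ?case by (rule exI[of _ "[]"]) simp
next
  case (step w i)
  then obtain "is" where wd: "set is \<subseteq> {1..<n}" "word_perm is = w \<circ> st i" by blast
  then have "word_perm (i # is) = w" by (simp only: word_perm_Cons comp_assoc) (simp add: fun_eq_iff)
  with step wd show ?case
    by (intro exI[of _ "i # is"]) auto
qed

section \<open>Words modulo the Coxeter relations\<close>

inductive cox :: "nat \<Rightarrow> nat list \<Rightarrow> nat list \<Rightarrow> bool" for n where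
  cox_sq: "i \<in> {1..<n} \<Longrightarrow> cox n (xs @ [i, i] @ ys) (xs @ ys)"
| cox_far: "i \<in> {1..<n} \<Longrightarrow> j \<in> {1..<n} \<Longrightarrow> Suc i < j \<Longrightarrow> cox n (xs @ [i, j] @ ys) (xs @ [j, i] @ ys)"
| cox_braid: "i \<in> {1..<n} \<Longrightarrow> Suc i \<in> {1..<n} \<Longrightarrow>
    cox n (xs @ [i, Suc i, i] @ ys) (xs @ [Suc i, i, Suc i] @ ys)"
| cox_refl: "cox n xs xs"
| cox_sym: "cox n xs ys \<Longrightarrow> cox n ys xs"
| cox_trans: "cox n xs ys \<Longrightarrow> cox n ys zs \<Longrightarrow> cox n xs zs"

declare cox_trans[trans]

lemma cox_cong: "cox n a b \<Longrightarrow> cox n (xs @ a @ ys) (xs @ b @ ys)"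
proof (induction rule: cox.induct)
  case (cox_sq i as bs)
  then show ?case using cox.cox_sq[of i n "xs @ as" "bs @ ys"] by simp
next
  case (cox_far i j as bs)
  then show ?case using cox.cox_far[of i n j "xs @ as" "bs @ ys"] by simp
next
  case (cox_braid i as bs)
  then show ?case using cox.cox_braid[of i n "xs @ as" "bs @ ys"] by simp
qed (blast intro: cox.intros)+

lemma cox_append: "cox n a b \<Longrightarrow> cox n (a @ ys) (b @ ys)"
  using cox_cong[of n a b "[]" ys] by simp

lemma cox_prepend: "cox n a b \<Longrightarrow> cox n (xs @ a) (xs @ b)"
  using cox_cong[of n a b xs "[]"] by simp

lemma st_braid: "st i \<circ> st (Suc i) \<circ> st i = st (Suc i) \<circ> st i \<circ> st (Suc i)"
  by (rule ext) (auto simp: st_apply)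

lemma st_far: "Suc i < j \<Longrightarrow> st i \<circ> st j = st j \<circ> st i"
  by (rule ext) (auto simp: st_apply)

lemma cox_word_perm: "cox n a b \<Longrightarrow> word_perm a = word_perm b"
proof (induction rule: cox.induct)
  case (cox_far i j xs ys)
  then show ?case using st_far[of i j] by (simp only: word_perm_append word_perm_Cons word_perm_Nil id_comp comp_assoc)
next
  case (cox_braid i xs ys)
  then show ?case using st_braid[of i] by (simp only: word_perm_append word_perm_Cons word_perm_Nil id_comp comp_assoc)
qed (simp_all add: comp_assoc)

lemma cox_mono: "cox m a b \<Longrightarrow> m \<le> n \<Longrightarrow> cox n a b"
proof (induction rule: cox.induct)
  case (cox_sq i xs ys)
  then show ?case by (intro cox.cox_sq) auto
next
  case (cox_far i j xs ys)
  then show ?case by (intro cox.cox_far) auto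
next
  case (cox_braid i xs ys)
  then show ?case by (intro cox.cox_braid) auto
qed (blast intro: cox.intros)+

lemma cox_commute:
  assumes "\<forall>x\<in>set xs. x \<in> {1..<n} \<and> (Suc x < i \<or> Suc i < x)" "i \<in> {1..<n}"
  shows "cox n (xs @ [i]) (i # xs)"
  using assms
proof (induction xs)
  case Nil
  show ?case by (simp add: cox_refl)
next
  case (Cons x xs)
  have "cox n ([x] @ (xs @ [i])) ([x] @ (i # xs))"
    by (rule cox_prepend) (use Cons in auto)
  moreover have "cox n ([x, i] @ xs) ([i, x] @ xs)"
    using cox_far[of x n i "[]" xs] cox_sym[OF cox_far[of i n x "[]" xs]] Cons.prems by auto
  ultimately show ?case by (auto intro: cox_trans)
qed

text \<open>The list \<open>rev [j..<n]\<close> is the descending run from \<open>n - 1\<close> to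
  \<open>j\<close>. A letter appended to it passes to the front unchanged
  (\<open>Suc i < j\<close>), lengthens the run (\<open>Suc i = j\<close>), cancels its last letter
  (\<open>i = j\<close>), or comes out at the front as \<open>i - 1\<close> after one braid move
  (\<open>j < i\<close>). What comes out at the front never is the letter
  \<open>n - 1\<close>.\<close>

lemma cox_descending_snoc:
  assumes j: "1 \<le> j" "j \<le> n" and i: "i \<in> {1..<n}"
  shows "\<exists>ws k. set ws \<subseteq> {1..<n - 1} \<and> 1 \<le> k \<and> k \<le> n \<and>
           cox n (rev [j..<n] @ [i]) (ws @ rev [k..<n])"
proof -
  consider "Suc i < j" | "Suc i = j" | "i = j" | "j < i" by linarith
  then show ?thesis
  proof cases
    case 1
    then have "cox n (rev [j..<n] @ [i]) (i # rev [j..<n])"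
      by (intro cox_commute) (use i j in auto)
    then show ?thesis using 1 i j by (intro exI[of _ "[i]"] exI[of _ j]) auto
  next
    case 2
    then have "rev [j..<n] @ [i] = rev [i..<n]" using i by (simp add: upt_rec[of i])
    then show ?thesis using i by (intro exI[of _ "[]"] exI[of _ i]) (auto intro: cox_refl)
  next
    case 3
    then have "rev [j..<n] @ [i] = rev [Suc j..<n] @ [j, j] @ []"
      using i by (simp add: upt_rec[of j])
    then have "cox n (rev [j..<n] @ [i]) (rev [Suc j..<n] @ [])"
      using cox_sq[of j n "rev [Suc j..<n]" "[]"] 3 i by simp
    then show ?thesis using i 3 by (intro exI[of _ "[]"] exI[of _ "Suc j"]) auto
  next
    case 4
    define h where "h = i - 1"
    have h: "i = Suc h" "j \<le> h" using 4 by (auto simp: h_def)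
    let ?A = "rev [Suc i..<n]" and ?B = "rev [j..<h]"
    have "[j..<n] = [j..<h] @ [h..<n]"
      using h i by (metis atLeastLessThan_iff le_add_diff_inverse less_imp_le_nat Suc_lessD upt_add_eq_append)
    moreover have "[h..<n] = h # i # [Suc i..<n]" using h i by (simp add: upt_rec)
    ultimately have e: "rev [j..<n] = ?A @ [i, h] @ ?B" by simp
    have hn: "h \<in> {1..<n}" using h i j by auto
    have "cox n (?B @ [i]) (i # ?B)" by (rule cox_commute) (use h i j in auto)
    then have "cox n ((?A @ [i, h]) @ (?B @ [i])) ((?A @ [i, h]) @ (i # ?B))" by (rule cox_prepend)
    moreover have "cox n (?A @ [i, h, i] @ ?B) (?A @ [h, i, h] @ ?B)"
      using cox_sym[OF cox_braid[of h n ?A ?B]] h hn i by simp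
    moreover have "cox n (?A @ [h]) (h # ?A)" by (rule cox_commute) (use h i j in auto)
    then have "cox n ((?A @ [h]) @ [i, h] @ ?B) ((h # ?A) @ [i, h] @ ?B)" by (rule cox_append)
    ultimately have "cox n (rev [j..<n] @ [i]) ([h] @ rev [j..<n])"
      unfolding e by (auto intro: cox_trans)
    then show ?thesis using h i j by (intro exI[of _ "[h]"] exI[of _ j]) auto
  qed
qed

text \<open>The descending runs represent the cosets of the permutations that fix \<open>n\<close>.
  The letters of a word are pushed into the run one after the other.\<close>

lemma cox_normal_form:
  assumes "set xs \<subseteq> {1..<n}" "1 \<le> n"
  shows "\<exists>ws k. set ws \<subseteq> {1..<n - 1} \<and> 1 \<le> k \<and> k \<le> n \<and> cox n xs (ws @ rev [k..<n])"
  using assms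
proof (induction xs rule: rev_induct)
  case Nil
  then show ?case by (intro exI[of _ "[]"] exI[of _ n]) (auto intro: cox_refl)
next
  case (snoc i xs)
  then obtain ws k where ws: "set ws \<subseteq> {1..<n - 1}" "1 \<le> k" "k \<le> n" "cox n xs (ws @ rev [k..<n])"
    by auto
  obtain ws' k' where ws': "set ws' \<subseteq> {1..<n - 1}" "1 \<le> k'" "k' \<le> n"
      "cox n (rev [k..<n] @ [i]) (ws' @ rev [k'..<n])"
    using cox_descending_snoc[of k n i] ws snoc.prems by auto
  have "cox n (xs @ [i]) ((ws @ rev [k..<n]) @ [i])" by (rule cox_append) (fact ws)
  moreover have "cox n (ws @ (rev [k..<n] @ [i])) (ws @ (ws' @ rev [k'..<n]))"
    by (rule cox_prepend) (fact ws')
  ultimately have "cox n (xs @ [i]) ((ws @ ws') @ rev [k'..<n])" by (auto intro: cox_trans)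
  then show ?case using ws ws' by (intro exI[of _ "ws @ ws'"] exI[of _ k']) auto
qed

lemma word_perm_descending: "1 \<le> k \<Longrightarrow> k \<le> n \<Longrightarrow> word_perm (rev [k..<n]) n = k"
proof (induction n)
  case (Suc n)
  then show ?case by (cases "k = Suc n") (auto simp: st_apply)
qed simp

text \<open>In the normal form the run is recovered from the permutation as the image of the largest
  letter, and the rest of the word falls to the induction hypothesis. Arbitrary words are compared,
  reduced or not, because \<open>hperm\<close> takes an unspecified one.\<close>

lemma cox_complete:
  assumes "set xs \<subseteq> {1..<n}" "set ys \<subseteq> {1..<n}" "word_perm xs = word_perm ys"
  shows "cox n xs ys"
  using assms
proof (induction n arbitrary: xs ys)
  case 0
  then show ?case by (simp add: cox_refl)
next
  case (Suc n)
  obtain ws k where ws: "set ws \<subseteq> {1..<n}" "1 \<le> k" "k \<le> Suc n" "cox (Suc n) xs (ws @ rev [k..<Suc n])"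
    using cox_normal_form[of xs "Suc n"] Suc.prems by auto
  obtain vs j where vs: "set vs \<subseteq> {1..<n}" "1 \<le> j" "j \<le> Suc n" "cox (Suc n) ys (vs @ rev [j..<Suc n])"
    using cox_normal_form[of ys "Suc n"] Suc.prems by auto
  have fix_n: "word_perm zs (Suc n) = Suc n" if "set zs \<subseteq> {1..<n}" for zs
    using word_perm_permutes[OF that] by (auto simp: permutes_def)
  have eq: "word_perm (ws @ rev [k..<Suc n]) = word_perm (vs @ rev [j..<Suc n])"
    using cox_word_perm[OF ws(4)] cox_word_perm[OF vs(4)] Suc.prems(3) by metis
  have eqn: "word_perm (rev [k..<Suc n]) (word_perm ws x) = word_perm (rev [j..<Suc n]) (word_perm vs x)" for x
    using fun_cong[OF eq, of x] by (simp del: upt_Suc)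
  have kj: "k = j"
    using eqn[of "Suc n"] word_perm_descending[of k "Suc n"]
      word_perm_descending[of j "Suc n"] fix_n[OF ws(1)] fix_n[OF vs(1)] ws vs
    by (simp del: upt_Suc)
  have "bij (word_perm (rev [k..<Suc n]))"
    by (rule permutes_bij[OF word_perm_permutes[of _ "Suc n"]]) (use ws in auto)
  then have "word_perm ws = word_perm vs"
    using eqn kj by (auto simp: bij_def inj_def fun_eq_iff simp del: upt_Suc)
  then have "cox (Suc n) (ws @ rev [k..<Suc n]) (vs @ rev [j..<Suc n])"
    using Suc.IH ws vs kj cox_mono[of n ws vs "Suc n"] by (auto intro: cox_append)
  then show ?case using ws(4) vs(4) by (blast intro: cox_trans cox_sym)
qed

section \<open>The algebra and its modules\<close>

lemma pm_sum_single: "p = (\<Sum>w\<in>Poly_Mapping.keys p. Poly_Mapping.single w (Poly_Mapping.lookup p w))"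
proof (rule poly_mapping_eqI)
  fix k
  have "(\<Sum>x\<in>Poly_Mapping.keys p. Poly_Mapping.lookup (Poly_Mapping.single x (Poly_Mapping.lookup p x)) k)
      = (\<Sum>x\<in>Poly_Mapping.keys p. if x = k then Poly_Mapping.lookup p k else 0)"
    by (rule sum.cong) (auto simp: lookup_single)
  then show "Poly_Mapping.lookup p k = Poly_Mapping.lookup
      (\<Sum>w\<in>Poly_Mapping.keys p. Poly_Mapping.single w (Poly_Mapping.lookup p w)) k"
    by (simp add: lookup_sum not_in_keys_iff_lookup_eq_zero)
qed

lemma pm_induct[case_names zero single add]:
  assumes "P 0" "\<And>w c. w \<in> Poly_Mapping.keys p \<Longrightarrow> P (Poly_Mapping.single w c)"
    "\<And>a b. P a \<Longrightarrow> P b \<Longrightarrow> P (a + b)"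
  shows "P (p :: 'a \<Rightarrow>\<^sub>0 'b::comm_monoid_add)"
proof -
  have "P (\<Sum>w\<in>A. Poly_Mapping.single w (Poly_Mapping.lookup p w))"
    if "finite A" "A \<subseteq> Poly_Mapping.keys p" for A
    using that by (induction A rule: finite_induct) (auto intro: assms)
  then show ?thesis by (subst pm_sum_single) simp
qed

lemma letters_plus[simp]: "letters (v + w) = letters v @ letters w"
  by (simp add: plus_gword_def)

lemma letters_zero[simp]: "letters 0 = []"
  by (simp add: zero_gword_def)

section \<open>Linear extension of maps from words to the free algebra\<close>

locale coeff_space = vector_space scale for scale :: "'k::field \<Rightarrow> 'v::ab_group_add \<Rightarrow> 'v"
begin

definition lin :: "(gword \<Rightarrow> 'v) \<Rightarrow> 'k free_alg \<Rightarrow> 'v" where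
  "lin f p = (\<Sum>w\<in>Poly_Mapping.keys p. scale (Poly_Mapping.lookup p w) (f w))"

lemma lin_superset:
  "finite A \<Longrightarrow> Poly_Mapping.keys p \<subseteq> A \<Longrightarrow> lin f p = (\<Sum>w\<in>A. scale (Poly_Mapping.lookup p w) (f w))"
  unfolding lin_def by (rule sum.mono_neutral_left) (auto simp: in_keys_iff)

lemma lin_zero[simp]: "lin f 0 = 0"
  by (simp add: lin_def)

lemma lin_add: "lin f (p + q) = lin f p + lin f q"
proof -
  let ?A = "Poly_Mapping.keys p \<union> Poly_Mapping.keys q"
  have "lin f (p + q) = (\<Sum>w\<in>?A. scale (Poly_Mapping.lookup (p + q) w) (f w))"
    by (rule lin_superset) (use keys_add[of p q] in auto)
  moreover have "lin f p = (\<Sum>w\<in>?A. scale (Poly_Mapping.lookup p w) (f w))"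
    by (rule lin_superset) auto
  moreover have "lin f q = (\<Sum>w\<in>?A. scale (Poly_Mapping.lookup q w) (f w))"
    by (rule lin_superset) auto
  ultimately show ?thesis by (simp add: lookup_add scale_left_distrib sum.distrib)
qed

lemma lin_single[simp]: "lin f (Poly_Mapping.single w c) = scale c (f w)"
  by (simp add: lin_def)

lemma lin_uminus: "lin f (- p) = - lin f p"
  using lin_add[of f p "- p"] by (simp add: eq_neg_iff_add_eq_0 add.commute)

lemma lin_diff: "lin f (p - q) = lin f p - lin f q"
  using lin_add[of f p "- q"] lin_uminus[of f q] by simp

lemma lin_cong: "(\<And>w. w \<in> Poly_Mapping.keys p \<Longrightarrow> f w = g w) \<Longrightarrow> lin f p = lin g p"
  unfolding lin_def by (rule sum.cong) auto

lemma lin_fun_add: "lin (\<lambda>w. f w + g w) p = lin f p + lin g p"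
  by (simp add: lin_def scale_right_distrib sum.distrib)

lemma lin_fun_scale: "lin (\<lambda>w. scale c (f w)) p = scale c (lin f p)"
  by (simp add: lin_def scale_sum_right mult.commute)

lemma lin_fun_zero: "lin (\<lambda>w. 0) p = 0"
  by (simp add: lin_def)

lemma lin_single_mult: "lin f (Poly_Mapping.single w c * p) = scale c (lin (\<lambda>x. f (w + x)) p)"
proof (induction p rule: pm_induct)
  case (single x d)
  then show ?case by (simp add: mult_single)
qed (simp_all add: ring_distribs lin_add scale_right_distrib)

lemma lin_mult: "lin f (p * q) = lin (\<lambda>w. lin (\<lambda>x. f (w + x)) q) p"
proof (induction p rule: pm_induct)
  case (single x d)
  then show ?case by (simp add: lin_single_mult)
qed (simp_all add: ring_distribs lin_add)

end

section \<open>The free algebra and the quotient map\<close>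

lemma free_hecke_simps[simp]:
  "mult (free_hecke n) = (*)" "one (free_hecke n) = 1"
  "zero (free_hecke n) = 0" "add (free_hecke n) = (+)"
  by (simp_all add: free_hecke_def)

lemma free_carrier_iff:
  "p \<in> carrier (free_hecke n) \<longleftrightarrow> (\<forall>w\<in>Poly_Mapping.keys p. set (letters w) \<subseteq> gens n)"
  by (simp add: free_hecke_def)

lemma free_carrier_add: "p \<in> carrier (free_hecke n) \<Longrightarrow> q \<in> carrier (free_hecke n) \<Longrightarrow>
    p + q \<in> carrier (free_hecke n)"
  using keys_add[of p q] by (auto simp: free_carrier_iff)

lemma free_carrier_mult: "p \<in> carrier (free_hecke n) \<Longrightarrow> q \<in> carrier (free_hecke n) \<Longrightarrow>
    p * q \<in> carrier (free_hecke n)"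
  using keys_mult[of p q] by (fastforce simp: free_carrier_iff)

lemma free_carrier_uminus: "p \<in> carrier (free_hecke n) \<Longrightarrow> - p \<in> carrier (free_hecke n)"
  by (auto simp: free_carrier_iff in_keys_iff)

lemma free_carrier_diff: "p \<in> carrier (free_hecke n) \<Longrightarrow> q \<in> carrier (free_hecke n) \<Longrightarrow>
    p - q \<in> carrier (free_hecke n)"
  using free_carrier_add[of p n "- q"] free_carrier_uminus[of q n] by simp

lemma free_carrier_0: "0 \<in> carrier (free_hecke n)"
  by (simp add: free_carrier_iff)

lemma free_carrier_1: "1 \<in> carrier (free_hecke n)"
  by (simp add: free_carrier_iff)

lemma free_carrier_single: "set (letters w) \<subseteq> gens n \<Longrightarrow> Poly_Mapping.single w c \<in> carrier (free_hecke n)"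
  by (simp add: free_carrier_iff)

lemma free_carrier_scl: "scl c \<in> carrier (free_hecke n)"
  by (simp add: scl_def free_carrier_single)

lemma free_carrier_gS: "i \<in> {1..<n} \<Longrightarrow> gS i \<in> carrier (free_hecke n)"
  by (simp add: gS_def free_carrier_single gens_def)

lemma free_carrier_gL: "k \<in> {1..n} \<Longrightarrow> gL k \<in> carrier (free_hecke n)"
  by (simp add: gL_def free_carrier_single gens_def)

lemma free_carrier_prod_list:
  "(\<And>x. x \<in> set xs \<Longrightarrow> x \<in> carrier (free_hecke n)) \<Longrightarrow> prod_list xs \<in> carrier (free_hecke n)"
  by (induction xs) (auto intro: free_carrier_1 free_carrier_mult)

lemmas free_carrier = free_carrier_add free_carrier_mult free_carrier_uminus free_carrier_diff
  free_carrier_0 free_carrier_1 free_carrier_scl free_carrier_gS free_carrier_gL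

lemma ring_free_hecke: "ring (free_hecke n :: 'k::field free_alg ring)"
proof (rule ringI)
  show "abelian_group (free_hecke n)"
    by (rule abelian_groupI)
       (auto simp: free_carrier algebra_simps intro: exI[of _ "- x" for x] bexI[of _ "- x" for x])
  show "Group.monoid (free_hecke n)"
    by (rule monoidI) (auto simp: free_carrier algebra_simps)
qed (auto simp: algebra_simps)

lemma hecke_rels_carrier: "hecke_rels l n u \<subseteq> carrier (free_hecke n)"
proof -
  have "prod_list (map (\<lambda>c. gL 1 - scl (u c)) [1..<Suc l]) \<in> carrier (free_hecke n)" if "1 \<le> n"
    by (rule free_carrier_prod_list) (use that in \<open>auto intro!: free_carrier\<close>)
  then show ?thesis unfolding hecke_rels_def by (auto intro!: free_carrier split: if_splits)
qed

lemma hecke_ideal: "ideal (hecke_ideal l n u) (free_hecke n)"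
  unfolding hecke_ideal_def
  by (rule ring.genideal_ideal[OF ring_free_hecke hecke_rels_carrier])

lemma ring_hecke: "ring (hecke l n u)"
  unfolding hecke_def by (rule ideal.quotient_is_ring[OF hecke_ideal])

lemma hecke_proj_hom: "hecke_proj l n u \<in> ring_hom (free_hecke n) (hecke l n u)"
  using ideal.rcos_ring_hom[OF hecke_ideal[of l n u]]
  unfolding hecke_def hecke_proj_def by (simp add: eta_contract_eq[symmetric])

lemma hecke_carrier: "carrier (hecke l n u) = hecke_proj l n u ` carrier (free_hecke n)"
  by (auto simp: hecke_def hecke_proj_def FactRing_def A_RCOSETS_def' a_r_coset_def)

lemma proj_closed: "x \<in> carrier (free_hecke n) \<Longrightarrow> hecke_proj l n u x \<in> carrier (hecke l n u)"
  by (simp add: hecke_carrier)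

lemma proj_add: "x \<in> carrier (free_hecke n) \<Longrightarrow> y \<in> carrier (free_hecke n) \<Longrightarrow>
    hecke_proj l n u x \<oplus>\<^bsub>hecke l n u\<^esub> hecke_proj l n u y = hecke_proj l n u (x + y)"
  using ring_hom_add[OF hecke_proj_hom, of x n y l u] by simp

lemma proj_mult: "x \<in> carrier (free_hecke n) \<Longrightarrow> y \<in> carrier (free_hecke n) \<Longrightarrow>
    hecke_proj l n u x \<otimes>\<^bsub>hecke l n u\<^esub> hecke_proj l n u y = hecke_proj l n u (x * y)"
  using ring_hom_mult[OF hecke_proj_hom, of x n y l u] by simp

lemma proj_one: "hecke_proj l n u 1 = \<one>\<^bsub>hecke l n u\<^esub>"
  using ring_hom_one[OF hecke_proj_hom] by simp

lemma proj_zero: "hecke_proj l n u 0 = \<zero>\<^bsub>hecke l n u\<^esub>"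
  using ring_hom_zero[OF hecke_proj_hom ring_free_hecke ring_hecke] by simp

lemma proj_uminus: "x \<in> carrier (free_hecke n) \<Longrightarrow>
    \<ominus>\<^bsub>hecke l n u\<^esub> hecke_proj l n u x = hecke_proj l n u (- x)"
  using proj_add[of x n "- x" l u] proj_zero[of l n u] ring.ring_simprules(3)[OF ring_hecke]
  by (metis add.right_inverse free_carrier_uminus proj_closed ring_hecke abelian_group.minus_equality
      ring.is_abelian_group add.left_inverse proj_add)

lemma proj_minus: "x \<in> carrier (free_hecke n) \<Longrightarrow> y \<in> carrier (free_hecke n) \<Longrightarrow>
    hecke_proj l n u x \<ominus>\<^bsub>hecke l n u\<^esub> hecke_proj l n u y = hecke_proj l n u (x - y)"
  by (simp add: a_minus_def proj_uminus proj_add free_carrier)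

lemma proj_eq_iff: "x \<in> carrier (free_hecke n) \<Longrightarrow> y \<in> carrier (free_hecke n) \<Longrightarrow>
    hecke_proj l n u x = hecke_proj l n u y \<longleftrightarrow> x - y \<in> hecke_ideal l n u"
proof -
  assume xy: "x \<in> carrier (free_hecke n)" "y \<in> carrier (free_hecke n)"
  interpret I: ideal "hecke_ideal l n u" "free_hecke n" by (rule hecke_ideal)
  have m: "x \<ominus>\<^bsub>free_hecke n\<^esub> y = x - y"
    using xy by (metis I.minus_eq I.minus_equality add.left_inverse diff_conv_add_uminus
        free_carrier_uminus free_hecke_simps(3,4))
  show ?thesis
    unfolding hecke_proj_def using I.quotient_eq_iff_same_a_r_cos[OF hecke_ideal xy] m by simp
qed

lemma proj_mem: "y \<in> hecke_proj l n u x \<longleftrightarrow> (\<exists>z\<in>hecke_ideal l n u. y = z + x)"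
  by (auto simp: hecke_proj_def a_r_coset_def')

lemma ideal_carrier: "hecke_ideal l n u \<subseteq> carrier (free_hecke n)"
  using ideal.Icarr[OF hecke_ideal] by blast

lemma ideal_rels: "r \<in> hecke_rels l n u \<Longrightarrow> r \<in> hecke_ideal l n u"
  unfolding hecke_ideal_def using ring.genideal_self[OF ring_free_hecke hecke_rels_carrier] by blast

lemma rel_sq: "i \<in> {1..<n} \<Longrightarrow> gS i * gS i - 1 \<in> hecke_rels l n u"
  unfolding hecke_rels_def atLeastLessThan_iff by blast

lemma rel_far: "i \<in> {1..<n} \<Longrightarrow> j \<in> {1..<n} \<Longrightarrow> Suc i < j \<Longrightarrow> gS i * gS j - gS j * gS i \<in> hecke_rels l n u"
  unfolding hecke_rels_def atLeastLessThan_iff by blast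

lemma rel_braid: "i \<in> {1..<n} \<Longrightarrow> Suc i < n \<Longrightarrow>
    gS i * gS (Suc i) * gS i - gS (Suc i) * gS i * gS (Suc i) \<in> hecke_rels l n u"
  unfolding hecke_rels_def atLeastLessThan_iff by blast

lemma rel_LL: "i \<in> {1..n} \<Longrightarrow> k \<in> {1..n} \<Longrightarrow> gL i * gL k - gL k * gL i \<in> hecke_rels l n u"
  unfolding hecke_rels_def atLeastAtMost_iff by blast

lemma rel_SL: "i \<in> {1..<n} \<Longrightarrow> k \<in> {1..n} \<Longrightarrow> k \<noteq> i \<Longrightarrow> k \<noteq> Suc i \<Longrightarrow>
    gS i * gL k - gL k * gS i \<in> hecke_rels l n u"
  unfolding hecke_rels_def atLeastLessThan_iff atLeastAtMost_iff by blast

lemma rel_L_Suc: "i \<in> {1..<n} \<Longrightarrow> gL (Suc i) - (gS i * gL i * gS i + gS i) \<in> hecke_rels l n u"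
  unfolding hecke_rels_def atLeastLessThan_iff by blast

text \<open>A module over the free algebra only: the action of its elements has to be available
  before the relations can be checked. The space \<open>M\<close> is a set and not a type, so that
  modules can be cut out of function types by conditions.\<close>

locale hecke_ops = coeff_space scale
  for scale :: "'k::field \<Rightarrow> 'v::ab_group_add \<Rightarrow> 'v" (infixr \<open>*s\<close> 75) +
  fixes n :: nat and M :: "'v set" and S L :: "nat \<Rightarrow> 'v \<Rightarrow> 'v"
  assumes subspace_M: "subspace M"
    and S_closed: "i \<in> {1..<n} \<Longrightarrow> v \<in> M \<Longrightarrow> S i v \<in> M"
    and L_closed: "k \<in> {1..n} \<Longrightarrow> v \<in> M \<Longrightarrow> L k v \<in> M"
    and S_add: "i \<in> {1..<n} \<Longrightarrow> v \<in> M \<Longrightarrow> w \<in> M \<Longrightarrow> S i (v + w) = S i v + S i w"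
    and L_add: "k \<in> {1..n} \<Longrightarrow> v \<in> M \<Longrightarrow> w \<in> M \<Longrightarrow> L k (v + w) = L k v + L k w"
    and S_scale: "i \<in> {1..<n} \<Longrightarrow> v \<in> M \<Longrightarrow> S i (c *s v) = c *s S i v"
    and L_scale: "k \<in> {1..n} \<Longrightarrow> v \<in> M \<Longrightarrow> L k (c *s v) = c *s L k v"
begin

lemma M_add: "v \<in> M \<Longrightarrow> w \<in> M \<Longrightarrow> v + w \<in> M"
  using subspace_M by (rule subspace_add)

lemma M_scale: "v \<in> M \<Longrightarrow> c *s v \<in> M"
  using subspace_M by (rule subspace_scale)

lemma M_zero: "0 \<in> M"
  using subspace_M by (rule subspace_0)

lemma M_diff: "v \<in> M \<Longrightarrow> w \<in> M \<Longrightarrow> v - w \<in> M"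
  using subspace_M by (rule subspace_diff)

lemma M_sum: "(\<And>x. x \<in> A \<Longrightarrow> f x \<in> M) \<Longrightarrow> sum f A \<in> M"
  using subspace_M by (rule subspace_sum)

lemmas M_simps = S_closed L_closed M_add M_scale M_zero M_diff

lemma S_zero: "i \<in> {1..<n} \<Longrightarrow> S i 0 = 0"
  using S_scale[of i 0 0] M_zero by simp

lemma L_zero: "k \<in> {1..n} \<Longrightarrow> L k 0 = 0"
  using L_scale[of k 0 0] M_zero by simp

lemma S_diff: "i \<in> {1..<n} \<Longrightarrow> v \<in> M \<Longrightarrow> w \<in> M \<Longrightarrow> S i (v - w) = S i v - S i w"
  using S_add[of i "v - w" w] by (simp add: M_simps)

lemma S_minus: "i \<in> {1..<n} \<Longrightarrow> v \<in> M \<Longrightarrow> S i (- v) = - S i v"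
  using S_scale[of i v "- 1"] by simp

lemma L_diff: "k \<in> {1..n} \<Longrightarrow> v \<in> M \<Longrightarrow> w \<in> M \<Longrightarrow> L k (v - w) = L k v - L k w"
  using L_add[of k "v - w" w] by (simp add: M_simps)

primrec gact :: "gen \<Rightarrow> 'v \<Rightarrow> 'v" where
  "gact (GS i) = S i"
| "gact (GL k) = L k"

definition wact :: "gword \<Rightarrow> 'v \<Rightarrow> 'v" where
  "wact w v = foldr gact (letters w) v"

definition act :: "'k free_alg \<Rightarrow> 'v \<Rightarrow> 'v" where
  "act p v = lin (\<lambda>w. wact w v) p"

lemma wact_plus: "wact (w + x) v = wact w (wact x v)"
  by (simp add: wact_def)

lemma wact_zero[simp]: "wact 0 v = v"
  by (simp add: wact_def)

lemma gact_linear: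
  assumes "g \<in> gens n" "v \<in> M" "w \<in> M"
  shows "gact g v \<in> M" "gact g (v + w) = gact g v + gact g w" "gact g (c *s v) = c *s gact g v"
  using assms by (auto simp: gens_def M_simps S_add L_add S_scale L_scale)

lemma foldr_gact_linear:
  assumes "set gs \<subseteq> gens n" "v \<in> M" "w \<in> M"
  shows "foldr gact gs v \<in> M \<and> foldr gact gs (v + w) = foldr gact gs v + foldr gact gs w \<and>
    foldr gact gs (c *s v) = c *s foldr gact gs v"
  using assms
proof (induction gs)
  case (Cons g gs)
  have "foldr gact gs w \<in> M"
    using Cons.prems by (induction gs) (auto simp: gact_linear(1))
  then show ?case using Cons gact_linear[of g "foldr gact gs v" "foldr gact gs w"] by auto
qed simp

lemma wact_closed: "set (letters w) \<subseteq> gens n \<Longrightarrow> v \<in> M \<Longrightarrow> wact w v \<in> M"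
  using foldr_gact_linear[of "letters w" v v] by (simp add: wact_def)

lemma wact_add: "set (letters w) \<subseteq> gens n \<Longrightarrow> v \<in> M \<Longrightarrow> v' \<in> M \<Longrightarrow> wact w (v + v') = wact w v + wact w v'"
  using foldr_gact_linear[of "letters w" v v'] by (simp add: wact_def)

lemma wact_scale: "set (letters w) \<subseteq> gens n \<Longrightarrow> v \<in> M \<Longrightarrow> wact w (c *s v) = c *s wact w v"
  using foldr_gact_linear[of "letters w" v v c] by (simp add: wact_def)

lemma act_add: "act (p + q) v = act p v + act q v"
  by (simp add: act_def lin_add)

lemma act_diff: "act (p - q) v = act p v - act q v"
  by (simp add: act_def lin_diff)

lemma act_zero[simp]: "act 0 v = 0"
  by (simp add: act_def)

lemma act_single: "act (Poly_Mapping.single w c) v = c *s wact w v"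
  by (simp add: act_def)

lemma act_one[simp]: "act 1 v = v"
  using act_single[of 0 1 v] by simp

lemma act_scl[simp]: "act (scl c) v = c *s v"
  by (simp add: scl_def act_single)

lemma act_gS[simp]: "act (gS i) v = S i v"
  by (simp add: gS_def act_single wact_def)

lemma act_gL[simp]: "act (gL i) v = L i v"
  by (simp add: gL_def act_single wact_def)

lemma act_closed: "p \<in> carrier (free_hecke n) \<Longrightarrow> v \<in> M \<Longrightarrow> act p v \<in> M"
  unfolding act_def lin_def
  by (intro M_sum M_scale wact_closed) (auto simp: free_carrier_iff)

lemma act_plus_right: "p \<in> carrier (free_hecke n) \<Longrightarrow> v \<in> M \<Longrightarrow> w \<in> M \<Longrightarrow>
    act p (v + w) = act p v + act p w"
  unfolding act_def by (subst lin_fun_add[symmetric], rule lin_cong) (auto simp: free_carrier_iff wact_add)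

lemma act_scale_right: "p \<in> carrier (free_hecke n) \<Longrightarrow> v \<in> M \<Longrightarrow> act p (c *s v) = c *s act p v"
  unfolding act_def by (subst lin_fun_scale[symmetric], rule lin_cong) (auto simp: free_carrier_iff wact_scale)

lemma act_zero_right: "p \<in> carrier (free_hecke n) \<Longrightarrow> act p 0 = 0"
  using act_scale_right[of p 0 0] M_zero by simp

lemma wact_lin:
  assumes "set (letters w) \<subseteq> gens n" "\<And>x. x \<in> Poly_Mapping.keys q \<Longrightarrow> f x \<in> M"
  shows "lin (\<lambda>x. wact w (f x)) q = wact w (lin f q)"
proof -
  have "(\<Sum>x\<in>A. Poly_Mapping.lookup q x *s wact w (f x)) = wact w (\<Sum>x\<in>A. Poly_Mapping.lookup q x *s f x)"
    if "finite A" "A \<subseteq> Poly_Mapping.keys q" for A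
    using that
  proof (induction A rule: finite_induct)
    case empty
    show ?case using wact_scale[OF assms(1) M_zero, of 0] by simp
  next
    case (insert a A)
    have "(\<Sum>x\<in>A. Poly_Mapping.lookup q x *s f x) \<in> M"
      using insert assms(2) by (intro M_sum M_scale) auto
    then show ?case using insert assms by (simp add: wact_add wact_scale M_scale)
  qed
  then show ?thesis unfolding lin_def by simp
qed

lemma act_mult:
  assumes "p \<in> carrier (free_hecke n)" "q \<in> carrier (free_hecke n)" "v \<in> M"
  shows "act (p * q) v = act p (act q v)"
proof -
  have "act (p * q) v = lin (\<lambda>w. lin (\<lambda>x. wact (w + x) v) q) p"
    by (simp add: act_def lin_mult)
  also have "\<dots> = lin (\<lambda>w. wact w (act q v)) p"
    unfolding act_def wact_plus
    by (intro lin_cong wact_lin) (use assms in \<open>auto simp: free_carrier_iff wact_closed\<close>)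
  finally show ?thesis by (simp add: act_def)
qed

lemma act_prod_L:
  assumes "1 \<le> n" "v \<in> M"
  shows "act (prod_list (map (\<lambda>c. gL 1 - scl (u c)) cs)) v = foldr (\<lambda>c w. L 1 w - u c *s w) cs v"
proof (induction cs)
  case (Cons c cs)
  have "prod_list (map (\<lambda>c. gL 1 - scl (u c)) cs) \<in> carrier (free_hecke n)"
    by (rule free_carrier_prod_list) (use assms in \<open>auto intro!: free_carrier\<close>)
  then show ?case using assms Cons by (simp add: act_mult act_diff free_carrier)
qed simp

text \<open>The ideal of relations is the least ideal that contains them. As the elements acting by
  zero form an ideal, it is enough that the relations themselves act by zero.\<close>

lemma annihilator_ideal: "ideal {p \<in> carrier (free_hecke n). \<forall>v\<in>M. act p v = 0} (free_hecke n)"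
proof (rule idealI[OF ring_free_hecke])
  show "subgroup {p \<in> carrier (free_hecke n). \<forall>v\<in>M. act p v = 0} (add_monoid (free_hecke n))"
  proof (rule group.subgroupI)
    show "Group.group (add_monoid (free_hecke n))"
      by (rule abelian_group.a_group[OF ring.is_abelian_group[OF ring_free_hecke]])
    show "{p \<in> carrier (free_hecke n). \<forall>v\<in>M. act p v = 0} \<noteq> {}"
      using free_carrier_0 by force
    fix a assume a: "a \<in> {p \<in> carrier (free_hecke n). \<forall>v\<in>M. act p v = 0}"
    have "inv\<^bsub>add_monoid (free_hecke n)\<^esub> a = - a"
      by (rule group.inv_equality[OF abelian_group.a_group[OF ring.is_abelian_group[OF ring_free_hecke]]])
         (use a in \<open>auto simp: free_carrier\<close>)
    then show "inv\<^bsub>add_monoid (free_hecke n)\<^esub> a \<in> {p \<in> carrier (free_hecke n). \<forall>v\<in>M. act p v = 0}"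
      using a act_diff[of 0 a] by (auto simp: free_carrier)
  qed (auto simp: act_add free_carrier)
qed (auto simp: act_mult free_carrier act_closed act_zero_right)

text \<open>Reduces the construction of a module to identities between operators. By symmetry the
  \<open>L_k\<close> need to be compared for \<open>i < k\<close> only.\<close>

lemma hecke_relsI:
  assumes "1 \<le> n \<Longrightarrow> v \<in> M \<Longrightarrow> foldr (\<lambda>c w. L 1 w - u c *s w) [1..<Suc l] v = 0"
    and "\<And>i. i \<in> {1..<n} \<Longrightarrow> v \<in> M \<Longrightarrow> S i (S i v) = v"
    and "\<And>i j. i \<in> {1..<n} \<Longrightarrow> j \<in> {1..<n} \<Longrightarrow> Suc i < j \<Longrightarrow> v \<in> M \<Longrightarrow> S i (S j v) = S j (S i v)"
    and "\<And>i. i \<in> {1..<n} \<Longrightarrow> Suc i < n \<Longrightarrow> v \<in> M \<Longrightarrow>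
        S i (S (Suc i) (S i v)) = S (Suc i) (S i (S (Suc i) v))"
    and "\<And>i k. i \<in> {1..n} \<Longrightarrow> k \<in> {1..n} \<Longrightarrow> i < k \<Longrightarrow> v \<in> M \<Longrightarrow> L i (L k v) = L k (L i v)"
    and "\<And>i k. i \<in> {1..<n} \<Longrightarrow> k \<in> {1..n} \<Longrightarrow> k \<noteq> i \<Longrightarrow> k \<noteq> Suc i \<Longrightarrow> v \<in> M \<Longrightarrow> S i (L k v) = L k (S i v)"
    and "\<And>i. i \<in> {1..<n} \<Longrightarrow> v \<in> M \<Longrightarrow> L (Suc i) v = S i (L i (S i v)) + S i v"
    and r: "r \<in> hecke_rels l n u" and v: "v \<in> M"
  shows "act r v = 0"
proof -
  have LL: "L i (L k v) = L k (L i v)" if "Suc 0 \<le> i" "i \<le> n" "Suc 0 \<le> k" "k \<le> n" for i k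
    using assms(5)[of i k] assms(5)[of k i] that v by (cases i k rule: linorder_cases) auto
  have f: "act (prod_list (map (\<lambda>c. gL 1 - scl (u c)) cs)) v = foldr (\<lambda>c w. L 1 w - u c *s w) cs v"
    if "1 \<le> n" for cs
    using that v by (rule act_prod_L)
  have SS: "S i (S j v) = S j (S i v)" if "Suc 0 \<le> i" "j < n" "Suc i < j" for i j
    using assms(3)[of i j] that v by auto
  have SL: "S i (L k v) = L k (S i v)" if "Suc 0 \<le> i" "i < n" "Suc 0 \<le> k" "k \<le> n" "k \<noteq> i" "k \<noteq> Suc i" for i k
    using assms(6)[of i k] that v by auto
  have f0: "foldr (\<lambda>c w. L (Suc 0) w - u c *s w) [Suc 0..<Suc l] v = 0" if "Suc 0 \<le> n"
    using assms(1) v that by (simp del: upt_Suc)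
  show ?thesis
    using r f[of "[1..<Suc l]"] v unfolding hecke_rels_def
    by (auto simp: act_mult act_diff act_add free_carrier M_simps assms(1,2,4,7) simp del: upt_Suc
        split: if_splits intro: LL SS SS[symmetric] SL f0)
qed

end

locale hecke_module = hecke_ops scale n M S L
  for scale :: "'k::field \<Rightarrow> 'v::ab_group_add \<Rightarrow> 'v" (infixr \<open>*s\<close> 75) and n M S L +
  fixes l :: nat and u :: "nat \<Rightarrow> 'k"
  assumes rels: "r \<in> hecke_rels l n u \<Longrightarrow> v \<in> M \<Longrightarrow> act r v = 0"
begin

lemma S_sq: "i \<in> {1..<n} \<Longrightarrow> v \<in> M \<Longrightarrow> S i (S i v) = v"
  using rels[OF rel_sq, of i v] by (simp add: act_mult act_diff free_carrier)

lemma S_far: "i \<in> {1..<n} \<Longrightarrow> j \<in> {1..<n} \<Longrightarrow> Suc i < j \<Longrightarrow> v \<in> M \<Longrightarrow> S i (S j v) = S j (S i v)"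
  using rels[OF rel_far, of i j v] by (simp add: act_mult act_diff free_carrier)

lemma S_braid: "i \<in> {1..<n} \<Longrightarrow> Suc i < n \<Longrightarrow> v \<in> M \<Longrightarrow>
    S i (S (Suc i) (S i v)) = S (Suc i) (S i (S (Suc i) v))"
  using rels[OF rel_braid, of i v] by (simp add: act_mult act_diff free_carrier M_simps)

lemma L_L: "i \<in> {1..n} \<Longrightarrow> k \<in> {1..n} \<Longrightarrow> v \<in> M \<Longrightarrow> L i (L k v) = L k (L i v)"
  using rels[OF rel_LL, of i k v] by (simp add: act_mult act_diff free_carrier)

lemma S_L: "i \<in> {1..<n} \<Longrightarrow> k \<in> {1..n} \<Longrightarrow> k \<noteq> i \<Longrightarrow> k \<noteq> Suc i \<Longrightarrow> v \<in> M \<Longrightarrow> S i (L k v) = L k (S i v)"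
  using rels[OF rel_SL, of i k v] by (simp add: act_mult act_diff free_carrier)

lemma L_Suc: "i \<in> {1..<n} \<Longrightarrow> v \<in> M \<Longrightarrow> L (Suc i) v = S i (L i (S i v)) + S i v"
  using rels[OF rel_L_Suc, of i v] by (simp add: act_mult act_diff act_add free_carrier M_simps)

lemma L_one: "1 \<le> n \<Longrightarrow> v \<in> M \<Longrightarrow> foldr (\<lambda>c w. L 1 w - u c *s w) [1..<Suc l] v = 0"
proof -
  assume n: "1 \<le> n" and v: "v \<in> M"
  show ?thesis
    using rels[of "prod_list (map (\<lambda>c. gL 1 - scl (u c)) [1..<Suc l])" v] n v
      act_prod_L[OF n v, of u "[1..<Suc l]"]
    by (simp add: hecke_rels_def del: upt_Suc)
qed

lemma act_ideal:
  assumes "p \<in> hecke_ideal l n u" "v \<in> M"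
  shows "act p v = 0"
proof -
  have "hecke_ideal l n u \<subseteq> {p \<in> carrier (free_hecke n). \<forall>v\<in>M. act p v = 0}"
    unfolding hecke_ideal_def
    by (rule ring.genideal_minimal[OF ring_free_hecke annihilator_ideal])
       (use rels hecke_rels_carrier in blast)
  then show ?thesis using assms by blast
qed

text \<open>All representatives of a coset act alike on \<open>M\<close> by
  \<open>act_ideal\<close>, so the description picks a definite value there.\<close>

definition opr :: "'k free_alg set \<Rightarrow> 'v \<Rightarrow> 'v" where
  "opr X v = (THE y. \<forall>p\<in>X. act p v = y)"

lemma opr_proj: "x \<in> carrier (free_hecke n) \<Longrightarrow> v \<in> M \<Longrightarrow> opr (hecke_proj l n u x) v = act x v"
proof -
  assume x: "x \<in> carrier (free_hecke n)" and v: "v \<in> M"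
  have a: "act p v = act x v" if "p \<in> hecke_proj l n u x" for p
    using that v by (auto simp: proj_mem act_add act_ideal)
  have *: "x \<in> hecke_proj l n u x"
    using x additive_subgroup.zero_closed[OF ideal.axioms(1)[OF hecke_ideal[of l n u]]]
    by (auto simp: proj_mem)
  show ?thesis unfolding opr_def
  proof (rule the_equality)
    show "\<forall>p\<in>hecke_proj l n u x. act p v = act x v" using a by blast
    show "y = act x v" if "\<forall>p\<in>hecke_proj l n u x. act p v = y" for y using that * a by metis
  qed
qed

abbreviation H where "H \<equiv> hecke l n u"

lemma opr_closed: "X \<in> carrier H \<Longrightarrow> v \<in> M \<Longrightarrow> opr X v \<in> M"
  by (auto simp: hecke_carrier opr_proj act_closed)

lemma opr_plus_right: "X \<in> carrier H \<Longrightarrow> v \<in> M \<Longrightarrow> w \<in> M \<Longrightarrow> opr X (v + w) = opr X v + opr X w"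
  by (auto simp: hecke_carrier opr_proj act_plus_right M_simps)

lemma opr_scale_right: "X \<in> carrier H \<Longrightarrow> v \<in> M \<Longrightarrow> opr X (c *s v) = c *s opr X v"
  by (auto simp: hecke_carrier opr_proj act_scale_right M_simps)

lemma opr_zero_right: "X \<in> carrier H \<Longrightarrow> opr X 0 = 0"
  using opr_scale_right[of X 0 0] M_zero by simp

lemma opr_mult: "X \<in> carrier H \<Longrightarrow> Y \<in> carrier H \<Longrightarrow> v \<in> M \<Longrightarrow> opr (X \<otimes>\<^bsub>H\<^esub> Y) v = opr X (opr Y v)"
  by (auto simp: hecke_carrier opr_proj proj_mult act_mult free_carrier act_closed)

lemma opr_add: "X \<in> carrier H \<Longrightarrow> Y \<in> carrier H \<Longrightarrow> v \<in> M \<Longrightarrow> opr (X \<oplus>\<^bsub>H\<^esub> Y) v = opr X v + opr Y v"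
  by (auto simp: hecke_carrier opr_proj proj_add act_add free_carrier)

lemma opr_minus: "X \<in> carrier H \<Longrightarrow> Y \<in> carrier H \<Longrightarrow> v \<in> M \<Longrightarrow> opr (X \<ominus>\<^bsub>H\<^esub> Y) v = opr X v - opr Y v"
  by (auto simp: hecke_carrier opr_proj proj_minus act_diff free_carrier)

lemma opr_one: "v \<in> M \<Longrightarrow> opr \<one>\<^bsub>H\<^esub> v = v"
  by (simp add: opr_proj free_carrier flip: proj_one)

lemma opr_zero: "v \<in> M \<Longrightarrow> opr \<zero>\<^bsub>H\<^esub> v = 0"
  by (simp add: opr_proj free_carrier flip: proj_zero)

lemma opr_hscl: "v \<in> M \<Longrightarrow> opr (hscl l n u c) v = c *s v"
  by (simp add: opr_proj free_carrier)

lemma opr_hL: "k \<in> {1..n} \<Longrightarrow> v \<in> M \<Longrightarrow> opr (hL l n u k) v = L k v"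
  by (simp add: opr_proj free_carrier)

lemma opr_finsum:
  assumes "finite A" "\<And>a. a \<in> A \<Longrightarrow> f a \<in> carrier H" "v \<in> M"
  shows "opr (finsum H f A) v = (\<Sum>a\<in>A. opr (f a) v)"
  using assms
proof (induction A rule: finite_induct)
  interpret R: ring H by (rule ring_hecke)
  case empty
  then show ?case by (simp add: opr_zero)
next
  interpret R: ring H by (rule ring_hecke)
  case (insert a A)
  then show ?case by (simp add: opr_add R.finsum_closed Pi_iff)
qed

lemma foldr_S_closed: "set is \<subseteq> {1..<n} \<Longrightarrow> v \<in> M \<Longrightarrow> foldr S is v \<in> M"
  by (induction "is") (auto simp: M_simps)

end

lemma hecke_rels_mono: "m \<le> n \<Longrightarrow> hecke_rels l m u \<subseteq> hecke_rels l n u"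
proof -
  assume m: "m \<le> n"
  note lt = less_le_trans[OF _ m] and le = order_trans[OF _ m]
  show ?thesis
    unfolding hecke_rels_def
  proof (intro Un_mono, goal_cases)
    case 1
    show ?case using m by auto
  qed (blast intro: lt le)+
qed

text \<open>Restriction to the smaller algebra keeps the space and the operators, because the
  generators and relations for \<open>m\<close> are among those for \<open>n\<close>.\<close>

lemma (in hecke_module) hecke_module_mono:
  assumes "m \<le> n"
  shows "hecke_module scale m M S L l u"
proof
  show "subspace M" by (rule subspace_M)
  show "hecke_ops.act scale S L r v = 0" if "r \<in> hecke_rels l m u" "v \<in> M" for r v
    using rels hecke_rels_mono[OF assms] that by blast
qed (use assms in \<open>auto simp: M_simps S_add L_add S_scale L_scale\<close>)

lemma cox_set: "cox n a b \<Longrightarrow> set a \<subseteq> {1..<n} \<longleftrightarrow> set b \<subseteq> {1..<n}"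
  by (induction rule: cox.induct) auto

lemma free_carrier_word: "set is \<subseteq> {1..<n} \<Longrightarrow> prod_list (map gS is) \<in> carrier (free_hecke n)"
  by (rule free_carrier_prod_list) (auto intro!: free_carrier_gS)

context hecke_module begin

lemma foldr_S_cox: "cox n a b \<Longrightarrow> set a \<subseteq> {1..<n} \<Longrightarrow> v \<in> M \<Longrightarrow> foldr S a v = foldr S b v"
proof (induction rule: cox.induct)
  case (cox_sq i xs ys)
  then have "foldr S ys v \<in> M" by (intro foldr_S_closed) auto
  then show ?case using cox_sq by (simp add: S_sq)
next
  case (cox_far i j xs ys)
  then have "foldr S ys v \<in> M" by (intro foldr_S_closed) auto
  then show ?case using cox_far S_far[of i j "foldr S ys v"] by simp
next
  case (cox_braid i xs ys)
  then have "foldr S ys v \<in> M" by (intro foldr_S_closed) auto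
  then show ?case using cox_braid S_braid[of i "foldr S ys v"] by simp
next
  case (cox_sym a b)
  then show ?case using cox_set by metis
next
  case (cox_trans a b c)
  then show ?case using cox_set by metis
qed simp

lemma act_word: "set is \<subseteq> {1..<n} \<Longrightarrow> v \<in> M \<Longrightarrow> act (prod_list (map gS is)) v = foldr S is v"
proof (induction "is")
  case (Cons i "is")
  then show ?case
    using act_mult[OF free_carrier_gS[of i] free_carrier_word[of "is"], of v] by simp
qed simp

text \<open>Whatever word the choice in \<open>hperm\<close> selects, \<open>cox_complete\<close>
  links it to \<open>is\<close> by Coxeter relations, and the operators respect these.\<close>

lemma opr_hperm:
  assumes "set is \<subseteq> {1..<n}" "v \<in> M"
  shows "opr (hperm l n u (word_perm is)) v = foldr S is v"
proof -
  define js where "js = (SOME js. set js \<subseteq> {1..<n} \<and> word_perm js = word_perm is)"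
  have js: "set js \<subseteq> {1..<n} \<and> word_perm js = word_perm is"
    unfolding js_def by (rule someI_ex) (use assms in blast)
  have "opr (hperm l n u (word_perm is)) v = foldr S js v"
    unfolding hperm_def js_def[symmetric] using js assms
    by (simp add: opr_proj free_carrier_word act_word)
  also have "\<dots> = foldr S is v"
    by (rule foldr_S_cox[OF cox_complete]) (use js assms in auto)
  finally show ?thesis .
qed

end

lemma hperm_closed:
  assumes "w permutes {1..n}"
  shows "hperm l n u w \<in> carrier (hecke l n u)"
proof -
  have "set (SOME is. set is \<subseteq> {1..<n} \<and> word_perm is = w) \<subseteq> {1..<n} \<and>
      word_perm (SOME is. set is \<subseteq> {1..<n} \<and> word_perm is = w) = w"
    by (rule someI_ex[OF word_exists[OF assms]])
  then show ?thesis
    unfolding hperm_def by (intro proj_closed free_carrier_word) blast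
qed

context hecke_module begin

lemma opr_hperm_id: "v \<in> M \<Longrightarrow> opr (hperm l n u id) v = v"
  using opr_hperm[of "[]" v] by simp

lemma opr_hperm_st_comp:
  assumes "w permutes {1..n}" "i \<in> {1..<n}" "v \<in> M"
  shows "opr (hperm l n u (st i \<circ> w)) v = opr (hperm l n u w) (S i v)"
proof -
  obtain "is" where wd: "set is \<subseteq> {1..<n}" "word_perm is = w" using word_exists[OF assms(1)] by blast
  then have "word_perm (is @ [i]) = st i \<circ> w" by (simp only: word_perm_append word_perm_Cons word_perm_Nil id_comp)
  then show ?thesis
    using opr_hperm[of "is @ [i]" v] opr_hperm[of "is" "S i v"] wd assms by (simp add: M_simps)
qed

lemma opr_hperm_comp_st:
  assumes "w permutes {1..n}" "i \<in> {1..<n}" "v \<in> M"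
  shows "opr (hperm l n u (w \<circ> st i)) v = S i (opr (hperm l n u w) v)"
proof -
  obtain "is" where wd: "set is \<subseteq> {1..<n}" "word_perm is = w" using word_exists[OF assms(1)] by blast
  then have "word_perm (i # is) = w \<circ> st i" by (simp only: word_perm_Cons)
  then show ?thesis
    using opr_hperm[of "i # is" v] opr_hperm[of "is" v] wd assms by (simp add: M_simps)
qed

end

section \<open>Products of commuting factors in a noncommutative ring\<close>

lemma (in monoid) finprod_commuting_insert:
  assumes "finite A" "a \<notin> A" "f \<in> insert a A \<rightarrow> carrier G"
    and "\<And>x y. x \<in> insert a A \<Longrightarrow> y \<in> insert a A \<Longrightarrow> f x \<otimes> f y = f y \<otimes> f x"
  shows "finprod G f (insert a A) = f a \<otimes> finprod G f A"
proof -
  have "LCD (insert a A) (carrier G) ((\<otimes>) \<circ> f)"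
  proof (rule LCD.intro)
    fix x y z assume x: "x \<in> insert a A" "y \<in> insert a A" "z \<in> carrier G"
    then have "f x \<in> carrier G" "f y \<in> carrier G" using assms(3) by blast+
    then show "((\<otimes>) \<circ> f) x (((\<otimes>) \<circ> f) y z) = ((\<otimes>) \<circ> f) y (((\<otimes>) \<circ> f) x z)"
      using x assms(4)[of x y] by (simp flip: m_assoc)
  qed (use assms(3) in auto)
  from LCD.foldD_insert[OF this assms(1,2), of "\<one>"] show ?thesis
    using assms(1) by (auto simp: finprod_def)
qed

text \<open>The double commutant of the \<open>L\<^sub>k\<close>, a commutative subring that contains all factors
  of the products in the definition of the seminormal basis.\<close>

definition hZ :: "nat \<Rightarrow> nat \<Rightarrow> (nat \<Rightarrow> 'k::field) \<Rightarrow> 'k free_alg set set" where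
  "hZ l n u = {x \<in> carrier (hecke l n u). \<forall>z\<in>carrier (hecke l n u).
     (\<forall>k\<in>{1..n}. z \<otimes>\<^bsub>hecke l n u\<^esub> hL l n u k = hL l n u k \<otimes>\<^bsub>hecke l n u\<^esub> z) \<longrightarrow>
     x \<otimes>\<^bsub>hecke l n u\<^esub> z = z \<otimes>\<^bsub>hecke l n u\<^esub> x}"

lemma hZ_carrier: "x \<in> hZ l n u \<Longrightarrow> x \<in> carrier (hecke l n u)"
  by (simp add: hZ_def)

lemma hL_commute:
  assumes "i \<in> {1..n}" "k \<in> {1..n}"
  shows "hL l n u i \<otimes>\<^bsub>hecke l n u\<^esub> hL l n u k = hL l n u k \<otimes>\<^bsub>hecke l n u\<^esub> hL l n u i"
  using assms rel_LL[OF assms, of l u] by (simp add: proj_mult free_carrier proj_eq_iff ideal_rels)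

text \<open>The \<open>L_k\<close> commute with one another, so an element \<open>y\<close> of the
  double commutant commutes with every \<open>L_k\<close>. It thereby lies in the commutant, with
  which \<open>x\<close> commutes.\<close>

lemma hZ_commute:
  assumes "x \<in> hZ l n u" "y \<in> hZ l n u"
  shows "x \<otimes>\<^bsub>hecke l n u\<^esub> y = y \<otimes>\<^bsub>hecke l n u\<^esub> x"
proof -
  have "y \<otimes>\<^bsub>hecke l n u\<^esub> hL l n u k = hL l n u k \<otimes>\<^bsub>hecke l n u\<^esub> y" if "k \<in> {1..n}" for k
    using assms(2) that hL_commute[of _ n k l u] proj_closed[OF free_carrier_gL[OF that]]
    unfolding hZ_def by blast
  then show ?thesis using assms unfolding hZ_def by blast
qed

lemma hZ_mult: "x \<in> hZ l n u \<Longrightarrow> y \<in> hZ l n u \<Longrightarrow> x \<otimes>\<^bsub>hecke l n u\<^esub> y \<in> hZ l n u"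
proof -
  interpret R: ring "hecke l n u" by (rule ring_hecke)
  assume xy: "x \<in> hZ l n u" "y \<in> hZ l n u"
  then have c: "x \<in> carrier (hecke l n u)" "y \<in> carrier (hecke l n u)" by (auto simp: hZ_carrier)
  show ?thesis
    unfolding hZ_def
  proof (intro CollectI conjI ballI impI)
    fix z assume z: "z \<in> carrier (hecke l n u)"
      "\<forall>k\<in>{1..n}. z \<otimes>\<^bsub>hecke l n u\<^esub> hL l n u k = hL l n u k \<otimes>\<^bsub>hecke l n u\<^esub> z"
    then have "x \<otimes>\<^bsub>hecke l n u\<^esub> z = z \<otimes>\<^bsub>hecke l n u\<^esub> x" "y \<otimes>\<^bsub>hecke l n u\<^esub> z = z \<otimes>\<^bsub>hecke l n u\<^esub> y"
      using xy unfolding hZ_def by blast+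
    then show "x \<otimes>\<^bsub>hecke l n u\<^esub> y \<otimes>\<^bsub>hecke l n u\<^esub> z = z \<otimes>\<^bsub>hecke l n u\<^esub> (x \<otimes>\<^bsub>hecke l n u\<^esub> y)"
      using c z(1) by (metis R.m_assoc)
  qed (use c in simp)
qed

lemma hZ_minus: "x \<in> hZ l n u \<Longrightarrow> y \<in> hZ l n u \<Longrightarrow> x \<ominus>\<^bsub>hecke l n u\<^esub> y \<in> hZ l n u"
proof -
  interpret R: ring "hecke l n u" by (rule ring_hecke)
  assume xy: "x \<in> hZ l n u" "y \<in> hZ l n u"
  then have c: "x \<in> carrier (hecke l n u)" "y \<in> carrier (hecke l n u)" by (auto simp: hZ_carrier)
  show ?thesis
    unfolding hZ_def
  proof (intro CollectI conjI ballI impI)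
    fix z assume z: "z \<in> carrier (hecke l n u)"
      "\<forall>k\<in>{1..n}. z \<otimes>\<^bsub>hecke l n u\<^esub> hL l n u k = hL l n u k \<otimes>\<^bsub>hecke l n u\<^esub> z"
    then have "x \<otimes>\<^bsub>hecke l n u\<^esub> z = z \<otimes>\<^bsub>hecke l n u\<^esub> x" "y \<otimes>\<^bsub>hecke l n u\<^esub> z = z \<otimes>\<^bsub>hecke l n u\<^esub> y"
      using xy unfolding hZ_def by blast+
    then show "(x \<ominus>\<^bsub>hecke l n u\<^esub> y) \<otimes>\<^bsub>hecke l n u\<^esub> z = z \<otimes>\<^bsub>hecke l n u\<^esub> (x \<ominus>\<^bsub>hecke l n u\<^esub> y)"
      using c z(1) by (simp add: R.minus_eq R.l_distr R.r_distr R.l_minus R.r_minus)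
  qed (use c in simp)
qed

lemma hZ_one: "\<one>\<^bsub>hecke l n u\<^esub> \<in> hZ l n u"
proof -
  interpret R: ring "hecke l n u" by (rule ring_hecke)
  show ?thesis by (simp add: hZ_def)
qed

lemma scl_central: "scl c * p = p * scl c"
  unfolding scl_def by (induction p rule: pm_induct) (simp_all add: mult_single ring_distribs mult.commute)

lemma hZ_hscl: "hscl l n u c \<in> hZ l n u"
  by (auto simp: hZ_def hecke_carrier proj_mult free_carrier scl_central)

lemma hZ_hL: "k \<in> {1..n} \<Longrightarrow> hL l n u k \<in> hZ l n u"
  by (auto simp: hZ_def intro!: proj_closed free_carrier_gL)

lemma finprod_hZ_insert:
  assumes "finite A" "a \<notin> A" "\<And>x. x \<in> insert a A \<Longrightarrow> f x \<in> hZ l n u"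
  shows "finprod (hecke l n u) f (insert a A) = f a \<otimes>\<^bsub>hecke l n u\<^esub> finprod (hecke l n u) f A"
proof -
  interpret R: ring "hecke l n u" by (rule ring_hecke)
  show ?thesis
    by (rule R.finprod_commuting_insert[OF assms(1,2)]) (auto intro!: hZ_carrier hZ_commute assms(3))
qed

lemma finprod_hecke_empty: "finprod (hecke l n u) f {} = \<one>\<^bsub>hecke l n u\<^esub>"
  by (simp add: finprod_def foldD_empty[OF hZ_carrier[OF hZ_one]])

lemma finprod_hZ:
  assumes "\<And>x. x \<in> A \<Longrightarrow> f x \<in> hZ l n u"
  shows "finprod (hecke l n u) f A \<in> hZ l n u"
proof (cases "finite A")
  case True
  then show ?thesis using assms
  proof (induction A rule: finite_induct)
    case empty
    then show ?case by (simp add: hZ_one finprod_hecke_empty)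
  next
    case (insert a A)
    then show ?case using finprod_hZ_insert[of A a f l n u] by (simp add: hZ_mult)
  qed
qed (simp add: finprod_def hZ_one)

lemma (in hecke_module) opr_finprod:
  assumes "finite A" "\<And>x. x \<in> A \<Longrightarrow> f x \<in> hZ l n u" "v \<in> M"
    and "\<And>x. x \<in> A \<Longrightarrow> opr (f x) v = e x *s v"
  shows "opr (finprod H f A) v = (\<Prod>x\<in>A. e x) *s v"
  using assms
proof (induction A rule: finite_induct)
  case empty
  then show ?case by (simp add: finprod_hecke_empty opr_one)
next
  case (insert a A)
  have "opr (finprod H f (insert a A)) v = opr (f a) (opr (finprod H f A) v)"
    using insert finprod_hZ_insert[of A a f l n u]
    by (simp add: opr_mult hZ_carrier finprod_hZ)
  then show ?case using insert by (simp add: opr_scale_right hZ_carrier mult.commute)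
qed

section \<open>The dual of the regular module\<close>

definition fscale :: "'k::field \<Rightarrow> ('x \<Rightarrow> 'k) \<Rightarrow> 'x \<Rightarrow> 'k" where
  "fscale c f = (\<lambda>x. c * f x)"

lemma vector_space_fscale: "vector_space (fscale :: 'k::field \<Rightarrow> ('x \<Rightarrow> 'k) \<Rightarrow> 'x \<Rightarrow> 'k)"
  by standard (auto simp: fscale_def fun_eq_iff algebra_simps)

lemma coeff_space_times: "coeff_space ((*) :: 'k::field \<Rightarrow> 'k \<Rightarrow> 'k)"
  by standard (auto simp: algebra_simps)

abbreviation ev :: "(gword \<Rightarrow> 'k::field) \<Rightarrow> 'k free_alg \<Rightarrow> 'k" where
  "ev \<equiv> coeff_space.lin (*)"

text \<open>The linear forms on the algebra, as functions on words that vanish on the ideal of relations.\<close>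

definition dualM :: "nat \<Rightarrow> nat \<Rightarrow> (nat \<Rightarrow> 'k::field) \<Rightarrow> (gword \<Rightarrow> 'k) set" where
  "dualM l n u = {f. (\<forall>w. \<not> set (letters w) \<subseteq> gens n \<longrightarrow> f w = 0) \<and> (\<forall>p\<in>hecke_ideal l n u. ev f p = 0)}"

text \<open>Right translation of the argument makes the linear forms a left module: applying
  \<open>g\<close> after \<open>h\<close> to \<open>f\<close> gives the function whose value at
  \<open>w\<close> is that of \<open>f\<close> at \<open>w g h\<close>.\<close>

definition dual_gen :: "gen \<Rightarrow> (gword \<Rightarrow> 'k::field) \<Rightarrow> gword \<Rightarrow> 'k" where
  "dual_gen g f = (\<lambda>w. f (w + GWord [g]))"

abbreviation "dualS i \<equiv> dual_gen (GS i)"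
abbreviation "dualL k \<equiv> dual_gen (GL k)"

lemma dual_gen_closed:
  fixes u :: "nat \<Rightarrow> 'k::field"
  assumes "g \<in> gens n" "f \<in> dualM l n u"
  shows "dual_gen g f \<in> dualM l n u"
proof -
  interpret K: coeff_space "(*) :: 'k::field \<Rightarrow> 'k \<Rightarrow> 'k" by (rule coeff_space_times)
  have "ev (dual_gen g f) p = 0" if p: "p \<in> hecke_ideal l n u" for p
  proof -
    have "p * Poly_Mapping.single (GWord [g]) 1 \<in> hecke_ideal l n u"
      using ideal.I_r_closed[OF hecke_ideal p, of "Poly_Mapping.single (GWord [g]) 1"] assms(1)
      by (simp add: free_carrier_single)
    then have "ev f (p * Poly_Mapping.single (GWord [g]) 1) = 0"
      using assms(2) by (simp add: dualM_def)
    then show ?thesis by (simp add: K.lin_mult dual_gen_def)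
  qed
  then show ?thesis using assms by (auto simp: dualM_def dual_gen_def)
qed

lemma dualM_subspace: "module.subspace fscale (dualM l n (u :: nat \<Rightarrow> 'k::field))"
proof -
  interpret F: vector_space "fscale :: 'k::field \<Rightarrow> (gword \<Rightarrow> 'k) \<Rightarrow> gword \<Rightarrow> 'k" by (rule vector_space_fscale)
  interpret K: coeff_space "(*) :: 'k::field \<Rightarrow> 'k \<Rightarrow> 'k" by (rule coeff_space_times)
  have "ev (f + g) p = ev f p + ev g p" for f g :: "gword \<Rightarrow> 'k" and p
    using K.lin_fun_add[of f g p] by (simp add: plus_fun_def)
  moreover have "ev (fscale c f) p = c * ev f p" for c and f :: "gword \<Rightarrow> 'k" and p
    using K.lin_fun_scale[of c f p] by (simp add: fscale_def)
  moreover have "ev 0 p = 0" for p :: "'k free_alg"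
    using K.lin_fun_zero[of p] by (simp add: zero_fun_def)
  ultimately show ?thesis
    by (intro F.subspaceI) (auto simp: dualM_def fscale_def)
qed

lemma dual_ops: "hecke_ops fscale n (dualM l n (u :: nat \<Rightarrow> 'k::field)) dualS dualL"
proof -
  interpret F: vector_space "fscale :: 'k::field \<Rightarrow> (gword \<Rightarrow> 'k) \<Rightarrow> gword \<Rightarrow> 'k" by (rule vector_space_fscale)
  show ?thesis
  proof
    show "F.subspace (dualM l n u)" by (rule dualM_subspace)
    show "dualS i v \<in> dualM l n u" if "i \<in> {1..<n}" "v \<in> dualM l n u" for i v
      by (rule dual_gen_closed) (use that in \<open>auto simp: gens_def\<close>)
    show "dualL i v \<in> dualM l n u" if "i \<in> {1..n}" "v \<in> dualM l n u" for i v
      by (rule dual_gen_closed) (use that in \<open>auto simp: gens_def\<close>)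
  qed (auto simp: dual_gen_def fscale_def fun_eq_iff)
qed

lemma dual_act:
  fixes f :: "gword \<Rightarrow> 'k::field"
  shows "hecke_ops.act fscale dualS dualL p f w = ev (\<lambda>x. f (w + x)) p"
proof -
  interpret F: hecke_ops "fscale :: 'k \<Rightarrow> (gword \<Rightarrow> 'k) \<Rightarrow> gword \<Rightarrow> 'k" n "dualM l n u" dualS dualL for n l and u :: "nat \<Rightarrow> 'k"
    by (rule dual_ops)
  interpret K: coeff_space "(*) :: 'k \<Rightarrow> 'k \<Rightarrow> 'k" by (rule coeff_space_times)
  have g: "F.gact g h = dual_gen g h" for g and h :: "gword \<Rightarrow> 'k"
    by (cases g) auto
  have gd: "F.gact = dual_gen" by (intro ext) (simp add: g)
  have "foldr dual_gen gs f w = f (w + GWord gs)" for gs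
  proof (induction gs arbitrary: w)
    case Nil
    then show ?case using add.right_neutral[of w] by (simp flip: zero_gword_def)
  next
    case (Cons a gs)
    have "dual_gen a (foldr dual_gen gs f) w = f (w + GWord (a # gs))"
      unfolding dual_gen_def[of a] Cons by (simp add: plus_gword_def)
    then show ?case by (simp only: foldr.simps comp_apply)
  qed
  then have w: "F.wact x f w = f (w + x)" for x by (cases x) (simp add: F.wact_def gd)
  show ?thesis
    by (induction p rule: pm_induct)
       (simp_all add: F.act_single F.act_add w K.lin_add, simp add: fscale_def w)
qed

lemma dual_module: "hecke_module fscale n (dualM l n u) dualS dualL l (u :: nat \<Rightarrow> 'k::field)"
proof -
  interpret F: hecke_ops "fscale :: 'k \<Rightarrow> (gword \<Rightarrow> 'k) \<Rightarrow> gword \<Rightarrow> 'k" n "dualM l n u" dualS dualL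
    by (rule dual_ops)
  interpret K: coeff_space "(*) :: 'k \<Rightarrow> 'k \<Rightarrow> 'k" by (rule coeff_space_times)
  show ?thesis
  proof
    fix r f assume r: "r \<in> hecke_rels l n u" and f: "f \<in> dualM l n u"
    show "F.act r f = 0"
    proof
      fix w
      show "F.act r f w = 0 w"
      proof (cases "set (letters w) \<subseteq> gens n")
        case True
        have "Poly_Mapping.single w 1 * r \<in> hecke_ideal l n u"
          using ideal.I_l_closed[OF hecke_ideal ideal_rels[OF r], of "Poly_Mapping.single w 1"] True
          by (simp add: free_carrier_single)
        then have "ev f (Poly_Mapping.single w 1 * r) = 0" using f by (simp add: dualM_def)
        then show ?thesis by (simp add: dual_act K.lin_single_mult)
      next
        case False
        then have "f (w + x) = 0" for x using f by (auto simp: dualM_def)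
        then show ?thesis by (simp add: dual_act K.lin_fun_zero)
      qed
    qed
  qed
qed

text \<open>A basis of the ideal together with a vector \<open>x\<close> outside it is independent,
  so some linear form vanishes on the ideal and is 1 at \<open>x\<close>. The result of acting by
  \<open>x\<close> on this form, evaluated at the empty word, is its value at
  \<open>x\<close>.\<close>

lemma dual_separates:
  fixes u :: "nat \<Rightarrow> 'k::field"
  assumes x: "x \<in> carrier (free_hecke n)" and act: "\<And>f. f \<in> dualM l n u \<Longrightarrow> hecke_ops.act fscale dualS dualL x f = 0"
  shows "x \<in> hecke_ideal l n u"
proof (rule ccontr)
  assume nx: "x \<notin> hecke_ideal l n u"
  interpret K: coeff_space "(*) :: 'k \<Rightarrow> 'k \<Rightarrow> 'k" by (rule coeff_space_times)
  interpret A: vector_space "\<lambda>c p :: 'k free_alg. scl c * p"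
    by standard (auto simp: scl_def algebra_simps mult_single single_add simp flip: mult.assoc)
  interpret AK: vector_space_pair "\<lambda>c p :: 'k free_alg. scl c * p" "(*) :: 'k \<Rightarrow> 'k \<Rightarrow> 'k" by standard
  interpret I: ideal "hecke_ideal l n u" "free_hecke n" by (rule hecke_ideal)
  have sub: "A.subspace (hecke_ideal l n u)"
    using additive_subgroup.zero_closed[OF I.is_additive_subgroup] additive_subgroup.a_closed[OF I.is_additive_subgroup]
      I.I_l_closed[OF _ free_carrier_scl] by (intro A.subspaceI) auto
  obtain B where B: "B \<subseteq> hecke_ideal l n u" "A.independent B" "hecke_ideal l n u \<subseteq> A.span B"
    by (rule A.maximal_independent_subset)
  have spB: "A.span B = hecke_ideal l n u"
    using B(3) A.span_minimal[OF B(1) sub] by (rule antisym[rotated])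
  have "A.independent (insert x B)" using B(2) nx unfolding spB[symmetric] by (subst A.independent_insert) auto
  then obtain g where g: "Vector_Spaces.linear (\<lambda>c p. scl c * p) (*) g" "\<forall>y\<in>insert x B. g y = (if y = x then 1 else 0)"
    using AK.linear_independent_extend[of "insert x B" "\<lambda>y. if y = x then 1 else 0"] by blast
  have gB: "g y = 0" if "y \<in> hecke_ideal l n u" for y
  proof (rule AK.linear_eq_0_on_span[OF g(1)])
    show "g y = 0" if "y \<in> B" for y using g(2) that B nx by auto
  qed (use that spB in auto)
  interpret g: Vector_Spaces.linear "\<lambda>c p. scl c * p" "(*)" g by (rule g(1))
  \<comment> \<open>The form is cut down to words in the generators for \<open>n\<close>, as
    membership in \<open>dualM\<close> requires; on the carrier of the free algebra nothing is
    lost.\<close>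
  define f where "f w = (if set (letters w) \<subseteq> gens n then g (Poly_Mapping.single w 1) else 0)" for w
  have fe: "ev f p = g p" if "p \<in> carrier (free_hecke n)" for p
  proof -
    have "ev f p = ev (\<lambda>w. g (Poly_Mapping.single w 1)) p"
      by (rule K.lin_cong) (use that in \<open>auto simp: free_carrier_iff f_def\<close>)
    also have "\<dots> = g p"
    proof (induction p rule: pm_induct)
      case (single w c)
      have "g (Poly_Mapping.single w c) = c * g (Poly_Mapping.single w 1)"
        using g.scale[of c "Poly_Mapping.single w 1"] by (simp add: scl_def mult_single)
      then show ?case by simp
    qed (simp_all add: K.lin_add g.add g.zero)
    finally show ?thesis .
  qed
  have "f \<in> dualM l n u"
    using gB fe ideal_carrier[of l n u] by (auto simp: dualM_def f_def)
  then have "ev f x = 0" using act[of f] dual_act[of x f 0] by simp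
  then show False using fe[OF x] g(2) by simp
qed

text \<open>Faithfulness of the dual module, in the form that turns an identity of cosets into an
  identity of operators.\<close>

lemma hecke_eqI:
  fixes u :: "nat \<Rightarrow> 'k::field"
  assumes "X \<in> carrier (hecke l n u)" "Y \<in> carrier (hecke l n u)"
    and "\<And>f. f \<in> dualM l n u \<Longrightarrow> hecke_module.opr fscale dualS dualL X f = hecke_module.opr fscale dualS dualL Y f"
  shows "X = Y"
proof -
  interpret D: hecke_module "fscale :: 'k \<Rightarrow> (gword \<Rightarrow> 'k) \<Rightarrow> gword \<Rightarrow> 'k" n "dualM l n u" dualS dualL l u
    by (rule dual_module)
  obtain x y where xy: "x \<in> carrier (free_hecke n)" "X = hecke_proj l n u x"
    "y \<in> carrier (free_hecke n)" "Y = hecke_proj l n u y"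
    using assms(1,2) by (auto simp: hecke_carrier)
  have "x - y \<in> hecke_ideal l n u"
  proof (rule dual_separates)
    show "D.act (x - y) f = 0" if "f \<in> dualM l n u" for f
      using assms(3)[OF that] xy that by (simp add: D.opr_proj D.act_diff)
  qed (use xy in \<open>simp add: free_carrier\<close>)
  then show ?thesis using xy by (simp add: proj_eq_iff)
qed

section \<open>The embedding of the smaller algebra\<close>

lemma free_carrier_mono: "m \<le> n \<Longrightarrow> p \<in> carrier (free_hecke m) \<Longrightarrow> p \<in> carrier (free_hecke n)"
  by (fastforce simp: free_carrier_iff gens_def)

text \<open>The dual module for \<open>n\<close>, restricted to \<open>m\<close>, is killed by the
  ideal for \<open>m\<close>; and it detects membership in the ideal for \<open>n\<close>. This
  makes the images of all representatives under \<open>hecke_iota\<close> agree.\<close>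

lemma hecke_ideal_mono:
  fixes u :: "nat \<Rightarrow> 'k::field"
  assumes "m \<le> n"
  shows "hecke_ideal l m u \<subseteq> hecke_ideal l n u"
proof
  fix p assume p: "p \<in> hecke_ideal l m u"
  interpret D: hecke_module "fscale :: 'k \<Rightarrow> (gword \<Rightarrow> 'k) \<Rightarrow> gword \<Rightarrow> 'k" m "dualM l n u" dualS dualL l u
    by (rule hecke_module.hecke_module_mono[OF dual_module assms])
  show "p \<in> hecke_ideal l n u"
    by (rule dual_separates) (use p ideal_carrier[of l m u] free_carrier_mono[OF assms] D.act_ideal in auto)
qed

lemma hecke_iota_proj:
  assumes "m \<le> n" "x \<in> carrier (free_hecke m)"
  shows "hecke_iota l n u (hecke_proj l m u x) = hecke_proj l n u x"
proof -
  have "hecke_proj l n u y = hecke_proj l n u x" if "y \<in> hecke_proj l m u x" for y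
  proof -
    obtain z where z: "z \<in> hecke_ideal l m u" "y = z + x" using \<open>y \<in> _\<close> by (auto simp: proj_mem)
    then have "z \<in> hecke_ideal l n u" using hecke_ideal_mono[OF assms(1)] by blast
    then show ?thesis
      using z free_carrier_mono[OF assms] ideal_carrier[of l n u] free_carrier_add[of z n x]
      by (subst proj_eq_iff) auto
  qed
  moreover have "x \<in> hecke_proj l m u x"
    using additive_subgroup.zero_closed[OF ideal.axioms(1)[OF hecke_ideal[of l m u]]]
    by (auto simp: proj_mem)
  ultimately have "hecke_proj l n u ` hecke_proj l m u x = {hecke_proj l n u x}" by blast
  then show ?thesis by (simp add: hecke_iota_def)
qed

lemma hecke_iota_closed:
  assumes "m \<le> n" "X \<in> carrier (hecke l m u)"
  shows "hecke_iota l n u X \<in> carrier (hecke l n u)"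
  using assms by (auto simp: hecke_carrier hecke_iota_proj intro: free_carrier_mono)

lemma (in hecke_module) opr_iota:
  assumes "m \<le> n" "X \<in> carrier (hecke l m u)" "v \<in> M"
  shows "opr (hecke_iota l n u X) v = opr X v"
proof -
  interpret R: hecke_module scale m M S L l u by (rule hecke_module_mono[OF assms(1)])
  show ?thesis
    using assms by (auto simp: hecke_carrier hecke_iota_proj opr_proj R.opr_proj free_carrier_mono)
qed

section \<open>Standard tableaux and contents\<close>

declare split_paired_All[simp del] split_paired_Ex[simp del]

definition valid_box :: "nat \<Rightarrow> box \<Rightarrow> bool" where
  "valid_box l = (\<lambda>(i, j, c). 1 \<le> i \<and> 1 \<le> j \<and> 1 \<le> c \<and> c \<le> l)"

definition adj :: "box \<Rightarrow> box \<Rightarrow> bool" where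
  "adj b b' \<longleftrightarrow> (\<exists>i j c. b = (i, j, c) \<and> (b' = (i, Suc j, c) \<or> b' = (Suc i, j, c)))"

text \<open>Standard tableaux of unspecified shape: the support of \<open>t\<close> plays the role of the diagram.\<close>

definition ST :: "nat \<Rightarrow> nat \<Rightarrow> tableau \<Rightarrow> bool" where
  "ST l n t \<longleftrightarrow> (\<forall>b. t b \<noteq> 0 \<longrightarrow> valid_box l b) \<and> bij_betw t {b. t b \<noteq> 0} {1..n} \<and>
     (\<forall>b b'. adj b b' \<and> valid_box l b \<and> t b' \<noteq> 0 \<longrightarrow> 0 < t b \<and> t b < t b')"

definition addable :: "nat \<Rightarrow> tableau \<Rightarrow> box \<Rightarrow> bool" where
  "addable l t b \<longleftrightarrow> valid_box l b \<and> t b = 0 \<and> (\<forall>b'. adj b' b \<and> valid_box l b' \<longrightarrow> t b' \<noteq> 0)"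

definition bx :: "tableau \<Rightarrow> nat \<Rightarrow> box" where
  "bx t k = (THE b. t b = k)"

text \<open>The content without its parameter, as an integer: contents are estimated over the
  integers, and only afterwards compared in the field.\<close>

definition ic :: "box \<Rightarrow> int" where
  "ic = (\<lambda>(i, j, c). int j - int i)"

definition cont :: "(nat \<Rightarrow> 'k::field) \<Rightarrow> box \<Rightarrow> 'k" where
  "cont u = (\<lambda>(i, j, c). of_nat j - of_nat i + u c)"

abbreviation tcontent :: "(nat \<Rightarrow> 'k::field) \<Rightarrow> tableau \<Rightarrow> nat \<Rightarrow> 'k" where
  "tcontent \<equiv> Defs.content"

lemma content_eq: "tcontent u t k = cont u (bx t k)"
  by (simp add: Defs.content_def cont_def bx_def)

lemma cont_eq: "cont u b = of_int (ic b) + u (snd (snd b))"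
  by (cases b) (simp add: cont_def ic_def)

lemma ST_valid: "ST l n t \<Longrightarrow> t b \<noteq> 0 \<Longrightarrow> valid_box l b"
  unfolding ST_def by blast

lemma ST_bij: "ST l n t \<Longrightarrow> bij_betw t {b. t b \<noteq> 0} {1..n}"
  unfolding ST_def by blast

lemma ST_adj: "ST l n t \<Longrightarrow> adj b b' \<Longrightarrow> valid_box l b \<Longrightarrow> t b' \<noteq> 0 \<Longrightarrow> 0 < t b \<and> t b < t b'"
  unfolding ST_def by blast

lemma ST_adj_lt: "ST l n t \<Longrightarrow> adj b b' \<Longrightarrow> t b \<noteq> 0 \<Longrightarrow> t b' \<noteq> 0 \<Longrightarrow> t b < t b'"
  using ST_adj ST_valid by blast

lemma ST_inj: "ST l n t \<Longrightarrow> t b = t b' \<Longrightarrow> t b \<noteq> 0 \<Longrightarrow> b = b'"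
  using inj_onD[OF bij_betw_imp_inj_on[OF ST_bij], of l n t b b'] by simp

lemma ST_le: "ST l n t \<Longrightarrow> t b \<le> n"
  using bij_betwE[OF ST_bij[of l n t]] by (cases "t b = 0") auto

lemma ST_ex: "ST l n t \<Longrightarrow> k \<in> {1..n} \<Longrightarrow> \<exists>b. t b = k"
  using bij_betw_imp_surj_on[OF ST_bij[of l n t]] by (metis (no_types, lifting) imageE)

lemma bx_eq: "ST l n t \<Longrightarrow> t b = k \<Longrightarrow> 1 \<le> k \<Longrightarrow> bx t k = b"
  unfolding bx_def by (rule the_equality) (auto dest: ST_inj)

lemma t_bx: "ST l n t \<Longrightarrow> k \<in> {1..n} \<Longrightarrow> t (bx t k) = k"
  using ST_ex[of l n t k] bx_eq[of l n t _ k] by auto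

lemma ST_card: "ST l n t \<Longrightarrow> finite {b. t b \<noteq> 0} \<and> card {b. t b \<noteq> 0} = n"
  using bij_betw_finite[OF ST_bij] bij_betw_same_card[OF ST_bij] by fastforce

lemma ST_down:
  assumes t: "ST l n t" and b: "t (i, j, c) \<noteq> 0" and "1 \<le> i'" "i' \<le> i" "1 \<le> j'" "j' \<le> j"
  shows "t (i', j', c) \<noteq> 0 \<and> t (i', j', c) \<le> t (i, j, c)"
proof -
  have c: "1 \<le> c" "c \<le> l" using ST_valid[OF t b] by (auto simp: valid_box_def)
  have 1: "t (i', j, c) \<noteq> 0 \<and> t (i', j, c) \<le> t (i, j, c)"
    using assms(4)
  proof (induction rule: inc_induct)
    case (step m)
    have "adj (m, j, c) (Suc m, j, c)" by (simp add: adj_def)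
    then show ?case
      using ST_adj[OF t, of "(m, j, c)" "(Suc m, j, c)"] step assms c by (auto simp: valid_box_def)
  qed (use b in simp)
  have "t (i', j', c) \<noteq> 0 \<and> t (i', j', c) \<le> t (i', j, c)"
    using assms(6)
  proof (induction rule: inc_induct)
    case (step m)
    have "adj (i', m, c) (i', Suc m, c)" by (simp add: adj_def)
    then show ?case
      using ST_adj[OF t, of "(i', m, c)" "(i', Suc m, c)"] step assms c by (auto simp: valid_box_def)
  qed (use 1 in simp)
  with 1 show ?thesis by simp
qed

lemma ST_restrict:
  assumes t: "ST l n t" and k: "k \<le> n"
  shows "ST l k (t \<down> k)"
proof -
  have "bij_betw (t \<down> k) {b. (t \<down> k) b \<noteq> 0} {1..k}"
    unfolding bij_betw_def
  proof
    show "inj_on (t \<down> k) {b. (t \<down> k) b \<noteq> 0}"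
      using ST_inj[OF t] by (auto simp: inj_on_def restrict_tab_def split: if_splits)
    show "(t \<down> k) ` {b. (t \<down> k) b \<noteq> 0} = {1..k}"
      using ST_ex[OF t] k by (force simp: restrict_tab_def image_iff)
  qed
  moreover have "0 < (t \<down> k) b \<and> (t \<down> k) b < (t \<down> k) b'"
    if "adj b b'" "valid_box l b" "(t \<down> k) b' \<noteq> 0" for b b'
    using ST_adj[OF t, of b b'] that by (auto simp: restrict_tab_def split: if_splits)
  moreover have val: "valid_box l b" if "(t \<down> k) b \<noteq> 0" for b
    using that ST_valid[OF t, of b] by (auto simp: restrict_tab_def split: if_splits)
  ultimately show ?thesis
    using val unfolding ST_def by blast
qed

lemma restrict_self: "ST l n t \<Longrightarrow> t \<down> n = t"
  by (rule ext) (use ST_le in \<open>auto simp: restrict_tab_def\<close>)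

lemma adj_irrefl: "\<not> adj b b"
  by (auto simp: adj_def)

lemma ST_extend:
  assumes t: "ST l n t" and b: "addable l t b"
  shows "ST l (Suc n) (t(b := Suc n))"
proof -
  let ?t = "t(b := Suc n)"
  have "{x. ?t x \<noteq> 0} = insert b {x. t x \<noteq> 0}" by auto
  then have supp: "{x. ?t x \<noteq> 0} = insert b {x. t x \<noteq> 0}" .
  have bij: "bij_betw ?t (insert b {x. t x \<noteq> 0}) (insert (Suc n) {1..n})"
  proof -
    have "bij_betw ?t {x. t x \<noteq> 0} {1..n}"
      using ST_bij[OF t] b by (subst bij_betw_cong[of _ ?t t]) (auto simp: addable_def)
    moreover have "b \<notin> {x. t x \<noteq> 0}" using b by (simp add: addable_def)
    ultimately show ?thesis using notIn_Un_bij_betw[of b "{x. t x \<noteq> 0}" ?t "{1..n}"] by simp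
  qed
  have ins: "insert (Suc n) {1..n} = {1..Suc n}" by auto
  have adj: "0 < ?t x \<and> ?t x < ?t x'" if x: "adj x x'" "valid_box l x" "?t x' \<noteq> 0" for x x'
  proof (cases "x' = b")
    case True
    then have "t x \<noteq> 0" "x \<noteq> b" using x b adj_irrefl by (auto simp: addable_def)
    then show ?thesis using True ST_le[OF t, of x] by simp
  next
    case False
    then have "0 < t x \<and> t x < t x'" using ST_adj[OF t x(1,2)] x by simp
    moreover have "x \<noteq> b" using b calculation by (auto simp: addable_def)
    ultimately show ?thesis using False by simp
  qed
  have val: "valid_box l x" if "?t x \<noteq> 0" for x
    using that b ST_valid[OF t, of x] by (cases "x = b") (auto simp: addable_def)
  show ?thesis
    unfolding ST_def supp ins[symmetric] using bij adj val by blast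
qed

lemma ST_last_addable:
  assumes t: "ST l n t" and k: "Suc k \<le> n"
  shows "addable l (t \<down> k) (bx t (Suc k))"
proof -
  have tb: "t (bx t (Suc k)) = Suc k" using t_bx[OF t] k by simp
  then have "t b' < Suc k \<and> t b' \<noteq> 0" if "adj b' (bx t (Suc k))" "valid_box l b'" for b'
    using ST_adj[OF t that] by simp
  then show ?thesis
    using tb ST_valid[OF t, of "bx t (Suc k)"] by (fastforce simp: addable_def restrict_tab_def)
qed

lemma ST_last_eq:
  assumes t: "ST l n t" and k: "Suc k \<le> n"
  shows "t \<down> Suc k = (t \<down> k)(bx t (Suc k) := Suc k)"
proof
  fix b
  have tb: "t (bx t (Suc k)) = Suc k" using t_bx[OF t] k by simp
  show "(t \<down> Suc k) b = ((t \<down> k)(bx t (Suc k) := Suc k)) b"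
  proof (cases "b = bx t (Suc k)")
    case False
    then have "t b \<noteq> Suc k" using tb ST_inj[OF t, of b "bx t (Suc k)"] by (metis nat.discI)
    then show ?thesis using False by (simp add: restrict_tab_def le_Suc_eq)
  qed (simp add: tb restrict_tab_def)
qed

lemma bx_restrict: "ST l n t \<Longrightarrow> m \<le> n \<Longrightarrow> k \<in> {1..m} \<Longrightarrow> bx (t \<down> m) k = bx t k"
  using t_bx[of l n t k] by (intro bx_eq[OF ST_restrict]) (auto simp: restrict_tab_def)

lemma content_restrict: "ST l n t \<Longrightarrow> m \<le> n \<Longrightarrow> k \<in> {1..m} \<Longrightarrow> tcontent u (t \<down> m) k = tcontent u t k"
  by (simp add: content_eq bx_restrict)

lemma ST_swap_supp: "1 \<le> i \<Longrightarrow> (st i \<circ> t) b \<noteq> 0 \<longleftrightarrow> t b \<noteq> 0"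
  by (simp add: st_apply)

lemma ST_swap:
  assumes t: "ST l n t" and i: "i \<in> {1..<n}" and na: "\<not> adj (bx t i) (bx t (Suc i))"
  shows "ST l n (st i \<circ> t)"
proof -
  have s: "{b. (st i \<circ> t) b \<noteq> 0} = {b. t b \<noteq> 0}" using i by (auto simp: st_apply)
  have "bij_betw t {b. t b \<noteq> 0} {1..n}" by (rule ST_bij[OF t])
  moreover have "bij_betw (st i) {1..n} {1..n}" using st_permutes[OF i] by (rule permutes_imp_bij)
  ultimately have "bij_betw (st i \<circ> t) {b. t b \<noteq> 0} {1..n}" by (rule bij_betw_trans)
  moreover have "0 < (st i \<circ> t) b \<and> (st i \<circ> t) b < (st i \<circ> t) b'"
    if a: "adj b b'" "valid_box l b" "(st i \<circ> t) b' \<noteq> 0" for b b'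
  proof -
    have "t b' \<noteq> 0" using a i by (auto simp: st_apply split: if_splits)
    then have lt: "0 < t b" "t b < t b'" using ST_adj[OF t a(1,2)] by auto
    have "\<not> (t b = i \<and> t b' = Suc i)"
      using na a(1) bx_eq[OF t, of b i] bx_eq[OF t, of b' "Suc i"] i by auto
    then show ?thesis using lt i by (auto simp: st_apply)
  qed
  moreover have "valid_box l b" if "(st i \<circ> t) b \<noteq> 0" for b
    using that s ST_valid[OF t, of b] by blast
  ultimately show ?thesis unfolding ST_def s by blast
qed

lemma bx_swap: "ST l n t \<Longrightarrow> i \<in> {1..<n} \<Longrightarrow> ST l n (st i \<circ> t) \<Longrightarrow> k \<in> {1..n} \<Longrightarrow>
    bx (st i \<circ> t) k = bx t (st i k)"
proof -
  assume t: "ST l n t" and i: "i \<in> {1..<n}" and s: "ST l n (st i \<circ> t)" and k: "k \<in> {1..n}"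
  have "st i k \<in> {1..n}" using i k by (auto simp: st_apply)
  then show ?thesis using t_bx[OF t] k by (intro bx_eq[OF s]) auto
qed

lemma content_swap: "ST l n t \<Longrightarrow> i \<in> {1..<n} \<Longrightarrow> ST l n (st i \<circ> t) \<Longrightarrow> k \<in> {1..n} \<Longrightarrow>
    tcontent u (st i \<circ> t) k = tcontent u t (st i k)"
  by (simp add: content_eq bx_swap)

lemma ST_swap_nonadj:
  assumes t: "ST l n t" and i: "i \<in> {1..<n}" and s: "ST l n (st i \<circ> t)"
  shows "\<not> adj (bx t i) (bx t (Suc i))"
proof
  assume a: "adj (bx t i) (bx t (Suc i))"
  have "t (bx t i) = i" "t (bx t (Suc i)) = Suc i" using t_bx[OF t] i by auto
  then show False using ST_adj_lt[OF s a] i by (simp add: st_apply)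
qed

lemma swap_swap: "st i \<circ> (st i \<circ> t) = t"
  by (simp add: fun_eq_iff)

lemma swap_restrict:
  assumes "m < i \<or> i < m" "1 \<le> i"
  shows "(st i \<circ> t) \<down> m = (if i < m then st i \<circ> (t \<down> m) else t \<down> m)"
  using assms by (auto simp: restrict_tab_def st_apply fun_eq_iff)

section \<open>Bounds for differences of contents\<close>

lemma two_boxes_same:
  assumes t: "ST l m t" and r: "j = 0 \<or> t (1, j, c) \<noteq> 0" and q: "i = 0 \<or> t (i, 1, c) \<noteq> 0"
  shows "i + j \<le> Suc m"
proof -
  let ?A = "(\<lambda>j. (1::nat, j, c)) ` {1..j}" and ?B = "(\<lambda>i. (i, 1::nat, c)) ` {2..i}"
  have "?A \<subseteq> {b. t b \<noteq> 0}"
    using ST_down[OF t, of 1 j c 1] r by auto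
  moreover have "?B \<subseteq> {b. t b \<noteq> 0}"
    using ST_down[OF t, of i 1 c _ 1] q by auto
  ultimately have "card (?A \<union> ?B) \<le> m" using ST_card[OF t] card_mono[of "{b. t b \<noteq> 0}" "?A \<union> ?B"] by auto
  moreover have "card (?A \<union> ?B) = card ?A + card ?B" by (rule card_Un_disjoint) auto
  moreover have "card ?A = j" by (subst card_image) (auto simp: inj_on_def)
  moreover have "card ?B = i - 1" by (subst card_image) (auto simp: inj_on_def)
  ultimately show ?thesis by auto
qed

lemma two_boxes_diff:
  assumes t: "ST l m t" and r: "j = 0 \<or> t (1, j, c) \<noteq> 0" and q: "i = 0 \<or> t (i, 1, c') \<noteq> 0" and c: "c \<noteq> c'"
  shows "i + j \<le> m"
proof -
  let ?A = "(\<lambda>j. (1::nat, j, c)) ` {1..j}" and ?B = "(\<lambda>i. (i, 1::nat, c')) ` {1..i}"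
  have "?A \<subseteq> {b. t b \<noteq> 0}"
    using ST_down[OF t, of 1 j c 1] r by auto
  moreover have "?B \<subseteq> {b. t b \<noteq> 0}"
    using ST_down[OF t, of i 1 c' _ 1] q by auto
  ultimately have "card (?A \<union> ?B) \<le> m" using ST_card[OF t] card_mono[of "{b. t b \<noteq> 0}" "?A \<union> ?B"] by auto
  moreover have "card (?A \<union> ?B) = card ?A + card ?B" by (rule card_Un_disjoint) (use c in auto)
  moreover have "card ?A = j" by (subst card_image) (auto simp: inj_on_def)
  moreover have "card ?B = i" by (subst card_image) (auto simp: inj_on_def)
  ultimately show ?thesis by auto
qed

lemma reach:
  assumes t: "ST l m t" and b: "t (i, j, c) \<noteq> 0 \<or> addable l t (i, j, c)"
  shows "(j - 1 = 0 \<or> t (1, j - 1, c) \<noteq> 0) \<and> (i - 1 = 0 \<or> t (i - 1, 1, c) \<noteq> 0) \<and> 1 \<le> i \<and> 1 \<le> j"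
  using b
proof
  assume nz: "t (i, j, c) \<noteq> 0"
  then have v: "1 \<le> i" "1 \<le> j" using ST_valid[OF t nz] by (auto simp: valid_box_def)
  then show ?thesis
    using ST_down[OF t nz, of 1 "j - 1"] ST_down[OF t nz, of "i - 1" 1] by (cases "j = 1"; cases "i = 1") auto
next
  assume a: "addable l t (i, j, c)"
  then have v: "1 \<le> i" "1 \<le> j" "1 \<le> c" "c \<le> l" by (auto simp: addable_def valid_box_def)
  have 1: "t (i, j - 1, c) \<noteq> 0" if "j \<noteq> 1"
    using a that v by (auto simp: addable_def valid_box_def adj_def)
  have 2: "t (i - 1, j, c) \<noteq> 0" if "i \<noteq> 1"
    using a that v by (auto simp: addable_def valid_box_def adj_def)
  show ?thesis
    using 1 2 v ST_down[OF t, of i "j - 1" c 1 "j - 1"] ST_down[OF t, of "i - 1" j c "i - 1" 1]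
    by (cases "j = 1"; cases "i = 1") auto
qed

text \<open>A large content needs a long first row and a small one a long first column, and both
  have to fit into \<open>m\<close> boxes; within one component they share the corner, which
  explains the extra 1. For \<open>m = N - 1\<close> these bounds just stay in the range where
  \<open>separated\<close> excludes zero.\<close>

lemma ic_bound:
  assumes t: "ST l m t" and b: "t b \<noteq> 0 \<or> addable l t b" and b': "t b' \<noteq> 0 \<or> addable l t b'"
  shows "ic b - ic b' \<le> (if snd (snd b) = snd (snd b') then int m + 1 else int m)"
proof -
  obtain i j c where e: "b = (i, j, c)" by (cases b)
  obtain i' j' c' where e': "b' = (i', j', c')" by (cases b')
  note r = reach[OF t b[unfolded e]] and r' = reach[OF t b'[unfolded e']]
  have "ic b - ic b' \<le> int (i' - 1) + int (j - 1)"
    using r r' by (auto simp: e e' ic_def)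
  also have "\<dots> \<le> (if c = c' then int m + 1 else int m)"
    using two_boxes_same[OF t, of "j - 1" c "i' - 1"] two_boxes_diff[OF t, of "j - 1" c "i' - 1" c'] r r'
    by auto
  finally show ?thesis by (simp add: e e')
qed

text \<open>Of two addable boxes in a component the lower one lies strictly further left: otherwise
  the filled box above it would force the upper one to be filled. Row and column each contribute at
  least one to the difference.\<close>

lemma addable_ic:
  assumes t: "ST l m t" and b: "addable l t b" and b': "addable l t b'" and "b \<noteq> b'"
    and c: "snd (snd b) = snd (snd b')"
  shows "2 \<le> \<bar>ic b - ic b'\<bar>"
proof -
  have main: "2 \<le> ic b - ic b'"
    if b: "addable l t b" and b': "addable l t b'" and "b \<noteq> b'" and c: "snd (snd b) = snd (snd b')"
      and le: "fst b < fst b' \<or> (fst b = fst b' \<and> fst (snd b') < fst (snd b))" for b b'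
  proof -
    obtain i j c where e: "b = (i, j, c)" by (cases b)
    obtain i' j' where e': "b' = (i', j', c)" using c e by (cases b') auto
    have v: "1 \<le> i" "1 \<le> j" "1 \<le> i'" "1 \<le> j'" "1 \<le> c" "c \<le> l"
      using b b' by (auto simp: e e' addable_def valid_box_def)
    have z: "t (i, j, c) = 0" "t (i', j', c) = 0" using b b' by (auto simp: e e' addable_def)
    show ?thesis
    proof (cases "i < i'")
      case True
      have "adj (i' - 1, j', c) b'" using True by (auto simp: adj_def e')
      then have "t (i' - 1, j', c) \<noteq> 0" using b' v True by (auto simp: addable_def valid_box_def)
      moreover have "i \<le> i' - 1" using True by simp
      ultimately have "\<not> j \<le> j'" using ST_down[OF t, of "i' - 1" j' c i j] v z by auto
      then show ?thesis using True by (simp add: e e' ic_def)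
    next
      case False
      then have "i = i'" "j' < j" using le by (auto simp: e e')
      moreover have "adj (i, j - 1, c) b" using calculation by (auto simp: adj_def e)
      ultimately have "t (i, j - 1, c) \<noteq> 0" using b v by (auto simp: addable_def valid_box_def)
      moreover have "j' \<le> j - 1" using \<open>j' < j\<close> by simp
      ultimately have False using ST_down[OF t, of i "j - 1" c i j'] v z \<open>i = i'\<close> by auto
      then show ?thesis ..
    qed
  qed
  have "fst b < fst b' \<or> (fst b = fst b' \<and> fst (snd b') < fst (snd b)) \<or>
        fst b' < fst b \<or> (fst b' = fst b \<and> fst (snd b) < fst (snd b'))"
    using assms(4) c by (cases b; cases b') auto
  then show ?thesis using main[OF b b'] main[OF b' b] assms(4) c by auto
qed

lemma ST_ge:
  assumes "ST l n t" "t (i, j, c) \<noteq> 0"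
  shows "i \<le> n \<and> j \<le> n"
proof -
  have 1: "t (1, j, c) \<noteq> 0" "t (i, 1, c) \<noteq> 0"
    using ST_down[OF assms, of 1 j] ST_down[OF assms, of i 1] ST_valid[OF assms] by (auto simp: valid_box_def)
  show ?thesis
    using two_boxes_same[OF assms(1), of j c 1] two_boxes_same[OF assms(1), of 1 c i]
      ST_down[OF assms, of 1 1] 1 ST_valid[OF assms] by (auto simp: valid_box_def)
qed

lemma finite_ST: "finite {t. ST l n t}"
proof (rule finite_subset)
  let ?A = "{1..n} \<times> {1..n} \<times> {1..l}"
  show "{t. ST l n t} \<subseteq> {t. \<forall>x. (x \<in> ?A \<longrightarrow> t x \<in> {0..n}) \<and> (x \<notin> ?A \<longrightarrow> t x = 0)}"
  proof (intro subsetI CollectI allI conjI impI)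
    fix t x assume "t \<in> {t. ST l n t}" and x: "x \<notin> ?A"
    then have t: "ST l n t" by simp
    show "t x = 0"
    proof (rule ccontr)
      assume nz: "t x \<noteq> 0"
      show False using x ST_ge[OF t, of "fst x" "fst (snd x)" "snd (snd x)"] nz ST_valid[OF t nz]
        by (cases x) (auto simp: valid_box_def)
    qed
  qed (use ST_le in auto)
  show "finite {t::tableau. \<forall>x. (x \<in> ?A \<longrightarrow> t x \<in> {0..n}) \<and> (x \<notin> ?A \<longrightarrow> t x = 0)}"
    by (rule finite_set_of_finite_funs) auto
qed

lemma finite_addable:
  assumes "ST l n t"
  shows "finite {b. addable l t b}"
proof (rule finite_subset)
  show "{b. addable l t b} \<subseteq> (\<lambda>s. bx s (Suc n)) ` {s. ST l (Suc n) s}"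
  proof
    fix b assume b: "b \<in> {b. addable l t b}"
    then have s: "ST l (Suc n) (t(b := Suc n))" using ST_extend[OF assms] by simp
    then have "bx (t(b := Suc n)) (Suc n) = b" by (rule bx_eq) auto
    then show "b \<in> (\<lambda>s. bx s (Suc n)) ` {s. ST l (Suc n) s}" using s by force
  qed
qed (simp add: finite_ST)

section \<open>Contents for separated parameters\<close>

locale separated =
  fixes l N :: nat and u :: "nat \<Rightarrow> 'k::field"
  assumes char: "k \<in> {1..N} \<Longrightarrow> of_nat k \<noteq> (0::'k)"
    and sep: "a \<in> {1..l} \<Longrightarrow> b \<in> {1..l} \<Longrightarrow> a \<noteq> b \<Longrightarrow> \<bar>d\<bar> < int N \<Longrightarrow> of_int d + u a - u b \<noteq> 0"
begin

lemma of_int_neq: "z \<noteq> 0 \<Longrightarrow> \<bar>z\<bar> \<le> int N \<Longrightarrow> of_int z \<noteq> (0::'k)"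
proof -
  assume z: "z \<noteq> 0" "\<bar>z\<bar> \<le> int N"
  have "of_nat (nat \<bar>z\<bar>) \<noteq> (0::'k)" by (rule char) (use z in auto)
  moreover have "of_int z = (of_nat (nat \<bar>z\<bar>) :: 'k) \<or> of_int z = - (of_nat (nat \<bar>z\<bar>) :: 'k)"
    by (metis abs_of_nonneg abs_of_neg linorder_not_less minus_minus nat_0_le of_int_minus of_int_of_nat_eq abs_ge_zero)
  ultimately show ?thesis by auto
qed

lemma cont_neq:
  assumes t: "ST l m t" and b: "t b \<noteq> 0 \<or> addable l t b" and b': "t b' \<noteq> 0 \<or> addable l t b'"
    and m: "int m + 1 + \<bar>e\<bar> \<le> int N"
    and ne: "snd (snd b) = snd (snd b') \<Longrightarrow> ic b - ic b' + e \<noteq> 0"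
  shows "cont u b - cont u b' + of_int e \<noteq> 0"
proof -
  have bd: "\<bar>ic b - ic b'\<bar> \<le> (if snd (snd b) = snd (snd b') then int m + 1 else int m)"
    using ic_bound[OF t b b'] ic_bound[OF t b' b] by (auto split: if_splits)
  have v: "valid_box l b" "valid_box l b'" using b b' ST_valid[OF t, of b] ST_valid[OF t, of b'] by (auto simp: addable_def)
  have eq: "cont u b - cont u b' + of_int e = of_int (ic b - ic b' + e) + u (snd (snd b)) - u (snd (snd b'))"
    by (simp add: cont_eq)
  show ?thesis
  proof (cases "snd (snd b) = snd (snd b')")
    case True
    then show ?thesis unfolding eq using of_int_neq[OF ne] bd m by simp
  next
    case False
    then show ?thesis unfolding eq using v bd m
      by (intro sep) (auto simp: valid_box_def split: prod.splits)
  qed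
qed

lemma addable_cont_inj:
  assumes t: "ST l m t" "Suc m \<le> N" and b: "addable l t b" "addable l t b'" "cont u b = cont u b'"
  shows "b = b'"
proof (rule ccontr)
  assume "b \<noteq> b'"
  then have "cont u b - cont u b' + of_int 0 \<noteq> 0"
    by (intro cont_neq[OF t(1)]) (use b t addable_ic[OF t(1) b(1,2)] in auto)
  then show False using b by simp
qed

lemma adj_cont: "adj b b' \<Longrightarrow> cont u b' = cont u b + 1 \<or> cont u b' = cont u b - 1"
  by (auto simp: adj_def cont_def)

lemma one_neq_minus_one: "2 \<le> N \<Longrightarrow> (1::'k) \<noteq> - 1"
  using char[of 2] by (auto simp: eq_neg_iff_add_eq_0)

text \<open>If the box of \<open>i + 1\<close> is not adjacent to that of \<open>i\<close>, it does
  not rest on it, and so it can be added before \<open>i\<close> is. Hence estimates for pairs of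
  addable boxes apply to the two.\<close>

lemma nonadj_addable:
  assumes t: "ST l n t" and i: "i \<in> {1..<n}" and na: "\<not> adj (bx t i) (bx t (Suc i))"
  shows "addable l (t \<down> (i - 1)) (bx t i)" "addable l (t \<down> (i - 1)) (bx t (Suc i))"
proof -
  show "addable l (t \<down> (i - 1)) (bx t i)" using ST_last_addable[OF t, of "i - 1"] i by auto
  have a: "addable l (t \<down> i) (bx t (Suc i))" using ST_last_addable[OF t, of i] i by auto
  have "(t \<down> (i - 1)) b' \<noteq> 0" if b': "adj b' (bx t (Suc i))" "valid_box l b'" for b'
  proof -
    have "(t \<down> i) b' \<noteq> 0" using a b' by (auto simp: addable_def)
    moreover have "t b' \<noteq> i" using na b' bx_eq[OF t, of b' i] i by auto
    ultimately show ?thesis by (auto simp: restrict_tab_def split: if_splits)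
  qed
  moreover have "t (bx t (Suc i)) = Suc i" using t_bx[OF t] i by auto
  ultimately show "addable l (t \<down> (i - 1)) (bx t (Suc i))"
    using a by (auto simp: addable_def restrict_tab_def)
qed

lemma content_nonadj:
  assumes t: "ST l n t" "n \<le> N" and i: "i \<in> {1..<n}" and na: "\<not> adj (bx t i) (bx t (Suc i))"
  shows "tcontent u t (Suc i) - tcontent u t i \<notin> {0, 1, - 1}"
proof -
  have r: "ST l (i - 1) (t \<down> (i - 1))" by (rule ST_restrict[OF t(1)]) (use i in auto)
  note ad = nonadj_addable[OF t(1) i na]
  have "bx t (Suc i) \<noteq> bx t i" using t_bx[OF t(1), of i] t_bx[OF t(1), of "Suc i"] i by auto
  then have ic: "snd (snd (bx t (Suc i))) = snd (snd (bx t i)) \<Longrightarrow> 2 \<le> \<bar>ic (bx t (Suc i)) - ic (bx t i)\<bar>"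
    using addable_ic[OF r ad(2,1)] by simp
  have "tcontent u t (Suc i) - tcontent u t i + of_int e \<noteq> 0" if "\<bar>e\<bar> \<le> 1" for e
    unfolding content_eq by (rule cont_neq[OF r]) (use ad ic that i t in auto)
  from this[of 0] this[of 1] this[of "-1"] show ?thesis
    by (auto simp: eq_neg_iff_add_eq_0)
qed

lemma content_adj:
  assumes "adj (bx t i) (bx t (Suc i))"
  shows "tcontent u t (Suc i) - tcontent u t i \<in> {1, - 1}"
  using adj_cont[OF assms] by (auto simp: content_eq)

lemma content_consec:
  assumes t: "ST l n t" "n \<le> N" and i: "i \<in> {1..<n}"
  shows "tcontent u t (Suc i) \<noteq> tcontent u t i"
  using content_nonadj[OF t i] content_adj[of t i] by (cases "adj (bx t i) (bx t (Suc i))") auto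

text \<open>Adjacent boxes have contents that differ by 1 or -1, and for non-adjacent boxes of
  \<open>i\<close> and \<open>i + 1\<close> these differences are excluded. Thus contents alone
  decide whether the swap is standard.\<close>

lemma swap_std_iff:
  assumes t: "ST l n t" "n \<le> N" and i: "i \<in> {1..<n}"
  shows "ST l n (st i \<circ> t) \<longleftrightarrow> (tcontent u t (Suc i) - tcontent u t i)\<^sup>2 \<noteq> 1"
proof
  assume "ST l n (st i \<circ> t)"
  then have "\<not> adj (bx t i) (bx t (Suc i))" by (rule ST_swap_nonadj[OF t(1) i])
  then show "(tcontent u t (Suc i) - tcontent u t i)\<^sup>2 \<noteq> 1"
    using content_nonadj[OF t i] by (simp add: power2_eq_1_iff)
next
  assume "(tcontent u t (Suc i) - tcontent u t i)\<^sup>2 \<noteq> 1"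
  then have "\<not> adj (bx t i) (bx t (Suc i))" using content_adj by (force simp: power2_eq_1_iff)
  then show "ST l n (st i \<circ> t)" by (rule ST_swap[OF t(1) i])
qed

text \<open>The entry \<open>k + 1\<close> sits in an addable box of the subtableau of size
  \<open>k\<close>, and addable boxes have distinct contents; so the contents determine the tableau
  step by step.\<close>

lemma content_inj:
  assumes "ST l n s" "ST l n t" "n \<le> N" "\<And>k. k \<in> {1..n} \<Longrightarrow> tcontent u s k = tcontent u t k"
  shows "s = t"
  using assms
proof (induction n arbitrary: s t)
  case 0
  then have "s b = 0" "t b = 0" for b using ST_le[of l 0] by auto
  then show ?case by auto
next
  case (Suc n)
  have r: "ST l n (s \<down> n)" "ST l n (t \<down> n)" using ST_restrict Suc.prems by auto
  have eq: "s \<down> n = t \<down> n"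
    by (rule Suc.IH[OF r])
       (use Suc.prems(3,4) content_restrict[OF Suc.prems(1), of n _ u] content_restrict[OF Suc.prems(2), of n _ u] in auto)
  have a: "addable l (s \<down> n) (bx s (Suc n))" "addable l (s \<down> n) (bx t (Suc n))"
    using ST_last_addable[OF Suc.prems(1), of n] ST_last_addable[OF Suc.prems(2), of n] eq by auto
  have "bx s (Suc n) = bx t (Suc n)"
    by (rule addable_cont_inj[OF r(1) _ a]) (use Suc.prems(3) Suc.prems(4)[of "Suc n"] in \<open>auto simp: content_eq\<close>)
  then show ?case
    using ST_last_eq[OF Suc.prems(1), of n] ST_last_eq[OF Suc.prems(2), of n] eq
      restrict_self[OF Suc.prems(1)] restrict_self[OF Suc.prems(2)] by simp
qed

text \<open>If one of the two pairs of neighbouring entries is non-adjacent, swapping it makes the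
  boxes in question consecutive. If both are adjacent, a straight move changes the content by 2 or
  -2, and a diagonal move would require the entry \<open>i + 1\<close> to fill both boxes in
  between. The lemma provides a denominator in \<open>snS_braid\<close>.\<close>

lemma content_two_apart:
  assumes t: "ST l n t" "n \<le> N" and i: "1 \<le> i" "Suc (Suc i) \<le> n"
  shows "tcontent u t (Suc (Suc i)) \<noteq> tcontent u t i"
proof (cases "adj (bx t i) (bx t (Suc i))")
  case False
  then have s: "ST l n (st i \<circ> t)" using ST_swap[OF t(1), of i] i by auto
  show ?thesis
    using content_consec[OF s t(2), of "Suc i"] content_swap[OF t(1) _ s, of _ u] i by (simp add: st_apply)
next
  case a1: True
  show ?thesis
  proof (cases "adj (bx t (Suc i)) (bx t (Suc (Suc i)))")
    case False
    then have s: "ST l n (st (Suc i) \<circ> t)" using ST_swap[OF t(1), of "Suc i"] i by auto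
    show ?thesis
      using content_consec[OF s t(2), of i] content_swap[OF t(1) _ s, of _ u] i by (simp add: st_apply)
  next
    case True
    have tb: "t (bx t i) = i" "t (bx t (Suc i)) = Suc i" "t (bx t (Suc (Suc i))) = Suc (Suc i)"
      using t_bx[OF t(1)] i by auto
    obtain a b c where e: "bx t i = (a, b, c)" by (cases "bx t i")
    have v: "1 \<le> a" "1 \<le> b" using ST_valid[OF t(1), of "bx t i"] tb i by (auto simp: e valid_box_def)
    have no: "bx t (Suc (Suc i)) \<noteq> (Suc a, Suc b, c)"
    proof
      assume e2: "bx t (Suc (Suc i)) = (Suc a, Suc b, c)"
      have "t (Suc a, b, c) \<noteq> 0" "t (a, Suc b, c) \<noteq> 0"
        using ST_down[OF t(1), of "Suc a" "Suc b" c "Suc a" b] ST_down[OF t(1), of "Suc a" "Suc b" c a "Suc b"] tb e2 v by auto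
      moreover have "adj (a, b, c) (Suc a, b, c)" "adj (a, b, c) (a, Suc b, c)"
        "adj (Suc a, b, c) (Suc a, Suc b, c)" "adj (a, Suc b, c) (Suc a, Suc b, c)" by (auto simp: adj_def)
      ultimately have "t (a, b, c) < t (Suc a, b, c)" "t (a, b, c) < t (a, Suc b, c)"
        "t (Suc a, b, c) < t (Suc a, Suc b, c)" "t (a, Suc b, c) < t (Suc a, Suc b, c)"
        using ST_adj_lt[OF t(1)] tb e e2 i by (metis One_nat_def Suc_le_eq not_less0 less_nat_zero_code nat.discI)+
      then have "t (Suc a, b, c) = Suc i" "t (a, Suc b, c) = Suc i" using tb by (auto simp: e e2)
      then have "(Suc a, b, c) = (a, Suc b, c)" using ST_inj[OF t(1)] by (metis Zero_not_Suc)
      then show False by simp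
    qed
    have two: "(2::'k) \<noteq> 0" using char[of 2] t i by auto
    show ?thesis
      using a1 True no two e by (auto simp: content_eq adj_def cont_def)
  qed
qed

end

section \<open>Weight vectors\<close>

definition roots_poly :: "'k::field set \<Rightarrow> 'k poly" where
  "roots_poly A = (\<Prod>c\<in>A. [:- c, 1:])"

lemma poly_roots_poly: "poly (roots_poly A) z = (\<Prod>c\<in>A. z - c)"
  by (simp add: roots_poly_def poly_prod)

lemma roots_poly_insert: "finite A \<Longrightarrow> c \<notin> A \<Longrightarrow> roots_poly (insert c A) = [:- c, 1:] * roots_poly A"
  by (simp add: roots_poly_def)

section \<open>Polynomials in a single operator \<open>L_k\<close>\<close>

context hecke_ops begin

definition pact :: "nat \<Rightarrow> 'k poly \<Rightarrow> 'v \<Rightarrow> 'v" where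
  "pact k p v = fold_coeffs (\<lambda>a w. a *s v + L k w) p 0"

lemma pact_0[simp]: "pact k 0 v = 0"
  by (simp add: pact_def)

lemma pact_pCons: "k \<in> {1..n} \<Longrightarrow> pact k (pCons a p) v = a *s v + L k (pact k p v)"
  by (cases "a = 0 \<and> p = 0") (auto simp: pact_def L_zero)

lemma pact_closed: "k \<in> {1..n} \<Longrightarrow> v \<in> M \<Longrightarrow> pact k p v \<in> M"
  by (induction p) (auto simp: pact_pCons M_simps)

lemma pact_closed_subspace:
  assumes "k \<in> {1..n}" "subspace T" "\<And>w. w \<in> T \<Longrightarrow> L k w \<in> T" "v \<in> T"
  shows "pact k p v \<in> T"
  using assms by (induction p) (auto simp: pact_pCons intro!: subspace_add subspace_scale subspace_0)

lemma pact_add: "k \<in> {1..n} \<Longrightarrow> v \<in> M \<Longrightarrow> pact k (p + q) v = pact k p v + pact k q v"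
proof (induction p q rule: poly_induct2)
  case (pCons a p b q)
  then show ?case by (simp add: pact_pCons L_add pact_closed scale_left_distrib algebra_simps)
qed simp

lemma pact_smult: "k \<in> {1..n} \<Longrightarrow> v \<in> M \<Longrightarrow> pact k (smult c p) v = c *s pact k p v"
  by (induction p) (auto simp: pact_pCons L_scale pact_closed scale_right_distrib)

lemma pact_mult:
  assumes "k \<in> {1..n}" "v \<in> M"
  shows "pact k (p * q) v = pact k p (pact k q v)"
proof (induction p)
  case (pCons a p)
  then show ?case using assms by (simp add: mult_pCons_left pact_add pact_smult pact_pCons)
qed simp

lemma pact_zero_right: "k \<in> {1..n} \<Longrightarrow> pact k p 0 = 0"
  by (induction p) (auto simp: pact_pCons L_zero)

lemma pact_eigen: "k \<in> {1..n} \<Longrightarrow> v \<in> M \<Longrightarrow> L k v = c *s v \<Longrightarrow> pact k p v = poly p c *s v"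
  by (induction p) (auto simp: pact_pCons L_scale scale_left_distrib mult.commute)

lemma pact_linear: "k \<in> {1..n} \<Longrightarrow> pact k [:- c, 1:] v = L k v - c *s v"
  by (simp add: pact_pCons L_zero scale_minus_left)

lemma pact_intertwine:
  assumes "k \<in> {1..n}" "j \<in> {1..n}" "subspace T" "\<And>w. w \<in> T \<Longrightarrow> L j w \<in> T" "v \<in> T"
    and "\<And>v w. v \<in> T \<Longrightarrow> w \<in> T \<Longrightarrow> f (v + w) = f v + f w" "\<And>v c. v \<in> T \<Longrightarrow> f (c *s v) = c *s f v"
    and "\<And>v. v \<in> T \<Longrightarrow> L k (f v) = f (L j v)"
  shows "pact k p (f v) = f (pact j p v)"
proof (induction p)
  case 0
  then show ?case using assms(7)[OF assms(5), of 0] by simp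
next
  case (pCons a p)
  have "pact j p v \<in> T" by (rule pact_closed_subspace[OF assms(2-5)])
  then show ?case using pCons assms by (simp add: pact_pCons subspace_scale)
qed

text \<open>Simple roots give diagonalisability. If \<open>L k h - b *s h\<close> is a sum of
  eigenvectors \<open>f c\<close>, subtracting \<open>f c\<close> divided by \<open>c - b\<close>
  for every \<open>c\<close> from \<open>h\<close> leaves an eigenvector for \<open>b\<close>. The
  subspace \<open>T\<close> is carried along so that the parts stay in a given weight space.\<close>

lemma eigen_decomposition:
  assumes k: "k \<in> {1..n}" and T: "subspace T" "T \<subseteq> M" "\<And>w. w \<in> T \<Longrightarrow> L k w \<in> T"
    and "finite A" "h \<in> T" "pact k (roots_poly A) h = 0"
  shows "h \<in> span {v \<in> T. \<exists>c\<in>A. L k v = c *s v}"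
proof -
  have "\<exists>f. h = (\<Sum>c\<in>A. f c) \<and> (\<forall>c\<in>A. f c \<in> T \<and> L k (f c) = c *s f c)"
    using assms(5-7)
  proof (induction A arbitrary: h rule: finite_induct)
    case empty
    then show ?case by (simp add: roots_poly_def pact_pCons[OF k] L_zero[OF k] one_pCons)
  next
    case (insert b A)
    let ?h = "L k h - b *s h"
    have hT: "?h \<in> T" using insert T by (auto intro!: subspace_diff subspace_scale)
    have hM: "h \<in> M" using insert T by auto
    have "roots_poly (insert b A) = roots_poly A * [:- b, 1:]"
      using insert by (simp add: roots_poly_insert mult.commute)
    then have "pact k (roots_poly A) ?h = 0"
      using insert.prems(2) by (simp only: pact_mult[OF k hM] pact_linear[OF k])
    then obtain f where f: "?h = (\<Sum>c\<in>A. f c)" "\<And>c. c \<in> A \<Longrightarrow> f c \<in> T" "\<And>c. c \<in> A \<Longrightarrow> L k (f c) = c *s f c"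
      using insert.IH[OF hT] by blast
    let ?g = "\<lambda>c. (1 / (c - b)) *s f c"
    let ?r = "h - (\<Sum>c\<in>A. ?g c)"
    have gT: "?g c \<in> T" if "c \<in> A" for c using f that T by (auto intro: subspace_scale)
    have sT: "(\<Sum>c\<in>A. ?g c) \<in> T" using gT T by (auto intro: subspace_sum)
    have Lsum: "L k (\<Sum>c\<in>B. ?g c) = (\<Sum>c\<in>B. c *s ?g c)" if "finite B" "B \<subseteq> A" for B
      using that
    proof (induction B rule: finite_induct)
      case (insert x B)
      have "(\<Sum>c\<in>B. ?g c) \<in> M" using gT T insert by (intro M_sum) auto
      moreover have "?g x \<in> M" "f x \<in> M" using gT f T insert by auto
      ultimately show ?case using insert f k by (simp add: L_add L_scale mult.commute)
    qed (simp add: L_zero[OF k])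
    have "L k ?r = L k h - (\<Sum>c\<in>A. c *s ?g c)"
      using L_diff[OF k hM, of "\<Sum>c\<in>A. ?g c"] sT T(2) Lsum[of A] insert.hyps(1) by auto
    moreover have "(\<Sum>c\<in>A. (c - b) *s ?g c) = (\<Sum>c\<in>A. c *s ?g c) - b *s (\<Sum>c\<in>A. ?g c)"
      by (simp only: scale_left_diff_distrib sum_subtractf scale_sum_right)
    ultimately have "L k ?r - b *s ?r = (L k h - b *s h) - (\<Sum>c\<in>A. (c - b) *s ?g c)"
      by (simp only: scale_right_diff_distrib) simp
    also have "(\<Sum>c\<in>A. (c - b) *s ?g c) = (\<Sum>c\<in>A. f c)"
      by (rule sum.cong) (use insert in auto)
    finally have r: "L k ?r = b *s ?r" using f by simp
    have rT: "?r \<in> T" using T insert sT by (auto intro: subspace_diff)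
    have g: "?g c \<in> T \<and> L k (?g c) = c *s ?g c" if "c \<in> A" for c
      using gT[OF that] f that T k by (auto simp: L_scale subsetD mult.commute)
    have "h = ?r + (\<Sum>c\<in>A. ?g c)" by simp
    also have "\<dots> = (\<Sum>c\<in>insert b A. if c = b then ?r else ?g c)"
      using insert by (simp, intro sum.cong) auto
    finally show ?case
      using r rT g insert by (intro exI[of _ "\<lambda>c. if c = b then ?r else ?g c"]) auto
  qed
  then obtain f where f: "h = (\<Sum>c\<in>A. f c)" "\<forall>c\<in>A. f c \<in> T \<and> L k (f c) = c *s f c" by blast
  show ?thesis unfolding f(1) by (rule span_sum, rule span_base) (use f in auto)
qed

end

section \<open>Weight spaces and the spectrum of \<open>L_k\<close>\<close>

locale sep_module = hecke_module scale n M S L l u + separated l N u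
  for scale :: "'k::field \<Rightarrow> 'v::ab_group_add \<Rightarrow> 'v" (infixr \<open>*s\<close> 75) and n M S L l u N +
  assumes nN: "n \<le> N"
begin

definition W :: "nat \<Rightarrow> tableau \<Rightarrow> 'v set" where
  "W k t = {v \<in> M. \<forall>j\<in>{1..k}. L j v = tcontent u t j *s v}"

lemma W_M: "v \<in> W k t \<Longrightarrow> v \<in> M"
  by (simp add: W_def)

lemma W_L: "v \<in> W k t \<Longrightarrow> j \<in> {1..k} \<Longrightarrow> L j v = tcontent u t j *s v"
  by (simp add: W_def)

lemma W_subspace: "k \<le> n \<Longrightarrow> subspace (W k t)"
  by (intro subspaceI) (auto simp: W_def M_simps L_add L_scale L_zero scale_right_distrib scale_left_commute)

lemma W_closed_L: "k \<le> n \<Longrightarrow> j \<in> {1..n} \<Longrightarrow> v \<in> W k t \<Longrightarrow> L j v \<in> W k t"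
  by (auto simp: W_def M_simps L_L[of _ j] L_scale)

lemma W_restrict: "ST l k t \<Longrightarrow> m \<le> k \<Longrightarrow> v \<in> W k t \<Longrightarrow> v \<in> W m (t \<down> m)"
  by (auto simp: W_def content_restrict)

lemma L_S: "i \<in> {1..<n} \<Longrightarrow> v \<in> M \<Longrightarrow> L (Suc i) (S i v) = S i (L i v) + v"
  using L_Suc[of i "S i v"] S_sq[of i v] by (simp add: M_simps)

lemma L_S': "i \<in> {1..<n} \<Longrightarrow> v \<in> M \<Longrightarrow> L i (S i v) = S i (L (Suc i) v) - v"
  using L_S[of i "S i v"] S_sq[of i v] S_sq[of i "L i (S i v)"] S_add[of i "S i (L i (S i v))" "S i v"]
  by (simp add: M_simps)

text \<open>The intertwiner: corrected by the scalar \<open>1 / (b - a)\<close>, the operator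
  \<open>S i\<close> exchanges the two eigenvalues.\<close>

lemma swap_eigen:
  assumes i: "i \<in> {1..<n}" and v: "v \<in> M" "L i v = a *s v" "L (Suc i) v = b *s v" and ab: "a \<noteq> b"
  defines "w \<equiv> S i v - (1 / (b - a)) *s v"
  shows "L i w = b *s w" "L (Suc i) w = a *s w"
proof -
  have i1: "i \<in> {1..n}" "Suc i \<in> {1..n}" using i by auto
  have 1: "1 + a / (b - a) = b / (b - a)" and 2: "1 - b / (b - a) = - (a / (b - a))"
    using ab by (auto simp: divide_simps)
  have "L i w = b *s S i v - v - (a / (b - a)) *s v"
    unfolding w_def using i i1 v by (simp add: L_diff L_scale M_simps L_S' S_scale)
  also have "\<dots> = b *s S i v - (1 + a / (b - a)) *s v" by (simp add: scale_left_distrib)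
  finally show "L i w = b *s w" unfolding 1 by (simp add: w_def scale_right_diff_distrib)
  have "L (Suc i) w = a *s S i v + v - (b / (b - a)) *s v"
    unfolding w_def using i i1 v by (simp add: L_diff L_scale M_simps L_S S_scale)
  also have "\<dots> = a *s S i v + (1 - b / (b - a)) *s v" by (simp add: scale_left_diff_distrib)
  finally show "L (Suc i) w = a *s w" unfolding 2 by (simp add: w_def scale_right_diff_distrib scale_minus_left)
qed

lemma W_swap:
  assumes t: "ST l k t" "k \<le> n" and i: "i \<in> {1..<k}" and s: "ST l k (st i \<circ> t)" and v: "v \<in> W k t"
  shows "S i v - (1 / (tcontent u t (Suc i) - tcontent u t i)) *s v \<in> W k (st i \<circ> t)"
proof -
  let ?w = "S i v - (1 / (tcontent u t (Suc i) - tcontent u t i)) *s v"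
  have in': "i \<in> {1..<n}" using i t by auto
  have vM: "v \<in> M" by (rule W_M[OF v])
  have L: "L i v = tcontent u t i *s v" "L (Suc i) v = tcontent u t (Suc i) *s v" using W_L[OF v] i by auto
  have ne: "tcontent u t i \<noteq> tcontent u t (Suc i)" using content_consec[OF t(1) _ i] t nN by auto
  note e = swap_eigen[OF in' vM L ne]
  have "L j ?w = tcontent u (st i \<circ> t) j *s ?w" if j: "j \<in> {1..k}" for j
  proof -
    consider "j = i" | "j = Suc i" | "j \<noteq> i" "j \<noteq> Suc i" by blast
    then show ?thesis
    proof cases
      case 3
      then have "L j ?w = tcontent u t j *s ?w"
        using W_L[OF v j] in' j t vM S_L[OF in', of j v]
        by (simp add: L_diff L_scale M_simps S_scale scale_right_diff_distrib scale_left_commute)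
      then show ?thesis using content_swap[OF t(1) i s j, of u] 3 by (simp add: st_apply)
    qed (use e content_swap[OF t(1) i s j, of u] in \<open>simp_all add: st_apply\<close>)
  qed
  moreover have "?w \<in> M" using vM in' by (simp add: M_simps)
  ultimately show ?thesis by (simp add: W_def)
qed

abbreviation A :: "tableau \<Rightarrow> 'k set" where
  "A t \<equiv> cont u ` {b. addable l t b}"

text \<open>The claim of the induction on \<open>k\<close>. Once it holds, a joint eigenvector of
  the first \<open>k - 1\<close> operators can be continued only along addable boxes.\<close>

definition spectral :: "nat \<Rightarrow> bool" where
  "spectral k \<longleftrightarrow> (\<forall>t v. ST l (k - 1) t \<longrightarrow> v \<in> W (k - 1) t \<longrightarrow> pact k (roots_poly (A t)) v = 0)"

text \<open>On \<open>W k t\<close> the map \<open>f\<close> is \<open>L k - a\<close> applied after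
  \<open>S k\<close>, and it carries \<open>L (Suc k)\<close> to \<open>L k\<close>. The polynomial
  that kills \<open>S k h\<close> under \<open>L k\<close>, with its factor for \<open>a\<close>
  absorbed into \<open>f\<close>, is therefore moved past \<open>f\<close> and becomes a polynomial
  in \<open>L (Suc k)\<close> applied to \<open>h\<close>. What remains is
  \<open>f g = 0\<close>.\<close>

lemma spectral_rel:
  assumes sp: "spectral k" and k: "k \<in> {1..<n}" and t: "ST l k t" and h: "h \<in> W k t"
  defines "a \<equiv> tcontent u t k"
  defines "g \<equiv> pact (Suc k) (roots_poly (A (t \<down> (k - 1)) - {a})) h"
  shows "S k (L (Suc k) g - a *s g) = g"
proof -
  let ?t = "t \<down> (k - 1)" and ?T = "W k t"
  let ?R = "A ?t - {a}"
  define f where "f v = S k (L (Suc k) v - a *s v) - v" for v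
  have t': "ST l (k - 1) ?t" by (rule ST_restrict[OF t]) simp
  have kn: "k \<in> {1..n}" "Suc k \<in> {1..n}" "k \<le> n" using k by auto
  have aA: "a \<in> A ?t"
    using ST_last_addable[OF t, of "k - 1"] k by (auto simp: a_def content_eq)
  have finA: "finite (A ?t)" using finite_addable[OF t'] by simp
  have rp: "roots_poly (A ?t) = roots_poly ?R * [:- a, 1:]"
    using roots_poly_insert[of ?R a] finA aA by (simp add: insert_absorb mult.commute)
  have sub: "subspace ?T" using kn by (intro W_subspace)
  have cl: "L (Suc k) v \<in> ?T" if "v \<in> ?T" for v using W_closed_L kn that by auto
  have La: "L k v = a *s v" if "v \<in> ?T" for v using W_L[OF that, of k] k by (auto simp: a_def)
  have fadd: "f (v + w) = f v + f w" if "v \<in> ?T" "w \<in> ?T" for v w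
    using W_M[OF that(1)] W_M[OF that(2)] kn k
    by (simp add: f_def L_add S_add S_diff M_simps scale_right_distrib S_scale)
  have fscale: "f (c *s v) = c *s f v" if "v \<in> ?T" for v c
    using W_M[OF that(1)] kn k
    by (simp add: f_def L_scale S_diff M_simps scale_right_diff_distrib S_scale mult.commute)
  have fint: "L k (f v) = f (L (Suc k) v)" if "v \<in> ?T" for v
  proof -
    have M: "v \<in> M" "L (Suc k) v \<in> M" "L (Suc k) v - a *s v \<in> M"
      using W_M[OF that] kn by (auto simp: M_simps)
    have "L k (f v) = S k (L (Suc k) (L (Suc k) v - a *s v)) - (L (Suc k) v - a *s v) - a *s v"
      unfolding f_def using M k kn La[OF that] by (simp add: L_diff M_simps L_S')
    moreover have "L (Suc k) (L (Suc k) v - a *s v) = L (Suc k) (L (Suc k) v) - a *s L (Suc k) v"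
      using M kn by (simp add: L_diff L_scale M_scale)
    ultimately show ?thesis by (simp add: f_def)
  qed
  have hM: "h \<in> M" by (rule W_M[OF h])
  have "S k h \<in> W (k - 1) ?t"
  proof -
    have "L j (S k h) = tcontent u ?t j *s S k h" if j: "j \<in> {1..k - 1}" for j
      using S_L[of k j h] j k hM W_L[OF h, of j] content_restrict[OF t, of "k - 1" j u]
      by (auto simp: S_scale)
    then show ?thesis using hM k by (auto simp: W_def M_simps)
  qed
  then have "pact k (roots_poly (A ?t)) (S k h) = 0"
    using sp t' unfolding spectral_def by blast
  then have "pact k (roots_poly ?R) (L k (S k h) - a *s S k h) = 0"
    unfolding rp pact_mult[OF kn(1) S_closed[OF k hM]] pact_linear[OF kn(1)] .
  moreover have "L k (S k h) - a *s S k h = f h"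
    using hM k kn by (simp add: f_def L_S' S_diff M_simps S_scale)
  ultimately have "pact k (roots_poly ?R) (f h) = 0" by simp
  then have "f g = 0"
    unfolding g_def using pact_intertwine[OF kn(1,2) sub cl h fadd fscale fint] by simp
  then show ?thesis by (simp add: f_def)
qed

lemma neighbour_not_addable:
  assumes k: "k \<in> {1..<n}" and t: "ST l k t" and e: "\<epsilon> \<in> {1, - 1}"
    and b: "addable l (t \<down> (k - 1)) b" "b \<noteq> bx t k"
  shows "tcontent u t k + of_int \<epsilon> - cont u b \<noteq> 0"
proof -
  have t': "ST l (k - 1) (t \<down> (k - 1))" by (rule ST_restrict[OF t]) simp
  have b': "addable l (t \<down> (k - 1)) (bx t k)" using ST_last_addable[OF t, of "k - 1"] k by auto
  have "cont u (bx t k) - cont u b + of_int \<epsilon> \<noteq> 0"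
    by (rule cont_neq[OF t']) (use b b' e k nN addable_ic[OF t' b' b(1)] in auto)
  then show ?thesis by (simp add: content_eq algebra_simps)
qed

lemma neighbour_not_root:
  assumes k: "k \<in> {1..<n}" and t: "ST l k t" and e: "\<epsilon> \<in> {1, - 1}"
  shows "tcontent u t k + of_int \<epsilon> \<notin> A (t \<down> (k - 1)) - {tcontent u t k}"
proof
  assume a: "tcontent u t k + of_int \<epsilon> \<in> A (t \<down> (k - 1)) - {tcontent u t k}"
  then have "tcontent u t k + of_int \<epsilon> \<in> A (t \<down> (k - 1))" by blast
  then obtain b where "tcontent u t k + of_int \<epsilon> = cont u b" "b \<in> {b. addable l (t \<down> (k - 1)) b}"
    by (rule imageE)
  then have b: "addable l (t \<down> (k - 1)) b" "tcontent u t k + of_int \<epsilon> = cont u b" by auto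
  have "b \<noteq> bx t k" using a b(2) by (auto simp: content_eq)
  then show False using neighbour_not_addable[OF k t e b(1)] b(2) by simp
qed

text \<open>For an eigenvector of \<open>L (Suc k)\<close> the vector \<open>g\<close> of
  \<open>spectral_rel\<close> is the multiple of \<open>w\<close> by the polynomial's value at the
  eigenvalue. This value is nonzero, since no addable box of the smaller tableau has a content
  neighbouring that of \<open>k\<close>. After cancelling it the relation says that
  \<open>of_int \<epsilon> *s S k w = w\<close>.\<close>

lemma S_adjacent:
  assumes sp: "spectral k" and k: "k \<in> {1..<n}" and t: "ST l k t" and w: "w \<in> W k t"
    and e: "\<epsilon> \<in> {1, - 1 :: int}" and L: "L (Suc k) w = (tcontent u t k + of_int \<epsilon>) *s w"
  shows "S k w = of_int \<epsilon> *s w"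
proof -
  let ?a = "tcontent u t k"
  let ?R = "A (t \<down> (k - 1)) - {?a}"
  have t': "ST l (k - 1) (t \<down> (k - 1))" by (rule ST_restrict[OF t]) simp
  define \<kappa> where "\<kappa> = poly (roots_poly ?R) (?a + of_int \<epsilon>)"
  have wM: "w \<in> M" by (rule W_M[OF w])
  have kn: "k \<in> {1..n}" "Suc k \<in> {1..n}" using k by auto
  have "?a + of_int \<epsilon> - c \<noteq> 0" if "c \<in> ?R" for c
  proof
    assume "?a + of_int \<epsilon> - c = 0"
    then have "?a + of_int \<epsilon> \<in> ?R" using that by simp
    then show False using neighbour_not_root[OF k t e] by blast
  qed
  then have "\<kappa> \<noteq> 0"
    unfolding \<kappa>_def poly_roots_poly using finite_addable[OF t'] by (subst prod_zero_iff) auto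
  have g: "pact (Suc k) (roots_poly ?R) w = \<kappa> *s w"
    unfolding \<kappa>_def by (rule pact_eigen[OF kn(2) wM L])
  have "S k (L (Suc k) (\<kappa> *s w) - ?a *s (\<kappa> *s w)) = \<kappa> *s w"
    using spectral_rel[OF sp k t w] unfolding g by simp
  moreover have "L (Suc k) (\<kappa> *s w) - ?a *s (\<kappa> *s w) = (\<kappa> * of_int \<epsilon>) *s w"
    using wM kn L by (simp add: L_scale algebra_simps scale_left_distrib)
  ultimately have "(\<kappa> * of_int \<epsilon>) *s S k w = \<kappa> *s w"
    using wM k by (simp add: S_scale)
  then have "\<kappa> *s (of_int \<epsilon> *s S k w) = \<kappa> *s w" by simp
  then have "of_int \<epsilon> *s S k w = w" using \<open>\<kappa> \<noteq> 0\<close> by (simp only: scale_cancel_left) simp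
  then have "of_int \<epsilon> *s (of_int \<epsilon> *s S k w) = of_int \<epsilon> *s w" by simp
  moreover have "of_int \<epsilon> * of_int \<epsilon> = (1::'k)" using e by auto
  ultimately show ?thesis by simp
qed

text \<open>If the box \<open>b\<^sub>0\<close> with content \<open>a + \<epsilon>\<close> next to the last box has no other successor in the
  tableau, its entry can be moved up to \<open>k - 1\<close>, and then the braid relation forces the vector to vanish.\<close>

lemma exclusion:
  assumes sp: "\<And>j. 1 \<le> j \<Longrightarrow> j \<le> k \<Longrightarrow> spectral j" and k: "k \<in> {1..<n}"
    and t: "ST l k t" and w: "w \<in> W k t"
    and e: "\<epsilon> \<in> {1, - 1 :: int}" and L: "L (Suc k) w = (tcontent u t k + of_int \<epsilon>) *s w"
    and b0: "adj b0 (bx t k)" "t b0 \<noteq> 0" "cont u b0 = tcontent u t k + of_int \<epsilon>"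
      "\<And>b'. adj b0 b' \<Longrightarrow> t b' \<noteq> 0 \<Longrightarrow> b' = bx t k"
  shows "w = 0"
  using t w L b0
proof (induction "k - t b0" arbitrary: t w rule: less_induct)
  case less
  note t = less.prems(1) and w = less.prems(2) and L = less.prems(3) and b0 = less.prems(4-7)
  have wM: "w \<in> M" by (rule W_M[OF w])
  have tk: "t (bx t k) = k" using t_bx[OF t] k by auto
  have lt: "t b0 < k" using ST_adj_lt[OF t b0(1,2)] tk k by auto
  define p where "p = t b0"
  have p: "1 \<le> p" "p < k" "bx t p = b0" using lt b0 bx_eq[OF t, of b0 p] by (auto simp: p_def)
  have pn: "p \<in> {1..<n}" using p k by auto
  show ?case
  proof (cases "Suc p = k")
    case True
    have e': "- \<epsilon> \<in> {1, - 1}" using e by auto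
    have tp: "ST l p (t \<down> p)" by (rule ST_restrict[OF t]) (use p in simp)
    have wp: "w \<in> W p (t \<down> p)" by (rule W_restrict[OF t _ w]) (use p in simp)
    have cp: "tcontent u (t \<down> p) p = tcontent u t k + of_int \<epsilon>"
      using content_restrict[OF t, of p p u] p b0 by (simp add: content_eq)
    have "L (Suc p) w = (tcontent u (t \<down> p) p + of_int (- \<epsilon>)) *s w"
      using W_L[OF w, of k] k True by (auto simp: cp)
    then have s1: "S p w = of_int (- \<epsilon>) *s w"
      using S_adjacent[OF sp pn tp wp e'] p by auto
    have s2: "S k w = of_int \<epsilon> *s w"
      using S_adjacent[OF sp k t w e L] k by auto
    \<comment> \<open>The generators \<open>S p\<close> and \<open>S k\<close> act on
      \<open>w\<close> by \<open>- \<epsilon>\<close> and \<open>\<epsilon>\<close>; the left side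
      is thus \<open>w\<close> times \<open>\<epsilon>\<close> and the right side \<open>w\<close>
      times \<open>- \<epsilon>\<close>.\<close>
    have "S p (S (Suc p) (S p w)) = S (Suc p) (S p (S (Suc p) w))"
      by (rule S_braid[OF pn _ wM]) (use True k in auto)
    then have "w = - w"
      using s1 s2 True e wM pn k S_minus by auto
    then have "(1 + 1) *s w = 0"
      unfolding scale_left_distrib scale_one by (simp only: eq_neg_iff_add_eq_0)
    moreover have "(2 :: 'k) \<noteq> 0" using char[of 2] k p nN by auto
    ultimately show ?thesis by (simp only: one_add_one scale_eq_0_iff) simp
  next
    case False
    then have pk: "p \<in> {1..<k}" "Suc p < k" using p by auto
    have na: "\<not> adj (bx t p) (bx t (Suc p))"
    proof
      assume a: "adj (bx t p) (bx t (Suc p))"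
      have "t (bx t (Suc p)) = Suc p" using t_bx[OF t] pk by auto
      then have "bx t (Suc p) = bx t k" using b0(4) a p by simp
      then show False using \<open>t (bx t (Suc p)) = Suc p\<close> tk pk by simp
    qed
    let ?s = "st p \<circ> t"
    have s: "ST l k ?s" by (rule ST_swap[OF t pk(1) na])
    let ?r = "tcontent u t (Suc p) - tcontent u t p"
    let ?w = "S p w - (1 / ?r) *s w"
    have w': "?w \<in> W k ?s" by (rule W_swap[OF t _ pk(1) s w]) (use k in auto)
    have bk: "bx ?s k = bx t k" using bx_swap[OF t pk(1) s, of k] pk by (auto simp: st_apply)
    then have ck: "tcontent u ?s k = tcontent u t k" by (simp add: content_eq)
    have Lw: "L (Suc k) ?w = (tcontent u t k + of_int \<epsilon>) *s ?w"
      using L wM pn pk k S_L[of p "Suc k" w]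
      by (simp add: L_diff L_scale M_simps S_scale scale_right_diff_distrib scale_left_commute)
    have sb0: "?s b0 = Suc p" by (simp add: p_def st_apply)
    have "?w = 0"
    proof (rule less.hyps[OF _ s w'])
      show "k - ?s b0 < k - t b0" using sb0 pk p_def by simp
      show "L (Suc k) ?w = (tcontent u ?s k + of_int \<epsilon>) *s ?w" using Lw ck by simp
      show "adj b0 (bx ?s k)" "?s b0 \<noteq> 0" "cont u b0 = tcontent u ?s k + of_int \<epsilon>"
        using b0 bk ck sb0 by simp_all
      show "b' = bx ?s k" if "adj b0 b'" "?s b' \<noteq> 0" for b'
        unfolding bk using b0(4)[OF that(1)] that(2) ST_swap_supp[OF p(1), of t b'] by blast
    qed
    \<comment> \<open>As the intertwined vector vanishes, \<open>w\<close> is an eigenvector of the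
      involution \<open>S p\<close>. Its eigenvalue \<open>1 / ?r\<close> would have square 1, which
      is impossible for non-adjacent boxes.\<close>
    then have sw: "S p w = (1 / ?r) *s w" by simp
    then have "S p (S p w) = (1 / ?r) *s ((1 / ?r) *s w)" using wM pn by (simp add: S_scale)
    then have "w = (1 / ?r)\<^sup>2 *s w" using S_sq[OF pn wM] by (simp add: power2_eq_square)
    then have "(1 - (1 / ?r)\<^sup>2) *s w = 0" by (simp add: scale_left_diff_distrib)
    moreover have "1 - (1 / ?r)\<^sup>2 \<noteq> 0"
      using content_nonadj[OF t _ pk(1) na] k nN by (auto simp: power2_eq_1_iff divide_simps)
    ultimately show ?thesis by simp
  qed
qed

lemma roots_poly_one: "1 \<le> n \<Longrightarrow> v \<in> M \<Longrightarrow> distinct cs \<Longrightarrow> inj_on u (set cs) \<Longrightarrow>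
    pact 1 (roots_poly (u ` set cs)) v = foldr (\<lambda>c w. L 1 w - u c *s w) cs v"
proof (induction cs)
  case Nil
  then show ?case by (simp add: roots_poly_def one_pCons pact_pCons L_zero)
next
  case (Cons c cs)
  have "foldr (\<lambda>c w. L 1 w - u c *s w) cs v \<in> M"
    using Cons.prems(1,2) by (induction cs) (auto simp: M_simps)
  moreover have "u c \<notin> u ` set cs" using Cons.prems by (auto simp: inj_on_def)
  moreover have "pact 1 ([:- u c, 1:] * roots_poly (u ` set cs)) v =
      L 1 (pact 1 (roots_poly (u ` set cs)) v) - u c *s pact 1 (roots_poly (u ` set cs)) v"
    using Cons.prems by (simp only: pact_mult pact_linear atLeastAtMost_iff order_refl)
  moreover have "pact 1 (roots_poly (u ` set cs)) v = foldr (\<lambda>c w. L 1 w - u c *s w) cs v"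
    using Cons by simp
  ultimately show ?case by (simp add: roots_poly_insert del: mult_pCons_left)
qed

text \<open>The empty tableau has one addable box in each component \<open>c\<close>, of content
  \<open>u c\<close>. As these contents are distinct, the polynomial is the one in the cyclotomic
  relation.\<close>

lemma spectral_1:
  assumes "1 \<le> n"
  shows "spectral 1"
  unfolding spectral_def
proof (intro allI impI)
  fix t v assume t: "ST l (1 - 1) t" and v: "v \<in> W (1 - 1) t"
  have t0: "t b = 0" for b using ST_le[OF t, of b] by simp
  have "b \<in> (\<lambda>c. (1, 1, c)) ` {1..l}" if "addable l t b" for b
  proof -
    obtain i j c where e: "b = (i, j, c)" by (cases b)
    have v: "1 \<le> i" "1 \<le> j" "1 \<le> c" "c \<le> l" using that by (auto simp: e addable_def valid_box_def)
    have "\<not> (adj (i - 1, j, c) b \<and> valid_box l (i - 1, j, c))" "\<not> (adj (i, j - 1, c) b \<and> valid_box l (i, j - 1, c))"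
      using that t0 unfolding addable_def by blast+
    then have "i = 1" "j = 1" using v by (auto simp: adj_def valid_box_def e)
    then show ?thesis using v by (auto simp: e)
  qed
  moreover have "addable l t (1, 1, c)" if "c \<in> {1..l}" for c
    using that t0 by (auto simp: addable_def valid_box_def adj_def)
  ultimately have "{b. addable l t b} = (\<lambda>c. (1, 1, c)) ` {1..l}" by blast
  then have A: "A t = u ` set [1..<Suc l]"
    by (simp add: image_image cont_def del: upt_Suc) (simp add: atLeastLessThanSuc_atLeastAtMost)
  have "inj_on u (set [1..<Suc l])"
    using sep[of _ _ 0] assms nN by (force simp: inj_on_def simp del: upt_Suc)
  then show "pact 1 (roots_poly (A t)) v = 0"
    unfolding A using roots_poly_one[of v "[1..<Suc l]"] L_one assms W_M[OF v]
    by (simp del: upt_Suc)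
qed

text \<open>By \<open>spectral_rel\<close>, \<open>L (Suc k) - a\<close> acts on \<open>g\<close> as
  \<open>S k\<close> does, and applying it twice gives \<open>g\<close> back. So
  \<open>a + 1\<close> and \<open>a - 1\<close> join the roots in \<open>?R\<close>. The latter stay
  contents of addable boxes of \<open>t\<close>, while \<open>exclusion\<close> discards each of the
  former that is not such a content.\<close>

lemma spectral_step:
  assumes sp: "\<And>j. 1 \<le> j \<Longrightarrow> j \<le> k \<Longrightarrow> spectral j" and k: "k \<in> {1..<n}"
  shows "spectral (Suc k)"
  unfolding spectral_def
proof (intro allI impI, unfold diff_Suc_1)
  fix t h assume t: "ST l k t" and h: "h \<in> W k t"
  let ?a = "tcontent u t k" and ?t = "t \<down> (k - 1)" and ?b = "bx t k"
  let ?R = "A ?t - {?a}"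
  define g where "g = pact (Suc k) (roots_poly ?R) h"
  have t': "ST l (k - 1) ?t" by (rule ST_restrict[OF t]) simp
  have kn: "k \<in> {1..n}" "Suc k \<in> {1..n}" "k \<le> n" using k by auto
  have two: "(2 :: 'k) \<noteq> 0" using char[of 2] k nN by auto
  have finR: "finite ?R" using finite_addable[OF t'] by simp
  have tk: "t ?b = k" using t_bx[OF t] k by auto
  have hM: "h \<in> M" by (rule W_M[OF h])
  have W: "subspace (W k t)" "\<And>w. w \<in> W k t \<Longrightarrow> L (Suc k) w \<in> W k t"
    using W_subspace W_closed_L kn by auto
  have pW: "pact (Suc k) p w \<in> W k t" if "w \<in> W k t" for p w
    by (rule pact_closed_subspace[OF kn(2) W that])
  have gW: "g \<in> W k t" unfolding g_def by (rule pW[OF h])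
  have gM: "g \<in> M" by (rule W_M[OF gW])
  have rel: "S k (L (Suc k) g - ?a *s g) = g"
    unfolding g_def using sp k by (intro spectral_rel[OF _ k t h]) auto
  define g1 where "g1 = L (Suc k) g - ?a *s g"
  have g1M: "g1 \<in> M" using gM kn by (simp add: g1_def M_simps)
  have g1: "g1 = S k g" using rel S_sq[of k g1] k g1M by (simp add: g1_def)
  have "L (Suc k) g1 = S k (L k g) + g" unfolding g1 using L_S k gM by simp
  also have "L k g = ?a *s g" using W_L[OF gW, of k] k by auto
  finally have g2: "L (Suc k) g1 - ?a *s g1 = g" using k gM by (simp add: S_scale g1)
  have q: "[:- (?a + 1), 1:] * [:- (?a - 1), 1:] = [:- ?a, 1:] * [:- ?a, 1:] - [:1:]"
    by (simp add: algebra_simps)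
  have quad: "pact (Suc k) ([:- (?a + 1), 1:] * [:- (?a - 1), 1:]) g = 0"
  proof -
    have "pact (Suc k) ([:- ?a, 1:] * [:- ?a, 1:] + [:- 1:]) g = 0"
      using g2 kn by (simp only: pact_add[OF kn(2) gM] pact_mult[OF kn(2) gM] pact_linear[OF kn(2)] g1_def[symmetric])
        (simp add: pact_pCons L_zero)
    then show ?thesis unfolding q by simp
  qed
  obtain i j c where b: "?b = (i, j, c)" by (cases ?b)
  have vb: "1 \<le> i" "1 \<le> j" "1 \<le> c" "c \<le> l"
    using ST_valid[OF t, of ?b] tk k by (auto simp: b valid_box_def)
  have succ0: "t b' = 0" if "adj ?b b'" for b'
    using ST_adj_lt[OF t that] ST_le[OF t, of b'] tk k by fastforce
  \<comment> \<open>With the last box, \<open>b0\<close>, \<open>b1\<close> and \<open>b2\<close>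
    form a square: \<open>b1\<close> is the neighbour of content \<open>z\<close>, \<open>b0\<close>
    is its counterpart of equal content on the other side, and \<open>b2\<close> is the remaining
    corner. If \<open>b1\<close> is not addable, then \<open>b2\<close> is empty, so the last box is
    the only successor of \<open>b0\<close> in \<open>t\<close>.\<close>
  have excl: "w = 0" if z: "z = ?a + of_int \<epsilon>" "\<epsilon> \<in> {1, - 1}" "z \<notin> A t" and w: "w \<in> W k t" "L (Suc k) w = z *s w"
    for z \<epsilon> w
  proof -
    define b1 where "b1 = (if \<epsilon> = 1 then (i, Suc j, c) else (Suc i, j, c))"
    define b0 where "b0 = (if \<epsilon> = 1 then (i - 1, j, c) else (i, j - 1, c))"
    define b2 where "b2 = (if \<epsilon> = 1 then (i - 1, Suc j, c) else (Suc i, j - 1, c))"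
    have a1: "adj ?b b1" by (auto simp: b b1_def adj_def)
    have "cont u b1 = z" using z by (auto simp: b1_def content_eq b cont_def)
    then have "\<not> addable l t b1" using z(3) by blast
    moreover have "valid_box l b1" using vb by (auto simp: b1_def valid_box_def)
    moreover have "t b1 = 0" by (rule succ0[OF a1])
    ultimately obtain b' where b': "adj b' b1" "valid_box l b'" "t b' = 0"
      by (auto simp: addable_def)
    have "b' = b2" using b' tk k z by (auto simp: b1_def b2_def adj_def b split: if_splits)
    then have t2: "t b2 = 0" and v2: "valid_box l b2" using b' by auto
    have v0: "valid_box l b0" "adj b0 ?b" "cont u b0 = ?a + of_int \<epsilon>"
      using v2 z vb by (auto simp: b0_def b2_def valid_box_def adj_def b content_eq cont_def of_nat_diff split: if_splits)
    have t0: "t b0 \<noteq> 0" using ST_adj[OF t v0(2,1)] tk k by simp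
    have only: "b'' = ?b" if "adj b0 b''" "t b'' \<noteq> 0" for b''
      using that t2 v2 z by (auto simp: b0_def b2_def adj_def b valid_box_def split: if_splits)
    show "w = 0"
      by (rule exclusion[OF sp k t w(1) z(2) _ v0(2) t0 v0(3) only]) (use w z in auto)
  qed
  \<comment> \<open>\<open>E1\<close> and \<open>E2\<close> keep those neighbours of
    \<open>a\<close> that are contents of addable boxes. Being disjoint from each other and from
    \<open>?R\<close>, they leave all roots simple.\<close>
  define E1 where "E1 = (if ?a + 1 \<in> A t then {?a + 1} else {})"
  define E2 where "E2 = (if ?a - 1 \<in> A t then {?a - 1} else {})"
  have p0: "pact (Suc k) ([:- (?a + 1), 1:] * [:- (?a - 1), 1:] * roots_poly ?R) h = 0"
    using quad hM kn unfolding g_def by (simp only: pact_mult)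
  have p1: "pact (Suc k) (roots_poly E1 * ([:- (?a - 1), 1:] * roots_poly ?R)) h = 0"
  proof (cases "?a + 1 \<in> A t")
    case True
    then have "roots_poly E1 = [:- (?a + 1), 1:]" by (simp add: E1_def roots_poly_def)
    then show ?thesis using p0 by (simp only: mult.assoc)
  next
    case False
    let ?w = "pact (Suc k) ([:- (?a - 1), 1:] * roots_poly ?R) h"
    have "pact (Suc k) [:- (?a + 1), 1:] ?w = 0"
      using p0 hM kn by (simp only: mult.assoc pact_mult)
    then have "L (Suc k) ?w = (?a + 1) *s ?w" using kn by (simp only: pact_linear) simp
    then have "?w = 0" using excl[of "?a + 1" 1 ?w] False pW[OF h] by simp
    then show ?thesis using False hM kn by (simp add: E1_def roots_poly_def)
  qed
  have p2: "pact (Suc k) (roots_poly E2 * (roots_poly E1 * roots_poly ?R)) h = 0"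
  proof (cases "?a - 1 \<in> A t")
    case True
    then have "roots_poly E2 = [:- (?a - 1), 1:]" by (simp add: E2_def roots_poly_def)
    then show ?thesis using p1 by (simp only: mult.left_commute)
  next
    case False
    let ?w = "pact (Suc k) (roots_poly E1 * roots_poly ?R) h"
    have "pact (Suc k) ([:- (?a - 1), 1:] * (roots_poly E1 * roots_poly ?R)) h = 0"
      using p1 by (simp only: mult.left_commute)
    then have "pact (Suc k) [:- (?a - 1), 1:] ?w = 0"
      using hM kn by (simp only: pact_mult)
    then have "L (Suc k) ?w = (?a - 1) *s ?w" using kn by (simp only: pact_linear) simp
    then have "?w = 0" using excl[of "?a - 1" "- 1" ?w] False pW[OF h] by simp
    then show ?thesis using False by (simp add: E2_def roots_poly_def)
  qed
  have neigh: "?a + of_int \<epsilon> \<notin> ?R" if "\<epsilon> \<in> {1, - 1}" for \<epsilon>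
    by (rule neighbour_not_root[OF k t that])
  have disj: "E1 \<inter> ?R = {}" "E2 \<inter> (E1 \<union> ?R) = {}"
  proof -
    have "?a + 1 \<noteq> ?a - 1"
    proof
      assume "?a + 1 = ?a - 1"
      then have "(1::'k) = -1" by simp
      then show False using one_neq_minus_one k nN by auto
    qed
    then show "E1 \<inter> ?R = {}" "E2 \<inter> (E1 \<union> ?R) = {}"
      using neigh[of 1] neigh[of "- 1"] by (auto simp: E1_def E2_def split: if_splits)
  qed
  have fin: "finite E1" "finite E2" by (auto simp: E1_def E2_def)
  have un: "roots_poly (E2 \<union> (E1 \<union> ?R)) = roots_poly E2 * (roots_poly E1 * roots_poly ?R)"
    unfolding roots_poly_def using fin finR disj by (simp add: prod.union_disjoint)
  have "?R \<subseteq> A t"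
  proof
    fix x assume "x \<in> ?R"
    then obtain b' where b': "addable l ?t b'" "x = cont u b'" "x \<noteq> ?a" by auto
    then have ne: "b' \<noteq> ?b" by (auto simp: content_eq)
    have up: "t y \<noteq> 0" if "?t y \<noteq> 0" for y using that by (auto simp: restrict_tab_def split: if_splits)
    have "t b' = 0"
    proof (rule ccontr)
      assume nz: "t b' \<noteq> 0"
      then have "t b' \<noteq> k" using bx_eq[OF t, of b' k] k ne by auto
      then show False using b'(1) nz ST_le[OF t, of b'] by (auto simp: addable_def restrict_tab_def split: if_splits)
    qed
    then have "addable l t b'" using b'(1) up by (auto simp: addable_def)
    then show "x \<in> A t" using b' by auto
  qed
  then have subA: "E2 \<union> (E1 \<union> ?R) \<subseteq> A t" by (auto simp: E1_def E2_def)
  have "roots_poly (A t) = roots_poly (A t - (E2 \<union> (E1 \<union> ?R))) * roots_poly (E2 \<union> (E1 \<union> ?R))"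
    unfolding roots_poly_def using finite_addable[OF t] subA by (intro prod.subset_diff) auto
  then show "pact (Suc k) (roots_poly (A t)) h = 0"
    unfolding un using p2 hM kn by (simp add: pact_mult pact_zero_right)
qed

lemma spectral: "1 \<le> k \<Longrightarrow> k \<le> n \<Longrightarrow> spectral k"
proof (induction k rule: less_induct)
  case (less k)
  show ?case
  proof (cases "k = 1")
    case True
    then show ?thesis using spectral_1 less.prems by simp
  next
    case False
    then have "spectral (Suc (k - 1))" by (intro spectral_step less.IH) (use less.prems in auto)
    then show ?thesis using less.prems by simp
  qed
qed

text \<open>By \<open>spectral\<close>, \<open>L (Suc k)\<close> splits a weight space for size
  \<open>k\<close> into eigenspaces for the contents of addable boxes; each of these is a weight
  space of the tableau with that box added.\<close>

lemma weight_span: "k \<le> n \<Longrightarrow> M \<subseteq> span (\<Union>t\<in>{t. ST l k t}. W k t)"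
proof (induction k)
  case 0
  have "ST l 0 (\<lambda>_. 0)" by (auto simp: ST_def bij_betw_def)
  moreover have "W 0 (\<lambda>_. 0) = M" by (auto simp: W_def)
  ultimately show ?case by (intro subset_trans[OF _ span_superset]) blast
next
  case (Suc k)
  then have kn: "Suc k \<in> {1..n}" "k \<le> n" by auto
  have "W k t \<subseteq> span (\<Union>t\<in>{t. ST l (Suc k) t}. W (Suc k) t)" if t: "ST l k t" for t
  proof
    fix v assume v: "v \<in> W k t"
    have "pact (Suc k) (roots_poly (A t)) v = 0"
      using spectral[of "Suc k"] kn t v unfolding spectral_def by simp
    then have "v \<in> span {w \<in> W k t. \<exists>c\<in>A t. L (Suc k) w = c *s w}"
      using W_subspace[OF kn(2)] W_closed_L[OF kn(2,1)] W_M finite_addable[OF t] v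
      by (intro eigen_decomposition[OF kn(1)]) auto
    also have "\<dots> \<subseteq> span (\<Union>t\<in>{t. ST l (Suc k) t}. W (Suc k) t)"
    proof (rule span_mono, rule subsetI)
      fix w assume "w \<in> {w \<in> W k t. \<exists>c\<in>A t. L (Suc k) w = c *s w}"
      then obtain b where w: "w \<in> W k t" and b: "addable l t b" "L (Suc k) w = cont u b *s w" by auto
      let ?s = "t(b := Suc k)"
      have s: "ST l (Suc k) ?s" by (rule ST_extend[OF t b(1)])
      have "bx ?s (Suc k) = b" by (rule bx_eq[OF s]) auto
      then have c1: "tcontent u ?s (Suc k) = cont u b" by (simp add: content_eq)
      have "?s \<down> k = t"
        using b(1) ST_le[OF t] by (auto simp: restrict_tab_def fun_eq_iff addable_def)
      then have "tcontent u ?s j = tcontent u t j" if "j \<in> {1..k}" for j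
        using content_restrict[OF s, of k j u] that by simp
      then have "w \<in> W (Suc k) ?s" using w b c1 by (auto simp: W_def le_Suc_eq)
      then show "w \<in> (\<Union>t\<in>{t. ST l (Suc k) t}. W (Suc k) t)" using s by blast
    qed
    finally show "v \<in> span (\<Union>t\<in>{t. ST l (Suc k) t}. W (Suc k) t)" .
  qed
  then have "span (\<Union>t\<in>{t. ST l k t}. W k t) \<subseteq> span (\<Union>t\<in>{t. ST l (Suc k) t}. W (Suc k) t)"
    by (intro span_minimal) auto
  then show ?case using Suc.IH kn by blast
qed

lemma weight_induct[consumes 1, case_names zero weight add]:
  assumes "v \<in> M" and "P 0"
    and "\<And>t v. ST l n t \<Longrightarrow> v \<in> W n t \<Longrightarrow> P v"
    and "\<And>v w. v \<in> M \<Longrightarrow> w \<in> M \<Longrightarrow> P v \<Longrightarrow> P w \<Longrightarrow> P (v + w)"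
  shows "P v"
proof -
  have "v \<in> span (\<Union>t\<in>{t. ST l n t}. W n t)" using weight_span[of n] assms(1) by auto
  then have "v \<in> M \<and> P v"
  proof (induction rule: span_induct_alt)
    case base
    then show ?case using assms(2) M_zero by simp
  next
    case (step c x y)
    then obtain t where t: "ST l n t" "x \<in> W n t" by auto
    then have "c *s x \<in> W n t" using W_subspace[of n t] by (auto intro: subspace_scale)
    then show ?case using step t assms(3,4) W_M by (auto intro: M_add)
  qed
  then show ?thesis by simp
qed

text \<open>Puts the two cases into one formula. If the swap is not standard, the contents differ by
  1 or -1, and \<open>S_adjacent\<close> shows that \<open>S i\<close> acts by this difference,
  which is its own reciprocal.\<close>

lemma W_swap_full:
  assumes t: "ST l n t" and i: "i \<in> {1..<n}" and v: "v \<in> W n t"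
  defines "\<rho> \<equiv> tcontent u t (Suc i) - tcontent u t i"
  obtains v' where "S i v = (1 / \<rho>) *s v + v'" "v' \<in> W n (st i \<circ> t)" "ST l n (st i \<circ> t) \<or> v' = 0"
proof (cases "ST l n (st i \<circ> t)")
  case True
  have "S i v - (1 / \<rho>) *s v \<in> W n (st i \<circ> t)"
    unfolding \<rho>_def by (rule W_swap[OF t _ i True v]) simp
  then show ?thesis using that[of "S i v - (1 / \<rho>) *s v"] True by simp
next
  case False
  then have "\<rho>\<^sup>2 = 1" using swap_std_iff[OF t nN i] by (simp add: \<rho>_def)
  then have r: "\<rho> = 1 \<or> \<rho> = - 1" by (simp add: power2_eq_1_iff)
  then obtain \<epsilon> :: int where e: "\<epsilon> \<in> {1, - 1}" "\<rho> = of_int \<epsilon>" by fastforce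
  have ti: "ST l i (t \<down> i)" "v \<in> W i (t \<down> i)" "tcontent u (t \<down> i) i = tcontent u t i"
    using ST_restrict[OF t] W_restrict[OF t _ v] content_restrict[OF t, of i i u] i by auto
  have "L (Suc i) v = (tcontent u (t \<down> i) i + of_int \<epsilon>) *s v"
    unfolding ti e(2)[symmetric] using W_L[OF v, of "Suc i"] i by (auto simp: \<rho>_def)
  then have "S i v = of_int \<epsilon> *s v"
    using S_adjacent[OF spectral i ti(1,2) e(1)] i by auto
  then have "S i v = (1 / \<rho>) *s v" using e by auto
  then show ?thesis using that[of 0] W_subspace[of n "st i \<circ> t"] by (auto intro: subspace_0)
qed

end

section \<open>Multipartitions and the initial tableau\<close>

text \<open>The reading order of boxes, in which \<open>init_tab\<close> numbers them.\<close>

definition rlt :: "box \<Rightarrow> box \<Rightarrow> bool" where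
  "rlt = (\<lambda>(i, j, c) (i', j', c'). c < c' \<or> c = c' \<and> (i < i' \<or> i = i' \<and> j < j'))"

lemma rlt_total: "b = b' \<or> rlt b b' \<or> rlt b' b"
  by (cases b; cases b') (auto simp: rlt_def)

lemma rlt_asym: "rlt b b' \<Longrightarrow> \<not> rlt b' b"
  by (cases b; cases b') (auto simp: rlt_def)

lemma adj_rlt: "adj b b' \<Longrightarrow> rlt b b'"
  by (auto simp: adj_def rlt_def)

lemma mparts_outside: "lam \<in> mparts l n \<Longrightarrow> c \<notin> {1..l} \<Longrightarrow> lam c i = 0"
  by (simp add: mparts_def)

lemma mparts_0: "lam \<in> mparts l n \<Longrightarrow> lam c 0 = 0"
  by (simp add: mparts_def is_partition_def)

lemma mparts_Suc: "lam \<in> mparts l n \<Longrightarrow> 1 \<le> i \<Longrightarrow> lam c (Suc i) \<le> lam c i"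
  by (simp add: mparts_def is_partition_def)

lemma mparts_finite: "lam \<in> mparts l n \<Longrightarrow> finite {i. lam c i \<noteq> 0}"
  by (simp add: mparts_def is_partition_def)

lemma mparts_sum: "lam \<in> mparts l n \<Longrightarrow> (\<Sum>c=1..l. psize (lam c)) = n"
  by (simp add: mparts_def)

lemma diagram_iff: "(i, j, c) \<in> diagram l lam \<longleftrightarrow> valid_box l (i, j, c) \<and> j \<le> lam c i"
  by (auto simp: diagram_def valid_box_def)

text \<open>Links tableaux of a given shape with \<open>ST\<close>. The condition of
  \<open>ST\<close> on neighbours also encodes that the support is a diagram; here it comes from the
  rows being weakly decreasing.\<close>

lemma Std_iff:
  assumes lam: "lam \<in> mparts l n"
  shows "t \<in> Std l n lam \<longleftrightarrow> ST l n t \<and> {b. t b \<noteq> 0} = diagram l lam"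
proof
  assume t: "t \<in> Std l n lam"
  then have bij: "bij_betw t (diagram l lam) {1..n}" and z: "\<And>b. b \<notin> diagram l lam \<Longrightarrow> t b = 0"
    and r: "\<And>i j c. (i, j, c) \<in> diagram l lam \<Longrightarrow> (i, Suc j, c) \<in> diagram l lam \<Longrightarrow> t (i, j, c) < t (i, Suc j, c)"
    and d: "\<And>i j c. (i, j, c) \<in> diagram l lam \<Longrightarrow> (Suc i, j, c) \<in> diagram l lam \<Longrightarrow> t (i, j, c) < t (Suc i, j, c)"
    unfolding Std_def by blast+
  have nz: "t b \<noteq> 0" if "b \<in> diagram l lam" for b using bij_betwE[OF bij] that by force
  have supp: "{b. t b \<noteq> 0} = diagram l lam"
  proof (rule Set.set_eqI)
    show "b \<in> {b. t b \<noteq> 0} \<longleftrightarrow> b \<in> diagram l lam" for b using z[of b] nz[of b] by (cases "b \<in> diagram l lam") auto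
  qed
  have "0 < t b \<and> t b < t b'" if a: "adj b b'" "valid_box l b" "t b' \<noteq> 0" for b b'
  proof -
    obtain i j c where b: "b = (i, j, c)" "b' = (i, Suc j, c) \<or> b' = (Suc i, j, c)"
      using a by (auto simp: adj_def)
    have b': "b' \<in> diagram l lam" using supp a by auto
    have "b \<in> diagram l lam"
      using b b' a(2) mparts_Suc[OF lam, of i c] by (auto simp: diagram_iff valid_box_def)
    then show ?thesis using nz b b' r d by auto
  qed
  moreover have "valid_box l b" if "t b \<noteq> 0" for b
    using that z[of b] by (cases b) (auto simp: diagram_iff)
  ultimately show "ST l n t \<and> {b. t b \<noteq> 0} = diagram l lam"
    unfolding ST_def supp using bij supp by blast
next
  assume t: "ST l n t \<and> {b. t b \<noteq> 0} = diagram l lam"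
  then have T: "ST l n t" and supp: "\<And>b. b \<in> diagram l lam \<longleftrightarrow> t b \<noteq> 0" by blast+
  have "bij_betw t (diagram l lam) {1..n}" using ST_bij[OF T] t by simp
  moreover have "t (i, j, c) < t (i, Suc j, c)"
    if "(i, j, c) \<in> diagram l lam" "(i, Suc j, c) \<in> diagram l lam" for i j c
    using ST_adj_lt[OF T] that supp by (auto simp: adj_def)
  moreover have "t (i, j, c) < t (Suc i, j, c)"
    if "(i, j, c) \<in> diagram l lam" "(Suc i, j, c) \<in> diagram l lam" for i j c
    using ST_adj_lt[OF T] that supp by (auto simp: adj_def)
  ultimately show "t \<in> Std l n lam" unfolding Std_def using supp by blast
qed

lemma Std_ST: "lam \<in> mparts l n \<Longrightarrow> t \<in> Std l n lam \<Longrightarrow> ST l n t"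
  by (simp add: Std_iff)

lemma Std_supp: "lam \<in> mparts l n \<Longrightarrow> t \<in> Std l n lam \<Longrightarrow> t b \<noteq> 0 \<longleftrightarrow> b \<in> diagram l lam"
  unfolding Std_iff by blast

lemma Std_swap:
  assumes lam: "lam \<in> mparts l n" and t: "t \<in> Std l n lam" and "1 \<le> i" and s: "ST l n (st i \<circ> t)"
  shows "st i \<circ> t \<in> Std l n lam"
proof -
  have "{b. (st i \<circ> t) b \<noteq> 0} = {b. t b \<noteq> 0}" by (simp only: ST_swap_supp[OF assms(3)])
  then show ?thesis using t s unfolding Std_iff[OF lam] by simp
qed

lemma shape_Std: "lam \<in> mparts l n \<Longrightarrow> t \<in> Std l n lam \<Longrightarrow> shape t = lam"
proof (intro ext)
  fix c i assume lam: "lam \<in> mparts l n" and t: "t \<in> Std l n lam"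
  have "{j. t (i, j, c) \<noteq> 0} = {1..lam c i}"
    using Std_supp[OF lam t] mparts_outside[OF lam, of c i] mparts_0[OF lam, of c]
    by (cases "c \<in> {1..l} \<and> i \<noteq> 0") (auto simp: diagram_iff valid_box_def)
  then show "shape t c i = lam c i" by (simp add: shape_def)
qed

lemma Std_disjoint: "lam \<in> mparts l n \<Longrightarrow> lam' \<in> mparts l n \<Longrightarrow> t \<in> Std l n lam \<Longrightarrow> t \<in> Std l n lam' \<Longrightarrow> lam = lam'"
  using shape_Std by metis

lemma card_rows:
  assumes fin: "finite {b. t b \<noteq> 0}" and P: "finite P"
  shows "card {b. t b \<noteq> 0 \<and> (snd (snd b), fst b) \<in> P} = (\<Sum>(c, i)\<in>P. shape t c i)"
  using P
proof (induction P rule: finite_induct)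
  case empty
  then show ?case by simp
next
  case (insert x P)
  obtain c i where x: "x = (c, i)" by (cases x)
  let ?A = "{b. t b \<noteq> 0 \<and> (snd (snd b), fst b) \<in> P}" and ?B = "(\<lambda>j. (i, j, c)) ` {j. t (i, j, c) \<noteq> 0}"
  have e: "{b. t b \<noteq> 0 \<and> (snd (snd b), fst b) \<in> insert x P} = ?B \<union> ?A" by (force simp: x)
  have "finite ?A" "finite ?B" by (rule finite_subset[OF _ fin], auto)+
  moreover have "?B \<inter> ?A = {}" using insert x by auto
  moreover have "card ?B = shape t c i"
    unfolding shape_def by (rule card_image) (auto simp: inj_on_def)
  ultimately show ?case unfolding e using insert by (simp add: card_Un_disjoint x)
qed

lemma shape_zero: "ST l n t \<Longrightarrow> i \<notin> {1..n} \<or> c \<notin> {1..l} \<Longrightarrow> shape t c i = 0"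
proof -
  assume t: "ST l n t" and i: "i \<notin> {1..n} \<or> c \<notin> {1..l}"
  have "t (i, j, c) = 0" for j
    using ST_ge[OF t, of i j c] ST_valid[OF t, of "(i, j, c)"] i by (fastforce simp: valid_box_def)
  then show ?thesis by (simp add: shape_def)
qed

lemma shape_rows: "ST l n t \<Longrightarrow> {i. shape t c i \<noteq> 0} \<subseteq> {1..n}"
proof
  fix i assume t: "ST l n t" and "i \<in> {i. shape t c i \<noteq> 0}"
  then show "i \<in> {1..n}" using shape_zero[OF t, of i c] by (cases "i \<in> {1..n}") auto
qed

lemma psize_shape: "ST l n t \<Longrightarrow> psize (shape t c) = (\<Sum>i=1..n. shape t c i)"
  unfolding psize_def by (intro sum.mono_neutral_left shape_rows) auto

text \<open>Turns the sums in the dominance order into numbers of boxes, where the effect of adding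
  a single box can be seen.\<close>

lemma shape_partial_sum:
  assumes t: "ST l n t"
  shows "(\<Sum>c=1..<s. psize (shape t c)) + (\<Sum>j=1..i. shape t s j) =
    card {b. t b \<noteq> 0 \<and> (snd (snd b) < s \<or> snd (snd b) = s \<and> fst b \<le> i)}"
proof -
  let ?P = "{1..<s} \<times> {1..n} \<union> {s} \<times> {1..i}"
  have v: "1 \<le> fst b \<and> fst b \<le> n \<and> 1 \<le> snd (snd b)" if "t b \<noteq> 0" for b
    using ST_ge[OF t, of "fst b" "fst (snd b)" "snd (snd b)"] ST_valid[OF t that] that
    by (cases b) (auto simp: valid_box_def)
  have "{b. t b \<noteq> 0 \<and> (snd (snd b) < s \<or> snd (snd b) = s \<and> fst b \<le> i)} =
    {b. t b \<noteq> 0 \<and> (snd (snd b), fst b) \<in> ?P}" using v by fastforce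
  then have "card {b. t b \<noteq> 0 \<and> (snd (snd b) < s \<or> snd (snd b) = s \<and> fst b \<le> i)} = (\<Sum>(c, i)\<in>?P. shape t c i)"
    using card_rows[of t ?P] ST_card[OF t] by simp
  also have "\<dots> = (\<Sum>(c, i)\<in>{1..<s} \<times> {1..n}. shape t c i) + (\<Sum>(c, i)\<in>{s} \<times> {1..i}. shape t c i)"
    by (rule sum.union_disjoint) auto
  finally show ?thesis by (simp add: psize_shape[OF t] flip: sum.cartesian_product)
qed

lemma ST_shape:
  assumes t: "ST l n t"
  shows "shape t \<in> mparts l n" "t \<in> Std l n (shape t)"
proof -
  have seg: "{j. t (i, j, c) \<noteq> 0} = {1..shape t c i}" for i c
  proof -
    let ?J = "{j. t (i, j, c) \<noteq> 0}"
    have fin: "finite ?J" by (rule finite_subset[of _ "{0..n}"]) (use ST_ge[OF t] in auto)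
    have "\<exists>m. ?J = {1..m}"
    proof (cases "?J = {}")
      case False
      let ?m = "Max ?J"
      have m: "t (i, ?m, c) \<noteq> 0" using Max_in[OF fin False] by simp
      have "?J = {1..?m}"
      proof (intro equalityI subsetI)
        fix j assume j: "j \<in> ?J"
        then show "j \<in> {1..?m}" using Max_ge[OF fin j] ST_valid[OF t, of "(i, j, c)"] by (auto simp: valid_box_def)
      next
        fix j assume "j \<in> {1..?m}"
        then show "j \<in> ?J" using ST_down[OF t m, of i j] ST_valid[OF t m] by (auto simp: valid_box_def)
      qed
      then show ?thesis by blast
    qed (auto intro: exI[of _ 0])
    then obtain m where m: "?J = {1..m}" ..
    then have "shape t c i = m" by (simp add: shape_def)
    then show ?thesis using m by simp
  qed
  have "is_partition (shape t c)" for c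
    unfolding is_partition_def
  proof (intro conjI allI impI)
    show "shape t c 0 = 0" using shape_zero[OF t, of 0 c] by simp
    show "shape t c (Suc i) \<le> shape t c i" if "1 \<le> i" for i
    proof (cases "shape t c (Suc i) = 0")
      case False
      then have "shape t c (Suc i) \<in> {1..shape t c (Suc i)}" by simp
      then have "t (Suc i, shape t c (Suc i), c) \<noteq> 0" unfolding seg[symmetric] by simp
      then have "t (i, shape t c (Suc i), c) \<noteq> 0"
        using ST_down[OF t, of "Suc i" "shape t c (Suc i)" c i "shape t c (Suc i)"] that False by auto
      then have "shape t c (Suc i) \<in> {j. t (i, j, c) \<noteq> 0}" by simp
      then show ?thesis unfolding seg by simp
    qed simp
    show "finite {i. shape t c i \<noteq> 0}"
      by (rule finite_subset[OF shape_rows[OF t]]) simp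
  qed
  moreover have "shape t c = (\<lambda>_. 0)" if "c \<notin> {1..l}" for c
    using that shape_zero[OF t] by auto
  moreover have "(\<Sum>c=1..l. psize (shape t c)) = n"
  proof -
    have v: "snd (snd b) < Suc l" if "t b \<noteq> 0" for b
      using ST_valid[OF t that] by (cases b) (auto simp: valid_box_def)
    have "(\<Sum>c=1..l. psize (shape t c)) = card {b. t b \<noteq> 0 \<and> (snd (snd b) < Suc l \<or> snd (snd b) = Suc l \<and> fst b \<le> 0)}"
      using shape_partial_sum[OF t, of "Suc l" 0] by (simp add: atLeastLessThanSuc_atLeastAtMost)
    also have "{b. t b \<noteq> 0 \<and> (snd (snd b) < Suc l \<or> snd (snd b) = Suc l \<and> fst b \<le> 0)} = {b. t b \<noteq> 0}"
      using v by blast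
    finally show ?thesis using ST_card[OF t] by simp
  qed
  ultimately show m: "shape t \<in> mparts l n" by (simp add: mparts_def)
  have "b \<in> diagram l (shape t) \<longleftrightarrow> t b \<noteq> 0" for b
  proof -
    obtain i j c where b: "b = (i, j, c)" by (cases b)
    have "j \<in> {j. t (i, j, c) \<noteq> 0} \<longleftrightarrow> j \<in> {1..shape t c i}" by (simp only: seg)
    then have s: "t (i, j, c) \<noteq> 0 \<longleftrightarrow> 1 \<le> j \<and> j \<le> shape t c i" by simp
    then show ?thesis unfolding b diagram_iff s using ST_valid[OF t, of "(i, j, c)"] s
      by (simp add: valid_box_def) blast
  qed
  then show "t \<in> Std l n (shape t)" unfolding Std_iff[OF m] using t by blast
qed

section \<open>The initial tableau\<close>

lemma psize_ge: "lam \<in> mparts l n \<Longrightarrow> (\<Sum>i'=1..<Suc i. lam c i') \<le> psize (lam c)"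
proof -
  assume lam: "lam \<in> mparts l n"
  have "(\<Sum>i'=1..<Suc i. lam c i') = (\<Sum>i'\<in>{1..<Suc i} \<inter> {i. lam c i \<noteq> 0}. lam c i')"
    by (rule sum.mono_neutral_right) auto
  also have "\<dots> \<le> psize (lam c)"
    unfolding psize_def using mparts_finite[OF lam] by (intro sum_mono2) auto
  finally show ?thesis .
qed

lemma init_tab_bounds:
  assumes lam: "lam \<in> mparts l n" and b: "(i, j, c) \<in> diagram l lam"
  shows "(\<Sum>c'=1..<c. psize (lam c')) < init_tab l lam (i, j, c)"
    "init_tab l lam (i, j, c) \<le> (\<Sum>c'=1..<Suc c. psize (lam c'))"
proof -
  have v: "1 \<le> i" "1 \<le> j" "1 \<le> c" "c \<le> l" "j \<le> lam c i" using b by (auto simp: diagram_iff valid_box_def)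
  show "(\<Sum>c'=1..<c. psize (lam c')) < init_tab l lam (i, j, c)" using b v by (simp add: init_tab_def)
  have "(\<Sum>i'=1..<i. lam c i') + j \<le> (\<Sum>i'=1..<Suc i. lam c i')" using v by simp
  also have "\<dots> \<le> psize (lam c)" by (rule psize_ge[OF lam])
  finally show "init_tab l lam (i, j, c) \<le> (\<Sum>c'=1..<Suc c. psize (lam c'))"
    using b v by (simp add: init_tab_def)
qed

lemma init_tab_mono:
  assumes lam: "lam \<in> mparts l n" and b: "b \<in> diagram l lam" "b' \<in> diagram l lam" and r: "rlt b b'"
  shows "init_tab l lam b < init_tab l lam b'"
proof -
  obtain i j c where e: "b = (i, j, c)" by (cases b)
  obtain i' j' c' where e': "b' = (i', j', c')" by (cases b')
  have v: "1 \<le> i" "1 \<le> j" "1 \<le> c" "c \<le> l" "j \<le> lam c i" "1 \<le> i'" "1 \<le> j'"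
    using b by (auto simp: e e' diagram_iff valid_box_def)
  consider "c < c'" | "c = c'" "i < i'" | "c = c'" "i = i'" "j < j'" using r by (auto simp: e e' rlt_def)
  then show ?thesis
  proof cases
    case 1
    have "init_tab l lam b \<le> (\<Sum>c'=1..<Suc c. psize (lam c'))"
      using init_tab_bounds(2)[OF lam] b e by simp
    also have "\<dots> \<le> (\<Sum>c'=1..<c'. psize (lam c'))" using 1 by (intro sum_mono2) auto
    also have "\<dots> < init_tab l lam b'" using init_tab_bounds(1)[OF lam] b e' by simp
    finally show ?thesis .
  next
    case 2
    have "(\<Sum>i'=1..<i. lam c i') + j \<le> (\<Sum>i'=1..<Suc i. lam c i')" using v by simp
    also have "\<dots> \<le> (\<Sum>i'=1..<i'. lam c i')" using 2 by (intro sum_mono2) auto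
    finally show ?thesis using b v 2 by (simp add: e e' init_tab_def)
  next
    case 3
    then show ?thesis using b by (simp add: e e' init_tab_def)
  qed
qed

lemma sum_psize_le: "lam \<in> mparts l n \<Longrightarrow> c \<le> Suc l \<Longrightarrow> (\<Sum>c'=1..<c. psize (lam c')) \<le> n"
proof -
  assume lam: "lam \<in> mparts l n" and c: "c \<le> Suc l"
  have "{1..<c} \<subseteq> {1..l}" using c by auto
  then show ?thesis
    using sum_mono2[of "{1..l}" "{1..<c}" "\<lambda>c. psize (lam c)"] unfolding mparts_sum[OF lam] by blast
qed

lemma diagram_card:
  assumes lam: "lam \<in> mparts l n"
  shows "finite (diagram l lam) \<and> card (diagram l lam) = n"
proof -
  let ?S = "SIGMA c:{1..l}. SIGMA i:{i. lam c i \<noteq> 0}. {1..lam c i}"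
  have "bij_betw (\<lambda>(c, i, j). (i, j, c)) ?S (diagram l lam)"
  proof (rule bij_betw_byWitness[where f' = "\<lambda>(i, j, c). (c, i, j)"])
    have "1 \<le> i" if "1 \<le> j" "j \<le> lam c i" for c i j using that mparts_0[OF lam, of c] by (cases i) auto
    then show "(\<lambda>(c, i, j). (i, j, c)) ` ?S \<subseteq> diagram l lam"
      by (auto simp: diagram_iff valid_box_def)
  qed (auto simp: diagram_iff valid_box_def)
  moreover have "finite ?S" by (intro finite_SigmaI) (use mparts_finite[OF lam] in auto)
  moreover have "card ?S = n"
    using mparts_finite[OF lam] mparts_sum[OF lam] by (simp add: psize_def)
  ultimately show ?thesis using bij_betw_finite[of _ ?S "diagram l lam"] bij_betw_same_card[of _ ?S "diagram l lam"] by auto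
qed

lemma init_tab_Std:
  assumes lam: "lam \<in> mparts l n"
  shows "init_tab l lam \<in> Std l n lam"
proof -
  let ?t = "init_tab l lam"
  have inj: "inj_on ?t (diagram l lam)"
    using init_tab_mono[OF lam] rlt_total by (metis inj_onI less_irrefl)
  have "?t b \<in> {1..n}" if "b \<in> diagram l lam" for b
  proof -
    obtain i j c where e: "b = (i, j, c)" by (cases b)
    have "c \<le> l" using that by (auto simp: e diagram_iff valid_box_def)
    then show ?thesis
      using init_tab_bounds[OF lam, of i j c] that sum_psize_le[OF lam, of "Suc c"] by (auto simp: e)
  qed
  then have "?t ` diagram l lam \<subseteq> {1..n}" by blast
  moreover have "card (?t ` diagram l lam) = n" using card_image[OF inj] diagram_card[OF lam] by simp
  ultimately have "?t ` diagram l lam = {1..n}" by (intro card_subset_eq) auto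
  then have "bij_betw ?t (diagram l lam) {1..n}" using inj by (simp add: bij_betw_def)
  then show ?thesis
    unfolding Std_def using init_tab_mono[OF lam] by (auto simp: rlt_def) (auto simp: init_tab_def)
qed

lemma init_tab_rlt_iff:
  assumes lam: "lam \<in> mparts l n" and b: "b \<in> diagram l lam" "b' \<in> diagram l lam"
  shows "init_tab l lam b < init_tab l lam b' \<longleftrightarrow> rlt b b'"
  using init_tab_mono[OF lam b] init_tab_mono[OF lam b(2,1)] rlt_total[of b b'] by auto

lemma init_tab_comp:
  assumes lam: "lam \<in> mparts l n" and b: "b \<in> diagram l lam"
  shows "init_tab l lam b \<le> (\<Sum>c'=1..<c. psize (lam c')) \<longleftrightarrow> snd (snd b) < c"
proof -
  obtain i j c0 where e: "b = (i, j, c0)" by (cases b)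
  note bd = init_tab_bounds[OF lam b[unfolded e]]
  have "(\<Sum>c'=1..<Suc c0. psize (lam c')) \<le> (\<Sum>c'=1..<c. psize (lam c'))" if "c0 < c"
    using that by (intro sum_mono2) auto
  moreover have "(\<Sum>c'=1..<c. psize (lam c')) \<le> (\<Sum>c'=1..<c0. psize (lam c'))" if "\<not> c0 < c"
    using that by (intro sum_mono2) auto
  ultimately show ?thesis using bd by (fastforce simp: e)
qed

lemma finite_Std: "lam \<in> mparts l n \<Longrightarrow> finite (Std l n lam)"
  by (rule finite_subset[OF _ finite_ST[of l n]]) (auto simp: Std_iff)

lemma finite_mparts: "finite (mparts l n)"
proof (rule finite_subset)
  show "mparts l n \<subseteq> shape ` {t. ST l n t}"
    using init_tab_Std shape_Std Std_ST by (metis (mono_tags, lifting) image_eqI mem_Collect_eq subsetI)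
qed (simp add: finite_ST)

section \<open>The permutations \<open>d(t)\<close> and their length\<close>

lemma d_perm_props:
  assumes lam: "lam \<in> mparts l n" and t: "t \<in> Std l n lam"
  shows "d_perm l n lam t permutes {1..n}" "d_perm l n lam t \<circ> init_tab l lam = t"
    and d_perm_unique: "\<And>w. w permutes {1..n} \<Longrightarrow> w \<circ> init_tab l lam = t \<Longrightarrow> d_perm l n lam t = w"
proof -
  let ?i = "init_tab l lam"
  note I = init_tab_Std[OF lam]
  note IS = Std_ST[OF lam I] and TS = Std_ST[OF lam t]
  have un: "w = w'" if "w permutes {1..n}" "w \<circ> ?i = t" "w' permutes {1..n}" "w' \<circ> ?i = t" for w w'
  proof
    fix k
    show "w k = w' k"
    proof (cases "k \<in> {1..n}")
      case True
      then show ?thesis using that t_bx[OF IS True] by (metis comp_apply)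
    next
      case False
      then show ?thesis using that by (simp add: permutes_def)
    qed
  qed
  define w where "w k = (if k \<in> {1..n} then t (bx ?i k) else k)" for k
  have "bij_betw (bx ?i) {1..n} (diagram l lam)"
  proof (rule bij_betw_byWitness[where f' = ?i])
    show "\<forall>a\<in>{1..n}. ?i (bx ?i a) = a" using t_bx[OF IS] by blast
    show "\<forall>a'\<in>diagram l lam. bx ?i (?i a') = a'"
      using Std_supp[OF lam I] by (auto intro!: bx_eq[OF IS] simp: Suc_le_eq)
    show "bx ?i ` {1..n} \<subseteq> diagram l lam"
    proof
      fix b assume "b \<in> bx ?i ` {1..n}"
      then obtain k where "k \<in> {1..n}" "b = bx ?i k" by blast
      then have "?i b \<noteq> 0" using t_bx[OF IS, of k] by auto
      then show "b \<in> diagram l lam" using Std_supp[OF lam I] by blast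
    qed
    show "?i ` diagram l lam \<subseteq> {1..n}"
      using Std_supp[OF lam I] ST_le[OF IS] by (auto simp: Suc_le_eq)
  qed
  moreover have "bij_betw t (diagram l lam) {1..n}" using t by (simp add: Std_def)
  ultimately have "bij_betw (t \<circ> bx ?i) {1..n} {1..n}" by (rule bij_betw_trans)
  moreover have "w a = (t \<circ> bx ?i) a" if "a \<in> {1..n}" for a using that by (simp add: w_def)
  ultimately have "bij_betw w {1..n} {1..n}" using bij_betw_cong[of "{1..n}" w "t \<circ> bx ?i"] by blast
  then have wp: "w permutes {1..n}" by (rule bij_imp_permutes) (auto simp: w_def)
  have "(w \<circ> ?i) b = t b" for b
  proof (cases "b \<in> diagram l lam")
    case True
    then have "?i b \<noteq> 0" using Std_supp[OF lam I] by blast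
    then have "?i b \<in> {1..n}" "bx ?i (?i b) = b"
      using ST_le[OF IS, of b] bx_eq[OF IS, of b "?i b"] by auto
    then show ?thesis by (simp add: w_def)
  next
    case False
    then have "?i b = 0" "t b = 0" using Std_supp[OF lam I] Std_supp[OF lam t] by blast+
    then show ?thesis by (simp add: w_def)
  qed
  then have wi: "w \<circ> ?i = t" by blast
  have "d_perm l n lam t = w"
    unfolding d_perm_def by (rule the_equality) (use wp wi un in blast)+
  then show "d_perm l n lam t permutes {1..n}" "d_perm l n lam t \<circ> ?i = t"
    "\<And>w. w permutes {1..n} \<Longrightarrow> w \<circ> ?i = t \<Longrightarrow> d_perm l n lam t = w"
    using wp wi un by blast+
qed

lemma d_perm_init: "lam \<in> mparts l n \<Longrightarrow> d_perm l n lam (init_tab l lam) = id"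
  by (rule d_perm_unique) (auto simp: init_tab_Std permutes_id)

lemma d_perm_swap:
  assumes lam: "lam \<in> mparts l n" and t: "t \<in> Std l n lam" and i: "i \<in> {1..<n}" and s: "st i \<circ> t \<in> Std l n lam"
  shows "d_perm l n lam (st i \<circ> t) = st i \<circ> d_perm l n lam t"
proof (rule d_perm_unique[OF lam s])
  show "st i \<circ> d_perm l n lam t permutes {1..n}"
    by (rule permutes_compose[OF d_perm_props(1)[OF lam t] st_permutes[OF i]])
  show "st i \<circ> d_perm l n lam t \<circ> init_tab l lam = st i \<circ> t"
    using d_perm_props(2)[OF lam t] by (simp add: comp_assoc)
qed

abbreviation pinv :: "(nat \<Rightarrow> nat) \<Rightarrow> nat \<Rightarrow> nat" where
  "pinv \<equiv> inv_into UNIV"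

lemma inv_d_perm_swap:
  assumes lam: "lam \<in> mparts l n" and t: "t \<in> Std l n lam" and i: "i \<in> {1..<n}" and s: "st i \<circ> t \<in> Std l n lam"
  shows "pinv (d_perm l n lam (st i \<circ> t)) = pinv (d_perm l n lam t) \<circ> st i"
proof -
  have "bij (d_perm l n lam t)" by (rule permutes_bij[OF d_perm_props(1)[OF lam t]])
  moreover have "bij (st i)" by (rule permutes_bij[OF st_permutes[OF i]])
  moreover have "pinv (st i) = st i" by (rule inv_equality) auto
  ultimately show ?thesis unfolding d_perm_swap[OF assms] by (simp add: o_inv_distrib)
qed

lemma inv_d_perm_apply:
  assumes lam: "lam \<in> mparts l n" and t: "t \<in> Std l n lam" and k: "k \<in> {1..n}"
  shows "pinv (d_perm l n lam t) k = init_tab l lam (bx t k)"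
proof -
  have "d_perm l n lam t (init_tab l lam (bx t k)) = k"
    using d_perm_props(2)[OF lam t] t_bx[OF Std_ST[OF lam t] k] by (metis comp_apply)
  then show ?thesis using permutes_inverses(2)[OF d_perm_props(1)[OF lam t]] by metis
qed

text \<open>The inverse of \<open>d(t)\<close> sends an entry to the place of its box in the reading
  order. Its inversions are the pairs of entries that stand against the reading order, and its
  descents are those of the tableau.\<close>

definition tlen :: "nat \<Rightarrow> nat \<Rightarrow> mpart \<Rightarrow> tableau \<Rightarrow> nat" where
  "tlen l n lam t = ninv n (pinv (d_perm l n lam t))"

definition descent :: "tableau \<Rightarrow> nat \<Rightarrow> bool" where
  "descent t i \<longleftrightarrow> rlt (bx t (Suc i)) (bx t i)"

lemma descent_iff:
  assumes lam: "lam \<in> mparts l n" and t: "t \<in> Std l n lam" and i: "i \<in> {1..<n}"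
  shows "descent t i \<longleftrightarrow> pinv (d_perm l n lam t) (Suc i) < pinv (d_perm l n lam t) i"
proof -
  note T = Std_ST[OF lam t]
  have "t (bx t i) \<noteq> 0" "t (bx t (Suc i)) \<noteq> 0" using t_bx[OF T] i by auto
  then have "bx t i \<in> diagram l lam" "bx t (Suc i) \<in> diagram l lam" using Std_supp[OF lam t] by blast+
  then show ?thesis
    using inv_d_perm_apply[OF lam t, of i] inv_d_perm_apply[OF lam t, of "Suc i"] i init_tab_rlt_iff[OF lam]
    by (simp add: descent_def)
qed

lemma descent_ST:
  assumes "ST l n t" "i \<in> {1..<n}" "descent t i"
  shows "ST l n (st i \<circ> t)"
  using assms adj_rlt[of "bx t i" "bx t (Suc i)"] rlt_asym[of "bx t i" "bx t (Suc i)"]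
  by (intro ST_swap) (auto simp: descent_def)

lemma tlen_descent:
  assumes lam: "lam \<in> mparts l n" and t: "t \<in> Std l n lam" and i: "i \<in> {1..<n}" and d: "descent t i"
  shows "tlen l n lam t = Suc (tlen l n lam (st i \<circ> t))"
proof -
  have s: "st i \<circ> t \<in> Std l n lam"
    using Std_swap[OF lam t _ descent_ST[OF Std_ST[OF lam t] i d]] i by simp
  show ?thesis
    unfolding tlen_def inv_d_perm_swap[OF lam t i s]
    using ninv_swap[OF i] d descent_iff[OF lam t i] by blast
qed

lemma tlen_swap_le:
  assumes lam: "lam \<in> mparts l n" and t: "t \<in> Std l n lam" and i: "i \<in> {1..<n}" and s: "st i \<circ> t \<in> Std l n lam"
  shows "tlen l n lam t \<le> Suc (tlen l n lam (st i \<circ> t))"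
proof -
  let ?w = "pinv (d_perm l n lam t)"
  have "?w permutes {1..n}" by (rule permutes_inv[OF d_perm_props(1)[OF lam t]])
  then have "?w i \<noteq> ?w (Suc i)" using permutes_inj by (metis injD n_not_Suc_n)
  then show ?thesis
    unfolding tlen_def inv_d_perm_swap[OF assms]
    using ninv_swap[OF i, of ?w] ninv_swap'[OF i, of ?w] by linarith
qed

text \<open>Undoing a descent keeps the tableau standard and shortens \<open>d(t)\<close>, and only
  the initial tableau has no descent. All later recursions run along such steps.\<close>

lemma std_induct[consumes 2, case_names init step]:
  assumes lam: "lam \<in> mparts l n" and t: "t \<in> Std l n lam"
    and init: "P (init_tab l lam)"
    and step: "\<And>t i. t \<in> Std l n lam \<Longrightarrow> i \<in> {1..<n} \<Longrightarrow> descent t i \<Longrightarrow> st i \<circ> t \<in> Std l n lam \<Longrightarrow>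
        P (st i \<circ> t) \<Longrightarrow> P t"
  shows "P t"
  using t
proof (induction "tlen l n lam t" arbitrary: t rule: less_induct)
  case less
  let ?d = "d_perm l n lam t"
  note t = less.prems
  show ?case
  proof (cases "pinv ?d = id")
    case True
    have "?d = pinv (pinv ?d)" using permutes_inv_inv[OF d_perm_props(1)[OF lam t]] by simp
    then have "?d = id" using True by simp
    then have "t = init_tab l lam" using d_perm_props(2)[OF lam t] by simp
    then show ?thesis using init by simp
  next
    case False
    then obtain i where i: "i \<in> {1..<n}" "pinv ?d (Suc i) < pinv ?d i"
      using exists_descent[OF permutes_inv[OF d_perm_props(1)[OF lam t]]] by blast
    then have d: "descent t i" using descent_iff[OF lam t i(1)] by simp
    have s: "st i \<circ> t \<in> Std l n lam"
      using Std_swap[OF lam t _ descent_ST[OF Std_ST[OF lam t] i(1) d]] i by simp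
    show ?thesis
      by (rule step[OF t i(1) d s less.hyps[OF _ s]]) (use tlen_descent[OF lam t i(1) d] in simp)
  qed
qed

lemma supp_card_insert:
  fixes t :: tableau
  assumes "finite {b. t b \<noteq> 0}" "t b0 = 0" "0 < m"
  shows "card {b. (t(b0 := m)) b \<noteq> 0 \<and> P b} = card {b. t b \<noteq> 0 \<and> P b} + (if P b0 then 1 else 0)"
proof -
  have "{b. (t(b0 := m)) b \<noteq> 0 \<and> P b} = (if P b0 then insert b0 {b. t b \<noteq> 0 \<and> P b} else {b. t b \<noteq> 0 \<and> P b})"
    using assms by auto
  moreover have "finite {b. t b \<noteq> 0 \<and> P b}" by (rule finite_subset[OF _ assms(1)]) auto
  ultimately show ?thesis using assms by simp
qed

text \<open>The shapes of the two restrictions differ only at \<open>k = i\<close>, where they arise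
  from a common tableau by adding one of two boxes. These boxes lie in different rows, so dominance
  compares the positions of their rows, as the reading order does.\<close>

lemma swap_dominates:
  assumes t: "ST l n t" and i: "i \<in> {1..<n}" and s: "ST l n (st i \<circ> t)"
  shows "tab_dominates l (st i \<circ> t) t \<longleftrightarrow> descent t i"
proof -
  let ?s = "st i \<circ> t" and ?r = "t \<down> (i - 1)"
  let ?B = "bx t i" and ?B' = "bx t (Suc i)"
  have na: "\<not> adj ?B ?B'" by (rule ST_swap_nonadj[OF t i s])
  have r: "ST l (i - 1) ?r" by (rule ST_restrict[OF t]) (use i in auto)
  have ad: "addable l ?r ?B"
    using ST_last_addable[OF t, of "i - 1"] i by auto
  have ti: "t \<down> i = ?r(?B := i)" using ST_last_eq[OF t, of "i - 1"] i by auto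
  have bs: "bx ?s i = ?B'" using bx_swap[OF t i s, of i] i by (simp add: st_apply)
  have sr: "?s \<down> (i - 1) = ?r" using swap_restrict[of "i - 1" i t] i by auto
  have si: "?s \<down> i = ?r(?B' := i)" using ST_last_eq[OF s, of "i - 1"] i bs sr by auto
  have ad': "addable l ?r ?B'" using ST_last_addable[OF s, of "i - 1"] i bs sr by auto
  have ne: "?B \<noteq> ?B'" using t_bx[OF t, of i] t_bx[OF t, of "Suc i"] i by auto
  have row: "\<not> (fst ?B = fst ?B' \<and> snd (snd ?B) = snd (snd ?B'))"
  proof
    assume e: "fst ?B = fst ?B' \<and> snd (snd ?B) = snd (snd ?B')"
    have no: False if a: "addable l ?r (a, j, c)" and b: "addable l ?r (a, j', c)" and "j < j'" for a j j' c
    proof -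
      have v: "1 \<le> a" "1 \<le> j" "1 \<le> c" "c \<le> l" using a by (auto simp: addable_def valid_box_def)
      have "adj (a, j' - 1, c) (a, j', c)" using that by (auto simp: adj_def)
      then have "?r (a, j' - 1, c) \<noteq> 0" using b v that by (auto simp: addable_def valid_box_def)
      moreover have "j \<le> j' - 1" using that by simp
      ultimately have "?r (a, j, c) \<noteq> 0" using ST_down[OF r, of a "j' - 1" c a j] v by simp
      then show False using a by (simp add: addable_def)
    qed
    obtain a j c where B: "?B = (a, j, c)" by (cases ?B)
    obtain j' where B': "?B' = (a, j', c)" using e B by (cases ?B') auto
    show False using no[of a j c j'] no[of a j' c j] ad ad' ne B B' by (metis linorder_neqE_nat)
  qed
  have "dominates l (shape (?s \<down> k)) (shape (t \<down> k))" if "k \<noteq> i" for k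
  proof -
    have "shape (?s \<down> k) = shape (t \<down> k)"
    proof (cases "k < i")
      case True
      then show ?thesis using swap_restrict[of k i t] i by simp
    next
      case False
      then have "?s \<down> k = st i \<circ> (t \<down> k)" using swap_restrict[of k i t] i that by simp
      then show ?thesis using ST_swap_supp[of i "t \<down> k"] i by (auto simp: shape_def)
    qed
    then show ?thesis by (simp add: dominates_def)
  qed
  then have "tab_dominates l ?s t \<longleftrightarrow> dominates l (shape (?s \<down> i)) (shape (t \<down> i))"
    unfolding tab_dominates_def by metis
  also have "\<dots> \<longleftrightarrow> (\<forall>c\<in>{1..l}. \<forall>a\<ge>1. (snd (snd ?B) < c \<or> snd (snd ?B) = c \<and> fst ?B \<le> a) \<longrightarrow>
      (snd (snd ?B') < c \<or> snd (snd ?B') = c \<and> fst ?B' \<le> a))"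
  proof -
    have S: "ST l i (t \<down> i)" "ST l i (?s \<down> i)" using ST_restrict[OF t] ST_restrict[OF s] i by auto
    have z: "?r ?B = 0" "?r ?B' = 0" using ad ad' by (auto simp: addable_def)
    have fin: "finite {b. ?r b \<noteq> 0}" using ST_card[OF r] by simp
    have i0: "0 < i" using i by simp
    show ?thesis
      unfolding dominates_def shape_partial_sum[OF S(1)] shape_partial_sum[OF S(2)]
      unfolding ti si supp_card_insert[OF fin z(1) i0] supp_card_insert[OF fin z(2) i0]
      by (intro ball_cong refl all_cong) auto
  qed
  also have "\<dots> \<longleftrightarrow> descent t i"
  proof -
    obtain a j c where B: "?B = (a, j, c)" by (cases ?B)
    obtain a' j' c' where B': "?B' = (a', j', c')" by (cases ?B')
    have v: "1 \<le> a" "1 \<le> c" "c \<le> l" using ad by (auto simp: B addable_def valid_box_def)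
    show ?thesis
    proof
      assume "\<forall>c\<in>{1..l}. \<forall>a\<ge>1. (snd (snd ?B) < c \<or> snd (snd ?B) = c \<and> fst ?B \<le> a) \<longrightarrow>
        (snd (snd ?B') < c \<or> snd (snd ?B') = c \<and> fst ?B' \<le> a)"
      then have "c' < c \<or> c' = c \<and> a' \<le> a" using v by (auto simp: B B')
      then show "descent t i" using row by (auto simp: descent_def B B' rlt_def)
    next
      assume "descent t i"
      then show "\<forall>c\<in>{1..l}. \<forall>a\<ge>1. (snd (snd ?B) < c \<or> snd (snd ?B) = c \<and> fst ?B \<le> a) \<longrightarrow>
        (snd (snd ?B') < c \<or> snd (snd ?B') = c \<and> fst ?B' \<le> a)"
        using row by (auto simp: descent_def B B' rlt_def)
    qed
  qed
  finally show ?thesis .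
qed

section \<open>Row stabilisers\<close>

definition rowk :: "nat \<Rightarrow> mpart \<Rightarrow> nat \<Rightarrow> nat \<times> nat" where
  "rowk l lam k = (snd (snd (bx (init_tab l lam) k)), fst (bx (init_tab l lam) k))"

lemma init_tab_bx:
  assumes "lam \<in> mparts l n"
  shows "k \<in> {1..n} \<Longrightarrow> init_tab l lam (bx (init_tab l lam) k) = k"
    "k \<in> {1..n} \<Longrightarrow> bx (init_tab l lam) k \<in> diagram l lam"
    "b \<in> diagram l lam \<Longrightarrow> init_tab l lam b \<in> {1..n}"
    "b \<in> diagram l lam \<Longrightarrow> bx (init_tab l lam) (init_tab l lam b) = b"
proof -
  note I = init_tab_Std[OF assms]
  note IS = Std_ST[OF assms I]
  show 1: "init_tab l lam (bx (init_tab l lam) k) = k" if "k \<in> {1..n}" for k using t_bx[OF IS that] .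
  show "bx (init_tab l lam) k \<in> diagram l lam" if "k \<in> {1..n}"
    using 1[OF that] Std_supp[OF assms I, of "bx (init_tab l lam) k"] that by auto
  assume "b \<in> diagram l lam"
  then have "init_tab l lam b \<noteq> 0" using Std_supp[OF assms I] by blast
  then show "init_tab l lam b \<in> {1..n}" "bx (init_tab l lam) (init_tab l lam b) = b"
    using ST_le[OF IS, of b] bx_eq[OF IS, of b] by auto
qed

lemma young_iff:
  assumes lam: "lam \<in> mparts l n"
  shows "w \<in> young l n lam \<longleftrightarrow> w permutes {1..n} \<and> (\<forall>k\<in>{1..n}. rowk l lam (w k) = rowk l lam k)"
proof
  assume w: "w \<in> young l n lam"
  then have p: "w permutes {1..n}" by (simp add: young_def)
  have "rowk l lam (w k) = rowk l lam k" if k: "k \<in> {1..n}" for k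
  proof -
    obtain i j c where b: "bx (init_tab l lam) k = (i, j, c)" by (cases "bx (init_tab l lam) k")
    have d: "(i, j, c) \<in> diagram l lam" using init_tab_bx(2)[OF lam k] b by simp
    then obtain j' where j': "(i, j', c) \<in> diagram l lam" "w (init_tab l lam (i, j, c)) = init_tab l lam (i, j', c)"
      using w unfolding young_def by blast
    then have "w k = init_tab l lam (i, j', c)" using init_tab_bx(1)[OF lam k] b by simp
    then show ?thesis using init_tab_bx(4)[OF lam j'(1)] b by (simp add: rowk_def)
  qed
  with p show "w permutes {1..n} \<and> (\<forall>k\<in>{1..n}. rowk l lam (w k) = rowk l lam k)" by blast
next
  assume a: "w permutes {1..n} \<and> (\<forall>k\<in>{1..n}. rowk l lam (w k) = rowk l lam k)"
  have "\<exists>j'. (i, j', c) \<in> diagram l lam \<and> w (init_tab l lam (i, j, c)) = init_tab l lam (i, j', c)"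
    if d: "(i, j, c) \<in> diagram l lam" for i j c
  proof -
    let ?k = "init_tab l lam (i, j, c)"
    have k: "?k \<in> {1..n}" by (rule init_tab_bx(3)[OF lam d])
    have wk: "w ?k \<in> {1..n}" using a k permutes_in_image[of w "{1..n}"] by blast
    have "rowk l lam (w ?k) = (c, i)" using a k init_tab_bx(4)[OF lam d] by (simp add: rowk_def)
    then obtain j' where "bx (init_tab l lam) (w ?k) = (i, j', c)"
      by (cases "bx (init_tab l lam) (w ?k)") (auto simp: rowk_def)
    then show ?thesis using init_tab_bx(1,2)[OF lam wk] by auto
  qed
  with a show "w \<in> young l n lam" by (auto simp: young_def)
qed

lemma young_permutes: "w \<in> young l n lam \<Longrightarrow> w permutes {1..n}"
  by (simp add: young_def)

lemma finite_young: "finite (young l n lam)"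
  by (rule finite_subset[OF _ finite_permutations[of "{1..n}"]]) (auto simp: young_def)

lemma young_swap:
  assumes lam: "lam \<in> mparts l n" and w: "w \<in> young l n lam" and q: "q \<in> {1..<n}"
    and r: "rowk l lam q = rowk l lam (Suc q)"
  shows "w \<circ> st q \<in> young l n lam" "st q \<circ> w \<in> young l n lam"
proof -
  have sq: "rowk l lam (st q k) = rowk l lam k" for k using r by (simp add: st_apply)
  have in': "st q k \<in> {1..n}" if "k \<in> {1..n}" for k using q that by (auto simp: st_apply)
  show "w \<circ> st q \<in> young l n lam" "st q \<circ> w \<in> young l n lam"
    using w sq in' permutes_compose[OF st_permutes[OF q]] permutes_compose[OF _ st_permutes[OF q]]
    unfolding young_iff[OF lam] comp_apply by metis+
qed

text \<open>The rows of the initial tableau are consecutive intervals in increasing order, so a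
  permutation that preserves them can invert \<open>i\<close> and \<open>i + 1\<close> only inside a
  row.\<close>

lemma young_descent:
  assumes lam: "lam \<in> mparts l n" and w: "w \<in> young l n lam" and i: "i \<in> {1..<n}" and d: "w (Suc i) < w i"
  shows "rowk l lam i = rowk l lam (Suc i)"
proof -
  let ?b = "bx (init_tab l lam)"
  have i': "i \<in> {1..n}" "Suc i \<in> {1..n}" using i by auto
  then have wi: "w i \<in> {1..n}" "w (Suc i) \<in> {1..n}"
    using permutes_in_image[OF young_permutes[OF w]] by blast+
  have rk: "rowk l lam (w i) = rowk l lam i" "rowk l lam (w (Suc i)) = rowk l lam (Suc i)"
    using w i' unfolding young_iff[OF lam] by blast+
  have lt: "rlt (?b a) (?b b)" if "a \<in> {1..n}" "b \<in> {1..n}" "a < b" for a b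
    using init_tab_rlt_iff[OF lam init_tab_bx(2)[OF lam that(1)] init_tab_bx(2)[OF lam that(2)]]
      init_tab_bx(1)[OF lam] that by simp
  have "rlt (?b i) (?b (Suc i))" "rlt (?b (w (Suc i))) (?b (w i))" using lt i' wi d by auto
  then show ?thesis using rk
    by (cases "?b i"; cases "?b (Suc i)"; cases "?b (w i)"; cases "?b (w (Suc i))") (auto simp: rlt_def rowk_def)
qed

lemma init_tab_row_adj:
  assumes lam: "lam \<in> mparts l n" and i: "i \<in> {1..<n}" and r: "rowk l lam i = rowk l lam (Suc i)"
  obtains a j c where "bx (init_tab l lam) i = (a, j, c)" "bx (init_tab l lam) (Suc i) = (a, Suc j, c)"
proof -
  obtain a j c where b: "bx (init_tab l lam) i = (a, j, c)" by (cases "bx (init_tab l lam) i")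
  obtain j' where b': "bx (init_tab l lam) (Suc i) = (a, j', c)"
    using r b by (cases "bx (init_tab l lam) (Suc i)") (auto simp: rowk_def)
  have i': "i \<in> {1..n}" "Suc i \<in> {1..n}" using i by auto
  have "init_tab l lam (a, j, c) = i" "(a, j, c) \<in> diagram l lam"
    "init_tab l lam (a, j', c) = Suc i" "(a, j', c) \<in> diagram l lam"
    using init_tab_bx(1,2)[OF lam i'(1)] init_tab_bx(1,2)[OF lam i'(2)] b b' by auto
  then have "j' = Suc j" by (simp add: init_tab_def)
  then show ?thesis using that b b' by blast
qed

text \<open>Induction over the classes: a permutation preserving them is an arbitrary permutation of
  the class \<open>r\<close> together with one that preserves the other classes.\<close>

lemma card_class_perms:
  fixes f :: "nat \<Rightarrow> 'r"
  assumes "finite R" "finite A" "f ` A \<subseteq> R"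
  shows "card {w. w permutes A \<and> (\<forall>k\<in>A. f (w k) = f k)} = (\<Prod>r\<in>R. fact (card {k\<in>A. f k = r}))"
  using assms
proof (induction R arbitrary: A rule: finite_induct)
  case empty
  then have "{w. w permutes A \<and> (\<forall>k\<in>A. f (w k) = f k)} = {id}" by auto
  then show ?case by simp
next
  case (insert r R)
  let ?C = "{k\<in>A. f k = r}" and ?B = "{k\<in>A. f k \<noteq> r}"
  let ?P = "\<lambda>A. {w. w permutes A \<and> (\<forall>k\<in>A. f (w k) = f k)}"
  have AB: "A = ?B \<union> ?C" "?B \<inter> ?C = {}" by auto
  have IH: "card (?P ?B) = (\<Prod>s\<in>R. fact (card {k\<in>?B. f k = s}))"
    using insert.prems by (intro insert.IH) auto
  have eqs: "{k\<in>?B. f k = s} = {k\<in>A. f k = s}" if "s \<in> R" for s using that insert.hyps by auto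
  have bij: "bij_betw (\<lambda>(p, q). p \<circ> q) (?P ?B \<times> {q. q permutes ?C}) (?P A)"
  proof (rule bij_betw_byWitness[where f' = "\<lambda>w. (\<lambda>x. if x \<in> ?B then w x else x, \<lambda>x. if x \<in> ?C then w x else x)"])
    show "(\<lambda>(p, q). p \<circ> q) ` (?P ?B \<times> {q. q permutes ?C}) \<subseteq> ?P A"
    proof (rule image_subsetI)
      fix pq assume "pq \<in> ?P ?B \<times> {q. q permutes ?C}"
      then obtain p q where e: "pq = (p, q)" and p: "p permutes ?B" "\<forall>k\<in>?B. f (p k) = f k" and q: "q permutes ?C"
        by auto
      have 1: "p \<circ> q permutes A"
        by (rule permutes_compose) (use permutes_subset[OF p(1), of A] permutes_subset[OF q, of A] in auto)
      have 2: "f ((p \<circ> q) k) = f k" if k: "k \<in> A" for k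
      proof (cases "k \<in> ?C")
        case True
        then have qk: "q k \<in> ?C" using permutes_in_image[OF q] by blast
        then have "p (q k) = q k" using permutes_not_in[OF p(1), of "q k"] by auto
        then show ?thesis using qk True by auto
      next
        case False
        then have "q k = k" using permutes_not_in[OF q] by blast
        then show ?thesis using p(2) False k by auto
      qed
      show "(\<lambda>(p, q). p \<circ> q) pq \<in> ?P A" using 1 2 by (simp add: e)
    qed
    show "(\<lambda>w. (\<lambda>x. if x \<in> ?B then w x else x, \<lambda>x. if x \<in> ?C then w x else x)) ` ?P A \<subseteq> ?P ?B \<times> {q. q permutes ?C}"
    proof (rule image_subsetI)
      fix w assume w: "w \<in> ?P A"
      then have wp: "w permutes A" and wf: "\<And>k. k \<in> A \<Longrightarrow> f (w k) = f k" by auto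
      have wA: "w k \<in> A \<longleftrightarrow> k \<in> A" for k by (rule permutes_in_image[OF wp])
      have inj: "inj w" by (rule permutes_inj[OF wp])
      have perm: "(\<lambda>x. if x \<in> {k\<in>A. P (f k)} then w x else x) permutes {k\<in>A. P (f k)}" for P
      proof (rule bij_imp_permutes)
        have fin: "finite {k\<in>A. P (f k)}" using insert.prems by simp
        have i: "inj_on (\<lambda>x. if x \<in> {k\<in>A. P (f k)} then w x else x) {k\<in>A. P (f k)}"
          using inj by (auto simp: inj_on_def)
        have "(\<lambda>x. if x \<in> {k\<in>A. P (f k)} then w x else x) ` {k\<in>A. P (f k)} \<subseteq> {k\<in>A. P (f k)}"
          using wA wf by auto
        then have "(\<lambda>x. if x \<in> {k\<in>A. P (f k)} then w x else x) ` {k\<in>A. P (f k)} = {k\<in>A. P (f k)}"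
          by (rule endo_inj_surj[OF fin _ i])
        with i show "bij_betw (\<lambda>x. if x \<in> {k\<in>A. P (f k)} then w x else x) {k\<in>A. P (f k)} {k\<in>A. P (f k)}"
          by (simp only: bij_betw_def)
      qed auto
      show "(\<lambda>x. if x \<in> ?B then w x else x, \<lambda>x. if x \<in> ?C then w x else x) \<in> ?P ?B \<times> {q. q permutes ?C}"
        using perm[of "\<lambda>s. s \<noteq> r"] perm[of "\<lambda>s. s = r"] wf by simp
    qed
    show "\<forall>pq\<in>?P ?B \<times> {q. q permutes ?C}. (\<lambda>w. (\<lambda>x. if x \<in> ?B then w x else x, \<lambda>x. if x \<in> ?C then w x else x)) ((\<lambda>(p, q). p \<circ> q) pq) = pq"
    proof
      fix pq assume "pq \<in> ?P ?B \<times> {q. q permutes ?C}"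
      then obtain p q where e: "pq = (p, q)" and p: "p permutes ?B" and q: "q permutes ?C" by auto
      have "(if x \<in> ?B then p (q x) else x) = p x" for x
        using permutes_not_in[OF q, of x] permutes_not_in[OF p, of x] by auto
      moreover have "(if x \<in> ?C then p (q x) else x) = q x" for x
        using permutes_not_in[OF q, of x] permutes_not_in[OF p, of "q x"] permutes_in_image[OF q, of x] by auto
      ultimately show "(\<lambda>w. (\<lambda>x. if x \<in> ?B then w x else x, \<lambda>x. if x \<in> ?C then w x else x)) ((\<lambda>(p, q). p \<circ> q) pq) = pq"
        by (simp only: e prod.case comp_apply)
    qed
    show "\<forall>w\<in>?P A. (\<lambda>(p, q). p \<circ> q) ((\<lambda>w. (\<lambda>x. if x \<in> ?B then w x else x, \<lambda>x. if x \<in> ?C then w x else x)) w) = w"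
    proof
      fix w assume w: "w \<in> ?P A"
      then have wp: "w permutes A" and wf: "\<And>k. k \<in> A \<Longrightarrow> f (w k) = f k" by auto
      have "(if (if x \<in> ?C then w x else x) \<in> ?B then w (if x \<in> ?C then w x else x) else if x \<in> ?C then w x else x) = w x" for x
        using wf[of x] permutes_not_in[OF wp, of x] by auto
      then show "(\<lambda>(p, q). p \<circ> q) ((\<lambda>w. (\<lambda>x. if x \<in> ?B then w x else x, \<lambda>x. if x \<in> ?C then w x else x)) w) = w"
        by (simp only: prod.case comp_def)
    qed
  qed
  have "card (?P A) = card (?P ?B) * card {q. q permutes ?C}"
    using bij_betw_same_card[OF bij] by (simp add: card_cartesian_product)
  also have "card {q. q permutes ?C} = fact (card ?C)"
    using insert.prems by (intro card_permutations) auto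
  also have "card (?P ?B) = (\<Prod>s\<in>R. fact (card {k\<in>A. f k = s}))"
    unfolding IH using eqs by simp
  finally show ?case using insert.hyps by (simp add: mult.commute)
qed

text \<open>The first factor of \<open>r_init\<close>; it arises as the scalar by which the sum over
  the row stabiliser acts on a vector of initial weight.\<close>

lemma card_young:
  assumes lam: "lam \<in> mparts l n"
  shows "card (young l n lam) = (\<Prod>c=1..l. \<Prod>i | lam c i \<noteq> 0. fact (lam c i))"
proof -
  let ?R = "SIGMA c:{1..l}. {i. lam c i \<noteq> 0}"
  have fin: "finite {i. lam c i \<noteq> 0}" for c by (rule mparts_finite[OF lam])
  have i1: "1 \<le> i" if "lam c i \<noteq> 0" for c i using that mparts_0[OF lam, of c] by (cases i) auto
  have "young l n lam = {w. w permutes {1..n} \<and> (\<forall>k\<in>{1..n}. rowk l lam (w k) = rowk l lam k)}"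
    using young_iff[OF lam] by blast
  then have "card (young l n lam) = (\<Prod>r\<in>?R. fact (card {k\<in>{1..n}. rowk l lam k = r}))"
  proof (simp only:, intro card_class_perms)
    show "rowk l lam ` {1..n} \<subseteq> ?R"
    proof (rule image_subsetI)
      fix k assume k: "k \<in> {1..n}"
      obtain i j c where b: "bx (init_tab l lam) k = (i, j, c)" by (cases "bx (init_tab l lam) k")
      have "(i, j, c) \<in> diagram l lam" using init_tab_bx(2)[OF lam k] b by simp
      then show "rowk l lam k \<in> ?R" using b by (auto simp: rowk_def diagram_iff valid_box_def)
    qed
  qed (use fin in auto)
  also have "\<dots> = (\<Prod>(c, i)\<in>?R. fact (lam c i))"
  proof (rule prod.cong[OF refl])
    fix r assume r: "r \<in> ?R"
    obtain c i where e: "r = (c, i)" by (cases r)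
    have ci: "c \<in> {1..l}" "1 \<le> i" using r i1 by (auto simp: e)
    have d: "(i, j, c) \<in> diagram l lam \<longleftrightarrow> j \<in> {1..lam c i}" for j
      using ci by (auto simp: diagram_iff valid_box_def)
    have "{k\<in>{1..n}. rowk l lam k = r} = (\<lambda>j. init_tab l lam (i, j, c)) ` {1..lam c i}"
    proof (intro equalityI subsetI)
      fix k assume k: "k \<in> {k\<in>{1..n}. rowk l lam k = r}"
      then obtain j where b: "bx (init_tab l lam) k = (i, j, c)"
        by (cases "bx (init_tab l lam) k") (auto simp: rowk_def e)
      then show "k \<in> (\<lambda>j. init_tab l lam (i, j, c)) ` {1..lam c i}"
        using init_tab_bx(1,2)[OF lam, of k] k d by (intro image_eqI[of _ _ j]) auto
    next
      fix k assume "k \<in> (\<lambda>j. init_tab l lam (i, j, c)) ` {1..lam c i}"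
      then obtain j where j: "(i, j, c) \<in> diagram l lam" "k = init_tab l lam (i, j, c)" using d by blast
      then show "k \<in> {k\<in>{1..n}. rowk l lam k = r}"
        using init_tab_bx(3,4)[OF lam j(1)] by (simp add: rowk_def e)
    qed
    moreover have "inj_on (\<lambda>j. init_tab l lam (i, j, c)) {1..lam c i}"
    proof (rule inj_onI)
      fix j j' assume "j \<in> {1..lam c i}" "j' \<in> {1..lam c i}" "init_tab l lam (i, j, c) = init_tab l lam (i, j', c)"
      then show "j = j'" using init_tab_bx(4)[OF lam] d by (metis prod.inject)
    qed
    ultimately have "card {k\<in>{1..n}. rowk l lam k = r} = lam c i" by (simp add: card_image)
    then show "fact (card {k\<in>{1..n}. rowk l lam k = r}) = (case r of (c, i) \<Rightarrow> fact (lam c i))"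
      by (simp add: e)
  qed
  also have "\<dots> = (\<Prod>c=1..l. \<Prod>i | lam c i \<noteq> 0. fact (lam c i))"
    by (rule prod.Sigma[symmetric]) (use fin in auto)
  finally show ?thesis .
qed

text \<open>The second factor of \<open>r_init\<close>, as the scalar of \<open>u_prod\<close> on
  initial weight: the entries up to the bound for \<open>c\<close> are those in the components
  before \<open>c\<close>. What remains is an exchange of the products over the two
  components.\<close>

lemma init_tab_content_prod:
  assumes lam: "lam \<in> mparts l n"
  shows "(\<Prod>c=2..l. \<Prod>k=1..(\<Sum>c'=1..<c. psize (lam c')). tcontent u (init_tab l lam) k - u c) =
    (\<Prod>a=1..l. \<Prod>b\<in>{a<..l}. \<Prod>(i, j)\<in>{(i, j). 1 \<le> i \<and> 1 \<le> j \<and> j \<le> lam a i}.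
        of_nat j - of_nat i + u a - u b)"
proof -
  let ?A = "\<lambda>a. {(i, j). 1 \<le> i \<and> 1 \<le> j \<and> j \<le> lam a i}"
  let ?g = "\<lambda>a b. \<Prod>(i, j)\<in>?A a. of_nat j - of_nat i + u a - u b"
  have finA: "finite (?A a)" for a
  proof (rule finite_subset)
    show "?A a \<subseteq> (SIGMA i:{i. lam a i \<noteq> 0}. {1..lam a i})" by auto
    show "finite (SIGMA i:{i. lam a i \<noteq> 0}. {1..lam a i})"
      using mparts_finite[OF lam] by (intro finite_SigmaI) auto
  qed
  have inner: "(\<Prod>k=1..(\<Sum>c'=1..<c. psize (lam c')). tcontent u (init_tab l lam) k - u c) = (\<Prod>a\<in>{1..<c}. ?g a c)"
    if c: "c \<in> {2..l}" for c
  proof -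
    let ?m = "\<Sum>c'=1..<c. psize (lam c')"
    let ?S = "SIGMA a:{1..<c}. ?A a"
    let ?h = "\<lambda>(a, i, j). init_tab l lam (i, j, a)"
    have mn: "?m \<le> n" using sum_psize_le[OF lam, of c] c by auto
    have d: "(i, j, a) \<in> diagram l lam" if "(a, i, j) \<in> ?S" for a i j
      using that c by (auto simp: diagram_iff valid_box_def)
    have "bij_betw ?h ?S {1..?m}"
    proof (rule bij_betw_byWitness[where f' = "\<lambda>k. case bx (init_tab l lam) k of (i, j, a) \<Rightarrow> (a, i, j)"])
      show "\<forall>x\<in>?S. (case bx (init_tab l lam) (?h x) of (i, j, a) \<Rightarrow> (a, i, j)) = x"
      proof
        fix x assume x: "x \<in> ?S"
        obtain a i j where e: "x = (a, i, j)" by (cases x)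
        show "(case bx (init_tab l lam) (?h x) of (i, j, a) \<Rightarrow> (a, i, j)) = x"
          using init_tab_bx(4)[OF lam d] x by (simp add: e)
      qed
      show "\<forall>k\<in>{1..?m}. ?h (case bx (init_tab l lam) k of (i, j, a) \<Rightarrow> (a, i, j)) = k"
        using init_tab_bx(1)[OF lam] mn by (auto split: prod.splits) (metis (no_types, lifting) Suc_leI le_trans atLeastAtMost_iff One_nat_def)
      show "?h ` ?S \<subseteq> {1..?m}"
      proof (rule image_subsetI)
        fix x assume x: "x \<in> ?S"
        obtain a i j where e: "x = (a, i, j)" by (cases x)
        have "a < c" using x by (auto simp: e)
        then show "?h x \<in> {1..?m}"
          using init_tab_bx(3)[OF lam d] init_tab_comp[OF lam d, of a i j c] x by (simp add: e)
      qed
      show "(\<lambda>k. case bx (init_tab l lam) k of (i, j, a) \<Rightarrow> (a, i, j)) ` {1..?m} \<subseteq> ?S"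
      proof (rule image_subsetI)
        fix k assume k: "k \<in> {1..?m}"
        then have kn: "k \<in> {1..n}" using mn by auto
        obtain i j a where b: "bx (init_tab l lam) k = (i, j, a)" by (cases "bx (init_tab l lam) k")
        have dd: "(i, j, a) \<in> diagram l lam" using init_tab_bx(2)[OF lam kn] b by simp
        then have "a < c" using init_tab_comp[OF lam dd, of c] init_tab_bx(1)[OF lam kn] k b by simp
        then show "(case bx (init_tab l lam) k of (i, j, a) \<Rightarrow> (a, i, j)) \<in> ?S"
          using dd by (auto simp: b diagram_iff valid_box_def)
      qed
    qed
    then have "(\<Prod>k=1..?m. tcontent u (init_tab l lam) k - u c) = (\<Prod>x\<in>?S. tcontent u (init_tab l lam) (?h x) - u c)"
      by (rule prod.reindex_bij_betw[symmetric])
    also have "\<dots> = (\<Prod>(a, i, j)\<in>?S. of_nat j - of_nat i + u a - u c)"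
      by (rule prod.cong) (use init_tab_bx(4)[OF lam d] in \<open>auto simp: content_eq cont_def\<close>)
    also have "\<dots> = (\<Prod>a\<in>{1..<c}. ?g a c)"
      using prod.Sigma[of "{1..<c}" ?A "\<lambda>a (i, j). of_nat j - of_nat i + u a - u c"] finA
      by (simp add: case_prod_unfold)
    finally show ?thesis .
  qed
  have "(\<Prod>c=2..l. \<Prod>k=1..(\<Sum>c'=1..<c. psize (lam c')). tcontent u (init_tab l lam) k - u c) =
      (\<Prod>c\<in>{2..l}. \<Prod>a\<in>{1..<c}. ?g a c)"
    by (rule prod.cong) (use inner in auto)
  also have "\<dots> = (\<Prod>(c, a)\<in>(SIGMA c:{2..l}. {1..<c}). ?g a c)"
    by (rule prod.Sigma) auto
  also have "\<dots> = (\<Prod>(a, b)\<in>(SIGMA a:{1..l}. {a<..l}). ?g a b)"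
    by (rule prod.reindex_bij_witness[of _ "\<lambda>(a, b). (b, a)" "\<lambda>(c, a). (a, c)"]) auto
  also have "\<dots> = (\<Prod>a=1..l. \<Prod>b\<in>{a<..l}. ?g a b)"
    by (rule prod.Sigma[symmetric]) auto
  finally show ?thesis .
qed

text \<open>The entry where a standard tableau first deviates from the initial one either starts a later
  component too early, or starts the next row too early.\<close>

lemma std_deviation:
  assumes lam: "lam \<in> mparts l n" and y: "y \<in> Std l n lam" and ne: "y \<noteq> init_tab l lam"
  obtains (comp) k c where "c \<in> {2..l}" "k \<in> {1..(\<Sum>c'=1..<c. psize (lam c'))}" "bx y k = (1, 1, c)"
  | (row) i c p q where "p \<in> {1..n}" "p < q" "q \<le> n" "y (Suc i, 1, c) = q"
      "\<And>e. p + e < q \<Longrightarrow> y (i, Suc e, c) = p + e"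
      "\<And>e. p + e \<le> q \<Longrightarrow> rowk l lam (p + e) = (c, i)"
proof -
  let ?i = "init_tab l lam"
  note I = init_tab_Std[OF lam]
  note IS = Std_ST[OF lam I] and Y = Std_ST[OF lam y]
  have supp: "y b \<noteq> 0 \<longleftrightarrow> b \<in> diagram l lam" for b by (rule Std_supp[OF lam y])
  have isupp: "?i b \<noteq> 0 \<longleftrightarrow> b \<in> diagram l lam" for b by (rule Std_supp[OF lam I])
  have "\<exists>k. k \<in> {1..n} \<and> bx y k \<noteq> bx ?i k"
  proof (rule ccontr)
    assume "\<not> ?thesis"
    then have same: "bx y k = bx ?i k" if "k \<in> {1..n}" for k using that by blast
    have "y b = ?i b" for b
    proof (cases "b \<in> diagram l lam")
      case True
      then have "?i b \<in> {1..n}" "bx ?i (?i b) = b" using init_tab_bx(3,4)[OF lam] by auto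
      then show ?thesis using same t_bx[OF Y] by metis
    next
      case False
      then show ?thesis using supp isupp by metis
    qed
    then show False using ne by blast
  qed
  then obtain k where k: "k \<in> {1..n}" "bx y k \<noteq> bx ?i k" and
    min: "\<And>m. m < k \<Longrightarrow> m \<in> {1..n} \<Longrightarrow> bx y m = bx ?i m"
    using exists_least_iff[of "\<lambda>k. k \<in> {1..n} \<and> bx y k \<noteq> bx ?i k"] by metis
  obtain i j c where B: "bx ?i k = (i, j, c)" by (cases "bx ?i k")
  obtain i' j' c' where B': "bx y k = (i', j', c')" by (cases "bx y k")
  have yB': "y (i', j', c') = k" using t_bx[OF Y k(1)] B' by simp
  have iB: "?i (i, j, c) = k" "(i, j, c) \<in> diagram l lam" using init_tab_bx(1,2)[OF lam k(1)] B by auto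
  have dB': "(i', j', c') \<in> diagram l lam" using supp[of "(i', j', c')"] yB' k by auto
  have same: "y b = ?i b" if "y b < k \<or> ?i b < k" "b \<in> diagram l lam" for b
  proof -
    have nz: "y b \<noteq> 0" "?i b \<noteq> 0" using supp isupp that by auto
    have r: "y b \<in> {1..n}" "?i b \<in> {1..n}" using nz ST_le[OF Y, of b] ST_le[OF IS, of b] by auto
    have "bx y (y b) = b" "bx ?i (?i b) = b" using bx_eq[OF Y, of b] bx_eq[OF IS, of b] nz by auto
    then show ?thesis using that(1) min[of "y b"] min[of "?i b"] r t_bx[OF Y, of "?i b"] t_bx[OF IS, of "y b"]
      by metis
  qed
  \<comment> \<open>Up to the entry \<open>k\<close> both tableaux agree, so all boxes read before
    the regular box of \<open>k\<close> are taken, and \<open>k\<close> can only deviate to a later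
    one.\<close>
  have lt: "rlt (i, j, c) (i', j', c')"
  proof -
    have "\<not> ?i (i', j', c') < k" using same[OF _ dB'] yB' by auto
    moreover have "?i (i', j', c') \<noteq> k" using init_tab_bx(4)[OF lam dB'] k B' by metis
    ultimately have "?i (i, j, c) < ?i (i', j', c')" using iB by simp
    then show ?thesis using init_tab_rlt_iff[OF lam iB(2) dB'] by simp
  qed
  \<comment> \<open>The neighbours above and to the left carry smaller entries and hence sit where
    the initial tableau has them, before the regular box of \<open>k\<close>. This confines
    \<open>k\<close> to the first box of a later component or of the next row.\<close>
  have before: "rlt b (i, j, c) \<and> y b = ?i b" if a: "adj b (i', j', c')" "valid_box l b" for b
  proof -
    have "0 < y b \<and> y b < k" using ST_adj[OF Y a] yB' k by auto
    then have "b \<in> diagram l lam" "y b < k" using supp by auto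
    then show ?thesis using same[of b] init_tab_rlt_iff[OF lam _ iB(2), of b] iB by auto
  qed
  have v: "1 \<le> i" "1 \<le> j" "1 \<le> c" "c \<le> l" "j \<le> lam c i" "1 \<le> i'" "1 \<le> j'" "1 \<le> c'" "c' \<le> l" "j' \<le> lam c' i'"
    using iB dB' by (auto simp: diagram_iff valid_box_def)
  show ?thesis
  proof (cases "c' = c")
    case False
    then have cc: "c < c'" using lt by (auto simp: rlt_def)
    have "i' = 1"
    proof (rule ccontr)
      assume "i' \<noteq> 1"
      then have "adj (i' - 1, j', c') (i', j', c')" "valid_box l (i' - 1, j', c')" using v by (auto simp: adj_def valid_box_def)
      then show False using before[of "(i' - 1, j', c')"] cc by (auto simp: rlt_def)
    qed
    moreover have "j' = 1"
    proof (rule ccontr)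
      assume "j' \<noteq> 1"
      then have "adj (i', j' - 1, c') (i', j', c')" "valid_box l (i', j' - 1, c')" using v by (auto simp: adj_def valid_box_def)
      then show False using before[of "(i', j' - 1, c')"] cc by (auto simp: rlt_def)
    qed
    moreover have "k \<le> (\<Sum>c'=1..<c'. psize (lam c'))"
      using init_tab_comp[OF lam iB(2), of c'] iB(1) cc by simp
    ultimately show ?thesis using comp[of c' k] v cc k B' by auto
  next
    case True
    have ii: "i < i' \<or> i = i' \<and> j < j'" using lt True by (auto simp: rlt_def)
    have i1: "i < i'"
    proof (rule ccontr)
      assume "\<not> i < i'"
      then have e: "i = i'" "j < j'" using ii by auto
      then have "adj (i', j' - 1, c') (i', j', c')" "valid_box l (i', j' - 1, c')" using v by (auto simp: adj_def valid_box_def)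
      then have "rlt (i', j' - 1, c') (i, j, c)" using before by blast
      then show False using e True by (auto simp: rlt_def)
    qed
    have "adj (i' - 1, j', c') (i', j', c')" "valid_box l (i' - 1, j', c')"
      using v i1 by (auto simp: adj_def valid_box_def)
    then have "rlt (i' - 1, j', c') (i, j, c)" using before by blast
    then have i': "i' = Suc i" and j'j: "j' < j" using i1 True by (auto simp: rlt_def)
    have j': "j' = 1"
    proof (rule ccontr)
      assume "j' \<noteq> 1"
      then have "adj (i', j' - 1, c') (i', j', c')" "valid_box l (i', j' - 1, c')" using v by (auto simp: adj_def valid_box_def)
      then have "rlt (i', j' - 1, c') (i, j, c)" using before by blast
      then show False using i1 True by (auto simp: rlt_def)
    qed
    define p where "p = ?i (i, 1, c)"
    have row_d: "(i, Suc e, c) \<in> diagram l lam" if "Suc e \<le> j" for e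
      using that v by (auto simp: diagram_iff valid_box_def)
    have row_i: "?i (i, Suc e, c) = p + e" if "Suc e \<le> j" for e
      using row_d[OF that] row_d[of 0] v by (simp add: p_def init_tab_def)
    have kp: "k = p + (j - 1)" using row_i[of "j - 1"] iB v by simp
    have p1: "p \<in> {1..n}" unfolding p_def using init_tab_bx(3)[OF lam row_d[of 0]] v by simp
    show ?thesis
    proof (rule row[OF p1, of k i c])
      show "p < k" "k \<le> n" using kp j'j j' k by auto
      show "y (Suc i, 1, c) = k" using yB' i' j' True by simp
      show "y (i, Suc e, c) = p + e" if "p + e < k" for e
      proof -
        have e: "Suc e \<le> j" using that kp by auto
        show ?thesis using same[OF _ row_d[OF e]] row_i[OF e] that by auto
      qed
      show "rowk l lam (p + e) = (c, i)" if "p + e \<le> k" for e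
      proof -
        have e: "Suc e \<le> j" using that kp v by auto
        show ?thesis using init_tab_bx(4)[OF lam row_d[OF e]] row_i[OF e] by (simp add: rowk_def)
      qed
    qed
  qed
qed

lemma (in separated) r_init_nonzero:
  assumes lam: "lam \<in> mparts l n" and n: "n \<le> N"
  shows "r_init l u lam \<noteq> 0"
proof -
  have fact: "of_nat (fact m) \<noteq> (0::'k)" if "m \<le> N" for m
    using that
  proof (induction m)
    case (Suc m)
    have "fact (Suc m) = Suc m * (fact m :: nat)" by simp
    then show ?case using char[of "Suc m"] Suc by (simp only: of_nat_mult mult_eq_0_iff) auto
  qed simp
  note I = Std_ST[OF lam init_tab_Std[OF lam]]
  have ge: "i \<le> n \<and> j \<le> n" if "(i, j, c) \<in> diagram l lam" for i j c
    using ST_ge[OF I, of i j c] Std_supp[OF lam init_tab_Std[OF lam]] that by blast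
  have d: "(i, j, c) \<in> diagram l lam" if "c \<in> {1..l}" "1 \<le> i" "1 \<le> j" "j \<le> lam c i" for i j c
    using that by (auto simp: diagram_iff valid_box_def)
  have le: "lam c i \<le> n" if "c \<in> {1..l}" for c i
    using ge[OF d[OF that, of i "lam c i"]] mparts_0[OF lam, of c] by (cases "i = 0"; cases "lam c i = 0") auto
  have "(\<Prod>c=1..l. \<Prod>i | lam c i \<noteq> 0. of_nat (fact (lam c i))) \<noteq> (0::'k)"
  proof -
    have "(\<Prod>i | lam c i \<noteq> 0. of_nat (fact (lam c i))) \<noteq> (0::'k)" if "c \<in> {1..l}" for c
      using mparts_finite[OF lam] fact le[OF that] n by (subst prod_zero_iff) (auto simp del: of_nat_fact intro: order_trans)
    then show ?thesis by (subst prod_zero_iff) auto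
  qed
  moreover have "of_nat j - of_nat i + u a - u b \<noteq> 0"
    if "a \<in> {1..l}" "b \<in> {a<..l}" "1 \<le> i" "1 \<le> j" "j \<le> lam a i" for a b i j
  proof -
    have "i \<le> n" "j \<le> n" using ge[OF d[of a i j]] that by simp_all
    then have "of_int (int j - int i) + u a - u b \<noteq> 0"
      by (intro sep) (use that n in auto)
    then show ?thesis by simp
  qed
  moreover have "finite {(i, j). 1 \<le> i \<and> 1 \<le> j \<and> j \<le> lam a i}" for a
    by (rule finite_subset[of _ "SIGMA i:{i. lam a i \<noteq> 0}. {1..lam a i}"])
       (use mparts_finite[OF lam] in auto)
  ultimately show ?thesis
    unfolding r_init_def by (simp add: prod_zero_iff case_prod_unfold del: of_nat_fact)
qed

section \<open>The seminormal elements acting on a module\<close>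

lemma finite_contents: "finite (contents l n u k)"
proof -
  have "contents l n u k \<subseteq> (\<lambda>t. tcontent u t k) ` {t. ST l n t}"
    unfolding contents_def using Std_ST by blast
  then show ?thesis by (rule finite_subset) (simp add: finite_ST)
qed

lemma contents_mem: "ST l n t \<Longrightarrow> tcontent u t k \<in> contents l n u k"
  unfolding contents_def using ST_shape by blast

lemma seminormal_F_factor_hZ:
  assumes "k \<in> {1..n}"
  shows "hscl l n u a \<otimes>\<^bsub>hecke l n u\<^esub> (hL l n u k \<ominus>\<^bsub>hecke l n u\<^esub> hscl l n u c) \<in> hZ l n u"
  by (intro hZ_mult hZ_minus hZ_hscl hZ_hL assms)

lemma seminormal_F_hZ: "seminormal_F l n u t \<in> hZ l n u"
  unfolding seminormal_F_def by (intro finprod_hZ seminormal_F_factor_hZ) auto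

lemma seminormal_F_closed: "seminormal_F l n u t \<in> carrier (hecke l n u)"
  by (rule hZ_carrier[OF seminormal_F_hZ])

definition young_sum :: "nat \<Rightarrow> nat \<Rightarrow> (nat \<Rightarrow> 'k::field) \<Rightarrow> mpart \<Rightarrow> 'k free_alg set" where
  "young_sum l n u lam = (\<Oplus>\<^bsub>hecke l n u\<^esub>w\<in>young l n lam. hperm l n u w)"

definition u_prod :: "nat \<Rightarrow> nat \<Rightarrow> (nat \<Rightarrow> 'k::field) \<Rightarrow> mpart \<Rightarrow> 'k free_alg set" where
  "u_prod l n u lam = (\<Otimes>\<^bsub>hecke l n u\<^esub>c\<in>{2..l}.
      \<Otimes>\<^bsub>hecke l n u\<^esub>k\<in>{1..(\<Sum>c'=1..<c. psize (lam c'))}. hL l n u k \<ominus>\<^bsub>hecke l n u\<^esub> hscl l n u (u c))"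

lemma young_sum_closed: "young_sum l n u lam \<in> carrier (hecke l n u)"
  unfolding young_sum_def
  by (rule abelian_monoid.finsum_closed[OF abelian_group.axioms(1)[OF ring.is_abelian_group[OF ring_hecke]]])
     (auto intro!: hperm_closed young_permutes)

lemma u_factor_hZ:
  assumes "lam \<in> mparts l n" "c \<in> {2..l}" "k \<in> {1..(\<Sum>c'=1..<c. psize (lam c'))}"
  shows "hL l n u k \<ominus>\<^bsub>hecke l n u\<^esub> hscl l n u (u c) \<in> hZ l n u"
  using assms sum_psize_le[OF assms(1), of c] by (intro hZ_minus hZ_hL hZ_hscl) auto

lemma u_prod_hZ: "lam \<in> mparts l n \<Longrightarrow> u_prod l n u lam \<in> hZ l n u"
  unfolding u_prod_def by (intro finprod_hZ u_factor_hZ)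

lemma u_prod_closed: "lam \<in> mparts l n \<Longrightarrow> u_prod l n u lam \<in> carrier (hecke l n u)"
  by (rule hZ_carrier[OF u_prod_hZ])

lemma seminormal_m_eq: "seminormal_m l n u lam s t =
    hperm l n u (pinv (d_perm l n lam s)) \<otimes>\<^bsub>hecke l n u\<^esub> young_sum l n u lam
     \<otimes>\<^bsub>hecke l n u\<^esub> u_prod l n u lam \<otimes>\<^bsub>hecke l n u\<^esub> hperm l n u (d_perm l n lam t)"
  by (simp add: seminormal_m_def young_sum_def u_prod_def)

lemma seminormal_m_closed:
  assumes "lam \<in> mparts l n" "s \<in> Std l n lam" "t \<in> Std l n lam"
  shows "seminormal_m l n u lam s t \<in> carrier (hecke l n u)"
proof -
  interpret R: ring "hecke l n u" by (rule ring_hecke)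
  show ?thesis
    unfolding seminormal_m_eq using assms
    by (intro R.m_closed hperm_closed young_sum_closed u_prod_closed permutes_inv d_perm_props(1)) auto
qed

lemma seminormal_f_closed:
  assumes "lam \<in> mparts l n" "s \<in> Std l n lam" "t \<in> Std l n lam"
  shows "seminormal_f l n u lam s t \<in> carrier (hecke l n u)"
proof -
  interpret R: ring "hecke l n u" by (rule ring_hecke)
  show ?thesis
    unfolding seminormal_f_def using assms
    by (intro R.m_closed seminormal_F_closed seminormal_m_closed) auto
qed

text \<open>The defining ratio with dominance replaced by a descent: for the difference
  \<open>x\<close> of contents, \<open>(x + 1) * (x - 1) / x^2\<close> is
  \<open>1 - (1 / x)^2\<close>, the factor that will come out of \<open>S_swap_back\<close>.\<close>

lemma (in separated) is_r_coeffs_descent: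
  assumes r: "is_r_coeffs l n u r" and lam: "lam \<in> mparts l n"
    and t: "t \<in> Std l n lam" and i: "i \<in> {1..<n}" and d: "descent t i" and s: "st i \<circ> t \<in> Std l n lam"
    and n: "n \<le> N"
  shows "r t = r (st i \<circ> t) * (1 - (1 / (tcontent u t (Suc i) - tcontent u t i))\<^sup>2)"
proof -
  let ?s = "st i \<circ> t" and ?\<rho> = "tcontent u t (Suc i) - tcontent u t i"
  note T = Std_ST[OF lam t] and Ss = Std_ST[OF lam s]
  have "tab_dominates l ?s t" using swap_dominates[OF T i Ss] d by simp
  moreover have "?s \<noteq> t" using tlen_descent[OF lam t i d] by auto
  ultimately have "r t / r ?s = (tcontent u ?s i - tcontent u t i + 1) * (tcontent u ?s i - tcontent u t i - 1)
      / (tcontent u ?s i - tcontent u t i)\<^sup>2"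
    using r lam s t i unfolding is_r_coeffs_def by blast
  moreover have "tcontent u ?s i = tcontent u t (Suc i)"
    using content_swap[OF T i Ss, of i u] i by (simp add: st_apply)
  ultimately have e: "r t / r ?s = (?\<rho> + 1) * (?\<rho> - 1) / ?\<rho>\<^sup>2" by simp
  have "r ?s \<noteq> 0" using r lam s unfolding is_r_coeffs_def by blast
  then have "r t = r ?s * ((?\<rho> + 1) * (?\<rho> - 1) / ?\<rho>\<^sup>2)" unfolding e[symmetric] by simp
  moreover have "?\<rho> \<noteq> 0" using content_consec[OF T n i] by simp
  moreover have "(x + 1) * (x - 1) / x\<^sup>2 = 1 - (1 / x)\<^sup>2" if "x \<noteq> 0" for x :: 'k
    using that by (simp add: field_simps power2_eq_square)
  ultimately show ?thesis by presburger
qed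

context sep_module begin

text \<open>On a weight vector each factor of \<open>F_t\<close> is a scalar. If the tableaux
  differ, their contents differ at some \<open>k\<close>, and the factor belonging to the content of
  \<open>k\<close> in \<open>y\<close> vanishes.\<close>

lemma opr_F:
  assumes t: "ST l n t" and y: "ST l n y" and v: "v \<in> W n y"
  shows "opr (seminormal_F l n u t) v = (if t = y then v else 0)"
proof -
  have vM: "v \<in> M" by (rule W_M[OF v])
  let ?e = "\<lambda>k c. 1 / (tcontent u t k - c) * (tcontent u y k - c)"
  let ?C = "\<lambda>k. contents l n u k - {tcontent u t k}"
  have "opr (seminormal_F l n u t) v = (\<Prod>k\<in>{1..n}. \<Prod>c\<in>?C k. ?e k c) *s v"
    unfolding seminormal_F_def
  proof (rule opr_finprod)
    fix k assume k: "k \<in> {1..n}"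
    show "opr (\<Otimes>\<^bsub>hecke l n u\<^esub>c\<in>?C k. hscl l n u (1 / (tcontent u t k - c)) \<otimes>\<^bsub>hecke l n u\<^esub>
          (hL l n u k \<ominus>\<^bsub>hecke l n u\<^esub> hscl l n u c)) v = (\<Prod>c\<in>?C k. ?e k c) *s v"
    proof (rule opr_finprod)
      fix c assume "c \<in> ?C k"
      have cl: "hscl l n u c \<in> carrier H" for c by (intro proj_closed free_carrier)
      have cL: "hL l n u k \<in> carrier H" by (intro proj_closed free_carrier k)
      have "opr (hL l n u k \<ominus>\<^bsub>H\<^esub> hscl l n u c) v = (tcontent u y k - c) *s v"
        using cl cL vM k W_L[OF v k] by (simp add: opr_minus opr_hL opr_hscl scale_left_diff_distrib)
      then show "opr (hscl l n u (1 / (tcontent u t k - c)) \<otimes>\<^bsub>H\<^esub> (hL l n u k \<ominus>\<^bsub>H\<^esub> hscl l n u c)) v = ?e k c *s v"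
        using cl cL vM hZ_carrier[OF hZ_minus[OF hZ_hL[OF k, of l u] hZ_hscl, of c]]
        by (simp add: opr_mult opr_hscl M_scale)
    qed (use finite_contents vM seminormal_F_factor_hZ[OF k] in auto)
  next
    fix k assume k: "k \<in> {1..n}"
    show "(\<Otimes>\<^bsub>hecke l n u\<^esub>c\<in>?C k. hscl l n u (1 / (tcontent u t k - c)) \<otimes>\<^bsub>hecke l n u\<^esub>
          (hL l n u k \<ominus>\<^bsub>hecke l n u\<^esub> hscl l n u c)) \<in> hZ l n u"
      by (intro finprod_hZ seminormal_F_factor_hZ k)
  qed (use vM in auto)
  also have "\<dots> = (if t = y then v else 0)"
  proof (cases "t = y")
    case True
    have "(\<Prod>c\<in>?C k. ?e k c) = 1" for k by (rule prod.neutral) (auto simp: True)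
    then show ?thesis using True by simp
  next
    case False
    then obtain k where k: "k \<in> {1..n}" "tcontent u t k \<noteq> tcontent u y k"
      using content_inj[OF t y nN] by blast
    have "(\<Prod>c\<in>?C k. ?e k c) = 0"
      using k contents_mem[OF y, of u k] finite_contents by (subst prod_zero_iff) force+
    then have "(\<Prod>k\<in>{1..n}. \<Prod>c\<in>?C k. ?e k c) = 0" using k(1) by (subst prod_zero_iff) auto
    then show ?thesis using False by simp
  qed
  finally show ?thesis .
qed

abbreviation "F t \<equiv> opr (seminormal_F l n u t)"

lemma F_W: "ST l n t \<Longrightarrow> v \<in> W n t \<Longrightarrow> F t v = v"
  by (simp add: opr_F)

lemma F_closed: "v \<in> M \<Longrightarrow> F t v \<in> M"
  by (rule opr_closed[OF seminormal_F_closed])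

lemma F_add: "v \<in> M \<Longrightarrow> w \<in> M \<Longrightarrow> F t (v + w) = F t v + F t w"
  by (rule opr_plus_right[OF seminormal_F_closed])

lemma F_scale: "v \<in> M \<Longrightarrow> F t (c *s v) = c *s F t v"
  by (rule opr_scale_right[OF seminormal_F_closed])

lemma F_zero: "F t 0 = 0"
  by (rule opr_zero_right[OF seminormal_F_closed])

lemma F_in_W:
  assumes v: "v \<in> M" and t: "ST l n t"
  shows "F t v \<in> W n t"
  using v
proof (induction v rule: weight_induct)
  case zero
  then show ?case using W_subspace[of n t] by (simp add: F_zero subspace_0)
next
  case (weight y v)
  then show ?case using W_subspace[of n t] t by (simp add: opr_F subspace_0)
next
  case (add v w)
  then show ?case using W_subspace[of n t] by (simp add: F_add subspace_add)
qed

section \<open>The elements \<open>m_st\<close> for a fixed shape\<close>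

context
  fixes lam :: mpart
  assumes lam: "lam \<in> mparts l n"
begin

abbreviation "t0 \<equiv> init_tab l lam"

lemma Std_W_swap:
  assumes y: "y \<in> Std l n lam" and i: "i \<in> {1..<n}" and v: "v \<in> W n y"
  obtains \<alpha> v' where "S i v = \<alpha> *s v + v'" "v' \<in> W n (st i \<circ> y)" "st i \<circ> y \<in> Std l n lam \<or> v' = 0"
    "\<alpha> = 1 / (tcontent u y (Suc i) - tcontent u y i)"
  using W_swap_full[OF Std_ST[OF lam y] i v] Std_swap[OF lam y, of i] i by (metis atLeastLessThan_iff)

text \<open>This is \<open>m_st\<close> without its leftmost factor, which becomes
  \<open>dinv s\<close>. The two halves are shown separately to be triangular with respect to the
  length.\<close>

definition mop :: "tableau \<Rightarrow> 'v \<Rightarrow> 'v" where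
  "mop t v = opr (young_sum l n u lam) (opr (u_prod l n u lam) (opr (hperm l n u (d_perm l n lam t)) v))"

definition dinv :: "tableau \<Rightarrow> 'v \<Rightarrow> 'v" where
  "dinv t v = opr (hperm l n u (pinv (d_perm l n lam t))) v"

lemma d_closed: "t \<in> Std l n lam \<Longrightarrow> hperm l n u (d_perm l n lam t) \<in> carrier H"
    "t \<in> Std l n lam \<Longrightarrow> hperm l n u (pinv (d_perm l n lam t)) \<in> carrier H"
  by (auto intro!: hperm_closed permutes_inv d_perm_props(1)[OF lam])

lemma mop_closed: "t \<in> Std l n lam \<Longrightarrow> v \<in> M \<Longrightarrow> mop t v \<in> M"
  unfolding mop_def by (intro opr_closed young_sum_closed u_prod_closed[OF lam] d_closed)

lemma mop_add: "t \<in> Std l n lam \<Longrightarrow> v \<in> M \<Longrightarrow> w \<in> M \<Longrightarrow> mop t (v + w) = mop t v + mop t w"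
  unfolding mop_def
  by (simp add: opr_plus_right opr_closed young_sum_closed u_prod_closed[OF lam] d_closed)

lemma mop_scale: "t \<in> Std l n lam \<Longrightarrow> v \<in> M \<Longrightarrow> mop t (c *s v) = c *s mop t v"
  unfolding mop_def
  by (simp add: opr_scale_right opr_closed young_sum_closed u_prod_closed[OF lam] d_closed)

lemma mop_zero: "t \<in> Std l n lam \<Longrightarrow> mop t 0 = 0"
  using mop_scale[of t 0 0] M_zero by simp

lemma dinv_closed: "t \<in> Std l n lam \<Longrightarrow> v \<in> M \<Longrightarrow> dinv t v \<in> M"
  unfolding dinv_def by (intro opr_closed d_closed)

lemma mop_swap: "t \<in> Std l n lam \<Longrightarrow> i \<in> {1..<n} \<Longrightarrow> st i \<circ> t \<in> Std l n lam \<Longrightarrow> v \<in> M \<Longrightarrow>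
    mop (st i \<circ> t) v = mop t (S i v)"
  using opr_hperm_st_comp[OF d_perm_props(1)[OF lam], of t i v] by (simp only: mop_def d_perm_swap[OF lam])

lemma dinv_swap: "t \<in> Std l n lam \<Longrightarrow> i \<in> {1..<n} \<Longrightarrow> st i \<circ> t \<in> Std l n lam \<Longrightarrow> v \<in> M \<Longrightarrow>
    dinv (st i \<circ> t) v = S i (dinv t v)"
  using opr_hperm_comp_st[OF permutes_inv[OF d_perm_props(1)[OF lam]], of t i v]
  by (simp only: dinv_def inv_d_perm_swap[OF lam])

lemma mop_init: "v \<in> M \<Longrightarrow> mop t0 v = opr (young_sum l n u lam) (opr (u_prod l n u lam) v)"
  by (simp add: mop_def d_perm_init[OF lam] opr_hperm_id)

lemma dinv_init: "v \<in> M \<Longrightarrow> dinv t0 v = v"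
  by (simp add: dinv_def d_perm_init[OF lam] opr_hperm_id)

lemma young_sum_S:
  assumes q: "q \<in> {1..<n}" "rowk l lam q = rowk l lam (Suc q)" and v: "v \<in> M"
  shows "opr (young_sum l n u lam) (S q v) = opr (young_sum l n u lam) v"
proof -
  have e: "opr (young_sum l n u lam) v = (\<Sum>w\<in>young l n lam. opr (hperm l n u w) v)" if "v \<in> M" for v
    unfolding young_sum_def
    by (rule opr_finsum) (use finite_young that in \<open>auto intro!: hperm_closed young_permutes\<close>)
  have "(\<Sum>w\<in>young l n lam. opr (hperm l n u w) (S q v)) = (\<Sum>w\<in>young l n lam. opr (hperm l n u (st q \<circ> w)) v)"
    by (rule sum.cong) (use opr_hperm_st_comp[OF young_permutes q(1) v] in auto)
  also have "\<dots> = (\<Sum>w\<in>young l n lam. opr (hperm l n u w) v)"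
    by (rule sum.reindex_bij_witness[of _ "\<lambda>w. st q \<circ> w" "\<lambda>w. st q \<circ> w"])
       (use young_swap(2)[OF lam _ q] swap_swap in \<open>auto simp del: comp_apply\<close>)
  finally show ?thesis using v q by (simp add: e M_simps)
qed

lemma u_prod_W:
  assumes v: "v \<in> W n y"
  shows "opr (u_prod l n u lam) v =
    (\<Prod>c=2..l. \<Prod>k=1..(\<Sum>c'=1..<c. psize (lam c')). tcontent u y k - u c) *s v"
proof -
  have vM: "v \<in> M" by (rule W_M[OF v])
  show ?thesis
    unfolding u_prod_def
  proof (rule opr_finprod)
    fix c assume c: "c \<in> {2..l}"
    show "(\<Otimes>\<^bsub>H\<^esub>k\<in>{1..(\<Sum>c'=1..<c. psize (lam c'))}. hL l n u k \<ominus>\<^bsub>H\<^esub> hscl l n u (u c)) \<in> hZ l n u"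
      by (intro finprod_hZ u_factor_hZ[OF lam c])
    show "opr (\<Otimes>\<^bsub>H\<^esub>k\<in>{1..(\<Sum>c'=1..<c. psize (lam c'))}. hL l n u k \<ominus>\<^bsub>H\<^esub> hscl l n u (u c)) v =
       (\<Prod>k=1..(\<Sum>c'=1..<c. psize (lam c')). tcontent u y k - u c) *s v"
    proof (rule opr_finprod)
      fix k assume k: "k \<in> {1..(\<Sum>c'=1..<c. psize (lam c'))}"
      then have kn: "k \<in> {1..n}" using sum_psize_le[OF lam, of c] c by auto
      have "hscl l n u (u c) \<in> carrier H" "hL l n u k \<in> carrier H"
        using kn by (intro proj_closed free_carrier; simp)+
      then show "opr (hL l n u k \<ominus>\<^bsub>H\<^esub> hscl l n u (u c)) v = (tcontent u y k - u c) *s v"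
        using vM kn W_L[OF v kn] by (simp add: opr_minus opr_hL opr_hscl scale_left_diff_distrib)
    qed (use u_factor_hZ[OF lam c] vM in auto)
  qed (use vM in auto)
qed

lemma S_row:
  assumes y: "ST l n y" and i: "i \<in> {1..<n}" and v: "v \<in> W n y"
    and b: "bx y i = (a, j, c)" "bx y (Suc i) = (a, Suc j, c)"
  shows "S i v = v"
proof -
  have "adj (bx y i) (bx y (Suc i))" by (simp add: b adj_def)
  then have "\<not> ST l n (st i \<circ> y)" using ST_swap_nonadj[OF y i] by blast
  moreover have "tcontent u y (Suc i) - tcontent u y i = 1" by (simp add: content_eq b cont_def)
  ultimately show ?thesis using W_swap_full[OF y i v] by (metis add.right_neutral div_by_1 scale_one)
qed

lemma S_column:
  assumes y: "ST l n y" and i: "i \<in> {1..<n}" and v: "v \<in> W n y"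
    and b: "bx y i = (a, j, c)" "bx y (Suc i) = (Suc a, j, c)"
  shows "S i v = - v"
proof -
  have "adj (bx y i) (bx y (Suc i))" by (simp add: b adj_def)
  then have n: "\<not> ST l n (st i \<circ> y)" using ST_swap_nonadj[OF y i] by blast
  have r: "tcontent u y (Suc i) - tcontent u y i = - 1" by (simp add: content_eq b cont_def)
  obtain v' where "S i v = (1 / (tcontent u y (Suc i) - tcontent u y i)) *s v + v'" "ST l n (st i \<circ> y) \<or> v' = 0"
    by (rule W_swap_full[OF y i v])
  then show ?thesis unfolding r using n by simp
qed

text \<open>Entries that are neighbours in a row of the initial tableau have contents differing by
  1, so the generators of the row stabiliser fix \<open>v\<close>; the sum over it acts by its
  order.\<close>

lemma mop_init_W:
  assumes v: "v \<in> W n t0"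
  shows "mop t0 v = r_init l u lam *s v"
proof -
  note I = Std_ST[OF lam init_tab_Std[OF lam]]
  have vM: "v \<in> M" by (rule W_M[OF v])
  have fixv: "opr (hperm l n u w) v = v" if "w \<in> young l n lam" for w
  proof -
    have "w permutes {1..n}" by (rule young_permutes[OF that])
    then have "w \<in> young l n lam \<longrightarrow> opr (hperm l n u w) v = v"
    proof (induction rule: perm_induct)
      case id
      then show ?case using opr_hperm_id[OF vM] by blast
    next
      case (step w i)
      show ?case
      proof
        assume w: "w \<in> young l n lam"
        note r = young_descent[OF lam w step(2,3)]
        have ws: "w \<circ> st i \<in> young l n lam" by (rule young_swap(1)[OF lam w step(2) r])
        have "w \<circ> st i \<circ> st i = w" by (simp add: fun_eq_iff)
        then have "opr (hperm l n u w) v = S i (opr (hperm l n u (w \<circ> st i)) v)"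
          using opr_hperm_comp_st[OF young_permutes[OF ws] step(2) vM] by simp
        also have "\<dots> = S i v" using step(4) ws by (simp del: comp_apply)
        also have "\<dots> = v"
          using init_tab_row_adj[OF lam step(2) r] S_row[OF I step(2) v] by metis
        finally show "opr (hperm l n u w) v = v" .
      qed
    qed
    then show ?thesis using that by blast
  qed
  have x: "opr (young_sum l n u lam) v = of_nat (card (young l n lam)) *s v"
  proof -
    have "opr (young_sum l n u lam) v = (\<Sum>w\<in>young l n lam. opr (hperm l n u w) v)"
      unfolding young_sum_def
      by (rule opr_finsum) (use finite_young vM in \<open>auto intro!: hperm_closed young_permutes\<close>)
    also have "\<dots> = (\<Sum>w\<in>young l n lam. v)" by (rule sum.cong) (use fixv in auto)
    also have "\<dots> = of_nat (card (young l n lam)) *s v"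
      using scale_sum_left[of "\<lambda>_. 1" "young l n lam" v] by simp
    finally show ?thesis .
  qed
  have "mop t0 v = ((\<Prod>c=2..l. \<Prod>k=1..(\<Sum>c'=1..<c. psize (lam c')). tcontent u t0 k - u c) *
      of_nat (card (young l n lam))) *s v"
    unfolding mop_init[OF vM] u_prod_W[OF v] opr_scale_right[OF young_sum_closed vM] x by simp
  then show ?thesis
    unfolding r_init_def init_tab_content_prod[OF lam] card_young[OF lam] by (simp add: mult.commute of_nat_prod)
qed

text \<open>In the first case of \<open>std_deviation\<close> a factor \<open>L_k - u_c\<close>
  vanishes on \<open>v\<close>. In the second the sum over the row stabiliser kills
  \<open>v\<close>: the entry that starts the next row too early is moved down to its predecessor in
  the first column, where a generator that the sum absorbs acts by -1.\<close>

lemma mop_init_zero: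
  assumes y: "y \<in> Std l n lam" and ne: "y \<noteq> t0" and v: "v \<in> W n y"
  shows "mop t0 v = 0"
  using lam y ne
proof (cases rule: std_deviation)
  case (comp k c)
  have "tcontent u y k - u c = 0" using comp by (simp add: content_eq cont_def)
  then have "(\<Prod>k=1..(\<Sum>c'=1..<c. psize (lam c')). tcontent u y k - u c) = 0"
    using comp(2) by (subst prod_zero_iff) auto
  then have z: "(\<Prod>c=2..l. \<Prod>k=1..(\<Sum>c'=1..<c. psize (lam c')). tcontent u y k - u c) = 0"
    using comp(1) by (subst prod_zero_iff) auto
  show ?thesis
    unfolding mop_init[OF W_M[OF v]] u_prod_W[OF v] z scale_zero_left by (rule opr_zero_right[OF young_sum_closed])
next
  case (row i c p q)
  let ?X = "opr (young_sum l n u lam)"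
  have rowq: "rowk l lam m = rowk l lam (Suc m)" if "p \<le> m" "Suc m \<le> q" for m
    using row(6)[of "m - p"] row(6)[of "Suc m - p"] that by (simp add: Suc_diff_le)
  \<comment> \<open>Induction on the entry \<open>q'\<close> that starts the next row.
    \<open>?X\<close> absorbs \<open>S m\<close>, and \<open>S m\<close> either changes the sign of
    \<open>w\<close> or yields, next to a multiple of \<open>w\<close>, a vector for
    \<open>q' - 1\<close>.\<close>
  have "?X w = 0" if "y \<in> Std l n lam" "w \<in> W n y" "y (Suc i, 1, c) = q'" "p < q'" "q' \<le> q"
      "\<And>e. p + e < q' \<Longrightarrow> y (i, Suc e, c) = p + e" for q' y w
    using that
  proof (induction q' arbitrary: y w rule: less_induct)
    case (less q')
    note y = less.prems(1) and w = less.prems(2)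
    have Y: "ST l n y" by (rule Std_ST[OF lam y])
    have wM: "w \<in> M" by (rule W_M[OF w])
    define m where "m = q' - 1"
    have m: "q' = Suc m" "p \<le> m" "m \<in> {1..<n}" using less.prems row by (auto simp: m_def)
    have bq: "bx y (Suc m) = (Suc i, 1, c)" by (rule bx_eq[OF Y]) (use less.prems m in auto)
    have bm: "bx y m = (i, Suc (m - p), c)" by (rule bx_eq[OF Y]) (use less.prems(6)[of "m - p"] m in auto)
    have X: "?X (S m w) = ?X w" by (rule young_sum_S[OF m(3) rowq wM]) (use m less.prems in auto)
    show ?case
    proof (cases "m = p")
      case True
      then have "S m w = - w" using S_column[OF Y m(3) w] bm bq by simp
      then have "?X w = - ?X w" using X opr_scale_right[OF young_sum_closed wM, where c = "- 1"] by simp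
      then have "(1 + 1) *s ?X w = 0"
        unfolding scale_left_distrib scale_one by (simp only: eq_neg_iff_add_eq_0)
      moreover have "(2 :: 'k) \<noteq> 0" using char[of 2] m nN by auto
      ultimately show ?thesis by (simp only: one_add_one scale_eq_0_iff) simp
    next
      case False
      have na: "\<not> adj (bx y m) (bx y (Suc m))" unfolding bm bq adj_def using False m by auto
      let ?\<rho> = "tcontent u y (Suc m) - tcontent u y m"
      have s: "ST l n (st m \<circ> y)" by (rule ST_swap[OF Y m(3) na])
      have sS: "st m \<circ> y \<in> Std l n lam" using Std_swap[OF lam y _ s] m by simp
      obtain \<alpha> w' where w': "S m w = \<alpha> *s w + w'" "w' \<in> W n (st m \<circ> y)" "\<alpha> = 1 / ?\<rho>"
        by (rule Std_W_swap[OF y m(3) w])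
      have "?X w' = 0"
      proof (rule less.IH[of m, OF _ sS w'(2)])
        show "(st m \<circ> y) (Suc i, 1, c) = m" using less.prems(3) m by (simp add: st_apply)
        show "(st m \<circ> y) (i, Suc e, c) = p + e" if "p + e < m" for e
          using less.prems(6)[of e] that m by (simp add: st_apply)
      qed (use m False less.prems in auto)
      then have "?X w = \<alpha> *s ?X w"
        using X w' wM W_M[OF w'(2)] by (simp add: opr_plus_right opr_scale_right young_sum_closed M_scale)
      then have "(1 - \<alpha>) *s ?X w = 0" by (simp add: scale_left_diff_distrib)
      moreover have "1 - \<alpha> \<noteq> 0"
        using content_nonadj[OF Y nN m(3) na] w'(3) by auto
      ultimately show ?thesis by simp
    qed
  qed
  then have "?X v = 0" using y v row by blast
  then show ?thesis
    using mop_init[OF W_M[OF v]] u_prod_W[OF v] opr_scale_right[OF young_sum_closed W_M[OF v]] by simp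
qed

text \<open>A descent of \<open>s\<close> moves one generator onto the vector, and this changes the
  length of its weight by at most one.\<close>

lemma mop_triangular:
  assumes s: "s \<in> Std l n lam" and y: "y \<in> Std l n lam" and v: "v \<in> W n y" and nz: "mop s v \<noteq> 0"
  shows "y = s \<or> tlen l n lam y < tlen l n lam s"
  using lam s y v nz
proof (induction arbitrary: y v rule: std_induct)
  case init
  then show ?case using mop_init_zero by blast
next
  case (step t i)
  let ?s = "st i \<circ> t"
  note y = step.prems(1) and v = step.prems(2)
  have len: "tlen l n lam t = Suc (tlen l n lam ?s)" by (rule tlen_descent[OF lam step.hyps(1-3)])
  have vM: "v \<in> M" by (rule W_M[OF v])
  obtain \<alpha> v' where v': "S i v = \<alpha> *s v + v'" "v' \<in> W n (st i \<circ> y)" "st i \<circ> y \<in> Std l n lam \<or> v' = 0"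
    by (rule Std_W_swap[OF y step.hyps(2) v])
  have "mop t v = mop ?s (S i v)"
    using mop_swap[OF step.hyps(4,2) _ vM] step.hyps(1) by (simp only: swap_swap)
  also have "\<dots> = \<alpha> *s mop ?s v + mop ?s v'"
    using v' vM W_M[OF v'(2)] step.hyps(4) by (simp add: mop_add mop_scale M_scale)
  finally have "mop ?s v \<noteq> 0 \<or> mop ?s v' \<noteq> 0" using step.prems(3) by auto
  then show ?case
  proof
    assume "mop ?s v \<noteq> 0"
    then have "y = ?s \<or> tlen l n lam y < tlen l n lam ?s" by (rule step.IH[OF y v])
    then show ?thesis using len by auto
  next
    assume nz: "mop ?s v' \<noteq> 0"
    then have sy: "st i \<circ> y \<in> Std l n lam" using v'(3) mop_zero[OF step.hyps(4)] by auto
    then have "st i \<circ> y = ?s \<or> tlen l n lam (st i \<circ> y) < tlen l n lam ?s"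
      using step.IH[OF _ v'(2) nz] by blast
    then show ?thesis
    proof
      assume "st i \<circ> y = ?s"
      then have "y = t" by (metis swap_swap)
      then show ?thesis by simp
    next
      assume "tlen l n lam (st i \<circ> y) < tlen l n lam ?s"
      then show ?thesis using tlen_swap_le[OF lam y step.hyps(2) sy] len by simp
    qed
  qed
qed

text \<open>The part of \<open>S i v\<close> of weight \<open>t\<close> is killed, since
  \<open>t\<close> is longer than its swap; only the part of the swapped weight contributes.\<close>

lemma mop_descent:
  assumes t: "t \<in> Std l n lam" and i: "i \<in> {1..<n}" and d: "descent t i" and s: "st i \<circ> t \<in> Std l n lam"
    and v: "v \<in> W n t" and v': "S i v = \<alpha> *s v + v'" "v' \<in> W n (st i \<circ> t)"
  shows "mop t v = mop (st i \<circ> t) v'"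
proof -
  let ?s = "st i \<circ> t"
  have vM: "v \<in> M" by (rule W_M[OF v])
  have "mop ?s v = 0"
  proof (rule ccontr)
    assume "mop ?s v \<noteq> 0"
    then have "t = ?s \<or> tlen l n lam t < tlen l n lam ?s" by (rule mop_triangular[OF s t v])
    then show False using tlen_descent[OF lam t i d] by auto
  qed
  moreover have "mop t v = mop ?s (S i v)" using mop_swap[OF s i _ vM] t by (simp only: swap_swap)
  ultimately show ?thesis
    using v' vM W_M[OF v'(2)] s by (simp add: mop_add mop_scale M_scale)
qed

lemma mop_W_init:
  assumes "t \<in> Std l n lam" "v \<in> W n t"
  shows "mop t v \<in> W n t0"
  using lam assms
proof (induction arbitrary: v rule: std_induct)
  case init
  then show ?case using mop_init_W W_subspace[of n t0] by (simp add: subspace_scale)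
next
  case (step t i)
  obtain \<alpha> v' where v': "S i v = \<alpha> *s v + v'" "v' \<in> W n (st i \<circ> t)"
    by (rule Std_W_swap[OF step.hyps(1,2) step.prems])
  then show ?case using mop_descent[OF step.hyps(1-4) step.prems v'] step.IH[OF v'(2)] by (simp del: comp_apply)
qed

definition Low :: "tableau \<Rightarrow> 'v set" where
  "Low t = span (\<Union>y\<in>{y\<in>Std l n lam. tlen l n lam y < tlen l n lam t}. W n y)"

lemma Low_M: "w \<in> Low t \<Longrightarrow> w \<in> M"
proof -
  have "Low t \<subseteq> M" unfolding Low_def by (rule span_minimal) (use W_M subspace_M in auto)
  then show "w \<in> Low t \<Longrightarrow> w \<in> M" by blast
qed

lemma W_Low: "y \<in> Std l n lam \<Longrightarrow> tlen l n lam y < tlen l n lam t \<Longrightarrow> w \<in> W n y \<Longrightarrow> w \<in> Low t"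
  unfolding Low_def by (rule span_base) blast

lemma Low_F:
  assumes "w \<in> Low t" "t \<in> Std l n lam"
  shows "F t w = 0"
proof -
  have "w \<in> M \<and> F t w = 0"
    using assms(1) unfolding Low_def
  proof (induction rule: span_induct_alt)
    case base
    then show ?case using M_zero F_zero by simp
  next
    case (step c x y)
    then obtain z where z: "z \<in> Std l n lam" "tlen l n lam z < tlen l n lam t" "x \<in> W n z" by blast
    have "F t x = 0" using opr_F[OF Std_ST[OF lam assms(2)] Std_ST[OF lam z(1)] z(3)] z(2) by auto
    then show ?case using step W_M[OF z(3)] by (simp add: F_add F_scale M_simps)
  qed
  then show ?thesis by simp
qed

lemma Low_S:
  assumes t: "t \<in> Std l n lam" "i \<in> {1..<n}" "descent t i" and w: "w \<in> Low (st i \<circ> t)"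
  shows "S i w \<in> Low t"
proof -
  have len: "tlen l n lam t = Suc (tlen l n lam (st i \<circ> t))" by (rule tlen_descent[OF lam t])
  have "w \<in> M \<and> S i w \<in> Low t"
    using w unfolding Low_def[of "st i \<circ> t"]
  proof (induction rule: span_induct_alt)
    case base
    then show ?case using M_zero t by (simp add: S_zero Low_def span_zero)
  next
    case (step c x z)
    then obtain y where y: "y \<in> Std l n lam" "tlen l n lam y < tlen l n lam (st i \<circ> t)" "x \<in> W n y" by blast
    obtain \<alpha> x' where x': "S i x = \<alpha> *s x + x'" "x' \<in> W n (st i \<circ> y)" "st i \<circ> y \<in> Std l n lam \<or> x' = 0"
      by (rule Std_W_swap[OF y(1) t(2) y(3)])
    have "x \<in> Low t" by (rule W_Low[OF y(1) _ y(3)]) (use y len in simp)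
    moreover have "x' \<in> Low t"
    proof (cases "st i \<circ> y \<in> Std l n lam")
      case True
      have "tlen l n lam (st i \<circ> y) \<le> Suc (tlen l n lam y)"
        using tlen_swap_le[OF lam True t(2)] y(1) by (simp only: swap_swap)
      then show ?thesis using W_Low[OF True _ x'(2)] y len by simp
    next
      case False
      then show ?thesis using x' by (simp add: Low_def span_zero)
    qed
    ultimately have "S i x \<in> Low t" unfolding x' Low_def by (intro span_add span_scale)
    moreover have "x \<in> M" by (rule W_M[OF y(3)])
    ultimately show ?case
      using step t(2) by (simp add: S_add S_scale M_simps Low_def span_add span_scale)
  qed
  then show ?thesis by simp
qed

text \<open>Along a reduced word for \<open>d(t)\<close> each generator produces the wanted weight
  plus weights of shorter tableaux, and by \<open>Low_S\<close> the latter stay behind in all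
  further steps.\<close>

lemma dinv_triangular:
  assumes "t \<in> Std l n lam" "v \<in> W n t0"
  shows "\<exists>a\<in>W n t. \<exists>b\<in>Low t. dinv t v = a + b"
  using lam assms(1)
proof (induction rule: std_induct)
  case init
  have "0 \<in> Low t0" by (simp add: Low_def span_zero)
  then show ?case using assms(2) dinv_init[OF W_M[OF assms(2)]] by (intro bexI[of _ v] bexI[of _ 0]) auto
next
  case (step t i)
  let ?s = "st i \<circ> t"
  have vM: "v \<in> M" by (rule W_M[OF assms(2)])
  from step.IH obtain a b where ab: "a \<in> W n ?s" "b \<in> Low ?s" "dinv ?s v = a + b" by blast
  have M: "a \<in> M" "b \<in> M" using W_M[OF ab(1)] Low_M[OF ab(2)] .
  have "dinv t v = S i (dinv ?s v)" using dinv_swap[OF step.hyps(4,2) _ vM] step.hyps(1) by (simp only: swap_swap)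
  also have "\<dots> = S i a + S i b" using ab M step.hyps(2) by (simp add: S_add)
  finally have e: "dinv t v = S i a + S i b" .
  obtain \<alpha> a' where a': "S i a = \<alpha> *s a + a'" "a' \<in> W n (st i \<circ> ?s)"
    by (rule Std_W_swap[OF step.hyps(4,2) ab(1)])
  have "a' \<in> W n t" using a'(2) by (simp only: swap_swap)
  moreover have "\<alpha> *s a + S i b \<in> Low t"
  proof -
    have "a \<in> Low t" by (rule W_Low[OF step.hyps(4) _ ab(1)]) (use tlen_descent[OF lam step.hyps(1-3)] in simp)
    moreover have "S i b \<in> Low t" by (rule Low_S[OF step.hyps(1-3) ab(2)])
    ultimately show ?thesis unfolding Low_def by (intro span_add span_scale)
  qed
  moreover have "dinv t v = a' + (\<alpha> *s a + S i b)" using e a' by (simp add: algebra_simps)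
  ultimately show ?case by blast
qed

text \<open>The part of lower length never returns to the weight \<open>t\<close>, so it may be cut
  off by a projection before \<open>S i\<close> is applied. This makes the left index accessible to
  recursion.\<close>

lemma F_dinv_descent:
  assumes t: "t \<in> Std l n lam" "i \<in> {1..<n}" "descent t i" "st i \<circ> t \<in> Std l n lam" and v: "v \<in> W n t0"
  shows "F t (dinv t v) = F t (S i (F (st i \<circ> t) (dinv (st i \<circ> t) v)))"
proof -
  let ?s = "st i \<circ> t"
  have vM: "v \<in> M" by (rule W_M[OF v])
  obtain a b where ab: "a \<in> W n ?s" "b \<in> Low ?s" "dinv ?s v = a + b"
    using dinv_triangular[OF t(4) v] by blast
  have M: "a \<in> M" "b \<in> M" using W_M[OF ab(1)] Low_M[OF ab(2)] .
  have "F ?s (dinv ?s v) = a"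
    using ab M Low_F[OF ab(2) t(4)] F_W[OF Std_ST[OF lam t(4)] ab(1)] by (simp add: F_add)
  moreover have "dinv t v = S i (dinv ?s v)" using dinv_swap[OF t(4,2) _ vM] t(1) by (simp only: swap_swap)
  moreover have "F t (S i b) = 0" by (rule Low_F[OF Low_S[OF t(1-3) ab(2)] t(1)])
  ultimately show ?thesis using ab M t(2) by (simp add: S_add F_add M_simps)
qed

section \<open>Recursions for the action of \<open>f_st\<close>\<close>

definition fop :: "tableau \<Rightarrow> tableau \<Rightarrow> 'v \<Rightarrow> 'v" where
  "fop s t v = opr (seminormal_f l n u lam s t) v"

lemma fop_eq:
  assumes "s \<in> Std l n lam" "t \<in> Std l n lam" "v \<in> M"
  shows "fop s t v = F s (dinv s (mop t (F t v)))"
proof -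
  interpret R: ring H by (rule ring_hecke)
  show ?thesis
    unfolding fop_def seminormal_f_def seminormal_m_eq mop_def dinv_def
    using assms d_closed young_sum_closed[of l n u lam] u_prod_closed[OF lam, of u] seminormal_F_closed[of l n u]
    by (simp add: opr_mult opr_closed R.m_closed)
qed

lemma fop_W:
  assumes "s \<in> Std l n lam" "t \<in> Std l n lam" "v \<in> W n t"
  shows "fop s t v = F s (dinv s (mop t v))"
  using fop_eq[OF assms(1,2) W_M[OF assms(3)]] F_W[OF Std_ST[OF lam assms(2)] assms(3)] by simp

lemma fop_W_ne:
  assumes "s \<in> Std l n lam" "t \<in> Std l n lam" "ST l n y" "v \<in> W n y" "y \<noteq> t"
  shows "fop s t v = 0"
proof -
  have "F t v = 0" using opr_F[OF Std_ST[OF lam assms(2)] assms(3,4)] assms(5) by auto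
  moreover have "dinv s 0 = 0"
    using d_closed(2)[OF assms(1)] by (simp add: dinv_def opr_zero_right)
  ultimately show ?thesis
    using fop_eq[OF assms(1,2) W_M[OF assms(4)]] mop_zero[OF assms(2)] F_zero by simp
qed

lemma fop_in_W:
  assumes "s \<in> Std l n lam" "t \<in> Std l n lam" "v \<in> M"
  shows "fop s t v \<in> W n s"
  unfolding fop_eq[OF assms] using assms
  by (intro F_in_W Std_ST[OF lam] dinv_closed mop_closed F_closed)

text \<open>This recursion and the next one involve only a generator and weight components, which
  are compatible with restriction to the smaller algebra. This is why the comparison in
  \<open>fop_branch\<close> can run along them.\<close>

lemma fop_right_descent:
  assumes x: "x \<in> Std l n lam" and t: "t \<in> Std l n lam" "i \<in> {1..<n}" "descent t i" "st i \<circ> t \<in> Std l n lam"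
    and v: "v \<in> W n t" and v': "S i v = \<alpha> *s v + v'" "v' \<in> W n (st i \<circ> t)"
  shows "fop x t v = fop x (st i \<circ> t) v'"
  using fop_W[OF x t(1) v] fop_W[OF x t(4) v'(2)] mop_descent[OF t v v'] by simp

lemma fop_left_descent:
  assumes x: "x \<in> Std l n lam" and t: "t \<in> Std l n lam" "i \<in> {1..<n}" "descent t i" "st i \<circ> t \<in> Std l n lam"
    and v: "v \<in> W n x"
  shows "fop t x v = F t (S i (fop (st i \<circ> t) x v))"
  using fop_W[OF t(1) x v] fop_W[OF t(4) x v] F_dinv_descent[OF t mop_W_init[OF x v]] by simp

lemma fop_init_diag:
  assumes v: "v \<in> W n t0"
  shows "fop t0 t0 v = r_init l u lam *s v"
proof -
  note I = init_tab_Std[OF lam]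
  have "r_init l u lam *s v \<in> W n t0" using v W_subspace[of n t0] by (simp add: subspace_scale)
  then show ?thesis
    using fop_W[OF I I v] mop_init_W[OF v] F_W[OF Std_ST[OF lam I]] W_M dinv_init by simp
qed

text \<open>As \<open>S i\<close> is an involution, the component of weight \<open>t\<close> in
  \<open>S i v'\<close> must complement the contribution \<open>\<alpha>^2\<close> of
  \<open>v\<close> itself to 1.\<close>

lemma S_swap_back:
  assumes t: "ST l n t" "i \<in> {1..<n}" "ST l n (st i \<circ> t)" and v: "v \<in> W n t"
    and v': "S i v = \<alpha> *s v + v'" "v' \<in> W n (st i \<circ> t)"
  shows "F t (S i v') = (1 - \<alpha>\<^sup>2) *s v"
proof -
  have M: "v \<in> M" "v' \<in> M" using W_M v v' by auto
  have "S i (S i v) = S i (\<alpha> *s v + v')" by (rule arg_cong[OF v'(1)])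
  also have "\<dots> = \<alpha> *s S i v + S i v'" using M t by (simp add: S_add S_scale M_simps)
  finally have "v = \<alpha> *s S i v + S i v'" using S_sq[OF t(2) M(1)] by simp
  then have "S i v' = v - \<alpha> *s S i v" by (metis add_diff_cancel_left')
  then have "S i v' = v - \<alpha> *s (\<alpha> *s v + v')" unfolding v'(1) .
  then have e: "S i v' = (1 - \<alpha>\<^sup>2) *s v + (- \<alpha>) *s v'"
    by (simp add: scale_left_diff_distrib scale_right_distrib power2_eq_square scale_minus_left)
  have "st i \<circ> t \<noteq> t"
    using t_bx[OF t(1), of i] t(2) by (metis atLeastAtMost_iff atLeastLessThan_iff comp_apply n_not_Suc_n order.strict_implies_order transpose_apply_first)
  then have "F t v' = 0" using opr_F[OF t(1,3) v'(2)] by auto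
  have "F t ((1 - \<alpha>\<^sup>2) *s v + (- \<alpha>) *s v') = F t ((1 - \<alpha>\<^sup>2) *s v) + F t ((- \<alpha>) *s v')"
    by (rule F_add[OF M_scale[OF M(1)] M_scale[OF M(2)]])
  also have "\<dots> = (1 - \<alpha>\<^sup>2) *s v"
    unfolding F_scale[OF M(1)] F_scale[OF M(2)] F_W[OF t(1) v] \<open>F t v' = 0\<close> by simp
  finally show ?thesis unfolding e .
qed

lemma fop_diag_descent:
  assumes t: "t \<in> Std l n lam" "i \<in> {1..<n}" "descent t i" "st i \<circ> t \<in> Std l n lam"
    and c: "\<And>w. w \<in> W n (st i \<circ> t) \<Longrightarrow> fop (st i \<circ> t) (st i \<circ> t) w = c *s w" and v: "v \<in> W n t"
  shows "fop t t v = (c * (1 - (1 / (tcontent u t (Suc i) - tcontent u t i))\<^sup>2)) *s v"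
proof -
  let ?s = "st i \<circ> t"
  note T = Std_ST[OF lam t(1)] and Ss = Std_ST[OF lam t(4)]
  obtain \<alpha> v' where v': "S i v = \<alpha> *s v + v'" "v' \<in> W n ?s" "\<alpha> = 1 / (tcontent u t (Suc i) - tcontent u t i)"
    by (rule Std_W_swap[OF t(1,2) v])
  have "fop t t v = F t (S i (fop ?s t v))" by (rule fop_left_descent[OF t(1) t v])
  also have "fop ?s t v = fop ?s ?s v'" by (rule fop_right_descent[OF t(4) t v v'(1,2)])
  also have "\<dots> = c *s v'" by (rule c[OF v'(2)])
  finally have "fop t t v = c *s F t (S i v')"
    using W_M[OF v'(2)] t(2) by (simp add: S_scale F_scale M_simps)
  then show ?thesis using S_swap_back[OF T t(2) Ss v v'(1,2)] v'(3) by simp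
qed

lemma descent_factor_nonzero:
  assumes t: "t \<in> Std l n lam" "i \<in> {1..<n}" "st i \<circ> t \<in> Std l n lam"
  shows "1 - (1 / (tcontent u t (Suc i) - tcontent u t i))\<^sup>2 \<noteq> 0"
proof -
  note T = Std_ST[OF lam t(1)] and Ss = Std_ST[OF lam t(3)]
  have "\<not> adj (bx t i) (bx t (Suc i))" by (rule ST_swap_nonadj[OF T t(2) Ss])
  then have "tcontent u t (Suc i) - tcontent u t i \<notin> {0, 1, - 1}" by (rule content_nonadj[OF T nN t(2)])
  then show ?thesis by (auto simp: power2_eq_1_iff power_one_over divide_simps)
qed

text \<open>The scalar is obtained without reference to \<open>r\<close>, whose existence is deduced
  from it in \<open>r_coeffs_exist\<close>.\<close>

lemma fop_diag_exists:
  assumes "t \<in> Std l n lam"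
  shows "\<exists>c. c \<noteq> 0 \<and> (\<forall>v\<in>W n t. fop t t v = c *s v)"
  using lam assms
proof (induction rule: std_induct)
  case init
  then show ?case using fop_init_diag r_init_nonzero[OF lam nN] by blast
next
  case (step t i)
  from step.IH obtain c where c: "c \<noteq> 0" "\<And>v. v \<in> W n (st i \<circ> t) \<Longrightarrow> fop (st i \<circ> t) (st i \<circ> t) v = c *s v" by blast
  show ?case
    using fop_diag_descent[OF step.hyps(1-4) c(2)] c(1) descent_factor_nonzero[OF step.hyps(1,2,4)]
    by (intro exI[of _ "c * (1 - (1 / (tcontent u t (Suc i) - tcontent u t i))\<^sup>2)"]) auto
qed

text \<open>If \<open>S i w\<close> had no component of weight \<open>t\<close>, then
  \<open>w\<close> would be an eigenvector of an involution with eigenvalue \<open>\<alpha>\<close>;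
  but \<open>\<alpha>^2\<close> is not 1 when the swap is standard.\<close>

lemma fop_nonzero_descent:
  assumes x: "x \<in> Std l n lam" and t: "t \<in> Std l n lam" "i \<in> {1..<n}" "descent t i" "st i \<circ> t \<in> Std l n lam"
    and v: "v \<in> W n x"
  shows "fop t x v \<noteq> 0 \<longleftrightarrow> fop (st i \<circ> t) x v \<noteq> 0"
proof -
  let ?s = "st i \<circ> t"
  note T = Std_ST[OF lam t(1)] and Ss = Std_ST[OF lam t(4)]
  define w where "w = fop ?s x v"
  have w: "w \<in> W n ?s" unfolding w_def by (rule fop_in_W[OF t(4) x W_M[OF v]])
  have e: "fop t x v = F t (S i w)" unfolding w_def by (rule fop_left_descent[OF x t v])
  have zero: "F t (S i 0) = 0" using t by (simp add: S_zero F_zero)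
  obtain \<alpha> w' where w': "S i w = \<alpha> *s w + w'" "w' \<in> W n (st i \<circ> ?s)"
    "\<alpha> = 1 / (tcontent u ?s (Suc i) - tcontent u ?s i)"
    by (rule Std_W_swap[OF t(4,2) w])
  have w't: "w' \<in> W n t" using w'(2) by (simp only: swap_swap)
  have M: "w \<in> M" "w' \<in> M" using W_M w w't by auto
  have "t \<noteq> ?s" using tlen_descent[OF lam t(1-3)] by auto
  then have "F t w = 0" using opr_F[OF T Ss w] by auto
  then have Fw: "F t (S i w) = w'" unfolding w'(1) using M F_W[OF T w't] by (simp add: F_add F_scale M_simps)
  have "w = 0" if "w' = 0"
  proof -
    have "S i w = \<alpha> *s w" using w' that by simp
    then have "w = \<alpha>\<^sup>2 *s w" using S_sq[OF t(2) M(1)] S_scale[OF t(2) M(1)] by (simp add: power2_eq_square)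
    then have "(1 - \<alpha>\<^sup>2) *s w = 0" by (simp add: scale_left_diff_distrib)
    moreover have "st i \<circ> ?s \<in> Std l n lam" using t(1) by (simp only: swap_swap)
    ultimately show ?thesis using descent_factor_nonzero[OF t(4,2)] unfolding w'(3) by simp
  qed
  then show ?thesis unfolding e Fw using zero Fw w_def by auto
qed

text \<open>Every left index is linked to the initial tableau, and through it to \<open>t\<close>
  itself, where the action is by a nonzero scalar. This is the source of the linear independence of
  the \<open>f_st\<close>.\<close>

lemma fop_nonzero:
  assumes s: "s \<in> Std l n lam" and t: "t \<in> Std l n lam" and v: "v \<in> W n t" "v \<noteq> 0"
  shows "fop s t v \<noteq> 0"
proof -
  have iff: "fop x t v \<noteq> 0 \<longleftrightarrow> fop t0 t v \<noteq> 0" if "x \<in> Std l n lam" for x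
    using lam that
  proof (induction rule: std_induct)
    case (step x i)
    show ?case using fop_nonzero_descent[OF t step.hyps(1-4) v(1)] step.IH by blast
  qed simp
  have "fop t t v \<noteq> 0" using fop_diag_exists[OF t] v by auto
  then show ?thesis using iff[OF s] iff[OF t] by simp
qed

lemma fop_diag_r:
  assumes r: "is_r_coeffs l n u r" and t: "t \<in> Std l n lam" and v: "v \<in> W n t"
  shows "fop t t v = r t *s v"
  using lam t v
proof (induction arbitrary: v rule: std_induct)
  case init
  then show ?case using fop_init_diag r lam by (simp add: is_r_coeffs_def)
next
  case (step t i)
  show ?case
    using fop_diag_descent[OF step.hyps(1-4) step.IH step.prems]
    unfolding is_r_coeffs_descent[OF r lam step.hyps(1-4) nN] .
qed

end

end

section \<open>The seminormal module\<close>

text \<open>The sum of the seminormal representations for all shapes of size \<open>n\<close>, in a basis indexed by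
  tableaux and normalised so that no square roots or choices are needed.\<close>

definition snM :: "nat \<Rightarrow> nat \<Rightarrow> (tableau \<Rightarrow> 'k::field) set" where
  "snM l n = {g. \<forall>t. \<not> ST l n t \<longrightarrow> g t = 0}"

definition sn_coeff :: "(nat \<Rightarrow> 'k::field) \<Rightarrow> nat \<Rightarrow> tableau \<Rightarrow> 'k" where
  "sn_coeff u i t = 1 / (tcontent u t (Suc i) - tcontent u t i)"

text \<open>Young's seminormal form in coordinates. The off-diagonal entries are
  \<open>1 + \<alpha>\<close> at \<open>t\<close> and \<open>1 - \<alpha>\<close> at the swap, with
  product \<open>1 - \<alpha>^2\<close>. If the swap is not standard, \<open>g\<close> vanishes
  there and \<open>\<alpha>\<close> is 1 or -1.\<close>

definition snS :: "nat \<Rightarrow> nat \<Rightarrow> (nat \<Rightarrow> 'k::field) \<Rightarrow> nat \<Rightarrow> (tableau \<Rightarrow> 'k) \<Rightarrow> tableau \<Rightarrow> 'k" where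
  "snS l n u i g t = (if ST l n t then sn_coeff u i t * g t + (1 + sn_coeff u i t) * g (st i \<circ> t) else 0)"

definition snL :: "nat \<Rightarrow> nat \<Rightarrow> (nat \<Rightarrow> 'k::field) \<Rightarrow> nat \<Rightarrow> (tableau \<Rightarrow> 'k) \<Rightarrow> tableau \<Rightarrow> 'k" where
  "snL l n u k g t = (if ST l n t then tcontent u t k * g t else 0)"

lemma sn_ops: "hecke_ops fscale n (snM l n) (snS l n u) (snL l n (u :: nat \<Rightarrow> 'k::field))"
proof -
  interpret V: vector_space "fscale :: 'k \<Rightarrow> (tableau \<Rightarrow> 'k) \<Rightarrow> tableau \<Rightarrow> 'k" by (rule vector_space_fscale)
  show ?thesis
  proof
    show "V.subspace (snM l n)" by (rule V.subspaceI) (auto simp: snM_def fscale_def)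
  qed (auto simp: snM_def snS_def snL_def fscale_def fun_eq_iff algebra_simps)
qed

context separated begin

lemma first_content: "ST l n t \<Longrightarrow> 1 \<le> n \<Longrightarrow> \<exists>c\<in>{1..l}. tcontent u t 1 = u c"
proof -
  assume t: "ST l n t" and n: "1 \<le> n"
  obtain i j c where b: "bx t 1 = (i, j, c)" by (cases "bx t 1")
  have t1: "t (i, j, c) = 1" using t_bx[OF t, of 1] n b by simp
  have v: "1 \<le> i" "1 \<le> j" "1 \<le> c" "c \<le> l" using ST_valid[OF t, of "(i, j, c)"] t1 by (auto simp: valid_box_def)
  have "i = 1"
  proof (rule ccontr)
    assume "i \<noteq> 1"
    then have "adj (i - 1, j, c) (i, j, c)" "valid_box l (i - 1, j, c)" using v by (auto simp: adj_def valid_box_def)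
    then show False using ST_adj[OF t] t1 by fastforce
  qed
  moreover have "j = 1"
  proof (rule ccontr)
    assume "j \<noteq> 1"
    then have "adj (i, j - 1, c) (i, j, c)" "valid_box l (i, j - 1, c)" using v by (auto simp: adj_def valid_box_def)
    then show False using ST_adj[OF t] t1 by fastforce
  qed
  ultimately show ?thesis using v b by (intro bexI[of _ c]) (auto simp: content_eq cont_def)
qed

lemma sn_coeff_swap:
  assumes "ST l n t" "i \<in> {1..<n}" "ST l n (st i \<circ> t)"
  shows "sn_coeff u i (st i \<circ> t) = - sn_coeff u i t"
proof -
  have "tcontent u (st i \<circ> t) (Suc i) = tcontent u t i" "tcontent u (st i \<circ> t) i = tcontent u t (Suc i)"
    using content_swap[OF assms, of "Suc i" u] content_swap[OF assms, of i u] assms(2) by (auto simp: st_apply)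
  then show ?thesis unfolding sn_coeff_def by (metis minus_diff_eq minus_divide_right)
qed

lemma sn_coeff_sq:
  assumes "ST l n t" "n \<le> N" "i \<in> {1..<n}" "\<not> ST l n (st i \<circ> t)"
  shows "(sn_coeff u i t)\<^sup>2 = 1"
  using swap_std_iff[OF assms(1-3)] assms(4) by (simp add: sn_coeff_def power_one_over)

lemma snS_ST: "ST l n t \<Longrightarrow> snS l n u i g t = sn_coeff u i t * g t + (1 + sn_coeff u i t) * g (st i \<circ> t)"
  by (simp add: snS_def)

lemma snS_not_ST: "\<not> ST l n t \<Longrightarrow> snS l n u i g t = 0"
  by (simp add: snS_def)

lemma snM_0: "g \<in> snM l n \<Longrightarrow> \<not> ST l n t \<Longrightarrow> g t = 0"
  by (simp add: snM_def)

lemma snS_sq: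
  assumes g: "g \<in> snM l n" and n: "n \<le> N" and i: "i \<in> {1..<n}"
  shows "snS l n u i (snS l n u i g) = g"
proof
  fix t
  show "snS l n u i (snS l n u i g) t = g t"
  proof (cases "ST l n t")
    case t: True
    show ?thesis
    proof (cases "ST l n (st i \<circ> t)")
      case True
      show ?thesis
        unfolding snS_ST[OF t] snS_ST[OF True] sn_coeff_swap[OF t i True] swap_swap by (simp add: algebra_simps)
    next
      case False
      show ?thesis
        unfolding snS_ST[OF t] snS_not_ST[OF False] snM_0[OF g False]
        using sn_coeff_sq[OF t n i False] by (simp add: power2_eq_square flip: mult.assoc)
    qed
  qed (simp add: snS_not_ST snM_0[OF g])
qed

text \<open>A swap fails to be standard only when the boxes of \<open>i\<close> and
  \<open>i + 1\<close> are adjacent, and then every \<open>w\<close> that inverts these entries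
  fails as well. So in longer products all terms beyond a failed swap vanish.\<close>

lemma swap_not_ST:
  assumes t: "ST l n t" and i: "i \<in> {1..<n}" and n: "\<not> ST l n (st i \<circ> t)"
    and w: "w (Suc i) < w i" "0 < w (Suc i)"
  shows "\<not> ST l n (w \<circ> t)"
proof
  assume s: "ST l n (w \<circ> t)"
  have a: "adj (bx t i) (bx t (Suc i))" using ST_swap[OF t i] n by blast
  have "t (bx t i) = i" "t (bx t (Suc i)) = Suc i" using t_bx[OF t] i by auto
  then show False using ST_adj_lt[OF s a] w by simp
qed

lemma snS_far:
  assumes g: "g \<in> snM l n" and i: "i \<in> {1..<n}" and j: "j \<in> {1..<n}" and far: "Suc i < j"
  shows "snS l n u i (snS l n u j g) = snS l n u j (snS l n u i g)"
proof
  fix t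
  show "snS l n u i (snS l n u j g) t = snS l n u j (snS l n u i g) t"
  proof (cases "ST l n t")
    case t: True
    let ?w = "st i \<circ> st j"
    have c: "st j \<circ> (st i \<circ> t) = ?w \<circ> t" "st i \<circ> (st j \<circ> t) = ?w \<circ> t"
      using st_far[OF far] by (simp_all add: comp_assoc) (simp_all flip: comp_assoc)
    have zi: "g (?w \<circ> t) = 0 \<and> g (st i \<circ> t) = 0" if "\<not> ST l n (st i \<circ> t)"
      using snM_0[OF g swap_not_ST[OF t i that, of ?w]] snM_0[OF g that] far i by (simp add: st_apply)
    have zj: "g (?w \<circ> t) = 0 \<and> g (st j \<circ> t) = 0" if "\<not> ST l n (st j \<circ> t)"
      using snM_0[OF g swap_not_ST[OF t j that, of ?w]] snM_0[OF g that] far i by (simp add: st_apply)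
    have cj: "sn_coeff u j (st i \<circ> t) = sn_coeff u j t" if "ST l n (st i \<circ> t)"
      using content_swap[OF t i that, of j u] content_swap[OF t i that, of "Suc j" u] i j far
      by (simp add: sn_coeff_def st_apply)
    have ci: "sn_coeff u i (st j \<circ> t) = sn_coeff u i t" if "ST l n (st j \<circ> t)"
      using content_swap[OF t j that, of i u] content_swap[OF t j that, of "Suc i" u] i j far
      by (simp add: sn_coeff_def st_apply)
    have 1: "snS l n u j g (st i \<circ> t) = sn_coeff u j t * g (st i \<circ> t) + (1 + sn_coeff u j t) * g (?w \<circ> t)"
    proof (cases "ST l n (st i \<circ> t)")
      case True
      then show ?thesis by (simp only: snS_ST[OF True] cj[OF True] c)
    next
      case False
      then show ?thesis using zi[OF False] by (simp add: snS_not_ST[OF False] del: comp_apply)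
    qed
    have 2: "snS l n u i g (st j \<circ> t) = sn_coeff u i t * g (st j \<circ> t) + (1 + sn_coeff u i t) * g (?w \<circ> t)"
    proof (cases "ST l n (st j \<circ> t)")
      case True
      then show ?thesis by (simp only: snS_ST[OF True] ci[OF True] c)
    next
      case False
      then show ?thesis using zj[OF False] by (simp add: snS_not_ST[OF False] del: comp_apply)
    qed
    show ?thesis unfolding snS_ST[OF t] 1 2 by (simp add: algebra_simps)
  qed (simp add: snS_not_ST)
qed

lemma snS_L:
  assumes g: "g \<in> snM l n" and i: "i \<in> {1..<n}" and k: "k \<in> {1..n}" "k \<noteq> i" "k \<noteq> Suc i"
  shows "snS l n u i (snL l n u k g) = snL l n u k (snS l n u i g)"
proof
  fix t
  show "snS l n u i (snL l n u k g) t = snL l n u k (snS l n u i g) t"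
  proof (cases "ST l n t")
    case t: True
    have "snL l n u k g (st i \<circ> t) = tcontent u t k * g (st i \<circ> t)"
      using content_swap[OF t i _ k(1), of u] k snM_0[OF g, of "st i \<circ> t"]
      by (cases "ST l n (st i \<circ> t)") (simp_all add: snL_def st_apply)
    then show ?thesis using t by (simp add: snS_ST snL_def algebra_simps)
  qed (simp add: snS_not_ST snL_def)
qed

lemma snL_Suc:
  assumes g: "g \<in> snM l n" and n: "n \<le> N" and i: "i \<in> {1..<n}"
  shows "snL l n u (Suc i) g = snS l n u i (snL l n u i (snS l n u i g)) + snS l n u i g"
proof
  fix t
  show "snL l n u (Suc i) g t = (snS l n u i (snL l n u i (snS l n u i g)) + snS l n u i g) t"
  proof (cases "ST l n t")
    case t: True
    define c d where "c = tcontent u t i" and "d = tcontent u t (Suc i)"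
    have a: "sn_coeff u i t = 1 / (d - c)" by (simp add: sn_coeff_def c_def d_def)
    have cd: "d - c \<noteq> 0" using content_consec[OF t n i] by (simp add: c_def d_def)
    show ?thesis
    proof (cases "ST l n (st i \<circ> t)")
      case s: True
      have e: "tcontent u (st i \<circ> t) i = d"
        using content_swap[OF t i s, of i u] i by (simp add: d_def st_apply)
      define x g0 g1 where "x = 1 / (d - c)" and "g0 = g t" and "g1 = g (st i \<circ> t)"
      have x: "x * (d - c) = 1" using cd by (simp add: x_def)
      have "x * (c * (x * g0 + (1 + x) * g1)) + (1 + x) * (d * (- x * g1 + (1 + - x) * g0)) + (x * g0 + (1 + x) * g1)
          = d * g0 + (1 - x * (d - c)) * (x * g0 + (1 + x) * g1)"
        by (simp add: algebra_simps)
      also have "\<dots> = d * g0" by (simp add: x)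
      finally show ?thesis
        using t s unfolding plus_fun_def snL_def
        by (simp add: snS_ST e a sn_coeff_swap[OF t i s] swap_swap flip: c_def d_def x_def g0_def g1_def del: comp_apply)
    next
      case s: False
      have "(1 / (d - c))\<^sup>2 = 1" using sn_coeff_sq[OF t n i s] by (simp add: a)
      then have "(d - c)\<^sup>2 = 1" by (simp add: power_one_over)
      then have "1 / (d - c) = d - c" using cd by (simp add: field_simps power2_eq_square)
      then have x: "sn_coeff u i t = d - c" by (simp add: a)
      have "(d - c) * (c * ((d - c) * g t)) + (d - c) * g t = (c * (d - c)\<^sup>2 + (d - c)) * g t"
        by (simp add: algebra_simps power2_eq_square)
      also have "\<dots> = d * g t" unfolding \<open>(d - c)\<^sup>2 = 1\<close> by simp
      finally show ?thesis
        using t s snM_0[OF g s] by (simp add: snS_ST snL_def x plus_fun_def flip: c_def d_def)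
    qed
  qed (simp add: snS_not_ST snL_def)
qed

text \<open>Both sides are expanded in the six tableaux reached from \<open>t\<close>. Their
  difference is a multiple of \<open>p * q - (r * p + q * r)\<close>, which is zero for the
  reciprocals of \<open>b - a\<close>, \<open>c - b\<close> and \<open>c - a\<close>.\<close>

lemma snS_braid:
  assumes g: "g \<in> snM l n" and n: "n \<le> N" and i: "i \<in> {1..<n}" and k: "Suc i < n"
  shows "snS l n u i (snS l n u (Suc i) (snS l n u i g)) = snS l n u (Suc i) (snS l n u i (snS l n u (Suc i) g))"
proof
  fix t
  let ?k = "Suc i"
  have k': "?k \<in> {1..<n}" using k by auto
  show "snS l n u i (snS l n u ?k (snS l n u i g)) t = snS l n u ?k (snS l n u i (snS l n u ?k g)) t"
  proof (cases "ST l n t")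
    case t: True
    define a b c where "a = tcontent u t i" and "b = tcontent u t ?k" and "c = tcontent u t (Suc ?k)"
    define p q r where "p = 1 / (b - a)" and "q = 1 / (c - b)" and "r = 1 / (c - a)"
    let ?t1 = "st i \<circ> t" and ?t2 = "st ?k \<circ> t" and ?t12 = "st ?k \<circ> (st i \<circ> t)" and ?t21 = "st i \<circ> (st ?k \<circ> t)"
    let ?t3 = "st i \<circ> (st ?k \<circ> (st i \<circ> t))"
    have t3: "st ?k \<circ> (st i \<circ> (st ?k \<circ> t)) = ?t3"
      using st_braid[of i] by (simp only: comp_assoc[symmetric])
    have in': "i \<in> {1..n}" "?k \<in> {1..n}" "Suc ?k \<in> {1..n}" using i k by auto
    have ne: "b \<noteq> a" "c \<noteq> b" "c \<noteq> a"
      using content_consec[OF t n i] content_consec[OF t n k'] content_two_apart[OF t n, of i] i k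
      by (auto simp: a_def b_def c_def)
    have c0: "sn_coeff u i t = p" "sn_coeff u ?k t = q"
      by (simp_all add: sn_coeff_def p_def q_def a_def b_def c_def)
    have c1: "sn_coeff u i ?t1 = - p" "sn_coeff u ?k ?t1 = r" if s: "ST l n ?t1"
      using sn_coeff_swap[OF t i s] c0 content_swap[OF t i s in'(2), of u] content_swap[OF t i s in'(3), of u]
      by (simp_all add: sn_coeff_def r_def a_def c_def st_apply)
    have c2: "sn_coeff u ?k ?t2 = - q" "sn_coeff u i ?t2 = r" if s: "ST l n ?t2"
      using sn_coeff_swap[OF t k' s] c0 content_swap[OF t k' s in'(1), of u] content_swap[OF t k' s in'(2), of u]
      by (simp_all add: sn_coeff_def r_def a_def c_def st_apply)
    have c12: "sn_coeff u i ?t12 = q" if s: "ST l n ?t1" "ST l n ?t12"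
      using content_swap[OF s(1) k' s(2) in'(1), of u] content_swap[OF s(1) k' s(2) in'(2), of u]
        content_swap[OF t i s(1) in'(1), of u] content_swap[OF t i s(1) in'(3), of u]
      by (simp add: sn_coeff_def q_def b_def c_def st_apply)
    have c21: "sn_coeff u ?k ?t21 = p" if s: "ST l n ?t2" "ST l n ?t21"
      using content_swap[OF s(1) i s(2) in'(2), of u] content_swap[OF s(1) i s(2) in'(3), of u]
        content_swap[OF t k' s(1) in'(1), of u] content_swap[OF t k' s(1) in'(3), of u]
      by (simp add: sn_coeff_def p_def a_def b_def st_apply)
    define g0 g1 g2 g12 g21 g3 where "g0 = g t" and "g1 = g ?t1" and "g2 = g ?t2" and "g12 = g ?t12"
      and "g21 = g ?t21" and "g3 = g ?t3"
    have X: "\<not> ST l n ?t12 \<and> \<not> ST l n ?t3" if s: "\<not> ST l n ?t1"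
      using swap_not_ST[OF t i s, of "st ?k \<circ> st i"] swap_not_ST[OF t i s, of "st i \<circ> (st ?k \<circ> st i)"] i
      by (simp add: st_apply comp_assoc)
    have Y: "\<not> ST l n ?t21 \<and> \<not> ST l n ?t3" if s: "\<not> ST l n ?t2"
      using swap_not_ST[OF t k' s, of "st i \<circ> st ?k"] swap_not_ST[OF t k' s, of "st i \<circ> (st ?k \<circ> st i)"] i
      by (simp add: st_apply comp_assoc)
    have Z: "\<not> ST l n ?t3" if s: "ST l n ?t1" "\<not> ST l n ?t12"
      using swap_not_ST[OF s(1) k' s(2), of "st i \<circ> st ?k"] i by (simp add: st_apply comp_assoc)
    have Z': "\<not> ST l n ?t3" if s: "ST l n ?t2" "\<not> ST l n ?t21"
      using swap_not_ST[OF s(1) i s(2), of "st ?k \<circ> st i"] i t3 by (simp add: st_apply comp_assoc)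
    have p1: "p\<^sup>2 = 1" if "\<not> ST l n ?t1" using sn_coeff_sq[OF t n i that] c0 by simp
    have q1: "q\<^sup>2 = 1" if "\<not> ST l n ?t2" using sn_coeff_sq[OF t n k' that] c0 by simp
    have S12: "snS l n u i g ?t12 = q * g12 + (1 + q) * g3" if "ST l n ?t1"
      using c12[OF that] Z[OF that] snM_0[OF g, of ?t12] snM_0[OF g, of ?t3]
      by (cases "ST l n ?t12") (simp_all add: snS_ST snS_not_ST g12_def g3_def del: comp_apply)
    have S21: "snS l n u ?k g ?t21 = p * g21 + (1 + p) * g3" if "ST l n ?t2"
      using c21[OF that] Z'[OF that] snM_0[OF g, of ?t21] snM_0[OF g, of ?t3]
      by (cases "ST l n ?t21") (simp_all add: snS_ST snS_not_ST g21_def g3_def t3 del: comp_apply)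
    \<comment> \<open>The coefficient of \<open>g0\<close> contains \<open>1 - p^2\<close> so that
      the formula also holds if \<open>?t1\<close> is not standard, in which case
      \<open>p^2 = 1\<close>.\<close>
    have S1: "(1 + p) * snS l n u ?k (snS l n u i g) ?t1 =
        (1 + p) * (r * (- p * g1) + (1 + r) * (q * g12 + (1 + q) * g3)) + (1 - p\<^sup>2) * r * g0"
    proof (cases "ST l n ?t1")
      case s: True
      have "snS l n u i g ?t1 = - p * g1 + (1 - p) * g0"
        by (simp only: snS_ST[OF s] c1(1)[OF s] swap_swap g1_def g0_def) simp
      then have e: "snS l n u ?k (snS l n u i g) ?t1 = r * (- p * g1 + (1 - p) * g0) + (1 + r) * (q * g12 + (1 + q) * g3)"
        by (simp only: snS_ST[OF s] c1(2)[OF s] S12[OF s])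
      show ?thesis unfolding e by (simp add: algebra_simps power2_eq_square)
    next
      case s: False
      show ?thesis using snM_0[OF g s] X[OF s] snM_0[OF g] p1[OF s]
        by (simp add: snS_not_ST[OF s] g1_def g12_def g3_def del: comp_apply)
    qed
    have S2: "(1 + q) * snS l n u i (snS l n u ?k g) ?t2 =
        (1 + q) * (r * (- q * g2) + (1 + r) * (p * g21 + (1 + p) * g3)) + (1 - q\<^sup>2) * r * g0"
    proof (cases "ST l n ?t2")
      case s: True
      have "snS l n u ?k g ?t2 = - q * g2 + (1 - q) * g0"
        by (simp only: snS_ST[OF s] c2(1)[OF s] swap_swap g2_def g0_def) simp
      then have e: "snS l n u i (snS l n u ?k g) ?t2 = r * (- q * g2 + (1 - q) * g0) + (1 + r) * (p * g21 + (1 + p) * g3)"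
        by (simp only: snS_ST[OF s] c2(2)[OF s] S21[OF s])
      show ?thesis unfolding e by (simp add: algebra_simps power2_eq_square)
    next
      case s: False
      show ?thesis using snM_0[OF g s] Y[OF s] snM_0[OF g] q1[OF s]
        by (simp add: snS_not_ST[OF s] g2_def g21_def g3_def del: comp_apply)
    qed
    have T2: "snS l n u i g ?t2 = r * g2 + (1 + r) * g21"
      using c2(2) Y snM_0[OF g, of ?t2] snM_0[OF g, of ?t21]
      by (cases "ST l n ?t2") (simp_all add: snS_ST snS_not_ST g2_def g21_def del: comp_apply)
    have T1: "snS l n u ?k g ?t1 = r * g1 + (1 + r) * g12"
      using c1(2) X snM_0[OF g, of ?t1] snM_0[OF g, of ?t12]
      by (cases "ST l n ?t1") (simp_all add: snS_ST snS_not_ST g1_def g12_def del: comp_apply)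
    have L: "snS l n u i (snS l n u ?k (snS l n u i g)) t =
        p * (q * (p * g0 + (1 + p) * g1) + (1 + q) * (r * g2 + (1 + r) * g21)) +
        ((1 + p) * (r * (- p * g1) + (1 + r) * (q * g12 + (1 + q) * g3)) + (1 - p\<^sup>2) * r * g0)"
      by (simp only: snS_ST[OF t] c0 T2 S1 flip: g0_def g1_def)
    have R: "snS l n u ?k (snS l n u i (snS l n u ?k g)) t =
        q * (p * (q * g0 + (1 + q) * g2) + (1 + p) * (r * g1 + (1 + r) * g12)) +
        ((1 + q) * (r * (- q * g2) + (1 + r) * (p * g21 + (1 + p) * g3)) + (1 - q\<^sup>2) * r * g0)"
      by (simp only: snS_ST[OF t] c0 T1 S2 flip: g0_def g2_def)
    have pq: "p * q = r * p + q * r"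
      using ne unfolding p_def q_def r_def by (simp add: divide_simps)
    have "p * (q * (p * g0 + (1 + p) * g1) + (1 + q) * (r * g2 + (1 + r) * g21)) +
        ((1 + p) * (r * (- p * g1) + (1 + r) * (q * g12 + (1 + q) * g3)) + (1 - p\<^sup>2) * r * g0) -
       (q * (p * (q * g0 + (1 + q) * g2) + (1 + p) * (r * g1 + (1 + r) * g12)) +
        ((1 + q) * (r * (- q * g2) + (1 + r) * (p * g21 + (1 + p) * g3)) + (1 - q\<^sup>2) * r * g0))
       = (p * q - (r * p + q * r)) * ((p - q) * g0 + (1 + p) * g1 - (1 + q) * g2)"
      by (simp add: algebra_simps power2_eq_square)
    then show ?thesis unfolding L R pq by simp
  qed (simp add: snS_not_ST)
qed

lemma sn_module:
  assumes n: "n \<le> N"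
  shows "sep_module fscale n (snM l n) (snS l n u) (snL l n u) l u N"
proof -
  interpret O: hecke_ops "fscale :: 'k \<Rightarrow> (tableau \<Rightarrow> 'k) \<Rightarrow> tableau \<Rightarrow> 'k" n "snM l n" "snS l n u" "snL l n u"
    by (rule sn_ops)
  show ?thesis
  proof
    fix r :: "'k free_alg" and g :: "tableau \<Rightarrow> 'k" assume r: "r \<in> hecke_rels l n u" and g: "g \<in> snM l n"
    show "O.act r g = 0"
    proof (rule O.hecke_relsI[OF _ _ _ _ _ _ _ r g])
      assume n1: "1 \<le> n"
      have f: "foldr (\<lambda>c w. snL l n u 1 w - fscale (u c) w) cs g t =
          (if ST l n t then (\<Prod>c\<leftarrow>cs. tcontent u t 1 - u c) * g t else 0)" for cs t
        by (induction cs) (auto simp: snL_def fscale_def algebra_simps snM_0[OF g])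
      show "foldr (\<lambda>c w. snL l n u 1 w - fscale (u c) w) [1..<Suc l] g = 0"
      proof
        fix t
        have "(\<Prod>c\<leftarrow>[1..<Suc l]. tcontent u t 1 - u c) = 0" if t: "ST l n t"
          using first_content[OF t n1] by (auto simp: prod_list_zero_iff simp del: upt_Suc)
        then show "foldr (\<lambda>c w. snL l n u 1 w - fscale (u c) w) [1..<Suc l] g t = 0 t"
          unfolding f by simp
      qed
    next
      fix i k
      show "snL l n u i (snL l n u k g) = snL l n u k (snL l n u i g)"
        by (rule ext) (simp add: snL_def)
    qed (use snS_sq[OF g n] snS_far[OF g] snS_braid[OF g n] snS_L[OF g] snL_Suc[OF g n] in blast)+
  qed (use n in simp)
qed

text \<open>Every standard tableau is a weight of this module, with an explicit vector on which
  scalars and coefficients can be read off.\<close>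

lemma sn_delta:
  assumes n: "n \<le> N" and t: "ST l n t"
  shows "(\<lambda>s. if s = t then 1 else 0) \<in> sep_module.W fscale (snM l n) (snL l n u) u n t"
proof -
  interpret V: sep_module "fscale :: 'k \<Rightarrow> (tableau \<Rightarrow> 'k) \<Rightarrow> tableau \<Rightarrow> 'k" n "snM l n" "snS l n u" "snL l n u" l u N
    by (rule sn_module[OF n])
  let ?d = "\<lambda>s. if s = t then 1 else 0 :: 'k"
  have "snL l n u k ?d = fscale (tcontent u t k) ?d" for k
    by (rule ext) (simp add: snL_def fscale_def t)
  moreover have "?d \<in> snM l n" using t by (auto simp: snM_def)
  ultimately show ?thesis by (simp add: V.W_def)
qed

end

section \<open>Consequences of semisimplicity\<close>

text \<open>Passes from left ideals, of which \<open>semisimple_ring\<close> speaks, to submodules.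
  The elements that carry \<open>v\<close> into \<open>W\<close> form a left ideal \<open>I\<close>
  with a complement \<open>J\<close>; write the unit as \<open>i + j\<close> and let
  \<open>x\<close> be \<open>opr j v\<close>. For \<open>X\<close> in \<open>I\<close> the product
  of \<open>X\<close> and \<open>j\<close> lies in both \<open>I\<close> and \<open>J\<close>, so it
  is zero.\<close>

lemma (in hecke_module) semisimple_split:
  assumes ss: "semisimple_ring H" and W: "subspace W" "W \<subseteq> M"
    and WS: "\<And>i w. i \<in> {1..<n} \<Longrightarrow> w \<in> W \<Longrightarrow> S i w \<in> W" and WL: "\<And>k w. k \<in> {1..n} \<Longrightarrow> w \<in> W \<Longrightarrow> L k w \<in> W"
    and v: "v \<in> M"
  obtains x where "x \<in> M" "v - x \<in> W"
    "\<And>X. X \<in> carrier H \<Longrightarrow> opr X v \<in> W \<Longrightarrow> opr X x = 0"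
proof -
  interpret R: ring H by (rule ring_hecke)
  interpret sub: hecke_ops scale n W S L
  proof
    have wM: "w \<in> M" if "w \<in> W" for w using that W by blast
    show "S i (v + w) = S i v + S i w" if "i \<in> {1..<n}" "v \<in> W" "w \<in> W" for i v w
      by (rule S_add[OF that(1) wM[OF that(2)] wM[OF that(3)]])
    show "L i (v + w) = L i v + L i w" if "i \<in> {1..n}" "v \<in> W" "w \<in> W" for i v w
      by (rule L_add[OF that(1) wM[OF that(2)] wM[OF that(3)]])
    show "S i (c *s v) = c *s S i v" if "i \<in> {1..<n}" "v \<in> W" for i v c
      by (rule S_scale[OF that(1) wM[OF that(2)]])
    show "L i (c *s v) = c *s L i v" if "i \<in> {1..n}" "v \<in> W" for i v c
      by (rule L_scale[OF that(1) wM[OF that(2)]])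
  qed (use W WS WL in auto)
  have oprW: "opr X w \<in> W" if "X \<in> carrier H" "w \<in> W" for X w
    using that W sub.act_closed by (auto simp: hecke_carrier opr_proj subsetD)
  define I where "I = {X \<in> carrier H. opr X v \<in> W}"
  have neg: "opr (\<ominus>\<^bsub>H\<^esub> X) v = - opr X v" if "X \<in> carrier H" for X
    using opr_minus[OF R.zero_closed that v] opr_zero[OF v] that by (simp add: R.minus_eq)
  have "additive_subgroup I H"
  proof (rule additive_subgroupI, rule group.subgroupI)
    show "Group.group (add_monoid H)" by (rule R.add.is_group)
    show "I \<noteq> {}" using opr_zero[OF v] subspace_0[OF W(1)] R.zero_closed by (auto simp: I_def)
    show "inv\<^bsub>add_monoid H\<^esub> a \<in> I" if "a \<in> I" for a
      using that neg[of a] subspace_neg[OF W(1)] R.a_inv_closed[of a] unfolding I_def a_inv_def by auto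
    show "a \<otimes>\<^bsub>add_monoid H\<^esub> b \<in> I" if "a \<in> I" "b \<in> I" for a b
      using that opr_add[of a b v] subspace_add[OF W(1)] v by (auto simp: I_def)
  qed (auto simp: I_def)
  then have "left_ideal I H"
    unfolding left_ideal_def using oprW opr_mult[OF _ _ v] by (auto simp: I_def)
  then obtain J where J: "left_ideal J H" "I \<inter> J = {\<zero>\<^bsub>H\<^esub>}" "I <+>\<^bsub>H\<^esub> J = carrier H"
    using ss unfolding semisimple_ring_def by blast
  then have "\<one>\<^bsub>H\<^esub> \<in> I <+>\<^bsub>H\<^esub> J" by simp
  then obtain i j where ij: "i \<in> I" "j \<in> J" "\<one>\<^bsub>H\<^esub> = i \<oplus>\<^bsub>H\<^esub> j" by (auto simp: set_add_def set_mult_def)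
  have ic: "i \<in> carrier H" using ij by (simp add: I_def)
  have Jsub: "additive_subgroup J H" using J by (simp add: left_ideal_def)
  have jc: "j \<in> carrier H" using ij additive_subgroup.a_Hcarr[OF Jsub] by blast
  have vsum: "v = opr i v + opr j v"
    using opr_one[OF v] opr_add[OF ic jc v] ij(3) by simp
  show ?thesis
  proof (rule that)
    show "opr j v \<in> M" by (rule opr_closed[OF jc v])
    have "v - opr j v = opr i v" using vsum by (metis add_diff_cancel_right')
    then show "v - opr j v \<in> W" using ij by (simp add: I_def)
    fix X assume X: "X \<in> carrier H" and "opr X v \<in> W"
    then have XI: "X \<in> I" by (simp add: I_def)
    have "X = X \<otimes>\<^bsub>H\<^esub> i \<oplus>\<^bsub>H\<^esub> X \<otimes>\<^bsub>H\<^esub> j"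
      using X ic jc R.r_one[OF X] by (simp add: ij(3) R.r_distr)
    then have "opr X v = opr (X \<otimes>\<^bsub>H\<^esub> i) v + opr (X \<otimes>\<^bsub>H\<^esub> j) v"
      using opr_add[of "X \<otimes>\<^bsub>H\<^esub> i" "X \<otimes>\<^bsub>H\<^esub> j" v] X ic jc v by simp
    moreover have "opr (X \<otimes>\<^bsub>H\<^esub> i) v \<in> W" using oprW[OF X] ij opr_mult[OF X ic v] by (simp add: I_def)
    moreover have "opr X v \<in> W" using XI by (simp add: I_def)
    ultimately have "opr (X \<otimes>\<^bsub>H\<^esub> j) v \<in> W" using subspace_diff[OF W(1)] by (metis add_diff_cancel_left')
    then have "X \<otimes>\<^bsub>H\<^esub> j \<in> I" using X jc by (simp add: I_def)
    moreover have "X \<otimes>\<^bsub>H\<^esub> j \<in> J" using J(1) X ij(2) by (simp add: left_ideal_def)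
    ultimately have "X \<otimes>\<^bsub>H\<^esub> j = \<zero>\<^bsub>H\<^esub>" using J(2) by blast
    then show "opr X (opr j v) = 0" using opr_mult[OF X jc v] opr_zero[OF v] by simp
  qed
qed

section \<open>Separation of the parameters from semisimplicity\<close>

lemma foldr_pull:
  assumes "\<And>c d x. D c (D d x) = D d (D c x)" "c \<in> set cs"
  shows "foldr D cs x = D c (foldr D (remove1 c cs) x)"
  using assms(2)
proof (induction cs)
  case (Cons d cs)
  then show ?case using assms(1)[of d c] by (cases "c = d") auto
qed simp

text \<open>The character \<open>s\<^sub>i \<mapsto> 1\<close>, \<open>L\<^sub>k \<mapsto> u\<^sub>a + k - 1\<close>, deformed over the dual numbers; the components
  \<^const>\<open>True\<close> and \<^const>\<open>False\<close> are the coordinates of \<open>1\<close> and \<open>\<epsilon>\<close>.\<close>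

definition epsL :: "'k::field \<Rightarrow> nat \<Rightarrow> (bool \<Rightarrow> 'k) \<Rightarrow> bool \<Rightarrow> 'k" where
  "epsL \<alpha> k f = (\<lambda>e. (\<alpha> + of_nat (k - 1)) * f e + (if e then 0 else f True))"

text \<open>The cyclotomic relation holds because the parameter occurs twice: each of the two equal
  factors acts by the nilpotent part, whose square is zero.\<close>

lemma eps_module:
  fixes u :: "nat \<Rightarrow> 'k::field"
  assumes ab: "a \<in> {1..l}" "b \<in> {1..l}" "a \<noteq> b" "u a = u b"
  shows "hecke_module fscale n (UNIV :: (bool \<Rightarrow> 'k) set) (\<lambda>_ f. f) (epsL (u a)) l u"
proof -
  interpret V: vector_space "fscale :: 'k \<Rightarrow> (bool \<Rightarrow> 'k) \<Rightarrow> bool \<Rightarrow> 'k" by (rule vector_space_fscale)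
  interpret O: hecke_ops "fscale :: 'k \<Rightarrow> (bool \<Rightarrow> 'k) \<Rightarrow> bool \<Rightarrow> 'k" n UNIV "\<lambda>_ f. f" "epsL (u a)"
    by unfold_locales (auto simp: epsL_def fscale_def fun_eq_iff algebra_simps)
  show ?thesis
  proof
    fix r :: "'k free_alg" and f :: "bool \<Rightarrow> 'k" assume r: "r \<in> hecke_rels l n u"
    show "O.act r f = 0"
    proof (rule O.hecke_relsI[OF _ _ _ _ _ _ _ r UNIV_I])
      let ?D = "\<lambda>c f. epsL (u a) 1 f - fscale (u c) f"
      have comm: "?D c (?D d x) = ?D d (?D c x)" for c d x
        by (auto simp: epsL_def fscale_def fun_eq_iff algebra_simps)
      have z: "?D a (?D b x) = 0" for x
        using ab(4) by (auto simp: epsL_def fscale_def fun_eq_iff algebra_simps)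
      have b': "b \<in> set (remove1 a [1..<Suc l])" using ab by (simp add: in_set_remove1 del: upt_Suc)
      have "foldr ?D [1..<Suc l] f = ?D a (foldr ?D (remove1 a [1..<Suc l]) f)"
        by (rule foldr_pull[of ?D, OF comm]) (use ab in \<open>simp del: upt_Suc\<close>)
      also have "foldr ?D (remove1 a [1..<Suc l]) f = ?D b (foldr ?D (remove1 b (remove1 a [1..<Suc l])) f)"
        by (rule foldr_pull[of ?D, OF comm b'])
      finally show "foldr ?D [1..<Suc l] f = 0" unfolding z .
    qed (auto simp: epsL_def fun_eq_iff algebra_simps of_nat_diff)
  qed
qed

text \<open>\<open>L_1 - u_a\<close> maps \<open>?v\<close> into the line of the second coordinate,
  so by \<open>semisimple_split\<close> it kills a vector \<open>x\<close> with the same first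
  coordinate as \<open>?v\<close>. But it copies the first coordinate into the second, so this
  coordinate would be zero.\<close>

lemma semisimple_distinct_params:
  fixes u :: "nat \<Rightarrow> 'k::field"
  assumes ss: "semisimple_ring (hecke l n u)" and n: "1 \<le> n" and ab: "a \<in> {1..l}" "b \<in> {1..l}" "a \<noteq> b"
  shows "u a \<noteq> u b"
proof
  assume e: "u a = u b"
  interpret V: hecke_module "fscale :: 'k \<Rightarrow> (bool \<Rightarrow> 'k) \<Rightarrow> bool \<Rightarrow> 'k" n UNIV "\<lambda>_ f. f" "epsL (u a)" l u
    by (rule eps_module[OF ab e])
  let ?v = "\<lambda>e. if e then 1 else 0 :: 'k" and ?W = "{f :: bool \<Rightarrow> 'k. f True = 0}"
  have sub: "V.subspace ?W" by (rule V.subspaceI) (auto simp: fscale_def)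
  obtain x where x: "?v - x \<in> ?W" "\<And>X. X \<in> carrier V.H \<Longrightarrow> V.opr X ?v \<in> ?W \<Longrightarrow> V.opr X x = 0"
    by (rule V.semisimple_split[OF ss sub, of ?v]) (auto simp: epsL_def)
  interpret R: ring V.H by (rule ring_hecke)
  let ?X = "hL l n u 1 \<ominus>\<^bsub>V.H\<^esub> hscl l n u (u a)"
  have cl: "hL l n u 1 \<in> carrier V.H" "hscl l n u (u a) \<in> carrier V.H"
    by (intro proj_closed free_carrier_gL free_carrier_scl; use n in simp)+
  have X: "?X \<in> carrier V.H" using cl by simp
  have act: "V.opr ?X f = (\<lambda>e. if e then 0 else f True)" for f
    using V.opr_minus[OF cl, of f] V.opr_hL[of 1 f] n
    by (auto simp: V.opr_hscl epsL_def fscale_def fun_eq_iff)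
  have "V.opr ?X ?v \<in> ?W" unfolding act by simp
  then have "V.opr ?X x = 0" by (rule x(2)[OF X])
  then have "x True = 0" using fun_cong[of "V.opr ?X x" 0 False] unfolding act by simp
  then show False using x(1) by simp
qed

text \<open>The module induced from the regular representations of the two blocks of letters singled
  out by \<open>B\<close>, on which \<open>L\<^sub>1\<close> has the eigenvalues \<open>\<beta>\<close> (on letters in \<open>B\<close>) and \<open>\<alpha>\<close>.\<close>

definition pmS :: "nat \<Rightarrow> ((nat \<Rightarrow> nat) \<Rightarrow> 'k::field) \<Rightarrow> (nat \<Rightarrow> nat) \<Rightarrow> 'k" where
  "pmS i g = (\<lambda>w. g (w \<circ> st i))"

definition pmL1 :: "(nat \<Rightarrow> bool) \<Rightarrow> 'k \<Rightarrow> 'k \<Rightarrow> nat \<Rightarrow> ((nat \<Rightarrow> nat) \<Rightarrow> 'k::field) \<Rightarrow> (nat \<Rightarrow> nat) \<Rightarrow> 'k" where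
  "pmL1 B \<alpha> \<beta> n g = (\<lambda>w. if B (w 1)
     then \<beta> * g w - (\<Sum>j | j \<in> {2..n} \<and> \<not> B (w j). g (w \<circ> Transposition.transpose 1 j)) else \<alpha> * g w)"

text \<open>The last relation of the algebra serves as the definition of the further
  \<open>L_k\<close>, which leaves the commutation relations to be proved. The value at index 0 is a
  dummy.\<close>

fun pmL :: "(nat \<Rightarrow> bool) \<Rightarrow> 'k \<Rightarrow> 'k \<Rightarrow> nat \<Rightarrow> nat \<Rightarrow> ((nat \<Rightarrow> nat) \<Rightarrow> 'k::field) \<Rightarrow> (nat \<Rightarrow> nat) \<Rightarrow> 'k" where
  "pmL B \<alpha> \<beta> n 0 g = g"
| "pmL B \<alpha> \<beta> n (Suc 0) g = pmL1 B \<alpha> \<beta> n g"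
| "pmL B \<alpha> \<beta> n (Suc (Suc k)) g = pmS (Suc k) (pmL B \<alpha> \<beta> n (Suc k) (pmS (Suc k) g)) + pmS (Suc k) g"

lemma pmL_rec:
  "pmL B \<alpha> \<beta> n (Suc (Suc k)) g = pmS (Suc k) (pmL B \<alpha> \<beta> n (Suc k) (pmS (Suc k) g)) + pmS (Suc k) g"
  by (rule ext) simp

declare pmL.simps(3)[simp del] plus_fun_apply[simp del]

lemma pmS_add: "pmS i (f + g) = pmS i f + pmS i g"
  by (simp add: pmS_def plus_fun_def)

lemma pmS_scale: "pmS i (fscale c g) = fscale c (pmS i g)"
  by (simp add: pmS_def fscale_def)

lemma pmL1_add: "pmL1 B \<alpha> \<beta> n (f + g) = pmL1 B \<alpha> \<beta> n f + pmL1 B \<alpha> \<beta> n g"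
  by (auto simp: pmL1_def plus_fun_def fun_eq_iff algebra_simps sum.distrib)

lemma pmL1_scale: "pmL1 B \<alpha> \<beta> n (fscale c g) = fscale c (pmL1 B \<alpha> \<beta> n g)"
  by (auto simp: pmL1_def fscale_def fun_eq_iff algebra_simps sum_distrib_left)

lemma pmL_add: "pmL B \<alpha> \<beta> n k (f + g) = pmL B \<alpha> \<beta> n k f + pmL B \<alpha> \<beta> n k g"
proof (induction k arbitrary: f g)
  case (Suc k)
  then show ?case by (cases k) (simp_all add: pmL1_add pmS_add pmL_rec)
qed simp

lemma pmL_scale: "pmL B \<alpha> \<beta> n k (fscale c g) = fscale c (pmL B \<alpha> \<beta> n k g)"
proof (induction k arbitrary: g)
  case (Suc k)
  have "fscale c (f + g) = fscale c f + fscale c g" for f g :: "(nat \<Rightarrow> nat) \<Rightarrow> 'a"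
    by (simp add: fscale_def fun_eq_iff algebra_simps plus_fun_apply)
  then show ?case using Suc by (cases k) (simp_all add: pmL1_scale pmS_scale pmL_rec)
qed simp

lemma pmS_sq: "pmS i (pmS i g) = g"
proof
  fix w :: "nat \<Rightarrow> nat"
  have "w \<circ> st i \<circ> st i = w" by (simp add: fun_eq_iff)
  then show "pmS i (pmS i g) w = g w" by (simp add: pmS_def)
qed

lemma pmS_far: "Suc i < j \<Longrightarrow> pmS i (pmS j g) = pmS j (pmS i g)"
proof -
  assume "Suc i < j"
  then have "st i \<circ> st j = st j \<circ> st i" by (rule st_far)
  then show ?thesis unfolding pmS_def comp_assoc by simp
qed

lemma pmS_braid: "pmS i (pmS (Suc i) (pmS i g)) = pmS (Suc i) (pmS i (pmS (Suc i) g))"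
proof
  fix w :: "nat \<Rightarrow> nat"
  have "w \<circ> st i \<circ> st (Suc i) \<circ> st i = w \<circ> st (Suc i) \<circ> st i \<circ> st (Suc i)"
    using st_braid[of i] by (metis comp_assoc)
  then show "pmS i (pmS (Suc i) (pmS i g)) w = pmS (Suc i) (pmS i (pmS (Suc i) g)) w"
    by (simp add: pmS_def)
qed

lemma pmS_L1:
  assumes j: "j \<in> {2..<n}"
  shows "pmS j (pmL1 B \<alpha> \<beta> n g) = pmL1 B \<alpha> \<beta> n (pmS j g)"
proof
  fix w :: "nat \<Rightarrow> nat"
  have w1: "(w \<circ> st j) 1 = w 1" using j by (simp add: st_apply)
  have "(\<Sum>i | i \<in> {2..n} \<and> \<not> B ((w \<circ> st j) i). g (w \<circ> st j \<circ> Transposition.transpose 1 i)) =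
      (\<Sum>i | i \<in> {2..n} \<and> \<not> B (w i). g (w \<circ> Transposition.transpose 1 i \<circ> st j))"
  proof (rule sum.reindex_bij_witness[of _ "st j" "st j"])
    fix i assume "i \<in> {i. i \<in> {2..n} \<and> \<not> B ((w \<circ> st j) i)}"
    then show "st j i \<in> {i. i \<in> {2..n} \<and> \<not> B (w i)}" using j by (auto simp: st_apply split: if_splits)
    have "st j \<circ> Transposition.transpose 1 i = Transposition.transpose 1 (st j i) \<circ> st j"
      using j by (auto simp: fun_eq_iff Transposition.transpose_def)
    then show "g (w \<circ> Transposition.transpose 1 (st j i) \<circ> st j) = g (w \<circ> st j \<circ> Transposition.transpose 1 i)"
      by (simp add: comp_assoc)
  qed (use j in \<open>auto simp: st_apply split: if_splits\<close>)
  then show "pmS j (pmL1 B \<alpha> \<beta> n g) w = pmL1 B \<alpha> \<beta> n (pmS j g) w"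
    using w1 by (simp add: pmS_def pmL1_def del: comp_apply)
qed

text \<open>The exchange partners that \<open>L_1\<close> and \<open>L_2\<close> have in common;
  positions 1 and 2 are split off because only these are treated specially by the two
  operators.\<close>

definition pmT :: "(nat \<Rightarrow> bool) \<Rightarrow> nat \<Rightarrow> (nat \<Rightarrow> nat) \<Rightarrow> nat set" where
  "pmT B n w = {j \<in> {3..n}. \<not> B (w j)}"

lemma finite_pmT: "finite (pmT B n w)"
  by (simp add: pmT_def)

lemma pmL1_eq:
  assumes "2 \<le> n"
  shows "pmL1 B \<alpha> \<beta> n g w = (if B (w 1)
     then \<beta> * g w - (if B (w 2) then 0 else g (w \<circ> st 1)) - (\<Sum>j\<in>pmT B n w. g (w \<circ> Transposition.transpose 1 j))
     else \<alpha> * g w)"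
proof -
  have "{j. j \<in> {2..n} \<and> \<not> B (w j)} = (if B (w 2) then pmT B n w else insert 2 (pmT B n w))"
    using assms by (auto simp: pmT_def) (metis Suc_leI le_neq_implies_less numeral_3_eq_3 numeral_2_eq_2)+
  moreover have "2 \<notin> pmT B n w" by (simp add: pmT_def)
  ultimately show ?thesis by (simp add: pmL1_def finite_pmT numeral_2_eq_2)
qed

lemma pmL_2: "pmL B \<alpha> \<beta> n 2 g = pmS 1 (pmL1 B \<alpha> \<beta> n (pmS 1 g)) + pmS 1 g"
  by (simp add: numeral_2_eq_2 pmL_rec)

lemma pmL2_eq:
  assumes "2 \<le> n"
  shows "pmL B \<alpha> \<beta> n 2 g w = (if B (w 2)
     then \<beta> * g w - (if B (w 1) then 0 else g (w \<circ> st 1)) - (\<Sum>j\<in>pmT B n w. g (w \<circ> Transposition.transpose 2 j))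
     else \<alpha> * g w) + g (w \<circ> st 1)"
proof -
  have T: "pmT B n (w \<circ> st 1) = pmT B n w" by (auto simp: pmT_def st_apply)
  have i: "w \<circ> st 1 \<circ> st 1 = w" by (simp add: fun_eq_iff)
  have "(\<Sum>j\<in>pmT B n w. g (w \<circ> st 1 \<circ> Transposition.transpose 1 j \<circ> st 1)) =
      (\<Sum>j\<in>pmT B n w. g (w \<circ> Transposition.transpose 2 j))"
  proof (rule sum.cong[OF refl])
    fix j assume "j \<in> pmT B n w"
    then have "3 \<le> j" by (simp add: pmT_def)
    then have "st 1 \<circ> (Transposition.transpose 1 j \<circ> st 1) = Transposition.transpose 2 j"
      by (auto simp: fun_eq_iff Transposition.transpose_def)
    then show "g (w \<circ> st 1 \<circ> Transposition.transpose 1 j \<circ> st 1) = g (w \<circ> Transposition.transpose 2 j)"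
      by (simp add: comp_assoc)
  qed
  moreover have "(w \<circ> st 1) 1 = w 2" "(w \<circ> st 1) 2 = w 1" by (simp_all add: st_apply numeral_2_eq_2)
  ultimately show ?thesis
    using i pmL1_eq[OF assms, of B \<alpha> \<beta> "pmS 1 g" "w \<circ> st 1"]
    unfolding pmL_2 T plus_fun_apply by (simp add: pmS_def del: comp_apply One_nat_def)
qed

text \<open>The only commutation among the \<open>L_k\<close> that rests on the formula for
  \<open>L_1\<close>; the others follow from it with the generators. The cases are whether the first
  two letters lie in \<open>B\<close>. If both do, the double sums agree after exchanging the
  indices, because disjoint transpositions commute.\<close>

lemma pmL1_L2:
  assumes n: "2 \<le> n"
  shows "pmL1 B \<alpha> \<beta> n (pmL B \<alpha> \<beta> n 2 g) = pmL B \<alpha> \<beta> n 2 (pmL1 B \<alpha> \<beta> n g)"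
proof
  fix w :: "nat \<Rightarrow> nat"
  let ?tr = Transposition.transpose
  let ?T = "pmT B n w"
  let ?L1 = "pmL1 B \<alpha> \<beta> n" and ?L2 = "pmL B \<alpha> \<beta> n 2"
  note L1 = pmL1_eq[OF n] and L2 = pmL2_eq[OF n]
  have s: "(w \<circ> st 1) 1 = w 2" "(w \<circ> st 1) 2 = w 1" by (simp_all add: st_apply numeral_2_eq_2)
  have Ts: "pmT B n (w \<circ> st 1) = ?T" by (auto simp: pmT_def st_apply)
  have ss: "w \<circ> st 1 \<circ> st 1 = w" by (simp add: fun_eq_iff)
  have j3: "3 \<le> j \<and> \<not> B (w j)" if "j \<in> ?T" for j using that by (simp add: pmT_def)
  have p1: "(w \<circ> ?tr 1 j) 1 = w j" "(w \<circ> ?tr 1 j) 2 = w 2" if "j \<in> ?T" for j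
    using j3[OF that] by (simp_all add: Transposition.transpose_def)
  have p2: "(w \<circ> ?tr 2 j) 1 = w 1" "(w \<circ> ?tr 2 j) 2 = w j" if "j \<in> ?T" for j
    using j3[OF that] by (simp_all add: Transposition.transpose_def)
  have c1: "w \<circ> st 1 \<circ> ?tr 2 j = w \<circ> ?tr 1 j \<circ> st 1" if "j \<in> ?T" for j
  proof -
    have "st 1 \<circ> ?tr 2 j = ?tr 1 j \<circ> st 1"
      using j3[OF that] by (auto simp: fun_eq_iff Transposition.transpose_def)
    then show ?thesis by (simp add: comp_assoc)
  qed
  have c2: "w \<circ> st 1 \<circ> ?tr 1 j = w \<circ> ?tr 2 j \<circ> st 1" if "j \<in> ?T" for j
  proof -
    have "st 1 \<circ> ?tr 1 j = ?tr 2 j \<circ> st 1"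
      using j3[OF that] by (auto simp: fun_eq_iff Transposition.transpose_def)
    then show ?thesis by (simp add: comp_assoc)
  qed
  show "?L1 (?L2 g) w = ?L2 (?L1 g) w"
  proof (cases "B (w 1)"; cases "B (w 2)")
    assume b: "\<not> B (w 1)" "\<not> B (w 2)"
    have "?L1 g (w \<circ> st 1) = \<alpha> * g (w \<circ> st 1)" using b by (simp add: L1 s del: comp_apply One_nat_def Suc_1)
    then show ?thesis using b by (simp add: L1[of B \<alpha> \<beta> _ w] L2[of B \<alpha> \<beta> _ w] algebra_simps del: comp_apply One_nat_def Suc_1)
  next
    assume b: "\<not> B (w 1)" "B (w 2)"
    have "(\<Sum>j\<in>?T. ?L1 g (w \<circ> ?tr 2 j)) = \<alpha> * (\<Sum>j\<in>?T. g (w \<circ> ?tr 2 j))"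
      unfolding sum_distrib_left by (rule sum.cong) (use b p2 in \<open>simp_all add: L1 del: comp_apply One_nat_def Suc_1\<close>)
    then show ?thesis using b by (simp add: L1[of B \<alpha> \<beta> _ w] L2[of B \<alpha> \<beta> _ w] algebra_simps del: comp_apply One_nat_def Suc_1)
  next
    assume b: "B (w 1)" "\<not> B (w 2)"
    have "(\<Sum>j\<in>?T. ?L2 g (w \<circ> ?tr 1 j)) = \<alpha> * (\<Sum>j\<in>?T. g (w \<circ> ?tr 1 j)) + (\<Sum>j\<in>?T. g (w \<circ> st 1 \<circ> ?tr 2 j))"
      unfolding sum_distrib_left sum.distrib[symmetric]
      by (rule sum.cong) (use b p1 c1 in \<open>simp_all add: L2 del: comp_apply One_nat_def Suc_1\<close>)
    moreover have "?L2 g (w \<circ> st 1) = \<beta> * g (w \<circ> st 1) - (\<Sum>j\<in>?T. g (w \<circ> st 1 \<circ> ?tr 2 j))"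
      using b by (simp add: L2 s Ts ss del: comp_apply One_nat_def Suc_1)
    moreover have "?L1 g (w \<circ> st 1) = \<alpha> * g (w \<circ> st 1)" using b by (simp add: L1 s del: comp_apply One_nat_def Suc_1)
    ultimately show ?thesis
      using b by (simp add: L1[of B \<alpha> \<beta> _ w] L2[of B \<alpha> \<beta> _ w] algebra_simps del: comp_apply One_nat_def Suc_1)
  next
    assume b: "B (w 1)" "B (w 2)"
    \<comment> \<open>The exchange puts a letter of \<open>B\<close> at position \<open>j\<close>,
      which thereby leaves the index set.\<close>
    have T1: "pmT B n (w \<circ> ?tr 1 j) = ?T - {j}" if "j \<in> ?T" for j
      using b j3[OF that] by (auto simp: pmT_def Transposition.transpose_def)
    have T2: "pmT B n (w \<circ> ?tr 2 j) = ?T - {j}" if "j \<in> ?T" for j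
      using b j3[OF that] by (auto simp: pmT_def Transposition.transpose_def)
    have e1: "(\<Sum>j\<in>?T. ?L2 g (w \<circ> ?tr 1 j)) = \<beta> * (\<Sum>j\<in>?T. g (w \<circ> ?tr 1 j)) -
        (\<Sum>j\<in>?T. \<Sum>i\<in>?T - {j}. g (w \<circ> ?tr 1 j \<circ> ?tr 2 i))"
      unfolding sum_distrib_left sum_subtractf[symmetric]
      by (rule sum.cong) (use b p1 j3 T1 in \<open>simp_all add: L2 del: comp_apply One_nat_def Suc_1\<close>)
    have e2: "(\<Sum>j\<in>?T. ?L1 g (w \<circ> ?tr 2 j)) = \<beta> * (\<Sum>j\<in>?T. g (w \<circ> ?tr 2 j)) -
        (\<Sum>j\<in>?T. g (w \<circ> st 1 \<circ> ?tr 1 j)) - (\<Sum>j\<in>?T. \<Sum>i\<in>?T - {j}. g (w \<circ> ?tr 2 j \<circ> ?tr 1 i))"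
      unfolding sum_distrib_left sum_subtractf[symmetric]
      by (rule sum.cong) (use b p2 j3 T2 c2 in \<open>simp_all add: L1 del: comp_apply One_nat_def Suc_1\<close>)
    have e3: "?L1 g (w \<circ> st 1) = \<beta> * g (w \<circ> st 1) - (\<Sum>j\<in>?T. g (w \<circ> st 1 \<circ> ?tr 1 j))"
      using b by (simp add: L1 s Ts del: comp_apply One_nat_def Suc_1)
    have "(\<Sum>j\<in>?T. \<Sum>i\<in>?T - {j}. g (w \<circ> ?tr 1 j \<circ> ?tr 2 i)) =
        (\<Sum>j\<in>?T. \<Sum>i\<in>?T - {j}. g (w \<circ> ?tr 2 i \<circ> ?tr 1 j))"
    proof (intro sum.cong refl)
      fix i j assume "j \<in> ?T" "i \<in> ?T - {j}"
      then have "?tr 1 j \<circ> ?tr 2 i = ?tr 2 i \<circ> ?tr 1 j"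
        using j3[of i] j3[of j] by (auto simp: fun_eq_iff Transposition.transpose_def)
      then show "g (w \<circ> ?tr 1 j \<circ> ?tr 2 i) = g (w \<circ> ?tr 2 i \<circ> ?tr 1 j)" by (simp add: comp_assoc)
    qed
    also have "\<dots> = (\<Sum>i\<in>?T. \<Sum>j\<in>?T - {i}. g (w \<circ> ?tr 2 i \<circ> ?tr 1 j))"
    proof -
      have "(\<Sum>j\<in>?T. \<Sum>i\<in>?T - {j}. h i j) = (\<Sum>i\<in>?T. \<Sum>j\<in>?T - {i}. h i j)" for h :: "nat \<Rightarrow> nat \<Rightarrow> 'a"
        by (subst sum.Sigma; (simp add: finite_pmT)?)+
           (rule sum.reindex_bij_witness[of _ "\<lambda>(i, j). (j, i)" "\<lambda>(i, j). (j, i)"]; auto)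
      then show ?thesis .
    qed
    finally have e4: "(\<Sum>j\<in>?T. \<Sum>i\<in>?T - {j}. g (w \<circ> ?tr 1 j \<circ> ?tr 2 i)) =
        (\<Sum>j\<in>?T. \<Sum>i\<in>?T - {j}. g (w \<circ> ?tr 2 j \<circ> ?tr 1 i))" .
    have f1: "?L1 (?L2 g) w = \<beta> * ?L2 g w - (\<Sum>j\<in>?T. ?L2 g (w \<circ> ?tr 1 j))"
      using b by (simp add: L1[of B \<alpha> \<beta> _ w] del: comp_apply One_nat_def Suc_1)
    have f2: "?L2 (?L1 g) w = \<beta> * ?L1 g w - (\<Sum>j\<in>?T. ?L1 g (w \<circ> ?tr 2 j)) + ?L1 g (w \<circ> st 1)"
      using b by (simp add: L2[of B \<alpha> \<beta> _ w] del: comp_apply One_nat_def Suc_1)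
    have f3: "?L2 g w = \<beta> * g w - (\<Sum>j\<in>?T. g (w \<circ> ?tr 2 j)) + g (w \<circ> st 1)"
      "?L1 g w = \<beta> * g w - (\<Sum>j\<in>?T. g (w \<circ> ?tr 1 j))"
      using b by (simp_all add: L1[of B \<alpha> \<beta> _ w] L2[of B \<alpha> \<beta> _ w] del: comp_apply One_nat_def Suc_1)
    show ?thesis by (simp only: f1 f2 f3 e1 e2 e3 e4) (simp add: algebra_simps)
  qed
qed

lemma pmS_L_gt:
  assumes "1 \<le> k" "k < i" "i \<in> {1..<n}"
  shows "pmS i (pmL B \<alpha> \<beta> n k g) = pmL B \<alpha> \<beta> n k (pmS i g)"
  using assms(1,2)
proof (induction k arbitrary: g rule: dec_induct)
  case base
  then show ?case using pmS_L1[of i n] assms by simp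
next
  case (step k)
  then obtain m where m: "k = Suc m" by (cases k) auto
  have far: "pmS i (pmS k h) = pmS k (pmS i h)" for h :: "(nat \<Rightarrow> nat) \<Rightarrow> 'a" using pmS_far[of k i h] step.prems by simp
  show ?case using step.IH step.prems by (simp add: m pmL_rec pmS_add far[unfolded m])
qed

text \<open>For \<open>k = i + 2\<close> the generator is moved through the two conjugating
  generators by the braid relation; the generators that enter for larger \<open>k\<close> commute
  with it.\<close>

lemma pmS_L_lt:
  assumes "Suc (Suc i) \<le> k" "k \<le> n" "1 \<le> i"
  shows "pmS i (pmL B \<alpha> \<beta> n k g) = pmL B \<alpha> \<beta> n k (pmS i g)"
  using assms(1,2)
proof (induction k arbitrary: g rule: dec_induct)
  case base
  then obtain m where m: "i = Suc m" using assms by (cases i) auto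
  let ?s = "pmS i" and ?t = "pmS (Suc i)" and ?L = "pmL B \<alpha> \<beta> n i"
  have tL: "?t (?L h) = ?L (?t h)" for h using pmS_L_gt[of i "Suc i" n B \<alpha> \<beta> h] base assms by simp
  have L: "pmL B \<alpha> \<beta> n (Suc (Suc i)) h = ?t (?s (?L (?s (?t h)))) + ?t (?s (?t h)) + ?t h" for h
    by (simp add: m pmL_rec pmS_add add.assoc)
  have "?s (?t (?s (?L (?s (?t g))))) = ?t (?s (?L (?t (?s (?t g)))))"
    by (simp add: pmS_braid tL)
  also have "\<dots> = ?t (?s (?L (?s (?t (?s g)))))" by (simp add: pmS_braid)
  finally have 1: "?s (?t (?s (?L (?s (?t g))))) = ?t (?s (?L (?s (?t (?s g)))))" .
  have 2: "?s (?t (?s (?t g))) = ?t (?s g)"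
    using pmS_braid[of i "?t g"] by (simp add: pmS_sq)
  have 3: "?t (?s (?t (?s g))) = ?s (?t g)"
    using pmS_braid[of i "?s g"] by (simp add: pmS_sq)
  show ?case unfolding L pmS_add 1 2 3 by (simp add: add.commute add.left_commute)
next
  case (step k)
  then obtain m where m: "k = Suc m" by (cases k) auto
  have far: "pmS i (pmS k h) = pmS k (pmS i h)" for h :: "(nat \<Rightarrow> nat) \<Rightarrow> 'a" using pmS_far[of i k h] step.hyps by simp
  show ?case using step.IH step.prems by (simp add: m pmL_rec pmS_add far[unfolded m])
qed

lemma pmL1_L:
  assumes "1 \<le> k" "k \<le> n"
  shows "pmL1 B \<alpha> \<beta> n (pmL B \<alpha> \<beta> n k g) = pmL B \<alpha> \<beta> n k (pmL1 B \<alpha> \<beta> n g)"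
  using assms
proof (induction k arbitrary: g rule: dec_induct)
  case (step k)
  show ?case
  proof (cases "k = 1")
    case True
    then show ?thesis using pmL1_L2[of n B \<alpha> \<beta> g] step.prems by (simp add: numeral_2_eq_2)
  next
    case False
    then obtain m where m: "k = Suc m" using step.hyps by (cases k) auto
    have c: "pmS k (pmL1 B \<alpha> \<beta> n h) = pmL1 B \<alpha> \<beta> n (pmS k h)" for h
      by (rule pmS_L1) (use False step in auto)
    show ?thesis using step.IH step.prems by (simp add: m pmL_rec pmL1_add c[unfolded m, symmetric])
  qed
qed simp

lemma pmL_L:
  assumes "1 \<le> i" "i < k" "k \<le> n"
  shows "pmL B \<alpha> \<beta> n i (pmL B \<alpha> \<beta> n k g) = pmL B \<alpha> \<beta> n k (pmL B \<alpha> \<beta> n i g)"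
  using assms(1,2)
proof (induction i arbitrary: g rule: dec_induct)
  case base
  then show ?case using pmL1_L[of k n B \<alpha> \<beta> g] assms by simp
next
  case (step i)
  then obtain m where m: "i = Suc m" by (cases i) auto
  have c: "pmS i (pmL B \<alpha> \<beta> n k h) = pmL B \<alpha> \<beta> n k (pmS i h)" for h
    by (rule pmS_L_lt) (use step assms in auto)
  show ?case using step.IH step.prems by (simp add: m pmL_rec pmL_add c[unfolded m])
qed

text \<open>For the cyclotomic relation the factors for \<open>a\<close> and \<open>b\<close> are
  pulled to the front. \<open>L_1\<close> is triangular with respect to whether the first letter
  lies in \<open>B\<close>, so these two compose to zero; if \<open>B\<close> is empty, the factor
  for \<open>a\<close> alone is zero.\<close>

lemma pm_module:
  fixes u :: "nat \<Rightarrow> 'k::field"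
  assumes a: "a \<in> {1..l}" and b: "(\<forall>x. \<not> B x) \<or> b \<in> {1..l} \<and> b \<noteq> a"
  shows "hecke_module fscale n (UNIV :: ((nat \<Rightarrow> nat) \<Rightarrow> 'k) set) pmS (pmL B (u a) (u b) n) l u"
proof -
  interpret V: vector_space "fscale :: 'k \<Rightarrow> ((nat \<Rightarrow> nat) \<Rightarrow> 'k) \<Rightarrow> (nat \<Rightarrow> nat) \<Rightarrow> 'k" by (rule vector_space_fscale)
  let ?L = "pmL B (u a) (u b) n"
  interpret O: hecke_ops "fscale :: 'k \<Rightarrow> ((nat \<Rightarrow> nat) \<Rightarrow> 'k) \<Rightarrow> (nat \<Rightarrow> nat) \<Rightarrow> 'k" n UNIV pmS ?L
    by unfold_locales (auto simp: pmS_add pmS_scale pmL_add pmL_scale)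
  show ?thesis
  proof
    fix r :: "'k free_alg" and f :: "(nat \<Rightarrow> nat) \<Rightarrow> 'k" assume r: "r \<in> hecke_rels l n u"
    show "O.act r f = 0"
    proof (rule O.hecke_relsI[OF _ _ _ _ _ _ _ r UNIV_I])
      let ?D = "\<lambda>c f. ?L 1 f - fscale (u c) f"
      have dd: "?L 1 (f - g) = ?L 1 f - ?L 1 g" for f g
        using pmL_add[of B "u a" "u b" n 1 "f - g" g] by (simp add: algebra_simps)
      have comm: "?D c (?D d x) = ?D d (?D c x)" for c d x
        unfolding dd pmL_scale by (simp add: fscale_def fun_eq_iff algebra_simps plus_fun_apply)
      have la: "a \<in> set [1..<Suc l]" using a by (simp del: upt_Suc)
      have pull_a: "foldr ?D [1..<Suc l] f = ?D a (foldr ?D (remove1 a [1..<Suc l]) f)"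
        by (rule foldr_pull[of ?D, OF comm la])
      show "foldr ?D [1..<Suc l] f = 0"
        using b
      proof
        assume "\<forall>x. \<not> B x"
        then have "?D a x = 0" for x by (simp add: pmL1_def fscale_def fun_eq_iff)
        then show ?thesis unfolding pull_a .
      next
        assume b: "b \<in> {1..l} \<and> b \<noteq> a"
        have b': "b \<in> set (remove1 a [1..<Suc l])" using b by (simp add: in_set_remove1 del: upt_Suc)
        have z: "?D a (?D b x) w = 0" for x w
        proof (cases "B (w 1)")
          case False
          then show ?thesis by (simp add: pmL1_def fscale_def)
        next
          case True
          have "(w \<circ> Transposition.transpose 1 j) 1 = w j" for j by simp
          then have "(\<Sum>j | j \<in> {2..n} \<and> \<not> B (w j). ?D b x (w \<circ> Transposition.transpose 1 j)) =
            (\<Sum>j | j \<in> {2..n} \<and> \<not> B (w j). (u a - u b) * x (w \<circ> Transposition.transpose 1 j))"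
            by (intro sum.cong refl) (auto simp: pmL1_def fscale_def algebra_simps)
          moreover have "?D b x w = - (\<Sum>j | j \<in> {2..n} \<and> \<not> B (w j). x (w \<circ> Transposition.transpose 1 j))"
            using True by (simp add: pmL1_def fscale_def del: comp_apply)
          moreover have "?D a y w = (u b - u a) * y w - (\<Sum>j | j \<in> {2..n} \<and> \<not> B (w j). y (w \<circ> Transposition.transpose 1 j))" for y
            using True by (simp add: pmL1_def fscale_def algebra_simps del: comp_apply)
          ultimately show ?thesis by (simp only: sum_distrib_left[symmetric]) (simp add: algebra_simps)
        qed
        have "foldr ?D (remove1 a [1..<Suc l]) f = ?D b (foldr ?D (remove1 b (remove1 a [1..<Suc l])) f)"
          by (rule foldr_pull[of ?D, OF comm b'])
        then show ?thesis unfolding pull_a using z by auto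
      qed
      show "pmS i (pmS i f) = f" for i by (rule pmS_sq)
      show "pmS i (pmS j f) = pmS j (pmS i f)" if "Suc i < j" for i j by (rule pmS_far[OF that])
      show "pmS i (pmS (Suc i) (pmS i f)) = pmS (Suc i) (pmS i (pmS (Suc i) f))" for i by (rule pmS_braid)
      show "?L i (?L k f) = ?L k (?L i f)" if "i \<in> {1..n}" "k \<in> {1..n}" "i < k" for i k
        by (rule pmL_L) (use that in auto)
      show "pmS i (?L k f) = ?L k (pmS i f)" if "i \<in> {1..<n}" "k \<in> {1..n}" "k \<noteq> i" "k \<noteq> Suc i" for i k
        using pmS_L_gt[of k i n] pmS_L_lt[of i k n] that by (cases "k < i") auto
      show "?L (Suc i) f = pmS i (?L i (pmS i f)) + pmS i f" if "i \<in> {1..<n}" for i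
        using that by (cases i) (auto simp: pmL_rec)
    qed
  qed
qed

lemma foldr_pmS: "foldr pmS is g (w \<circ> word_perm is) = g w"
proof (induction "is")
  case (Cons i "is")
  have "w \<circ> word_perm (i # is) \<circ> st i = w \<circ> word_perm is" by (simp add: fun_eq_iff)
  then show ?case using Cons pmS_def[of i "foldr pmS is g"] by (simp only: foldr.simps comp_apply[of "pmS i"])
qed simp

text \<open>Semisimplicity splits off the submodule of functions that are constant on permutations. The sum
  of all permutations then shows that \<open>n!\<close> is invertible, as it maps the indicator of the identity
  into this submodule.\<close>

lemma semisimple_pm_split:
  fixes u :: "nat \<Rightarrow> 'k::field"
  assumes ss: "semisimple_ring (hecke l n u)"
    and a: "a \<in> {1..l}" and b: "(\<forall>x. \<not> B x) \<or> b \<in> {1..l} \<and> b \<noteq> a"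
    and const: "\<And>w. w permutes {1..n} \<Longrightarrow> B (w 1) \<Longrightarrow> u b = u a + of_nat (card {j. j \<in> {2..n} \<and> \<not> B (w j)})"
  obtains x c where "\<forall>w. w permutes {1..n} \<longrightarrow> x w = (if w = id then 1 else 0) - c"
    "of_nat (fact n) * c = (1 :: 'k)"
    "\<forall>X \<in> carrier (hecke l n u).
       hecke_module.opr fscale pmS (pmL B (u a) (u b) n) X (\<lambda>w. if w = id then 1 else 0) = 0 \<longrightarrow>
       hecke_module.opr fscale pmS (pmL B (u a) (u b) n) X x = 0"
proof -
  interpret V: hecke_module "fscale :: 'k \<Rightarrow> ((nat \<Rightarrow> nat) \<Rightarrow> 'k) \<Rightarrow> (nat \<Rightarrow> nat) \<Rightarrow> 'k" n UNIV pmS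
    "pmL B (u a) (u b) n" l u by (rule pm_module[OF a b])
  interpret R: ring V.H by (rule ring_hecke)
  let ?P = "\<lambda>w. w permutes {1..n}"
  define v :: "(nat \<Rightarrow> nat) \<Rightarrow> 'k" where "v w = (if w = id then 1 else 0)" for w
  define W where "W = {g :: (nat \<Rightarrow> nat) \<Rightarrow> 'k. \<exists>c. \<forall>w. ?P w \<longrightarrow> g w = c}"
  have WI: "g \<in> W" if "\<And>w. ?P w \<Longrightarrow> g w = c" for g c using that unfolding W_def by blast
  have sub: "V.subspace W"
  proof (rule V.subspaceI)
    show "0 \<in> W" by (rule WI[of _ 0]) simp
    fix f g assume "f \<in> W" "g \<in> W"
    then obtain c d where "\<And>w. ?P w \<Longrightarrow> f w = c" "\<And>w. ?P w \<Longrightarrow> g w = d" unfolding W_def by blast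
    then show "f + g \<in> W" by (intro WI[of _ "c + d"]) (simp add: plus_fun_apply)
  next
    fix k f assume "f \<in> W"
    then obtain c where "\<And>w. ?P w \<Longrightarrow> f w = c" unfolding W_def by blast
    then show "fscale k f \<in> W" by (intro WI[of _ "k * c"]) (simp add: fscale_def)
  qed
  have WS: "pmS i g \<in> W" if i: "i \<in> {1..<n}" and g: "g \<in> W" for i g
  proof -
    obtain c where "\<And>w. ?P w \<Longrightarrow> g w = c" using g unfolding W_def by blast
    then have "pmS i g w = c" if "?P w" for w unfolding pmS_def using permutes_compose[OF st_permutes[OF i] that] by blast
    then show ?thesis by (rule WI)
  qed
  \<comment> \<open>If the first letter is in \<open>B\<close>, the constant is multiplied by
    \<open>u b\<close> minus the number of exchanges, which \<open>const\<close> turns into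
    \<open>u a\<close>, the scalar for the other letters.\<close>
  have WL1: "pmL1 B (u a) (u b) n g \<in> W" if g: "g \<in> W" and n: "1 \<le> n" for g
  proof -
    obtain c where c: "\<And>w. ?P w \<Longrightarrow> g w = c" using g unfolding W_def by blast
    have "pmL1 B (u a) (u b) n g w = u a * c" if w: "?P w" for w
    proof (cases "B (w 1)")
      case True
      have "g (w \<circ> Transposition.transpose 1 j) = c" if "j \<in> {2..n}" for j
        by (rule c[OF permutes_compose[OF permutes_swap_id w]]) (use that n in auto)
      then have "(\<Sum>j | j \<in> {2..n} \<and> \<not> B (w j). g (w \<circ> Transposition.transpose 1 j)) =
          of_nat (card {j. j \<in> {2..n} \<and> \<not> B (w j)}) * c"
        by simp
      then show ?thesis using True c[OF w] const[OF w True] by (simp add: pmL1_def algebra_simps)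
    qed (use c[OF w] in \<open>simp add: pmL1_def\<close>)
    then show ?thesis by (rule WI)
  qed
  have WL: "pmL B (u a) (u b) n k g \<in> W" if "k \<in> {1..n}" "g \<in> W" for k g
    using that
  proof (induction k arbitrary: g)
    case (Suc k)
    show ?case
    proof (cases k)
      case 0
      then show ?thesis using WL1 Suc.prems by simp
    next
      case (Suc m)
      have g: "pmS k g \<in> W" by (rule WS) (use Suc.prems \<open>k = Suc m\<close> in auto)
      then have "pmL B (u a) (u b) n k (pmS k g) \<in> W" using Suc.IH[of "pmS k g"] Suc.prems \<open>k = Suc m\<close> by simp
      then have "pmS k (pmL B (u a) (u b) n k (pmS k g)) \<in> W" by (rule WS[rotated]) (use Suc.prems \<open>k = Suc m\<close> in auto)
      then show ?thesis using V.subspace_add[OF sub _ g] unfolding Suc pmL_rec by blast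
    qed
  qed simp
  obtain x where x: "v - x \<in> W" "\<And>X. X \<in> carrier V.H \<Longrightarrow> V.opr X v \<in> W \<Longrightarrow> V.opr X x = 0"
    by (rule V.semisimple_split[where v = v, OF ss sub subset_UNIV WS WL UNIV_I]) auto
  obtain c where "\<And>w. ?P w \<Longrightarrow> (v - x) w = c" using x(1) unfolding W_def by blast
  then have xc: "x w = v w - c" if "?P w" for w using that by (metis fun_diff_def minus_diff_eq diff_diff_eq2 add_diff_cancel_left' diff_add_cancel)
  have hp: "V.opr (hperm l n u s) g w = g (w \<circ> pinv s)" if s: "?P s" for s g w
  proof -
    obtain "is" where "is": "set is \<subseteq> {1..<n}" "word_perm is = s" using word_exists[OF s] by blast
    have "w \<circ> pinv s \<circ> s = w" using permutes_inv_o(2)[OF s] by (simp add: comp_assoc)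
    then show ?thesis using V.opr_hperm[OF "is"(1) UNIV_I, of g] foldr_pmS[of "is" g "w \<circ> pinv s"] "is" by simp
  qed
  let ?h = "finsum V.H (hperm l n u) {s. ?P s}"
  have hc: "?h \<in> carrier V.H" by (intro R.finsum_closed) (auto intro: hperm_closed)
  have h: "V.opr ?h g w = (\<Sum>s | ?P s. g (w \<circ> pinv s))" for g w
  proof -
    have "V.opr ?h g w = (\<Sum>s | ?P s. V.opr (hperm l n u s) g) w"
      by (subst V.opr_finsum) (auto intro: hperm_closed finite_permutations)
    also have "\<dots> = (\<Sum>s | ?P s. V.opr (hperm l n u s) g w)"
      by (induction rule: infinite_finite_induct) (auto simp: plus_fun_apply)
    finally show ?thesis by (simp add: hp)
  qed
  have hv: "(\<Sum>s | ?P s. v (w \<circ> pinv s)) = 1" if w: "?P w" for w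
  proof -
    have "w \<circ> pinv s = id \<longleftrightarrow> s = w" if s: "?P s" for s
    proof
      assume "w \<circ> pinv s = id"
      then have "w \<circ> pinv s \<circ> s = s" by simp
      then show "s = w" using permutes_inv_o(2)[OF s] by (simp add: comp_assoc)
    qed (use permutes_inv_o(1)[OF w] in simp)
    then have "(\<Sum>s | ?P s. v (w \<circ> pinv s)) = (\<Sum>s | ?P s. if s = w then 1 else 0)"
      by (intro sum.cong) (auto simp: v_def)
    then show ?thesis using w by (simp add: finite_permutations)
  qed
  have "V.opr ?h v \<in> W" by (rule WI[of _ 1]) (simp only: h hv)
  then have "V.opr ?h x id = 0" using x(2)[OF hc] by simp
  moreover have "(\<Sum>s | ?P s. x (id \<circ> pinv s)) = (\<Sum>s | ?P s. v (id \<circ> pinv s) - c)"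
    by (intro sum.cong refl) (simp add: xc permutes_inv)
  ultimately have "1 - of_nat (card {s. ?P s}) * c = 0"
    using hv[OF permutes_id] by (simp add: h sum_subtractf del: One_nat_def)
  moreover have "card {s. ?P s} = fact n" by (rule card_permutations) auto
  ultimately have fc: "of_nat (fact n) * c = 1" by simp
  show ?thesis
  proof (rule that)
    show "\<forall>w. ?P w \<longrightarrow> x w = (if w = id then 1 else 0) - c" using xc by (simp add: v_def)
    show "\<forall>X\<in>carrier V.H. V.opr X (\<lambda>w. if w = id then 1 else 0) = 0 \<longrightarrow> V.opr X x = 0"
      using x(2) V.subspace_0[OF sub] unfolding v_def[abs_def] by auto
  qed (rule fc)
qed

text \<open>With \<open>B\<close> empty the hypothesis on the parameters in
  \<open>semisimple_pm_split\<close> is vacuous, and the split yields an inverse of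
  \<open>n!\<close> in the field.\<close>

lemma semisimple_char:
  fixes u :: "nat \<Rightarrow> 'k::field"
  assumes ss: "semisimple_ring (hecke l n u)" and l: "1 \<le> l" and k: "k \<in> {1..n}"
  shows "of_nat k \<noteq> (0::'k)"
proof -
  obtain c :: 'k where "of_nat (fact n) * c = 1"
    by (rule semisimple_pm_split[OF ss, of 1 "\<lambda>_. False" 1]) (use l in auto)
  then have "of_nat (fact n) \<noteq> (0::'k)" by auto
  moreover have "k dvd fact n" using k by (intro dvd_fact) auto
  ultimately show ?thesis by (metis dvdE mult_zero_left of_nat_mult)
qed

text \<open>\<open>B\<close> consists of \<open>n - d\<close> letters, so that \<open>L_1\<close>
  has exactly \<open>d\<close> exchanges, the number by which \<open>u b\<close> exceeds
  \<open>u a\<close>. The indicator of the identity is an eigenvector of \<open>L_1\<close> for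
  \<open>u b\<close>, hence so is the vector split off from it. At the identity this says
  \<open>d * c = 0\<close>, although both factors are nonzero.\<close>

lemma semisimple_separated_params:
  fixes u :: "nat \<Rightarrow> 'k::field"
  assumes ss: "semisimple_ring (hecke l n u)" and ab: "a \<in> {1..l}" "b \<in> {1..l}" "b \<noteq> a"
    and d: "1 \<le> d" "d < n"
  shows "u b \<noteq> u a + of_nat d"
proof
  assume e: "u b = u a + of_nat d"
  define B where "B x \<longleftrightarrow> 1 \<le> x \<and> x \<le> n - d" for x
  have b: "(\<forall>x. \<not> B x) \<or> b \<in> {1..l} \<and> b \<noteq> a" using ab by simp
  interpret V: hecke_module "fscale :: 'k \<Rightarrow> ((nat \<Rightarrow> nat) \<Rightarrow> 'k) \<Rightarrow> (nat \<Rightarrow> nat) \<Rightarrow> 'k" n UNIV pmS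
    "pmL B (u a) (u b) n" l u by (rule pm_module[OF ab(1) b])
  interpret R: ring V.H by (rule ring_hecke)
  have B1: "B 1" using d by (simp add: B_def)
  have card: "card {j. j \<in> {2..n} \<and> \<not> B (w j)} = d" if w: "w permutes {1..n}" and "B (w 1)" for w
  proof -
    have "w ` {j. j \<in> {2..n} \<and> \<not> B (w j)} = {n - d<..n}"
    proof (intro subset_antisym subsetI)
      fix x assume x: "x \<in> {n - d<..n}"
      then have "pinv w x \<in> {1..n}" using permutes_in_image[OF permutes_inv[OF w], of x] by auto
      moreover have wx: "w (pinv w x) = x" by (rule permutes_inverses(1)[OF w])
      moreover have "pinv w x \<noteq> 1"
      proof
        assume "pinv w x = 1"
        then show False using wx \<open>B (w 1)\<close> x by (simp add: B_def)
      qed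
      ultimately have "pinv w x \<in> {j. j \<in> {2..n} \<and> \<not> B (w j)}" using x by (auto simp: B_def)
      then show "x \<in> w ` {j. j \<in> {2..n} \<and> \<not> B (w j)}" using wx by force
    next
      fix x assume "x \<in> w ` {j. j \<in> {2..n} \<and> \<not> B (w j)}"
      then obtain j where "x = w j" "j \<in> {1..n}" "\<not> B x" by auto
      then show "x \<in> {n - d<..n}" using permutes_in_image[OF w, of j] by (auto simp: B_def)
    qed
    then show ?thesis using card_image[OF inj_on_subset[OF permutes_inj[OF w] subset_UNIV],
        of "{j. j \<in> {2..n} \<and> \<not> B (w j)}"] d by simp
  qed
  have "\<And>w. w permutes {1..n} \<Longrightarrow> B (w 1) \<Longrightarrow> u b = u a + of_nat (card {j. j \<in> {2..n} \<and> \<not> B (w j)})"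
    using card e by simp
  then obtain x c where x: "\<forall>w. w permutes {1..n} \<longrightarrow> x w = (if w = id then 1 else 0) - c"
      "of_nat (fact n) * c = (1 :: 'k)"
    and X: "\<forall>X\<in>carrier V.H. V.opr X (\<lambda>w. if w = id then 1 else 0) = 0 \<longrightarrow> V.opr X x = 0"
    by (rule semisimple_pm_split[OF ss ab(1) b])
  let ?v = "\<lambda>w :: nat \<Rightarrow> nat. if w = id then 1 else 0 :: 'k"
  let ?X = "hL l n u 1 \<ominus>\<^bsub>V.H\<^esub> hscl l n u (u b)"
  have cl: "hL l n u 1 \<in> carrier V.H" "hscl l n u (u b) \<in> carrier V.H"
    by (intro proj_closed free_carrier_gL free_carrier_scl; use d in simp)+
  have act: "V.opr ?X f = pmL1 B (u a) (u b) n f - fscale (u b) f" for f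
    using V.opr_minus[OF cl, of f] V.opr_hL[of 1 f] d by (simp add: V.opr_hscl)
  have "pmL1 B (u a) (u b) n ?v w = u b * ?v w" for w
  proof (cases "B (w 1)")
    case True
    have "w \<circ> Transposition.transpose 1 j \<noteq> id" if "\<not> B (w j)" for j
    proof
      assume "w \<circ> Transposition.transpose 1 j = id"
      from fun_cong[OF this, of 1] have "w j = 1" by simp
      then show False using that B1 by simp
    qed
    then have "(\<Sum>j | j \<in> {2..n} \<and> \<not> B (w j). ?v (w \<circ> Transposition.transpose 1 j)) = 0"
      by (intro sum.neutral) auto
    then show ?thesis using True by (simp add: pmL1_def)
  next
    case False
    then have "w \<noteq> id" using B1 by auto
    then show ?thesis using False by (simp add: pmL1_def)
  qed
  then have "V.opr ?X ?v = 0" unfolding act by (simp add: fun_eq_iff fscale_def)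
  then have "V.opr ?X x = 0" using X cl R.minus_closed by blast
  then have "pmL1 B (u a) (u b) n x id = u b * x id" unfolding act by (simp add: fun_eq_iff fscale_def)
  then have "(\<Sum>j | j \<in> {2..n} \<and> \<not> B j. x (Transposition.transpose 1 j)) = 0"
    using B1 by (simp add: pmL1_def)
  moreover have "x (Transposition.transpose 1 j) = - c" if "j \<in> {2..n}" for j
  proof -
    have "Transposition.transpose 1 j \<noteq> id" using that by (auto dest: fun_cong[of _ _ 1])
    moreover have "Transposition.transpose 1 j permutes {1..n}" by (rule permutes_swap_id) (use that in auto)
    ultimately show ?thesis using x(1) by simp
  qed
  ultimately have "of_nat d * c = 0" using card[OF permutes_id] B1 by simp
  moreover have "of_nat d \<noteq> (0::'k)" by (rule semisimple_char[OF ss]) (use ab d in auto)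
  ultimately show False using x(2) by simp
qed

lemma semisimple_separated:
  fixes u :: "nat \<Rightarrow> 'k::field"
  assumes ss: "semisimple_ring (hecke l n u)" and l: "1 \<le> l" and n: "1 \<le> n"
  shows "separated l n u"
proof
  show "of_nat k \<noteq> (0::'k)" if "k \<in> {1..n}" for k by (rule semisimple_char[OF ss l that])
  fix a b :: nat and d :: int assume ab: "a \<in> {1..l}" "b \<in> {1..l}" "a \<noteq> b" and d: "\<bar>d\<bar> < int n"
  consider "d = 0" | "d > 0" | "d < 0" by linarith
  then show "of_int d + u a - u b \<noteq> 0"
  proof cases
    case 1
    then show ?thesis using semisimple_distinct_params[OF ss n ab] by simp
  next
    case 2
    then have "u b \<noteq> u a + of_nat (nat d)" using semisimple_separated_params[OF ss ab(1,2), of "nat d"] ab d by simp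
    then show ?thesis using 2 by (simp add: add.commute)
  next
    case 3
    then have "u a \<noteq> u b + of_nat (nat (- d))" using semisimple_separated_params[OF ss ab(2,1), of "nat (- d)"] ab d by simp
    then show ?thesis using 3 by (simp add: algebra_simps)
  qed
qed

declare plus_fun_apply[simp]

section \<open>The \<open>r\<close>-coefficients\<close>

context separated begin

text \<open>The recursion reaches a tableau along many chains of transpositions, and consistency has
  to be shown. Here \<open>r t\<close> is taken to be the scalar by which \<open>f_tt\<close> acts
  on the indicator of \<open>t\<close> in the seminormal module; this depends on \<open>t\<close>
  alone, and \<open>fop_diag_descent\<close> shows that it obeys every instance of the
  recursion.\<close>

lemma r_coeffs_exist:
  assumes n: "n \<le> N"
  shows "\<exists>r. is_r_coeffs l n u r \<and> (\<forall>t. \<not> (\<exists>lam\<in>mparts l n. t \<in> Std l n lam) \<longrightarrow> r t = 0)"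
proof -
  interpret V: sep_module "fscale :: 'k \<Rightarrow> (tableau \<Rightarrow> 'k) \<Rightarrow> tableau \<Rightarrow> 'k" n "snM l n" "snS l n u" "snL l n u" l u N
    by (rule sn_module[OF n])
  define \<delta> :: "tableau \<Rightarrow> tableau \<Rightarrow> 'k" where "\<delta> t = (\<lambda>s. if s = t then 1 else 0)" for t
  have \<delta>W: "\<delta> t \<in> V.W n t" if "ST l n t" for t unfolding \<delta>_def by (rule sn_delta[OF n that])
  define r where "r t = (if ST l n t then V.fop (shape t) t t (\<delta> t) t else 0)" for t
  have r: "r t \<noteq> 0" "\<And>v. v \<in> V.W n t \<Longrightarrow> V.fop lam t t v = fscale (r t) v"
    if lam: "lam \<in> mparts l n" and t: "t \<in> Std l n lam" for lam t
  proof -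
    note T = Std_ST[OF lam t]
    obtain c where c: "c \<noteq> 0" "\<forall>v\<in>V.W n t. V.fop lam t t v = fscale c v"
      using V.fop_diag_exists[OF lam t] by blast
    have "r t = c" using T shape_Std[OF lam t] c(2) \<delta>W[OF T] by (simp add: r_def fscale_def \<delta>_def)
    then show "r t \<noteq> 0" "\<And>v. v \<in> V.W n t \<Longrightarrow> V.fop lam t t v = fscale (r t) v" using c by auto
  qed
  have eq: "c = d" if "fscale c (\<delta> t) = fscale d (\<delta> t)" for c d t
    using fun_cong[OF that, of t] by (simp add: fscale_def \<delta>_def)
  have "is_r_coeffs l n u r"
    unfolding is_r_coeffs_def
  proof (intro conjI ballI impI)
    fix lam assume lam: "lam \<in> mparts l n"
    note I = init_tab_Std[OF lam]
    show "r (init_tab l lam) = r_init l u lam"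
      using r(2)[OF lam I \<delta>W[OF Std_ST[OF lam I]]] V.fop_init_diag[OF lam \<delta>W[OF Std_ST[OF lam I]]] by (metis eq)
  next
    fix lam s t i
    assume lam: "lam \<in> mparts l n" and s: "s \<in> Std l n lam" and t: "t \<in> Std l n lam" and i: "i \<in> {1..<n}"
      and st: "s = st i \<circ> t \<and> tab_dominates l s t \<and> s \<noteq> t"
    note T = Std_ST[OF lam t]
    have s': "st i \<circ> t \<in> Std l n lam" using s st by blast
    note Ss = Std_ST[OF lam s']
    have d: "descent t i" using swap_dominates[OF T i Ss] st by blast
    let ?\<rho> = "tcontent u t (Suc i) - tcontent u t i"
    have "r t = r (st i \<circ> t) * (1 - (1 / ?\<rho>)\<^sup>2)"
      using V.fop_diag_descent[OF lam t i d s' r(2)[OF lam s'] \<delta>W[OF T]] r(2)[OF lam t \<delta>W[OF T]] by (metis eq)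
    moreover have "r (st i \<circ> t) \<noteq> 0" by (rule r(1)[OF lam s'])
    ultimately have "r t / r (st i \<circ> t) = 1 - (1 / ?\<rho>)\<^sup>2" by (simp del: comp_apply)
    moreover have "?\<rho> \<noteq> 0" using content_consec[OF T n i] by simp
    moreover have "1 - (1 / x)\<^sup>2 = (x + 1) * (x - 1) / x\<^sup>2" if "x \<noteq> 0" for x :: 'k
      using that by (simp add: field_simps power2_eq_square)
    moreover have "tcontent u (st i \<circ> t) i = tcontent u t (Suc i)"
      using content_swap[OF T i Ss, of i u] i by (simp add: st_apply)
    ultimately show "r t / r s = (tcontent u s i - tcontent u t i + 1) * (tcontent u s i - tcontent u t i - 1)
        / (tcontent u s i - tcontent u t i)\<^sup>2"
      using st by presburger
  qed (rule r(1))
  moreover have "r t = 0" if "\<not> (\<exists>lam\<in>mparts l n. t \<in> Std l n lam)" for t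
    using that ST_shape[of l n t] unfolding r_def by auto
  ultimately show ?thesis by blast
qed

lemma r_coeffs_unique:
  assumes n: "n \<le> N" and r: "is_r_coeffs l n u r" "is_r_coeffs l n u r'"
    and lam: "lam \<in> mparts l n" and t: "t \<in> Std l n lam"
  shows "r t = r' t"
  using lam t
proof (induction rule: std_induct)
  case init
  then show ?case using r lam unfolding is_r_coeffs_def by simp
next
  case (step t i)
  show ?case
    unfolding is_r_coeffs_descent[OF r(1) lam step.hyps(1-4) n] is_r_coeffs_descent[OF r(2) lam step.hyps(1-4) n]
      step.IH ..
qed

lemma is_r_coeffs_r_coeff:
  assumes n: "n \<le> N"
  shows "is_r_coeffs l n u (r_coeff l n u)"
proof -
  let ?P = "\<lambda>r. is_r_coeffs l n u r \<and> (\<forall>t. \<not> (\<exists>lam\<in>mparts l n. t \<in> Std l n lam) \<longrightarrow> r t = 0)"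
  have "\<exists>!r. ?P r"
  proof (rule ex_ex1I)
    show "\<exists>r. ?P r" by (rule r_coeffs_exist[OF n])
    fix r r' assume r: "?P r" "?P r'"
    show "r = r'"
    proof
      fix t
      show "r t = r' t"
        using r r_coeffs_unique[OF n, of r r' _ t] by (cases "\<exists>lam\<in>mparts l n. t \<in> Std l n lam") auto
    qed
  qed
  then show ?thesis unfolding r_coeff_def by (rule theI'[THEN conjunct1])
qed

lemma r_coeff_nonzero: "n \<le> N \<Longrightarrow> lam \<in> mparts l n \<Longrightarrow> t \<in> Std l n lam \<Longrightarrow> r_coeff l n u t \<noteq> 0"
  using is_r_coeffs_r_coeff[of n] unfolding is_r_coeffs_def by blast

end

section \<open>Branching\<close>

text \<open>\<open>s\<close> and \<open>V \<down> m\<close> have the same support, so the box that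
  \<open>V\<close> adds to the one can be added to the other.\<close>

lemma Std_extend:
  assumes mu: "mu \<in> mparts l m" and lam: "lam \<in> mparts l (Suc m)" and V: "V \<in> Std l (Suc m) lam"
    and t: "V \<down> m \<in> Std l m mu" and s: "s \<in> Std l m mu"
  shows "s(bx V (Suc m) := Suc m) \<in> Std l (Suc m) lam" "s (bx V (Suc m)) = 0"
proof -
  let ?b = "bx V (Suc m)"
  note VT = Std_ST[OF lam V] and S = Std_ST[OF mu s]
  have ad: "addable l (V \<down> m) ?b" by (rule ST_last_addable[OF VT]) simp
  have supp: "s x \<noteq> 0 \<longleftrightarrow> (V \<down> m) x \<noteq> 0" for x
    unfolding Std_supp[OF mu s] Std_supp[OF mu t] ..
  have ad': "addable l s ?b" using ad supp unfolding addable_def by blast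
  then show "s ?b = 0" by (simp add: addable_def)
  have "V = (V \<down> m)(?b := Suc m)" using ST_last_eq[OF VT, of m] restrict_self[OF VT] by simp
  then have "V x \<noteq> 0 \<longleftrightarrow> x = ?b \<or> (V \<down> m) x \<noteq> 0" for x by (metis fun_upd_apply nat.simps(3))
  then have "(s(?b := Suc m)) x \<noteq> 0 \<longleftrightarrow> V x \<noteq> 0" for x using supp[of x] by simp
  then show "s(?b := Suc m) \<in> Std l (Suc m) lam"
    using ST_extend[OF S ad'] V unfolding Std_iff[OF lam] by simp
qed

locale branching = sep_module scale "Suc m" M S L l u N
  for scale :: "'k::field \<Rightarrow> 'v::ab_group_add \<Rightarrow> 'v" (infixr \<open>*s\<close> 75) and m M S L l u N +
  fixes mu lam :: mpart and b :: box and r r' :: "tableau \<Rightarrow> 'k"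
  assumes mu: "mu \<in> mparts l m" and lam: "lam \<in> mparts l (Suc m)"
    and E_Std: "s \<in> Std l m mu \<Longrightarrow> s(b := Suc m) \<in> Std l (Suc m) lam"
    and E_0: "s \<in> Std l m mu \<Longrightarrow> s b = 0"
    and r: "is_r_coeffs l (Suc m) u r" and r': "is_r_coeffs l m u r'"
begin

lemma sep_module_m: "sep_module scale m M S L l u N"
  unfolding sep_module_def sep_module_axioms_def
  using hecke_module_mono[of m] separated_axioms nN by simp

interpretation R: sep_module scale m M S L l u N
  by (rule sep_module_m)

abbreviation E :: "tableau \<Rightarrow> tableau" where
  "E s \<equiv> s(b := Suc m)"

lemma E_ST: "s \<in> Std l m mu \<Longrightarrow> ST l (Suc m) (E s)"
  by (rule Std_ST[OF lam E_Std])

lemma E_restrict: "s \<in> Std l m mu \<Longrightarrow> E s \<down> m = s"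
  using ST_le[OF Std_ST[OF mu]] E_0 by (auto simp: restrict_tab_def fun_eq_iff)

lemma E_swap: "i \<in> {1..<m} \<Longrightarrow> E (st i \<circ> s) = st i \<circ> E s"
  by (auto simp: fun_eq_iff st_apply)

lemma E_bx: "s \<in> Std l m mu \<Longrightarrow> k \<in> {1..m} \<Longrightarrow> bx (E s) k = bx s k"
  using bx_restrict[OF E_ST, of s m k] E_restrict[of s] by simp

lemma E_descent:
  assumes "s \<in> Std l m mu" "i \<in> {1..<m}"
  shows "descent (E s) i \<longleftrightarrow> descent s i"
    "tcontent u (E s) (Suc i) - tcontent u (E s) i = tcontent u s (Suc i) - tcontent u s i"
  using assms E_bx[of s i] E_bx[of s "Suc i"] by (simp_all add: descent_def content_eq)

text \<open>The ratio is read off at the initial tableau of \<open>mu\<close>, whose extension by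
  \<open>b\<close> need not be initial; by \<open>r_ratio\<close> it depends only on the added
  box.\<close>

definition \<kappa> :: 'k where
  "\<kappa> = r' (init_tab l mu) / r (E (init_tab l mu))"

lemma r_nonzero: "s \<in> Std l m mu \<Longrightarrow> r (E s) \<noteq> 0"
  using r lam E_Std unfolding is_r_coeffs_def by blast

lemma r_ratio:
  assumes s: "s \<in> Std l m mu"
  shows "r' s = \<kappa> * r (E s)"
  using mu s
proof (induction rule: std_induct)
  case init
  show ?case using r_nonzero[OF init_tab_Std[OF mu]] by (simp add: \<kappa>_def del: fun_upd_apply)
next
  case (step t i)
  note t = step.hyps
  have i: "i \<in> {1..<Suc m}" using t(2) by simp
  have s: "st i \<circ> E t \<in> Std l (Suc m) lam" using E_Std[OF t(4)] unfolding E_swap[OF t(2)] .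
  have "r (E t) = r (E (st i \<circ> t)) * (1 - (1 / (tcontent u t (Suc i) - tcontent u t i))\<^sup>2)"
    using is_r_coeffs_descent[OF r lam E_Std[OF t(1)] i _ s nN] t(3)
    unfolding E_descent[OF t(1,2)] E_swap[OF t(2)] by blast
  moreover have "m \<le> N" using nN by simp
  ultimately show ?case
    using is_r_coeffs_descent[OF r' mu t] step.IH by (simp only: mult.assoc)
qed

lemma W_E: "s \<in> Std l m mu \<Longrightarrow> v \<in> W (Suc m) (E s) \<Longrightarrow> v \<in> W m s"
  using W_restrict[OF E_ST, of s m v] E_restrict[of s] by simp

lemma E_swap_full:
  assumes t: "t \<in> Std l m mu" "i \<in> {1..<m}" "st i \<circ> t \<in> Std l m mu" and v: "v \<in> W (Suc m) (E t)"
  obtains \<alpha> v' where "S i v = \<alpha> *s v + v'" "v' \<in> W (Suc m) (E (st i \<circ> t))"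
proof -
  have i: "i \<in> {1..<Suc m}" using t(2) by simp
  show ?thesis
    using W_swap_full[OF E_ST[OF t(1)] i v] that unfolding E_swap[OF t(2)] by metis
qed

text \<open>At the diagonal pair of the initial tableau both sides act by their
  \<open>r\<close>-coefficients. From there the right index is moved away first and the left index
  after it, each by the descent recursion valid for both sizes.\<close>

lemma fop_branch:
  assumes s: "s \<in> Std l m mu" and t: "t \<in> Std l m mu" and v: "v \<in> W (Suc m) (E t)"
  shows "R.fop mu s t v = \<kappa> *s fop lam (E s) (E t) v"
proof -
  let ?z = "init_tab l mu"
  note z = init_tab_Std[OF mu]
  have E_sw: "st i \<circ> E t \<in> Std l (Suc m) lam" if "i \<in> {1..<m}" "st i \<circ> t \<in> Std l m mu" for i t
    using E_Std[OF that(2)] unfolding E_swap[OF that(1)] .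
  have base: "R.fop mu ?z y v = \<kappa> *s fop lam (E ?z) (E y) v" if "y \<in> Std l m mu" "v \<in> W (Suc m) (E y)" for y v
    using mu that
  proof (induction arbitrary: v rule: std_induct)
    case init
    show ?case
      using R.fop_diag_r[OF mu r' z W_E[OF z init]] fop_diag_r[OF lam r E_Std[OF z] init] r_ratio[OF z] by (simp del: fun_upd_apply)
  next
    case (step y i)
    note y = step.hyps
    have i: "i \<in> {1..<Suc m}" using y(2) by simp
    have d: "descent (E y) i" using y(3) unfolding E_descent[OF y(1,2)] .
    obtain \<alpha> v' where v': "S i v = \<alpha> *s v + v'" "v' \<in> W (Suc m) (E (st i \<circ> y))"
      by (rule E_swap_full[OF y(1,2,4) step.prems])
    have "R.fop mu ?z y v = R.fop mu ?z (st i \<circ> y) v'"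
      by (rule R.fop_right_descent[OF mu z y W_E[OF y(1) step.prems] v'(1) W_E[OF y(4) v'(2)]])
    also have "\<dots> = \<kappa> *s fop lam (E ?z) (E (st i \<circ> y)) v'" by (rule step.IH[OF v'(2)])
    also have "fop lam (E ?z) (E (st i \<circ> y)) v' = fop lam (E ?z) (E y) v"
      using v'(2) unfolding E_swap[OF y(2)]
      by (rule fop_right_descent[OF lam E_Std[OF z] E_Std[OF y(1)] i d E_sw[OF y(2,4)] step.prems v'(1), symmetric])
    finally show ?case .
  qed
  show ?thesis
    using mu s
  proof (induction rule: std_induct)
    case init
    show ?case by (rule base[OF t v])
  next
    case (step x i)
    note x = step.hyps
    have i: "i \<in> {1..<Suc m}" using x(2) by simp
    have d: "descent (E x) i" using x(3) unfolding E_descent[OF x(1,2)] .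
    define w where "w = fop lam (E (st i \<circ> x)) (E t) v"
    have w: "w \<in> W (Suc m) (E (st i \<circ> x))"
      unfolding w_def by (rule fop_in_W[OF lam E_Std[OF x(4)] E_Std[OF t] W_M[OF v]])
    have x': "st i \<circ> (st i \<circ> x) \<in> Std l m mu" using x(1) by (simp only: swap_swap)
    obtain \<alpha> w' where w': "S i w = \<alpha> *s w + w'" "w' \<in> W (Suc m) (E (st i \<circ> (st i \<circ> x)))"
      by (rule E_swap_full[OF x(4,2) x' w])
    have w'x: "w' \<in> W (Suc m) (E x)" using w'(2) by (simp only: swap_swap)
    have M: "w \<in> M" "w' \<in> M" using W_M w w'x by auto
    have ne: "x \<noteq> st i \<circ> x" using tlen_descent[OF mu x(1-3)] by auto
    then have neE: "E x \<noteq> E (st i \<circ> x)" using E_restrict[OF x(1)] E_restrict[OF x(4)] by metis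
    \<comment> \<open>\<open>w\<close> is a weight vector even for the larger algebra, so
      \<open>S i w\<close> has only the components \<open>w\<close> and \<open>w'\<close>, and the
      projections for both sizes select the same one.\<close>
    have "F (E x) (S i w) = w'"
      using opr_F[OF E_ST[OF x(1)] E_ST[OF x(4)] w] neE F_W[OF E_ST[OF x(1)] w'x] M
      unfolding w'(1) by (simp add: F_add F_scale M_simps)
    moreover have "R.F x (S i w) = w'"
      using R.opr_F[OF Std_ST[OF mu x(1)] Std_ST[OF mu x(4)] W_E[OF x(4) w]] ne
        R.F_W[OF Std_ST[OF mu x(1)] W_E[OF x(1) w'x]] M
      unfolding w'(1) by (simp add: R.F_add R.F_scale M_simps)
    moreover have "R.fop mu x t v = R.F x (S i (\<kappa> *s w))"
      unfolding w_def step.IH[symmetric] by (rule R.fop_left_descent[OF mu t x W_E[OF t v]])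
    moreover have "fop lam (E x) (E t) v = F (E x) (S i w)"
      using fop_left_descent[OF lam E_Std[OF t] E_Std[OF x(1)] i d E_sw[OF x(2,4)] v]
      unfolding w_def E_swap[OF x(2)] .
    ultimately show ?case using M i by (simp add: S_scale R.F_scale M_simps del: fun_upd_apply)
  qed
qed

end

definition branch_coeff :: "nat \<Rightarrow> nat \<Rightarrow> (nat \<Rightarrow> 'k::field) \<Rightarrow> tableau \<Rightarrow> tableau \<Rightarrow> tableau \<Rightarrow> tableau \<Rightarrow> 'k" where
  "branch_coeff l m u s t U V =
     (if (\<exists>lam\<in>mparts l (Suc m). U \<in> Std l (Suc m) lam \<and> V \<in> Std l (Suc m) lam) \<and> U \<down> m = s \<and> V \<down> m = t
      then r_coeff l m u s / r_coeff l (Suc m) u U else 0)"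

lemma sum_eq_single:
  "finite A \<Longrightarrow> a \<in> A \<Longrightarrow> (\<And>x. x \<in> A \<Longrightarrow> x \<noteq> a \<Longrightarrow> f x = 0) \<Longrightarrow> sum f A = f a"
  by (simp add: sum.remove[of A a])

section \<open>Comparing the expansion on weight vectors\<close>

context sep_module begin

definition expand :: "(tableau \<Rightarrow> tableau \<Rightarrow> 'k) \<Rightarrow> 'v \<Rightarrow> 'v" where
  "expand b v = (\<Sum>lam\<in>mparts l n. \<Sum>s\<in>Std l n lam. \<Sum>t\<in>Std l n lam. b s t *s fop lam s t v)"

lemma fop_add:
  "lam \<in> mparts l n \<Longrightarrow> s \<in> Std l n lam \<Longrightarrow> t \<in> Std l n lam \<Longrightarrow> v \<in> M \<Longrightarrow> w \<in> M \<Longrightarrow>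
     fop lam s t (v + w) = fop lam s t v + fop lam s t w"
  unfolding fop_def by (rule opr_plus_right[OF seminormal_f_closed])

lemma fop_zero: "lam \<in> mparts l n \<Longrightarrow> s \<in> Std l n lam \<Longrightarrow> t \<in> Std l n lam \<Longrightarrow> fop lam s t 0 = 0"
  unfolding fop_def by (rule opr_zero_right[OF seminormal_f_closed])

lemma expand_add: "v \<in> M \<Longrightarrow> w \<in> M \<Longrightarrow> expand b (v + w) = expand b v + expand b w"
  by (simp add: expand_def fop_add scale_right_distrib sum.distrib)

lemma expand_zero: "expand b 0 = 0"
  by (simp add: expand_def fop_zero)

lemma expand_W:
  assumes lam: "lam \<in> mparts l n" and V: "V \<in> Std l n lam" and v: "v \<in> W n V"
  shows "expand b v = (\<Sum>U\<in>Std l n lam. b U V *s fop lam U V v)"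
proof -
  note VT = Std_ST[OF lam V]
  have z: "fop lam' s t v = 0" if "lam' \<in> mparts l n" "s \<in> Std l n lam'" "t \<in> Std l n lam'" "t \<noteq> V" for lam' s t
    by (rule fop_W_ne[OF that(1-3) VT v]) (use that(4) in simp)
  have "expand b v = (\<Sum>s\<in>Std l n lam. \<Sum>t\<in>Std l n lam. b s t *s fop lam s t v)"
    unfolding expand_def
  proof (rule sum_eq_single[OF finite_mparts lam])
    fix lam' assume l': "lam' \<in> mparts l n" "lam' \<noteq> lam"
    then have "t \<noteq> V" if "t \<in> Std l n lam'" for t using Std_disjoint[OF lam l'(1) V] that by blast
    then show "(\<Sum>s\<in>Std l n lam'. \<Sum>t\<in>Std l n lam'. b s t *s fop lam' s t v) = 0"
      using z l'(1) by (intro sum.neutral ballI) simp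
  qed
  also have "\<dots> = (\<Sum>s\<in>Std l n lam. b s V *s fop lam s V v)"
    by (intro sum.cong refl sum_eq_single[OF finite_Std[OF lam] V]) (simp add: z[OF lam])
  finally show ?thesis .
qed

lemma F_sum: "(\<And>a. a \<in> I \<Longrightarrow> f a \<in> M) \<Longrightarrow> F t (sum f I) = (\<Sum>a\<in>I. F t (f a))"
proof (induction I rule: infinite_finite_induct)
  case (insert x I)
  then show ?case using subspace_sum[OF subspace_M, of I f] by (simp add: F_add)
qed (simp_all add: F_zero)

text \<open>Isolates a single coefficient: the weight of the argument selects the right index and
  the projection selects the left one.\<close>

lemma F_expand:
  assumes lam: "lam \<in> mparts l n" and U: "U \<in> Std l n lam" and V: "V \<in> Std l n lam" and v: "v \<in> W n V"
  shows "F U (expand b v) = b U V *s fop lam U V v"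
proof -
  have W: "fop lam s V v \<in> W n s" if "s \<in> Std l n lam" for s
    by (rule fop_in_W[OF lam that V W_M[OF v]])
  have "F U (expand b v) = (\<Sum>s\<in>Std l n lam. F U (b s V *s fop lam s V v))"
    unfolding expand_W[OF lam V v] by (rule F_sum) (use W W_M M_scale in blast)
  also have "\<dots> = F U (b U V *s fop lam U V v)"
  proof (rule sum_eq_single[OF finite_Std[OF lam] U])
    fix s assume s: "s \<in> Std l n lam" "s \<noteq> U"
    then have "F U (fop lam s V v) = 0"
      using opr_F[OF Std_ST[OF lam U] Std_ST[OF lam s(1)] W[OF s(1)]] by simp
    then show "F U (b s V *s fop lam s V v) = 0" using F_scale[OF W_M[OF W[OF s(1)]]] by simp
  qed
  also have "\<dots> = b U V *s fop lam U V v"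
    using F_W[OF Std_ST[OF lam U] W[OF U]] W_M[OF W[OF U]] by (simp add: F_scale)
  finally show ?thesis .
qed

lemma opr_expand:
  assumes v: "v \<in> M"
  shows "opr (\<Oplus>\<^bsub>H\<^esub>lam\<in>mparts l n. \<Oplus>\<^bsub>H\<^esub>s\<in>Std l n lam. \<Oplus>\<^bsub>H\<^esub>t\<in>Std l n lam.
      hscl l n u (b s t) \<otimes>\<^bsub>H\<^esub> seminormal_f l n u lam s t) v = expand b v"
proof -
  interpret R: ring H by (rule ring_hecke)
  let ?f = "\<lambda>lam s t. hscl l n u (b s t) \<otimes>\<^bsub>H\<^esub> seminormal_f l n u lam s t"
  have h: "hscl l n u c \<in> carrier H" for c by (intro proj_closed free_carrier)
  have f: "?f lam s t \<in> carrier H" if "lam \<in> mparts l n" "s \<in> Std l n lam" "t \<in> Std l n lam" for lam s t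
    using seminormal_f_closed[OF that] h by blast
  have "opr (?f lam s t) v = b s t *s fop lam s t v"
    if "lam \<in> mparts l n" "s \<in> Std l n lam" "t \<in> Std l n lam" for lam s t
    using seminormal_f_closed[OF that, of u] that h v by (simp add: opr_mult opr_hscl opr_closed fop_def)
  moreover have "(\<Oplus>\<^bsub>H\<^esub>t\<in>Std l n lam. ?f lam s t) \<in> carrier H" if "lam \<in> mparts l n" "s \<in> Std l n lam" for lam s
    by (rule R.finsum_closed) (use f that in blast)
  moreover from this have "(\<Oplus>\<^bsub>H\<^esub>s\<in>Std l n lam. \<Oplus>\<^bsub>H\<^esub>t\<in>Std l n lam. ?f lam s t) \<in> carrier H"
    if "lam \<in> mparts l n" for lam
    by (intro R.finsum_closed) (use that in blast)
  ultimately show ?thesis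
    unfolding expand_def using f v by (simp add: opr_finsum finite_mparts finite_Std cong: sum.cong)
qed

end

lemma hecke_finsum_closed:
  "(\<Oplus>\<^bsub>hecke l n u\<^esub>lam\<in>mparts l n. \<Oplus>\<^bsub>hecke l n u\<^esub>s\<in>Std l n lam. \<Oplus>\<^bsub>hecke l n u\<^esub>t\<in>Std l n lam.
      hscl l n u (b s t) \<otimes>\<^bsub>hecke l n u\<^esub> seminormal_f l n u lam s t) \<in> carrier (hecke l n u)"
proof -
  interpret R: ring "hecke l n u" by (rule ring_hecke)
  have h: "hscl l n u c \<in> carrier (hecke l n u)" for c by (intro proj_closed free_carrier)
  show ?thesis
    by (intro R.finsum_closed Pi_I R.m_closed h seminormal_f_closed)
qed

text \<open>By linearity the vector has a weight \<open>Y\<close>, which must restrict to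
  \<open>t\<close>. A tableau \<open>U\<close> that contributes restricts to \<open>s\<close> and
  has the shape of \<open>Y\<close>; comparing supports, its last box is that of \<open>Y\<close>.
  So one term is left, and it is given by \<open>fop_branch\<close>.\<close>

lemma branching_expand:
  fixes scale :: "'k::field \<Rightarrow> 'v::ab_group_add \<Rightarrow> 'v"
  assumes V: "sep_module scale (Suc m) M S L l u N" and mu: "mu \<in> mparts l m"
    and s: "s \<in> Std l m mu" and t: "t \<in> Std l m mu" and v: "v \<in> M"
  shows "hecke_module.opr scale S L (seminormal_f l m u mu s t) v =
    sep_module.expand scale (Suc m) S L l u (branch_coeff l m u s t) v"
proof -
  interpret V: sep_module scale "Suc m" M S L l u N by (rule V)
  have nN: "Suc m \<le> N" by (rule V.nN)
  interpret R: sep_module scale m M S L l u N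
    unfolding sep_module_def sep_module_axioms_def
    using V.hecke_module_mono[of m] V.separated_axioms nN by simp
  have "R.fop mu s t v = V.expand (branch_coeff l m u s t) v"
    using v
  proof (induction v rule: V.weight_induct)
    case zero
    then show ?case by (simp add: R.fop_zero mu s t V.expand_zero)
  next
    case (add v w)
    then show ?case by (simp add: R.fop_add mu s t V.expand_add)
  next
    case (weight Y v)
    note lam = ST_shape(1)[OF weight(1)] and Y = ST_shape(2)[OF weight(1)]
    let ?lam = "shape Y" and ?b = "bx Y (Suc m)"
    note ex = V.expand_W[OF lam Y weight(2)]
    have Ym: "ST l m (Y \<down> m)" by (rule ST_restrict[OF weight(1)]) simp
    have vW: "v \<in> V.W m (Y \<down> m)" by (rule V.W_restrict[OF weight(1) _ weight(2)]) simp
    show ?case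
    proof (cases "Y \<down> m = t")
      case False
      then have "R.fop mu s t v = 0" by (rule R.fop_W_ne[OF mu s t Ym vW])
      then show ?thesis unfolding ex using False by (simp add: branch_coeff_def)
    next
      case True
      have Yt: "Y \<down> m \<in> Std l m mu" using t True by simp
      interpret B: branching scale m M S L l u N mu ?lam ?b "r_coeff l (Suc m) u" "r_coeff l m u"
        using Std_extend[OF mu lam Y Yt] V.is_r_coeffs_r_coeff nN mu lam
        by unfold_locales auto
      have Et: "B.E t = Y" using ST_last_eq[OF weight(1), of m] restrict_self[OF weight(1)] True by simp
      have only: "U = B.E s" if U: "U \<in> Std l (Suc m) ?lam" "U \<down> m = s" for U
      proof -
        let ?c = "bx U (Suc m)"
        note UT = Std_ST[OF lam U(1)]
        have eU: "U = s(?c := Suc m)" using ST_last_eq[OF UT, of m] restrict_self[OF UT] U(2) by simp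
        have "s ?c = 0" by (rule Std_extend(2)[OF mu lam U(1) _ s]) (use U s in simp)
        moreover have "B.E s ?c \<noteq> 0"
          using Std_supp[OF lam U(1), of ?c] Std_supp[OF lam B.E_Std[OF s], of ?c] t_bx[OF UT, of "Suc m"] by simp
        ultimately have "?c = ?b" by (metis fun_upd_apply)
        then show ?thesis using eU by simp
      qed
      have "V.expand (branch_coeff l m u s t) v =
          scale (branch_coeff l m u s t (B.E s) Y) (V.fop ?lam (B.E s) Y v)"
        unfolding ex
        by (rule sum_eq_single[OF finite_Std[OF lam] B.E_Std[OF s]])
           (use only in \<open>auto simp: branch_coeff_def\<close>)
      moreover have "branch_coeff l m u s t (B.E s) Y = B.\<kappa>"
        using B.r_ratio[OF s] B.r_nonzero[OF s] True lam Y B.E_Std[OF s] B.E_restrict[OF s]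
        unfolding branch_coeff_def by auto
      moreover have "R.fop mu s t v = scale B.\<kappa> (V.fop ?lam (B.E s) Y v)"
        using B.fop_branch[OF s t] weight(2) unfolding Et by blast
      ultimately show ?thesis by simp
    qed
  qed
  then show ?thesis by (simp add: R.fop_def[OF mu])
qed

text \<open>\<open>U\<close> and \<open>V\<close> have the same shape, and so have their
  restrictions; both arise by adding the same box and share the ratio \<open>\<kappa>\<close>. The
  seminormal module supplies the instance of \<open>branching\<close>.\<close>

lemma branch_coeff_eq:
  fixes u :: "nat \<Rightarrow> 'k::field"
  assumes sep: "separated l N u" and mN: "Suc m \<le> N" and mu: "mu \<in> mparts l m" and lam: "lam \<in> mparts l (Suc m)"
    and U: "U \<in> Std l (Suc m) lam" "U \<down> m \<in> Std l m mu" and V: "V \<in> Std l (Suc m) lam" "V \<down> m \<in> Std l m mu"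
  shows "r_coeff l m u (U \<down> m) / r_coeff l (Suc m) u U = r_coeff l m u (V \<down> m) / r_coeff l (Suc m) u V"
proof -
  interpret sep: separated l N u by (rule sep)
  interpret V: sep_module "fscale :: 'k \<Rightarrow> (tableau \<Rightarrow> 'k) \<Rightarrow> tableau \<Rightarrow> 'k" "Suc m" "snM l (Suc m)" "snS l (Suc m) u"
    "snL l (Suc m) u" l u N by (rule sep.sn_module[OF mN])
  let ?b = "bx V (Suc m)"
  interpret B: branching "fscale :: 'k \<Rightarrow> (tableau \<Rightarrow> 'k) \<Rightarrow> tableau \<Rightarrow> 'k" m "snM l (Suc m)" "snS l (Suc m) u"
    "snL l (Suc m) u" l u N mu lam ?b "r_coeff l (Suc m) u" "r_coeff l m u"
    using Std_extend[OF mu lam V] sep.is_r_coeffs_r_coeff mN mu lam by unfold_locales auto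
  note UT = Std_ST[OF lam U(1)] and VT = Std_ST[OF lam V(1)]
  let ?c = "bx U (Suc m)"
  have eU: "U = (U \<down> m)(?c := Suc m)" using ST_last_eq[OF UT, of m] restrict_self[OF UT] by simp
  have "(U \<down> m) ?c = 0" by (rule Std_extend(2)[OF mu lam U U(2)])
  moreover have "B.E (U \<down> m) ?c \<noteq> 0"
    using Std_supp[OF lam U(1), of ?c] Std_supp[OF lam B.E_Std[OF U(2)], of ?c] t_bx[OF UT, of "Suc m"] by simp
  ultimately have "?c = ?b" by (metis fun_upd_apply)
  then have E: "B.E (U \<down> m) = U" "B.E (V \<down> m) = V"
    using eU ST_last_eq[OF VT, of m] restrict_self[OF VT] by simp_all
  show ?thesis
    using B.r_ratio[OF U(2)] B.r_nonzero[OF U(2)] B.r_ratio[OF V(2)] B.r_nonzero[OF V(2)] unfolding E by simp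
qed

lemma seminormal_coeffs_iota:
  fixes u :: "nat \<Rightarrow> 'k::field"
  assumes sep: "separated l N u" and mN: "Suc m \<le> N" and mu: "mu \<in> mparts l m"
    and s: "s \<in> Std l m mu" and t: "t \<in> Std l m mu"
  shows "seminormal_coeffs l (Suc m) u (hecke_iota l (Suc m) u (seminormal_f l m u mu s t)) = branch_coeff l m u s t"
proof -
  interpret sep: separated l N u by (rule sep)
  interpret D: sep_module "fscale :: 'k \<Rightarrow> (gword \<Rightarrow> 'k) \<Rightarrow> gword \<Rightarrow> 'k" "Suc m" "dualM l (Suc m) u" dualS dualL l u N
    unfolding sep_module_def sep_module_axioms_def using dual_module sep mN by blast
  interpret V: sep_module "fscale :: 'k \<Rightarrow> (tableau \<Rightarrow> 'k) \<Rightarrow> tableau \<Rightarrow> 'k" "Suc m" "snM l (Suc m)" "snS l (Suc m) u"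
    "snL l (Suc m) u" l u N by (rule sep.sn_module[OF mN])
  let ?X = "hecke_iota l (Suc m) u (seminormal_f l m u mu s t)"
  let ?n = "Suc m"
  let ?sum = "\<lambda>b. \<Oplus>\<^bsub>hecke l ?n u\<^esub>lam\<in>mparts l ?n. \<Oplus>\<^bsub>hecke l ?n u\<^esub>s\<in>Std l ?n lam. \<Oplus>\<^bsub>hecke l ?n u\<^esub>t\<in>Std l ?n lam.
      hscl l ?n u (b s t) \<otimes>\<^bsub>hecke l ?n u\<^esub> seminormal_f l ?n u lam s t"
  let ?b = "branch_coeff l m u s t"
  have f: "seminormal_f l m u mu s t \<in> carrier (hecke l m u)" by (rule seminormal_f_closed[OF mu s t])
  have mn: "m \<le> ?n" by simp
  have X: "?X = ?sum ?b"
  proof (rule hecke_eqI[OF hecke_iota_closed[OF mn f] hecke_finsum_closed])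
    fix \<phi> assume \<phi>: "\<phi> \<in> dualM l ?n u"
    show "D.opr ?X \<phi> = D.opr (?sum ?b) \<phi>"
      unfolding D.opr_iota[OF mn f \<phi>] D.opr_expand[OF \<phi>]
      by (rule branching_expand[OF D.sep_module_axioms mu s t \<phi>])
  qed
  show ?thesis
    unfolding seminormal_coeffs_def
  proof (rule the_equality)
    show "(\<forall>s t. \<not> (\<exists>lam\<in>mparts l ?n. s \<in> Std l ?n lam \<and> t \<in> Std l ?n lam) \<longrightarrow> ?b s t = 0) \<and> ?X = ?sum ?b"
      using X by (auto simp: branch_coeff_def)
  next
    fix c
    assume c: "(\<forall>s t. \<not> (\<exists>lam\<in>mparts l ?n. s \<in> Std l ?n lam \<and> t \<in> Std l ?n lam) \<longrightarrow> c s t = 0) \<and> ?X = ?sum c"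
    show "c = ?b"
    proof (intro ext)
      fix U V
      show "c U V = ?b U V"
      proof (cases "\<exists>lam\<in>mparts l ?n. U \<in> Std l ?n lam \<and> V \<in> Std l ?n lam")
        case True
        then obtain lam where lam: "lam \<in> mparts l ?n" and U: "U \<in> Std l ?n lam" and V: "V \<in> Std l ?n lam" by blast
        \<comment> \<open>A nonzero vector of weight \<open>V\<close>: projecting the expansion of
          its image to weight \<open>U\<close> leaves the coefficient at \<open>U\<close> and
          \<open>V\<close> times a nonzero vector.\<close>
        define \<delta> :: "tableau \<Rightarrow> 'k" where "\<delta> = (\<lambda>s. if s = V then 1 else 0)"
        have \<delta>: "\<delta> \<in> V.W ?n V" unfolding \<delta>_def by (rule sep.sn_delta[OF mN Std_ST[OF lam V]])
        have "\<delta> \<noteq> 0" by (auto simp: \<delta>_def fun_eq_iff)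
        then have nz: "V.fop lam U V \<delta> \<noteq> 0" by (rule V.fop_nonzero[OF lam U V \<delta>])
        have "V.expand c \<delta> = V.expand ?b \<delta>"
          unfolding V.opr_expand[OF V.W_M[OF \<delta>], symmetric] using X c by simp
        then have "fscale (c U V) (V.fop lam U V \<delta>) = fscale (?b U V) (V.fop lam U V \<delta>)"
          unfolding V.F_expand[OF lam U V \<delta>, symmetric] by simp
        then show ?thesis using nz by simp
      next
        case False
        then have "?b U V = 0" by (auto simp: branch_coeff_def)
        moreover have "c U V = 0" using c False by blast
        ultimately show ?thesis by simp
      qed
    qed
  qed
qed

theorem theorem1p6:
  fixes u :: "nat \<Rightarrow> 'k::field"
    and l n :: nat
    and mu lam :: mpart
    and s t U V :: tableau
    and b :: 'k
  assumes "1 \<le> l" and "1 \<le> n"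
    and "semisimple_ring (hecke l n u)"
    and "mu \<in> mparts l (n - 1)" and "lam \<in> mparts l n"
    and "s \<in> Std l (n - 1) mu" and "t \<in> Std l (n - 1) mu"
    and "U \<in> Std l n lam" and "V \<in> Std l n lam"
    and "b = seminormal_coeffs l n u (hecke_iota l n u (seminormal_f l (n - 1) u mu s t)) U V"
  shows "(b \<noteq> 0 \<longleftrightarrow> U \<down> (n - 1) = s \<and> V \<down> (n - 1) = t) \<and>
         (U \<down> (n - 1) = s \<and> V \<down> (n - 1) = t \<longrightarrow>
            b = r_coeff l (n - 1) u s / r_coeff l n u U \<and>
            b = r_coeff l (n - 1) u t / r_coeff l n u V)"
proof -
  define m where "m = n - 1"
  have n: "n = Suc m" using assms(2) by (simp add: m_def)
  \<comment> \<open>With \<open>N = n\<close> the numerical consequence of semisimplicity for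
    \<open>n\<close> also covers the tableaux of size \<open>n - 1\<close>.\<close>
  have sep: "separated l n u" by (rule semisimple_separated[OF assms(3,1,2)])
  note A = assms(4-9)[unfolded m_def[symmetric], unfolded n, simplified]
  have b: "b = branch_coeff l m u s t U V"
    using seminormal_coeffs_iota[OF sep _ A(1,3,4)] assms(10) by (simp add: n)
  have nz: "r_coeff l m u s \<noteq> 0" "r_coeff l (Suc m) u U \<noteq> 0"
    using separated.r_coeff_nonzero[OF sep _ A(1,3)] separated.r_coeff_nonzero[OF sep _ A(2,5)] by (simp_all add: n)
  have "r_coeff l m u s / r_coeff l (Suc m) u U = r_coeff l m u t / r_coeff l (Suc m) u V"
    if "U \<down> m = s" "V \<down> m = t"
    using branch_coeff_eq[OF sep _ A(1,2,5) _ A(6)] that A(3,4) by (simp add: n)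
  then show ?thesis
    using A nz unfolding b branch_coeff_def n by auto
qed

end
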